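(* For a countable group $\Gamma$, the two following properties are equivalent: (i) $\Gamma$ has an infinite dimensional faithful irreducible unitary representation; (ii) $\Gamma$ has the mutually equivalent properties (P1)–(P5) listed in the context, and $\Gamma$ is not virtually abelian. In other words, the following properties are equivalent: (iii) $\Gamma$ has a faithful irreducible unitary representation, and all its faithful irreducible unitary representations are finite dimensional; (iv) $\Gamma$ has the mutually equivalent properties (P1)–(P5) listed in the context, and $\Gamma$ is virtually abelian.
   Context: A group is virtually abelian if it has an abelian subgroup of finite index. A foot of a group $\Gamma$ is a minimal normal subgroup of $\Gamma$: a normal subgroup $M\ne\{e\}$ such that every normal subgroup of $\Gamma$ contained in $M$ is $M$ or $\{e\}$. $\mathcal F_\Gamma$ is the set of finite feet of $\Gamma$, $\mathcal A_\Gamma\subset\mathcal F_\Gamma$ the subset of abelian ones, $\mathcal H_\Gamma=\mathcal F_\Gamma\setminus\mathcal A_\Gamma$. $MS(\Gamma)$ and $MA(\Gamma)$ are the subgroups of $\Gamma$ generated respectively by $\bigcup_{M\in\mathcal F_\Gamma}M$ and $\bigcup_{A\in\mathcal A_\Gamma}A$ (equal to $\{e\}$ if the corresponding set is empty). There is a family $\{A_i\}_{i\in I}$ of finite abelian feet of $\Gamma$ with $MA(\Gamma)=\bigoplus_{i\in I}A_i$ (internal direct sum), and $MS(\Gamma)=\left(\bigoplus_{i\in I}A_i\right)\oplus\left(\bigoplus_{H\in\mathcal H_\Gamma}H\right)$; fix such a family. For a normal subgroup $N$ of $\Gamma$, a unitary representation $\sigma$ of $N$ is $\Gamma$-faithful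 if $\bigcap_{\gamma\in\Gamma}\ker(\sigma^\gamma)=\{e\}$, where $\sigma^\gamma(n)=\sigma(\gamma n\gamma^{-1})$. For a countable group $\Gamma$ the following properties are equivalent to each other: (P1) $\Gamma$ has a faithful irreducible unitary representation (of finite or infinite dimension); (P2) $MA(\Gamma)$ has a $\Gamma$-faithful unitary character; (P3) $MS(\Gamma)$ has a $\Gamma$-faithful irreducible unitary representation; (P4) for every finite $E\subset I$ there is an element of $\bigoplus_{i\in E}A_i$ whose $\Gamma$-conjugacy class generates $\bigoplus_{i\in E}A_i$; (P5) for every pair of finite subsets $E\subset I$, $F\subset\mathcal H_\Gamma$ there is an element of $\left(\bigoplus_{i\in E}A_i\right)\oplus\left(\bigoplus_{H\in F}H\right)$ whose $\Gamma$-conjugacy class generates this group. *)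

theory Defs
  imports
    "HOL-Analysis.Analysis"
    "HOL-Library.Equipollence"
    "HOL-Algebra.Bij"
    "HOL-Algebra.Generated_Groups"
    "Jordan_Normal_Form.VS_Connect"
begin

hide_const (open) Modules.module Real_Vector_Spaces.subspace Module.submodule

text \<open>
  The underlying set is a carrier in a type \<open>'h\<close>, so that one can quantify over Hilbert spaces
  inside a formula.  The fields \<open>mult\<close> and \<open>one\<close> inherited from the record of modules play no role.
\<close>

record 'h inner_product_struct = "(complex, 'h) module" +
  ip :: "'h \<Rightarrow> 'h \<Rightarrow> complex"

text \<open>\<open>ip x x\<close> is real by conjugate symmetry.\<close>

locale complex_inner_product_space = vectorspace class_ring H
  for H :: "('h, 'x) inner_product_struct_scheme" (structure) +
  assumes ip_add: "\<lbrakk>x \<in> carrier H; y \<in> carrier H; z \<in> carrier H\<rbrakk>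
      \<Longrightarrow> ip H (x \<oplus> y) z = ip H x z + ip H y z"
    and ip_smult: "\<lbrakk>x \<in> carrier H; y \<in> carrier H\<rbrakk> \<Longrightarrow> ip H (c \<odot> x) y = c * ip H x y"
    and ip_cnj: "\<lbrakk>x \<in> carrier H; y \<in> carrier H\<rbrakk> \<Longrightarrow> ip H y x = cnj (ip H x y)"
    and ip_pos: "\<lbrakk>x \<in> carrier H; x \<noteq> \<zero>\<rbrakk> \<Longrightarrow> Re (ip H x x) > 0"

definition ip_norm :: "('h, 'x) inner_product_struct_scheme \<Rightarrow> 'h \<Rightarrow> real" where
  "ip_norm H x = sqrt (Re (ip H x x))"

text \<open>The value off the carrier is set to 0 because the locale \<^locale>\<open>Metric_space\<close> requires
  nonnegativity and symmetry for all arguments.\<close>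

definition ip_dist :: "('h, 'x) inner_product_struct_scheme \<Rightarrow> 'h \<Rightarrow> 'h \<Rightarrow> real" where
  "ip_dist H x y = (if x \<in> carrier H \<and> y \<in> carrier H then ip_norm H (x \<ominus>\<^bsub>H\<^esub> y) else 0)"

context complex_inner_product_space
begin

lemma ip_zero_left: "y \<in> carrier H \<Longrightarrow> ip H \<zero> y = 0"
  using ip_add[of \<zero> \<zero> y] by simp

lemma ip_add_right: "\<lbrakk>x \<in> carrier H; y \<in> carrier H; z \<in> carrier H\<rbrakk>
    \<Longrightarrow> ip H z (x \<oplus> y) = ip H z x + ip H z y"
  using ip_cnj[of "x \<oplus> y" z] ip_cnj[of x z] ip_cnj[of y z] ip_add[of x y z] by simp

lemma ip_smult_right: "\<lbrakk>x \<in> carrier H; y \<in> carrier H\<rbrakk> \<Longrightarrow> ip H y (c \<odot> x) = cnj c * ip H y x"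
  using ip_cnj[of "c \<odot> x" y] ip_cnj[of x y] ip_smult[of x y c] by simp

lemma ip_real: "x \<in> carrier H \<Longrightarrow> ip H x x = of_real (Re (ip H x x))"
  using ip_cnj[of x x] by (simp add: complex_eq_iff)

lemma ip_nonneg: "x \<in> carrier H \<Longrightarrow> 0 \<le> Re (ip H x x)"
  using ip_pos[of x] ip_zero_left[of \<zero>] by (cases "x = \<zero>") auto

lemma ip_norm_eq_0: "x \<in> carrier H \<Longrightarrow> ip_norm H x = 0 \<longleftrightarrow> x = \<zero>"
  unfolding ip_norm_def using ip_pos[of x] ip_zero_left[of \<zero>] by fastforce

lemma ip_Cauchy_Schwarz:
  assumes x: "x \<in> carrier H" and y: "y \<in> carrier H"
  shows "cmod (ip H x y) \<le> ip_norm H x * ip_norm H y"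
proof (cases "y = \<zero>")
  case True
  then show ?thesis
    using ip_cnj[OF y x] ip_zero_left[OF x] ip_zero_left[OF y] by (simp add: ip_norm_def)
next
  case False
  define a where "a = Re (ip H y y)"
  define b where "b = ip H x y"
  define c where "c = - b / of_real a"
  have a: "a > 0" using ip_pos[OF y False] by (simp add: a_def)
  have yy: "ip H y y = of_real a" using ip_real[OF y] by (simp add: a_def)
  have yx: "ip H y x = cnj b" using ip_cnj[OF x y] by (simp add: b_def)
  have cy: "c \<odot> y \<in> carrier H" using y by simp
  have "ip H (x \<oplus> c \<odot> y) (x \<oplus> c \<odot> y)
      = ip H x x + cnj c * b + c * cnj b + c * cnj c * of_real a"
    using x y cy by (simp add: ip_add ip_add_right ip_smult ip_smult_right yy yx b_def algebra_simps)
  also have "\<dots> = ip H x x - of_real ((cmod b)\<^sup>2 / a)"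
    using a complex_norm_square[of b] by (simp add: c_def field_simps)
  finally have "0 \<le> Re (ip H x x) - (cmod b)\<^sup>2 / a"
    using ip_nonneg[of "x \<oplus> c \<odot> y"] x cy by simp
  then have "(cmod b)\<^sup>2 \<le> Re (ip H x x) * a"
    using a by (simp add: field_simps)
  then have "cmod b \<le> sqrt (Re (ip H x x) * a)"
    by (simp add: real_le_rsqrt)
  then show ?thesis
    by (simp add: ip_norm_def real_sqrt_mult a_def b_def)
qed

lemma ip_norm_triangle:
  assumes x: "x \<in> carrier H" and y: "y \<in> carrier H"
  shows "ip_norm H (x \<oplus> y) \<le> ip_norm H x + ip_norm H y"
proof -
  have sq: "(ip_norm H z)\<^sup>2 = Re (ip H z z)" if "z \<in> carrier H" for z
    using ip_nonneg[OF that] by (simp add: ip_norm_def)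
  have "(ip_norm H (x \<oplus> y))\<^sup>2 = (ip_norm H x)\<^sup>2 + 2 * Re (ip H x y) + (ip_norm H y)\<^sup>2"
    using x y ip_cnj[OF x y] by (simp add: sq ip_add ip_add_right)
  also have "\<dots> \<le> (ip_norm H x + ip_norm H y)\<^sup>2"
    using ip_Cauchy_Schwarz[OF x y] complex_Re_le_cmod[of "ip H x y"]
    by (simp add: power2_eq_square algebra_simps)
  finally show ?thesis
    by (rule power2_le_imp_le) (use x y in \<open>simp add: ip_norm_def ip_nonneg\<close>)
qed

lemma ip_norm_uminus: "x \<in> carrier H \<Longrightarrow> ip_norm H (\<ominus> x) = ip_norm H x"
proof -
  assume x: "x \<in> carrier H"
  have "ip H (x \<oplus> \<ominus> x) z = ip H x z + ip H (\<ominus> x) z" if "z \<in> carrier H" for z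
    using ip_add[of x "\<ominus> x" z] x that by simp
  then have 1: "ip H (\<ominus> x) z = - ip H x z" if "z \<in> carrier H" for z
    using that x ip_zero_left[OF that] by (simp add: M.r_neg add_eq_0_iff)
  have "ip H (\<ominus> x) (\<ominus> x) = ip H x x"
    using 1[of "\<ominus> x"] 1[of x] x ip_cnj[of "\<ominus> x" x] ip_cnj[of x x] by simp
  then show ?thesis by (simp add: ip_norm_def)
qed

sublocale Metric_space "carrier H" "ip_dist H"
proof
  fix x y z
  show "0 \<le> ip_dist H x y"
    by (auto simp: ip_dist_def ip_norm_def ip_nonneg)
  show "ip_dist H x y = ip_dist H y x"
  proof (cases "x \<in> carrier H \<and> y \<in> carrier H")
    case True
    then have "\<ominus> (x \<ominus> y) = y \<ominus> x"
      by (simp add: a_minus_def M.minus_add M.a_comm)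
    with True show ?thesis
      using ip_norm_uminus[of "x \<ominus> y"] by (simp add: ip_dist_def)
  qed (auto simp: ip_dist_def)
  assume x: "x \<in> carrier H" and y: "y \<in> carrier H"
  show "ip_dist H x y = 0 \<longleftrightarrow> x = y"
    using x y by (simp add: ip_dist_def ip_norm_eq_0)
  assume z: "z \<in> carrier H"
  have "x \<ominus> z = (x \<ominus> y) \<oplus> (y \<ominus> z)"
    using x y z by (simp add: a_minus_def M.a_assoc M.r_neg1)
  then show "ip_dist H x z \<le> ip_dist H x y + ip_dist H y z"
    using ip_norm_triangle[of "x \<ominus> y" "y \<ominus> z"] x y z by (simp add: ip_dist_def)
qed

end

locale complex_hilbert_space = complex_inner_product_space +
  assumes complete: "mcomplete"

definition unitary_group :: "('h, 'x) inner_product_struct_scheme \<Rightarrow> ('h \<Rightarrow> 'h) monoid" where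
  "unitary_group H = (BijGroup (carrier H))
     \<lparr>carrier := {U \<in> Bij (carrier H). U \<in> module_hom class_ring H H \<and>
        (\<forall>x\<in>carrier H. \<forall>y\<in>carrier H. ip H (U x) (U y) = ip H x y)}\<rparr>"

definition unitary_rep ::
    "('a, 'b) monoid_scheme \<Rightarrow> ('h, 'x) inner_product_struct_scheme \<Rightarrow> ('a \<Rightarrow> 'h \<Rightarrow> 'h) \<Rightarrow> bool" where
  "unitary_rep G H \<rho> \<longleftrightarrow> complex_hilbert_space H \<and> \<rho> \<in> hom G (unitary_group H)"

definition irreducible_unitary_rep ::
    "('a, 'b) monoid_scheme \<Rightarrow> ('h, 'x) inner_product_struct_scheme \<Rightarrow> ('a \<Rightarrow> 'h \<Rightarrow> 'h) \<Rightarrow> bool" where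
  "irreducible_unitary_rep G H \<rho> \<longleftrightarrow>
     unitary_rep G H \<rho> \<and> carrier H \<noteq> {\<zero>\<^bsub>H\<^esub>} \<and>
     (\<forall>W. subspace class_ring W H \<and>
          closedin (Metric_space.mtopology (carrier H) (ip_dist H)) W \<and>
          (\<forall>g\<in>carrier G. \<rho> g ` W \<subseteq> W)
        \<longrightarrow> W = {\<zero>\<^bsub>H\<^esub>} \<or> W = carrier H)"

definition faithful_irreducible_unitary_rep ::
    "('a, 'b) monoid_scheme \<Rightarrow> ('h, 'x) inner_product_struct_scheme \<Rightarrow> ('a \<Rightarrow> 'h \<Rightarrow> 'h) \<Rightarrow> bool" where
  "faithful_irreducible_unitary_rep G H \<rho> \<longleftrightarrow>
     irreducible_unitary_rep G H \<rho> \<and> inj_on \<rho> (carrier G)"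

abbreviation finite_dimensional :: "('h, 'x) inner_product_struct_scheme \<Rightarrow> bool" where
  "finite_dimensional H \<equiv> vectorspace.fin_dim class_ring H"

definition circle_group :: "complex monoid" where
  "circle_group = \<lparr>carrier = {z. cmod z = 1}, monoid.mult = (*), one = 1\<rparr>"

text \<open>\<open>\<sigma>\<close> is a homomorphism from the normal subgroup \<open>N\<close> of \<open>G\<close> to a group \<open>U\<close>, which is either
  a unitary group or the circle group.\<close>

definition conj_faithful ::
    "('a, 'b) monoid_scheme \<Rightarrow> 'a set \<Rightarrow> ('u, 'v) monoid_scheme \<Rightarrow> ('a \<Rightarrow> 'u) \<Rightarrow> bool" where
  "conj_faithful G N U \<sigma> \<longleftrightarrow>
     (\<Inter>g\<in>carrier G. kernel (G\<lparr>carrier := N\<rparr>) U (\<lambda>n. \<sigma> (g \<otimes>\<^bsub>G\<^esub> n \<otimes>\<^bsub>G\<^esub> inv\<^bsub>G\<^esub> g))) = {\<one>\<^bsub>G\<^esub>}"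

definition virtually_abelian :: "('a, 'b) monoid_scheme \<Rightarrow> bool" where
  "virtually_abelian G \<longleftrightarrow>
     (\<exists>K. subgroup K G \<and> comm_group (G\<lparr>carrier := K\<rparr>) \<and> finite (rcosets\<^bsub>G\<^esub> K))"

definition foot :: "('a, 'b) monoid_scheme \<Rightarrow> 'a set \<Rightarrow> bool" where
  "foot G M \<longleftrightarrow> M \<lhd> G \<and> M \<noteq> {\<one>\<^bsub>G\<^esub>} \<and>
     (\<forall>N. N \<lhd> G \<and> N \<subseteq> M \<longrightarrow> N = M \<or> N = {\<one>\<^bsub>G\<^esub>})"

definition finite_feet :: "('a, 'b) monoid_scheme \<Rightarrow> 'a set set" where
  "finite_feet G = {M. foot G M \<and> finite M}"

definition abelian_finite_feet :: "('a, 'b) monoid_scheme \<Rightarrow> 'a set set" where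
  "abelian_finite_feet G = {M \<in> finite_feet G. comm_group (G\<lparr>carrier := M\<rparr>)}"

definition nonabelian_finite_feet :: "('a, 'b) monoid_scheme \<Rightarrow> 'a set set" where
  "nonabelian_finite_feet G = finite_feet G - abelian_finite_feet G"

definition MS :: "('a, 'b) monoid_scheme \<Rightarrow> 'a set" where
  "MS G = generate G (\<Union>(finite_feet G))"

definition MA :: "('a, 'b) monoid_scheme \<Rightarrow> 'a set" where
  "MA G = generate G (\<Union>(abelian_finite_feet G))"

text \<open>The (restricted) direct sum of a possibly infinite family of subgroups of \<open>G\<close>.\<close>

definition internal_direct_sum ::
    "('a, 'b) monoid_scheme \<Rightarrow> 'j set \<Rightarrow> ('j \<Rightarrow> 'a set) \<Rightarrow> 'a set \<Rightarrow> bool" where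
  "internal_direct_sum G J K N \<longleftrightarrow>
     (\<forall>j\<in>J. subgroup (K j) G) \<and>
     (\<forall>i\<in>J. \<forall>j\<in>J. i \<noteq> j \<longrightarrow> (\<forall>x\<in>K i. \<forall>y\<in>K j. x \<otimes>\<^bsub>G\<^esub> y = y \<otimes>\<^bsub>G\<^esub> x)) \<and>
     (\<forall>j\<in>J. K j \<inter> generate G (\<Union>i\<in>J - {j}. K i) = {\<one>\<^bsub>G\<^esub>}) \<and>
     N = generate G (\<Union>j\<in>J. K j)"

definition conj_class :: "('a, 'b) monoid_scheme \<Rightarrow> 'a \<Rightarrow> 'a set" where
  "conj_class G x = (\<lambda>g. g \<otimes>\<^bsub>G\<^esub> x \<otimes>\<^bsub>G\<^esub> inv\<^bsub>G\<^esub> g) ` carrier G"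

definition generated_by_conj_class :: "('a, 'b) monoid_scheme \<Rightarrow> 'a set \<Rightarrow> bool" where
  "generated_by_conj_class G N \<longleftrightarrow> (\<exists>x\<in>N. generate G (conj_class G x) = N)"

text \<open>
  The argument of type \<open>'h itself\<close> names the type in which carriers of Hilbert spaces live.  For
  irreducible representations of countable groups it suffices that \<open>'h\<close> has the cardinality of the
  continuum: such representations are cyclic, so they act on separable spaces.
\<close>

definition has_faithful_irrep :: "'h itself \<Rightarrow> ('a, 'b) monoid_scheme \<Rightarrow> bool" where
  "has_faithful_irrep _ G \<longleftrightarrow>
     (\<exists>(H :: 'h inner_product_struct) \<rho>. faithful_irreducible_unitary_rep G H \<rho>)"

definition MA_has_conj_faithful_character :: "('a, 'b) monoid_scheme \<Rightarrow> bool" where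
  "MA_has_conj_faithful_character G \<longleftrightarrow>
     (\<exists>\<theta> \<in> hom (G\<lparr>carrier := MA G\<rparr>) circle_group. conj_faithful G (MA G) circle_group \<theta>)"

definition MS_has_conj_faithful_irrep :: "'h itself \<Rightarrow> ('a, 'b) monoid_scheme \<Rightarrow> bool" where
  "MS_has_conj_faithful_irrep _ G \<longleftrightarrow>
     (\<exists>(H :: 'h inner_product_struct) \<sigma>. irreducible_unitary_rep (G\<lparr>carrier := MS G\<rparr>) H \<sigma> \<and>
        conj_faithful G (MS G) (unitary_group H) \<sigma>)"

text \<open>In the next two definitions the subgroups generated by unions are the partial direct sums of
  the families decomposing \<^term>\<open>MA G\<close> and \<^term>\<open>MS G\<close>.\<close>

definition abelian_sums_conj_generated ::
    "('a, 'b) monoid_scheme \<Rightarrow> 'i set \<Rightarrow> ('i \<Rightarrow> 'a set) \<Rightarrow> bool" where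
  "abelian_sums_conj_generated G I A \<longleftrightarrow>
     (\<forall>E. finite E \<and> E \<subseteq> I \<longrightarrow> generated_by_conj_class G (generate G (\<Union>i\<in>E. A i)))"

definition mixed_sums_conj_generated ::
    "('a, 'b) monoid_scheme \<Rightarrow> 'i set \<Rightarrow> ('i \<Rightarrow> 'a set) \<Rightarrow> bool" where
  "mixed_sums_conj_generated G I A \<longleftrightarrow>
     (\<forall>E F. finite E \<and> E \<subseteq> I \<and> finite F \<and> F \<subseteq> nonabelian_finite_feet G \<longrightarrow>
        generated_by_conj_class G (generate G ((\<Union>i\<in>E. A i) \<union> \<Union>F)))"

definition irreducibly_represented ::
    "'h itself \<Rightarrow> ('a, 'b) monoid_scheme \<Rightarrow> 'i set \<Rightarrow> ('i \<Rightarrow> 'a set) \<Rightarrow> bool" where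
  "irreducibly_represented T G I A \<longleftrightarrow>
     has_faithful_irrep T G \<and>
     MA_has_conj_faithful_character G \<and>
     MS_has_conj_faithful_irrep T G \<and>
     abelian_sums_conj_generated G I A \<and>
     mixed_sums_conj_generated G I A"

end

theory Submission
  imports Defs
begin

text \<open>Representations are handled through states, the normalised positive definite functions: by the
  GNS construction the extreme states are the vector states of irreducible representations. A Baire
  category argument in place of Choquet's theorem gives the basic existence result: if no convex
  summand of some state lies in any of countably many closed convex sets, then some extreme state
  lies outside all of them.

  Let \<open>\<pi>\<close> be a faithful irreducible representation. A vector state of \<open>\<pi>\<close> restricted to \<open>MA\<close> or \<open>MS\<close>
  has no convex summand that is trivial on all conjugates of some nontrivial element, because a
  nontrivial normal subgroup has no nonzero fixed vectors in \<open>\<pi>\<close>; this gives (P2) and (P3).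
  For (P4), let the conjugacy class of \<open>x\<close> generate \<open>X\<close> and let \<open>S\<close> be a further abelian foot. If the
  class of \<open>x s\<close> generates \<open>X S\<close> for no \<open>s\<close> in \<open>S\<close>, then each \<open>s\<close> is the image of \<open>x\<close> under an
  equivariant homomorphism from \<open>X\<close> to \<open>S\<close>. But there are fewer than \<open>|S|\<close> of these, since composition
  with a \<open>G\<close>-faithful character turns the equivariant homomorphisms from \<open>S\<close> to \<open>X\<close>, which are at least
  as many, into distinct characters of \<open>S\<close> and misses one. For (P5), multiply by a noncentral element of
  each nonabelian foot and take commutators.

  If an abelian subgroup \<open>K\<close> has finite index, an irreducible representation contains a minimal closed
  \<open>K\<close>-invariant subspace; by Schur's lemma it is a line, and its finitely many translates span.
  If \<open>G\<close> is not virtually abelian and \<open>\<pi>\<close> is finite dimensional, the elements with finite conjugacy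
  class form a normal subgroup \<open>fc_center\<close> of infinite index. Extend a vector state of \<open>\<pi>\<close> on
  \<open>fc_center\<close> by 0: no convex summand of it is trivial on the conjugates of a nontrivial element of
  \<open>fc_center\<close>, or makes an element outside \<open>fc_center\<close> act uniformly close to the identity. An
  extreme state with the same property gives a faithful representation, which is infinite dimensional
  since by compactness every finite dimensional one has such elements.\<close>

subsection \<open>Extreme points outside countably many closed convex sets\<close>

text \<open>All of (P1) to (P5) are drawn from one faithful irreducible representation, since their
  conjunction contains (P1). The Baire argument dictates how each requirement on a new
  representation is phrased: the states to be avoided must be cut out by closed convex conditions.
  Triviality on a conjugacy class is one; uniform closeness to the identity is another because, once
  squared, it compares two forms that are linear in the state. A summand \<open>\<psi>\<close> of
  weight \<open>t\<close> is handled by the inequality of forms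
  \<open>t \<psi> \<le> \<phi>0\<close>: what is small for \<open>\<phi>0\<close> is small for
  \<open>\<psi>\<close>. The extension by 0 makes different cosets of \<open>fc_center\<close>
  orthogonal, so an element outside \<open>fc_center\<close> that is close to the identity for
  \<open>\<psi>\<close> has its conjugates in finitely many cosets. Its commutators with elements
  centralising \<open>fc_center\<close> then yield a nontrivial element of \<open>fc_center\<close>
  all of whose powers are close to the identity, and such an element acts trivially. A commutator
  involves the element twice, which is why 1/8 is imposed where 1/4 is used.\<close>

abbreviation clhull :: "'e::real_normed_vector set \<Rightarrow> 'e set" where
  "clhull S \<equiv> closure (convex hull S)"

lemma clhull_minimal: "S \<subseteq> T \<Longrightarrow> convex T \<Longrightarrow> closed T \<Longrightarrow> clhull S \<subseteq> T"
  by (meson closure_minimal hull_minimal)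

lemma subset_clhull: "S \<subseteq> clhull S"
  by (meson closure_subset hull_subset order_trans)

lemma clhull_inc: "x \<in> S \<Longrightarrow> x \<in> clhull S"
  by (rule subsetD[OF subset_clhull])

lemma clhull_mono: "S \<subseteq> T \<Longrightarrow> clhull S \<subseteq> clhull T"
  by (meson closure_mono hull_mono)

lemma convex_clhull: "convex (clhull S)"
  by (simp add: convex_closure)

text \<open>The join of two compact convex sets is compact and convex, so it already contains the
  closed hull of the union. The alternative \<open>t = 1\<close> covers empty \<open>S\<close>,
  where no point \<open>a\<close> is available.\<close>

lemma clhull_Un_decompose:
  fixes S T :: "'e::real_normed_vector set"
  assumes S: "compact (clhull S)" and T: "compact (clhull T)"
    and p: "p \<in> clhull (S \<union> T)" "p \<notin> clhull S"
  obtains t a b where "0 < t" "t \<le> 1" "b \<in> clhull T" "t = 1 \<or> a \<in> clhull S"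
    "p = (1 - t) *\<^sub>R a + t *\<^sub>R b"
proof (cases "S = {}")
  case True
  then show ?thesis using p that[of 1 p undefined] by simp
next
  case ne: False
  have neT: "T \<noteq> {}" using p by auto
  define J where "J = (\<lambda>(t, a, b). (1 - t) *\<^sub>R a + t *\<^sub>R b) ` ({0..1::real} \<times> clhull S \<times> clhull T)"
  have "compact ({0..1::real} \<times> clhull S \<times> clhull T)"
    using S T by (intro compact_Times) auto
  then have cJ: "compact J"
    unfolding J_def by (intro compact_continuous_image) (auto intro!: continuous_intros simp: case_prod_unfold)
  have JI: "(1 - t) *\<^sub>R a + t *\<^sub>R b \<in> J" if "0 \<le> t" "t \<le> 1" "a \<in> clhull S" "b \<in> clhull T" for t a b
    using that unfolding J_def by force
  obtain a0 b0 where ab0: "a0 \<in> clhull S" "b0 \<in> clhull T"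
    using ne neT subset_clhull by blast
  have vJ: "convex J"
  proof (rule convexI)
    fix x y and u v :: real
    assume xy: "x \<in> J" "y \<in> J" and uv: "0 \<le> u" "0 \<le> v" "u + v = 1"
    obtain t a b where x: "0 \<le> t" "t \<le> 1" "a \<in> clhull S" "b \<in> clhull T" "x = (1 - t) *\<^sub>R a + t *\<^sub>R b"
      using xy(1) unfolding J_def by auto
    obtain t' a' b' where y: "0 \<le> t'" "t' \<le> 1" "a' \<in> clhull S" "b' \<in> clhull T" "y = (1 - t') *\<^sub>R a' + t' *\<^sub>R b'"
      using xy(2) unfolding J_def by auto
    \<comment> \<open>The weights stay unnormalised because the \<open>S\<close>-part or the
      \<open>T\<close>-part of the combination of \<open>x\<close> and \<open>y\<close> may have
      total weight 0.\<close>
    have mix: "\<exists>c\<in>C. \<alpha> *\<^sub>R a + \<beta> *\<^sub>R a' = (\<alpha> + \<beta>) *\<^sub>R c"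
      if "convex C" "a \<in> C" "a' \<in> C" "0 \<le> \<alpha>" "0 \<le> \<beta>" for C :: "'e set" and a a' and \<alpha> \<beta> :: real
    proof (cases "\<alpha> + \<beta> = 0")
      case True
      then have "\<alpha> = 0" "\<beta> = 0" using that by linarith+
      then show ?thesis using that by (intro bexI[of _ a]) auto
    next
      case False
      then have "(\<alpha>/(\<alpha>+\<beta>)) *\<^sub>R a + (\<beta>/(\<alpha>+\<beta>)) *\<^sub>R a' \<in> C"
        using that by (intro convexD) (auto simp: add_divide_distrib[symmetric])
      moreover have "(\<alpha> + \<beta>) *\<^sub>R ((\<alpha>/(\<alpha>+\<beta>)) *\<^sub>R a + (\<beta>/(\<alpha>+\<beta>)) *\<^sub>R a') = \<alpha> *\<^sub>R a + \<beta> *\<^sub>R a'"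
        using False by (simp add: scaleR_right_distrib)
      ultimately show ?thesis by metis
    qed
    obtain c where c: "c \<in> clhull S" "(u*(1-t)) *\<^sub>R a + (v * (1-t')) *\<^sub>R a' = (u*(1-t) + v * (1-t')) *\<^sub>R c"
      using mix[OF convex_clhull x(3) y(3), of "u*(1-t)" "v * (1-t')"] x y uv by auto
    obtain d where d: "d \<in> clhull T" "(u*t) *\<^sub>R b + (v * t') *\<^sub>R b' = (u*t + v * t') *\<^sub>R d"
      using mix[OF convex_clhull x(4) y(4), of "u*t" "v * t'"] x y uv by auto
    have "u *\<^sub>R x + v *\<^sub>R y = ((u*(1-t)) *\<^sub>R a + (v * (1-t')) *\<^sub>R a') + ((u*t) *\<^sub>R b + (v * t') *\<^sub>R b')"
      unfolding x(5) y(5) by (simp add: scaleR_right_distrib)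
    also have "\<dots> = (1 - (u*t + v * t')) *\<^sub>R c + (u*t + v * t') *\<^sub>R d"
      unfolding c d using uv by (simp add: algebra_simps flip: scaleR_add_left)
    also have "\<dots> \<in> J"
    proof (rule JI)
      show "0 \<le> u*t + v * t'" using x y uv by simp
      have "u*t + v * t' \<le> u*1 + v * 1" using x y uv by (intro add_mono mult_left_mono) auto
      then show "u*t + v * t' \<le> 1" using uv by simp
    qed (use c d in auto)
    finally show "u *\<^sub>R x + v *\<^sub>R y \<in> J" .
  qed
  have "S \<union> T \<subseteq> J"
  proof
    fix x assume "x \<in> S \<union> T"
    then consider "x \<in> clhull S" | "x \<in> clhull T" using subset_clhull by blast
    then show "x \<in> J"
    proof cases
      case 1 then show ?thesis using JI[of 0 x b0] ab0 by simp
    next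
      case 2 then show ?thesis using JI[of 1 a0 x] ab0 by simp
    qed
  qed
  then have "p \<in> J" using clhull_minimal[OF _ vJ compact_imp_closed[OF cJ]] p(1) by blast
  then obtain t a b where x: "0 \<le> t" "t \<le> 1" "a \<in> clhull S" "b \<in> clhull T" "p = (1 - t) *\<^sub>R a + t *\<^sub>R b"
    unfolding J_def by auto
  moreover have "t \<noteq> 0" using x p(2) by auto
  ultimately show ?thesis using that[of t b a] by simp
qed

lemma compact_clhull_subset:
  assumes "compact H" "convex H" "S \<subseteq> H"
  shows "compact (clhull S)"
  using assms clhull_minimal[OF assms(3,2)] compact_imp_closed closed_closure
  by (metis compact_Int_closed inf.absorb_iff2)

text \<open>The chain condition for Zorn's lemma below. For each \<open>e\<close>, compactness
  yields one member \<open>U\<close> of the chain that covers every point of \<open>K\<close> whose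
  image is at distance at least \<open>e\<close> from the image of \<open>Z\<close>. So
  \<open>g\<close> maps \<open>K - U\<close> into the closed \<open>e\<close>-neighbourhood of the
  hull over \<open>Z\<close>, which is closed and convex and hence contains
  \<open>p\<close>.\<close>

lemma clhull_graph_chain:
  fixes K :: "'e::real_normed_vector set" and g :: "'e \<Rightarrow> 'f::real_normed_vector"
  assumes K: "compact K" and g: "continuous_on K g"
    and H: "compact H" "convex H" "g ` K \<subseteq> H"
    and op: "\<And>U. U \<in> \<C> \<Longrightarrow> open U" and chain: "subset.chain UNIV \<C>" and ne: "\<C> \<noteq> {}"
    and p: "\<And>U. U \<in> \<C> \<Longrightarrow> p \<in> clhull (g ` (K - U))"
  shows "p \<in> clhull (g ` (K - \<Union>\<C>))"
proof -
  define Z where "Z = K - \<Union>\<C>"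
  have cZ: "compact (clhull (g ` Z))"
    by (rule compact_clhull_subset[OF H(1,2)]) (use H(3) in \<open>auto simp: Z_def\<close>)
  have "\<exists>x\<in>clhull (g ` Z). dist x p \<le> e" if e: "e > 0" for e
  proof -
    define Oe where "Oe = (\<Union>z\<in>Z. ball (g z) e)"
    have "closed (- Oe)" unfolding Oe_def by auto
    then have "compact (K \<inter> g -` (- Oe))"
    proof -
      have "closed (K \<inter> g -` (- Oe))"
        using continuous_closed_preimage[OF g compact_imp_closed[OF K] \<open>closed (- Oe)\<close>] .
      then show ?thesis using K by (metis compact_Int_closed inf.left_idem)
    qed
    moreover have "K \<inter> g -` (- Oe) \<subseteq> \<Union>\<C>"
    proof
      fix x assume x: "x \<in> K \<inter> g -` (- Oe)"
      then have "x \<notin> Z" using centre_in_ball[of "g x" e] e unfolding Oe_def by blast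
      then show "x \<in> \<Union>\<C>" using x by (simp add: Z_def)
    qed
    ultimately obtain \<D> where D: "\<D> \<subseteq> \<C>" "finite \<D>" "K \<inter> g -` (- Oe) \<subseteq> \<Union>\<D>"
      using compactE[of "K \<inter> g -` (- Oe)" \<C>] op by blast
    obtain U where U: "U \<in> \<C>" "\<Union>\<D> \<subseteq> U"
    proof (cases "\<D> = {}")
      case True then show ?thesis using ne that by auto
    next
      case False
      have "\<exists>U\<in>\<D>. \<forall>V\<in>\<D>. V \<subseteq> U"
        using D(2) False D(1)
      proof (induction rule: finite_ne_induct)
        case (insert x F)
        then obtain U where "U \<in> F" "\<forall>V\<in>F. V \<subseteq> U" by auto
        moreover have "x \<subseteq> U \<or> U \<subseteq> x"
          using chain insert.prems \<open>U \<in> F\<close> unfolding subset.chain_def by blast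
        ultimately show ?case by blast
      qed auto
      then show ?thesis using that D(1) by blast
    qed
    define C where "C = (\<Union>x\<in>clhull (g ` Z). \<Union>y\<in>cball 0 e. {x + y})"
    have "closed C" unfolding C_def by (intro compact_closed_sums cZ) simp
    moreover have "convex C" unfolding C_def by (intro convex_sums convex_clhull) simp
    moreover have "g ` (K - U) \<subseteq> C"
    proof
      fix y assume "y \<in> g ` (K - U)"
      then obtain k where k: "k \<in> K" "k \<notin> U" "y = g k" by auto
      then have "k \<notin> K \<inter> g -` (- Oe)" using subset_trans[OF D(3) U(2)] by (meson subsetD)
      then have "g k \<in> Oe" using k(1) by simp
      then obtain z where "z \<in> Z" "g k \<in> ball (g z) e" unfolding Oe_def by blast
      then have z: "z \<in> Z" "dist (g z) (g k) < e" by simp_all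
      then have "g z \<in> clhull (g ` Z)" by (intro clhull_inc imageI)
      moreover have "g k - g z \<in> cball 0 e" using z(2) by (simp add: dist_norm norm_minus_commute)
      ultimately show "y \<in> C" unfolding C_def k(3)
        by (intro UN_I[of "g z"] UN_I[of "g k - g z"]) auto
    qed
    ultimately have "p \<in> C" using p[OF U(1)] clhull_minimal by blast
    then obtain x y where "x \<in> clhull (g ` Z)" "norm y \<le> e" "p = x + y"
      unfolding C_def by auto
    then show ?thesis by (intro bexI[of _ x]) (auto simp: dist_norm)
  qed
  then have "\<exists>x\<in>clhull (g ` Z). dist x p < e" if "e > 0" for e
    using that half_gt_zero[OF that] field_sum_of_halves[of e] by (metis less_add_same_cancel2 order_le_less_trans)
  then have "p \<in> closure (clhull (g ` Z))"
    unfolding closure_approachable by blast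
  then show ?thesis by (simp add: Z_def)
qed

text \<open>A substitute for the integral representation of \<open>s\<close> by a measure on the extreme points: among
  the closed sets \<open>Z\<close> such that \<open>s\<close> is represented over \<open>Z\<close> with the largest possible value of the
  strictly convex function \<open>f\<close>, take a minimal one.  The nonextreme points and the sets \<open>B n\<close> are
  meagre in it.\<close>

theorem extreme_point_avoiding:
  fixes K :: "'e::real_normed_vector set" and f :: "'e \<Rightarrow> real" and B :: "nat \<Rightarrow> 'e set"
  assumes K: "compact K" "convex K" and s: "s \<in> K"
    and f: "continuous_on K f"
    and f_strict: "\<And>a b. a \<in> K \<Longrightarrow> b \<in> K \<Longrightarrow> a \<noteq> b \<Longrightarrow> f ((1/2) *\<^sub>R a + (1/2) *\<^sub>R b) < (f a + f b) / 2"
    and B: "\<And>n. closed (B n)" "\<And>n. convex (B n)"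
    and avoid: "\<And>n t a b. 0 < t \<Longrightarrow> t \<le> 1 \<Longrightarrow> a \<in> K \<Longrightarrow> b \<in> K \<Longrightarrow> b \<in> B n \<Longrightarrow>
       s \<noteq> (1 - t) *\<^sub>R a + t *\<^sub>R b"
  shows "\<exists>e\<in>K. (\<forall>n. e \<notin> B n) \<and> (\<forall>a\<in>K. \<forall>b\<in>K. e = (1/2) *\<^sub>R a + (1/2) *\<^sub>R b \<longrightarrow> a = b)"
proof -
  define g where "g x = (x, f x)" for x
  have g: "continuous_on K g" unfolding g_def by (intro continuous_intros f)
  have "bounded (f ` K)" using compact_continuous_image[OF f K(1)] compact_imp_bounded by blast
  then obtain M where M: "\<And>x. x \<in> K \<Longrightarrow> \<bar>f x\<bar> \<le> M"
    unfolding bounded_iff by auto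
  define H0 where "H0 = K \<times> {-M..M}"
  have H0: "compact H0" "convex H0" "g ` K \<subseteq> H0"
  proof -
    have "- M \<le> f x \<and> f x \<le> M" if "x \<in> K" for x using M[OF that] by linarith
    then show "compact H0" "convex H0" "g ` K \<subseteq> H0"
      unfolding H0_def g_def using K by (auto intro!: compact_Times convex_Times)
  qed
  define H where "H = clhull (g ` K)"
  have cH: "compact H" "convex H" unfolding H_def
    using compact_clhull_subset[OF H0] convex_clhull by auto
  have HH0: "H \<subseteq> H0" unfolding H_def
    by (rule clhull_minimal) (use H0 compact_imp_closed in auto)
  have gH: "x \<in> K \<Longrightarrow> g x \<in> H" for x unfolding H_def by (intro clhull_inc imageI)
  define R where "R = {r. (s, r) \<in> H}"
  have "R = snd ` (H \<inter> fst -` {s})" unfolding R_def by force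
  moreover have "compact (H \<inter> fst -` {s})"
    using cH(1) by (intro compact_Int_closed closed_vimage_fst) auto
  ultimately have "compact R" using compact_continuous_image continuous_on_snd[OF continuous_on_id] by metis
  moreover have "R \<noteq> {}" using gH[OF s] by (auto simp: R_def g_def)
  \<comment> \<open>The largest height over \<open>s\<close> in the closed hull of the graph, that
    is the upper envelope of \<open>f\<close> at \<open>s\<close>; a maximal measure representing
    \<open>s\<close> would give \<open>f\<close> this integral.\<close>
  ultimately obtain r where r: "(s, r) \<in> H" "\<And>r'. (s, r') \<in> H \<Longrightarrow> r' \<le> r"
    using compact_attains_sup[of R] unfolding R_def by auto
  define \<A> where "\<A> = {U. open U \<and> (s, r) \<in> clhull (g ` (K - U))}"
  have "\<exists>U\<in>\<A>. \<forall>X\<in>\<A>. U \<subseteq> X \<longrightarrow> X = U"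
  proof (rule subset_Zorn_nonempty)
    have "{} \<in> \<A>" using r(1) by (auto simp: \<A>_def H_def)
    then show "\<A> \<noteq> {}" by blast
    fix \<C> assume C: "\<C> \<noteq> {}" "subset.chain \<A> \<C>"
    then have sub: "\<C> \<subseteq> \<A>" and ch: "subset.chain UNIV \<C>"
      by (auto simp: subset.chain_def)
    have "(s, r) \<in> clhull (g ` (K - \<Union>\<C>))"
      by (rule clhull_graph_chain[OF K(1) g H0]) (use sub ch C in \<open>auto simp: \<A>_def\<close>)
    moreover have "open (\<Union>\<C>)" using sub by (auto simp: \<A>_def)
    ultimately show "\<Union>\<C> \<in> \<A>" by (simp add: \<A>_def)
  qed
  then obtain U0 where U0: "U0 \<in> \<A>" "\<And>X. X \<in> \<A> \<Longrightarrow> U0 \<subseteq> X \<Longrightarrow> X = U0" by blast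
  define Z where "Z = K - U0"
  have oU0: "open U0" and srZ: "(s, r) \<in> clhull (g ` Z)" using U0(1) by (auto simp: \<A>_def Z_def)
  have cZ: "compact Z" unfolding Z_def using K(1) oU0 by (simp add: compact_diff)
  have ZK: "Z \<subseteq> K" by (auto simp: Z_def)
  have Zne: "Z \<noteq> {}" using srZ by auto
  \<comment> \<open>Minimality in use: cutting a nonempty relatively open piece out of
    \<open>Z\<close> loses \<open>(s, r)\<close>, so every such piece carries a positive weight
    \<open>t\<close> in some representation of \<open>(s, r)\<close>.\<close>
  have local: "\<exists>t a b. 0 < t \<and> t \<le> 1 \<and> b \<in> V \<and> a \<in> H \<and> (s, r) = (1 - t) *\<^sub>R a + t *\<^sub>R b"
    if z: "z \<in> Z \<inter> U'" "open U'" and V: "g ` (Z \<inter> U') \<subseteq> V" "convex V" "closed V" for z U' V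
  proof -
    obtain e where e: "e > 0" "cball z e \<subseteq> U'" using z open_contains_cball[of U'] by auto
    define U C where "U = ball z e" and "C = cball z e"
    have z: "z \<in> Z" "z \<in> U" "open U" "U \<subseteq> C" using z(1) e(1) by (auto simp: U_def C_def)
    have CV: "clhull (g ` (Z \<inter> C)) \<subseteq> V" using e(2) V by (intro clhull_minimal) (auto simp: C_def)
    have "U0 \<union> U \<notin> \<A>"
      using U0(2)[of "U0 \<union> U"] z by (auto simp: Z_def)
    then have no: "(s, r) \<notin> clhull (g ` (Z - U))"
      using oU0 z by (auto simp: \<A>_def Z_def Diff_eq Int_assoc)
    have "g ` Z \<subseteq> g ` (Z - U) \<union> g ` (Z \<inter> C)" using z by auto
    then have yes: "(s, r) \<in> clhull (g ` (Z - U) \<union> g ` (Z \<inter> C))"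
      by (rule subsetD[OF clhull_mono srZ])
    have c1: "compact (clhull (g ` (Z - U)))" and c2: "compact (clhull (g ` (Z \<inter> C)))"
      using H0 ZK by (auto intro!: compact_clhull_subset[OF H0(1,2)])
    obtain t a b where t: "0 < t" "t \<le> 1" "b \<in> clhull (g ` (Z \<inter> C))" "t = 1 \<or> a \<in> clhull (g ` (Z - U))"
      "(s, r) = (1 - t) *\<^sub>R a + t *\<^sub>R b"
      using clhull_Un_decompose[OF c1 c2 yes no] by metis
    show ?thesis
    proof (cases "t = 1")
      case True
      then show ?thesis using t gH[OF s] CV by (intro exI[of _ 1] exI[of _ "g s"] exI[of _ b]) auto
    next
      case False
      then have "a \<in> H" using t(4) clhull_mono[of "g ` (Z - U)" "g ` K"] ZK unfolding H_def by auto
      then show ?thesis using t CV by blast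
    qed
  qed
  \<comment> \<open>The points over which the hull of the graph rises above \<open>f\<close> by at
    least \<open>1 / (n + 1)\<close>. By strict convexity of \<open>f\<close> every nonextreme point
    of \<open>K\<close> lies in one of these sets.\<close>
  define Gn where "Gn n = {x \<in> K. (x, f x + 1 / (real n + 1)) \<in> H}" for n :: nat
  have cG: "closed (Gn n)" for n
  proof -
    have "continuous_on K (\<lambda>x. (x, f x + 1 / (real n + 1)))" by (intro continuous_intros f)
    moreover have "Gn n = K \<inter> (\<lambda>x. (x, f x + 1 / (real n + 1))) -` H" by (auto simp: Gn_def)
    ultimately show ?thesis
      using K(1) cH(1) by (metis compact_imp_closed continuous_closed_preimage)
  qed
  have B_meagre: "\<not> Z \<inter> U \<subseteq> B n" if U: "open U" "z \<in> Z \<inter> U" for U z n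
  proof
    assume sub: "Z \<inter> U \<subseteq> B n"
    have "g ` (Z \<inter> U) \<subseteq> (K \<inter> B n) \<times> UNIV" using sub ZK by (auto simp: g_def)
    moreover have "convex ((K \<inter> B n) \<times> (UNIV :: real set))" "closed ((K \<inter> B n) \<times> (UNIV :: real set))"
      using K B compact_imp_closed[OF K(1)] by (auto intro!: convex_Times convex_Int closed_Times closed_Int)
    ultimately obtain t a b where t: "0 < t" "t \<le> 1" "b \<in> (K \<inter> B n) \<times> UNIV" "a \<in> H" "(s, r) = (1 - t) *\<^sub>R a + t *\<^sub>R b"
      using local[OF U(2,1)] by blast
    have "fst b \<in> K" "fst b \<in> B n" using t(3) by auto
    moreover have "fst a \<in> K" using t(4) HH0 by (auto simp: H0_def)
    moreover have "s = (1 - t) *\<^sub>R fst a + t *\<^sub>R fst b" using arg_cong[OF t(5), of fst] by simp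
    ultimately show False using avoid t(1,2) by blast
  qed
  have G_meagre: "\<not> Z \<inter> U \<subseteq> Gn n" if U: "open U" "z \<in> Z \<inter> U" for U z n
  proof
    assume sub: "Z \<inter> U \<subseteq> Gn n"
    define \<delta> where "\<delta> = 1 / (real n + 1)"
    have \<delta>: "\<delta> > 0" by (simp add: \<delta>_def)
    \<comment> \<open>If \<open>Gn n\<close> contained a piece of \<open>Z\<close>, the share of
      that piece in the representation could be lifted by \<open>\<delta>\<close> within
      \<open>H\<close>, which would bring \<open>s\<close> above the maximal height
      \<open>r\<close>.\<close>
    define V where "V = (\<lambda>y. - (0, \<delta>) + y) ` H"
    have "g ` (Z \<inter> U) \<subseteq> V"
    proof
      fix y assume "y \<in> g ` (Z \<inter> U)"
      then obtain x where x: "x \<in> Gn n" "y = g x" using sub by auto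
      then have "(x, f x + \<delta>) \<in> H" by (auto simp: Gn_def \<delta>_def)
      moreover have "y = - (0, \<delta>) + (x, f x + \<delta>)" by (simp add: x g_def)
      ultimately show "y \<in> V" unfolding V_def by blast
    qed
    moreover have "convex V" "closed V"
      using cH unfolding V_def by (auto intro: convex_translation closed_translation compact_imp_closed)
    ultimately obtain t a b where t: "0 < t" "t \<le> 1" "b \<in> V" "a \<in> H" "(s, r) = (1 - t) *\<^sub>R a + t *\<^sub>R b"
      using local[OF U(2,1)] by blast
    have "b + (0, \<delta>) \<in> H" using t(3) by (auto simp: V_def algebra_simps)
    then have "(1 - t) *\<^sub>R a + t *\<^sub>R (b + (0, \<delta>)) \<in> H"
      using t cH(2) by (simp add: convexD)
    moreover have "(1 - t) *\<^sub>R a + t *\<^sub>R (b + (0, \<delta>)) = (s, r + t * \<delta>)"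
    proof -
      have "(1 - t) *\<^sub>R a + t *\<^sub>R (b + (0, \<delta>)) = ((1 - t) *\<^sub>R a + t *\<^sub>R b) + (0, t * \<delta>)"
        by (simp add: scaleR_add_right)
      then show ?thesis by (simp flip: t(5))
    qed
    ultimately have "r + t * \<delta> \<le> r" using r(2)[of "r + t * \<delta>"] by simp
    then show False using t(1) \<delta> by (simp add: mult_le_0_iff)
  qed
  \<comment> \<open>Even indices run through the sets \<open>B n\<close> and odd ones through the
    sets \<open>Gn n\<close>, so that Baire's theorem is applied to a single countable
    family.\<close>
  define F where "F n = (if even n then Z \<inter> B (n div 2) else Z \<inter> Gn (n div 2))" for n
  have Fc: "closed (F n)" for n
    using cZ B cG by (auto simp: F_def compact_imp_closed)
  have "top_of_set Z interior_of \<Union>(range F) = {}"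
  proof (rule Baire_category_alt)
    have "compact_space (top_of_set Z)" using cZ by (simp add: compact_space_subtopology)
    then have "locally_compact_space (top_of_set Z)" by (rule compact_imp_locally_compact_space)
    moreover have "regular_space (top_of_set Z)"
      by (rule regular_space_subtopology[OF regular_space_euclidean])
    ultimately show "completely_metrizable_space (top_of_set Z) \<or> locally_compact_space (top_of_set Z) \<and> regular_space (top_of_set Z)"
      by blast
    show "countable (range F)" by simp
    fix T assume "T \<in> range F"
    then obtain n where n: "T = F n" by auto
    have sub: "T \<subseteq> Z" by (auto simp: n F_def)
    have "closedin (top_of_set Z) T"
      using Fc[of n] sub n closed_subset by blast
    moreover have "top_of_set Z interior_of T = {}"
    proof (rule ccontr)
      assume "top_of_set Z interior_of T \<noteq> {}"
      then obtain z V where V: "openin (top_of_set Z) V" "z \<in> V" "V \<subseteq> T"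
        by (auto simp: interior_of_def)
      then obtain U where U: "open U" "V = Z \<inter> U" by (auto simp: openin_open)
      show False
        using B_meagre[OF U(1), of z "n div 2"] G_meagre[OF U(1), of z "n div 2"] V U n
        by (auto simp: F_def split: if_splits)
    qed
    ultimately show "closedin (top_of_set Z) T \<and> top_of_set Z interior_of T = {}" by blast
  qed
  then have "\<not> Z \<subseteq> \<Union>(range F)"
    using Zne interior_of_mono[of Z "\<Union>(range F)" "top_of_set Z"] interior_of_topspace[of "top_of_set Z"] by auto
  then obtain e where e: "e \<in> Z" "\<And>n. e \<notin> F n" by auto
  have eB: "e \<notin> B n" for n using e(2)[of "2 * n"] e(1) by (auto simp: F_def)
  have eG: "e \<notin> Gn n" for n using e(2)[of "2 * n + 1"] e(1) by (auto simp: F_def)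
  have eK: "e \<in> K" using e ZK by blast
  have "a = b" if ab: "a \<in> K" "b \<in> K" "e = (1/2) *\<^sub>R a + (1/2) *\<^sub>R b" for a b
  proof (rule ccontr)
    assume "a \<noteq> b"
    define m where "m = (f a + f b) / 2"
    have m: "f e < m" using f_strict[OF ab(1,2) \<open>a \<noteq> b\<close>] ab(3) by (simp add: m_def)
    have "(1/2) *\<^sub>R g a + (1/2) *\<^sub>R g b \<in> H" using cH(2) gH ab by (intro convexD) auto
    then have mH: "(e, m) \<in> H" using ab(3) by (simp add: g_def m_def add_divide_distrib)
    obtain n where n: "1 / (real n + 1) < m - f e"
      using m nat_approx_posE[of "m - f e"] by (metis diff_gt_0_iff_gt of_nat_Suc add.commute)
    \<comment> \<open>The parameter at which the vertical segment from \<open>(e, f e)\<close> to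
      \<open>(e, m)\<close> in \<open>H\<close> has risen by exactly
      \<open>1 / (n + 1)\<close>.\<close>
    define t where "t = (1 / (real n + 1)) / (m - f e)"
    have t: "0 \<le> t" "t \<le> 1" "t * (m - f e) = 1 / (real n + 1)" using n m by (auto simp: t_def divide_simps mult.commute)
    have "(1 - t) *\<^sub>R g e + t *\<^sub>R (e, m) \<in> H" using cH(2) gH[OF eK] mH t by (intro convexD) auto
    moreover have "(1 - t) *\<^sub>R g e + t *\<^sub>R (e, m) = (e, f e + 1 / (real n + 1))"
      using t(3) by (simp add: g_def algebra_simps)
    ultimately show False using eG[of n] eK by (simp add: Gn_def)
  qed
  then show ?thesis using eB eK by blast
qed

text \<open>Formal linear combinations are represented by lists: concatenation is addition, and no
  bookkeeping of supports is needed.\<close>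

definition fform :: "('a \<Rightarrow> 'a \<Rightarrow> complex) \<Rightarrow> (complex \<times> 'a) list \<Rightarrow> (complex \<times> 'a) list \<Rightarrow> complex" where
  "fform k l m = (\<Sum>(a, x)\<leftarrow>l. \<Sum>(b, y)\<leftarrow>m. a * cnj b * k x y)"

definition fscale :: "complex \<Rightarrow> (complex \<times> 'a) list \<Rightarrow> (complex \<times> 'a) list" where
  "fscale c = map (\<lambda>(a, x). (c * a, x))"

abbreviation fdiff :: "(complex \<times> 'a) list \<Rightarrow> (complex \<times> 'a) list \<Rightarrow> (complex \<times> 'a) list" where
  "fdiff l m \<equiv> l @ fscale (- 1) m"

definition fnorm :: "('a \<Rightarrow> 'a \<Rightarrow> complex) \<Rightarrow> (complex \<times> 'a) list \<Rightarrow> real" where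
  "fnorm k l = sqrt (Re (fform k l l))"

definition fsupp :: "(complex \<times> 'a) list \<Rightarrow> 'a set" where
  "fsupp l = snd ` set l"

lemma fsupp_simps [simp]:
  "fsupp [] = {}" "fsupp (p # l) = insert (snd p) (fsupp l)" "fsupp (l @ m) = fsupp l \<union> fsupp m"
  "fsupp (fscale c l) = fsupp l"
  by (force simp: fscale_def fsupp_def)+

lemma fform_Nil [simp]: "fform k [] m = 0" "fform k l [] = 0"
  by (induction l) (auto simp: fform_def)

lemma fform_Cons_left: "fform k (p # l) m = fform k [p] m + fform k l m"
  by (simp add: fform_def)

lemma fform_single: "fform k [(a, x)] [(b, y)] = a * cnj b * k x y"
  by (simp add: fform_def)

lemma fform_append_left [simp]: "fform k (l @ l') m = fform k l m + fform k l' m"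
  by (simp add: fform_def)

lemma fform_append_right [simp]: "fform k l (m @ m') = fform k l m + fform k l m'"
  by (induction l) (auto simp: fform_def algebra_simps split: prod.splits)

lemma fform_Cons_right: "fform k l (p # m) = fform k l [p] + fform k l m"
  using fform_append_right[of k l "[p]" m] by simp

lemma sum_list_mult_left: "(\<Sum>x\<leftarrow>xs. c * (f x :: complex)) = c * (\<Sum>x\<leftarrow>xs. f x)"
  by (induction xs) (auto simp: algebra_simps)

lemma fform_fscale_left [simp]: "fform k (fscale c l) m = c * fform k l m"
proof (induction l)
  case (Cons p l)
  have "fform k (fscale c [p]) m = c * fform k [p] m"
    by (cases p) (simp add: fform_def fscale_def sum_list_mult_left[symmetric] case_prod_unfold mult.assoc)
  moreover have "fscale c (p # l) = fscale c [p] @ fscale c l" by (simp add: fscale_def)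
  ultimately show ?case
    using Cons by (subst fform_Cons_left) (simp add: algebra_simps)
qed (simp add: fscale_def)

lemma fform_fscale_right [simp]: "fform k l (fscale c m) = cnj c * fform k l m"
proof (induction l)
  case (Cons p l)
  have "fform k [p] (fscale c m) = cnj c * fform k [p] m"
    by (cases p) (simp add: fform_def fscale_def sum_list_mult_left[symmetric] case_prod_unfold mult.left_commute o_def mult.assoc)
  then show ?case
    using Cons by (subst (1 2) fform_Cons_left) (simp add: algebra_simps)
qed simp

lemma fform_sum_list_right: "fform k l m = (\<Sum>(b, y)\<leftarrow>m. cnj b * fform k l [(1, y)])"
proof (induction m)
  case (Cons p m)
  have "fform k l [p] = cnj (fst p) * fform k l [(1, snd p)]"
    using fform_fscale_right[of k l "fst p" "[(1, snd p)]"] by (simp add: fscale_def)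
  then show ?case using Cons by (subst fform_Cons_right) (simp add: case_prod_unfold)
qed simp

lemma fform_cong:
  assumes "\<And>x y. x \<in> fsupp l \<Longrightarrow> y \<in> fsupp m \<Longrightarrow> k x y = k' x y"
  shows "fform k l m = fform k' l m"
  unfolding fform_def using assms[unfolded fsupp_def]
  by (intro arg_cong[where f = sum_list] map_cong refl) (force intro!: arg_cong[where f = sum_list] map_cong)

lemma fform_kernel_add: "fform (\<lambda>x y. k x y + k' x y) l m = fform k l m + fform k' l m"
proof (induction l)
  case (Cons p l)
  have "fform (\<lambda>x y. k x y + k' x y) [p] m = fform k [p] m + fform k' [p] m"
    by (cases p, induction m) (auto simp: fform_def algebra_simps)
  then show ?case using Cons by (subst (1 2 3) fform_Cons_left) simp
qed simp

lemma fform_kernel_mult: "fform (\<lambda>x y. c * k x y) l m = c * fform k l m"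
proof (induction l)
  case (Cons p l)
  have "fform (\<lambda>x y. c * k x y) [p] m = c * fform k [p] m"
    by (cases p, induction m) (auto simp: fform_def algebra_simps)
  then show ?case using Cons by (subst (1 2) fform_Cons_left) (simp add: algebra_simps)
qed simp

lemma tendsto_fform:
  assumes "\<And>x y. x \<in> fsupp l \<Longrightarrow> y \<in> fsupp m \<Longrightarrow> (\<lambda>n. k n x y) \<longlonglongrightarrow> k' x y"
  shows "(\<lambda>n. fform (k n) l m) \<longlonglongrightarrow> fform k' l m"
  using assms
proof (induction l)
  case (Cons p l)
  have "(\<lambda>n. fform (k n) [p] m) \<longlonglongrightarrow> fform k' [p] m"
    using Cons.prems
  proof (induction m)
    case (Cons q m)
    have "(\<lambda>n. fform (k n) [p] [q]) \<longlonglongrightarrow> fform k' [p] [q]"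
      using Cons.prems by (cases p, cases q) (auto simp: fform_single intro!: tendsto_intros)
    then show ?case using Cons by (subst (1 2) fform_Cons_right) (auto intro!: tendsto_add)
  qed simp
  then show ?case using Cons by (subst (1 2) fform_Cons_left) (auto intro!: tendsto_add)
qed simp

section \<open>Positive semidefinite kernels\<close>

locale pd_kernel =
  fixes X :: "'a set" and k :: "'a \<Rightarrow> 'a \<Rightarrow> complex"
  assumes fform_Im: "fsupp l \<subseteq> X \<Longrightarrow> Im (fform k l l) = 0"
    and fform_nonneg: "fsupp l \<subseteq> X \<Longrightarrow> 0 \<le> Re (fform k l l)"

lemma pd_kernel_cong:
  assumes "pd_kernel X k" and eq: "\<And>x y. x \<in> X \<Longrightarrow> y \<in> X \<Longrightarrow> k' x y = k x y"
  shows "pd_kernel X k'"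
proof -
  interpret pd_kernel X k by fact
  have "fform k' l l = fform k l l" if "fsupp l \<subseteq> X" for l
    by (rule fform_cong) (use that eq in auto)
  then show ?thesis by unfold_locales (simp_all add: fform_Im fform_nonneg)
qed

context pd_kernel
begin

text \<open>Polarisation: the form is real on the combinations \<open>x + y\<close> and
  \<open>x + \<i> y\<close>.\<close>

lemma kernel_cnj: "x \<in> X \<Longrightarrow> y \<in> X \<Longrightarrow> k y x = cnj (k x y)"
proof -
  assume xy: "x \<in> X" "y \<in> X"
  have 1: "Im (k x x) = 0" "Im (k y y) = 0"
    using xy fform_Im[of "[(1, x)]"] fform_Im[of "[(1, y)]"] by (auto simp: fform_def)
  have "Im (k x y + k y x) = 0"
    using fform_Im[of "[(1, x), (1, y)]"] xy 1 by (auto simp: fform_def)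
  moreover have "Im (k x y * (- \<i>) + \<i> * k y x) = 0"
    using fform_Im[of "[(1, x), (\<i>, y)]"] xy 1 by (auto simp: fform_def)
  ultimately show ?thesis by (simp add: complex_eq_iff)
qed

lemma fform_cnj: "fsupp l \<subseteq> X \<Longrightarrow> fsupp m \<subseteq> X \<Longrightarrow> fform k m l = cnj (fform k l m)"
proof (induction l)
  case (Cons p l)
  have "fform k m [p] = cnj (fform k [p] m)"
    using Cons.prems(2)
  proof (induction m)
    case (Cons q m)
    have "fform k [q] [p] = cnj (fform k [p] [q])"
      using Cons.prems \<open>fsupp (p # l) \<subseteq> X\<close> kernel_cnj[of "snd p" "snd q"]
      by (cases p, cases q) (auto simp: fform_single)
    then show ?case
      using Cons fform_Cons_left[of k q m "[p]"] fform_Cons_right[of k "[p]" q m] by auto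
  qed simp
  then show ?case
    using Cons fform_Cons_left[of k p l m] fform_Cons_right[of k m p l] by auto
qed simp

lemma fform_real: "fsupp l \<subseteq> X \<Longrightarrow> fform k l l = of_real (Re (fform k l l))"
  using fform_Im by (simp add: complex_eq_iff)

lemma fnorm_sq: "fsupp l \<subseteq> X \<Longrightarrow> (fnorm k l)\<^sup>2 = Re (fform k l l)"
  using fform_nonneg by (simp add: fnorm_def)

lemma fnorm_nonneg: "fsupp l \<subseteq> X \<Longrightarrow> 0 \<le> fnorm k l"
  using fform_nonneg by (simp add: fnorm_def)

text \<open>The form may be degenerate, so \<open>B = 0\<close> is treated apart: the quadratic
  inequality is then linear in the multiple of \<open>b\<close> inserted for \<open>c\<close>, and
  its boundedness from below forces \<open>b = 0\<close>.\<close>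

lemma fform_CS:
  assumes l: "fsupp l \<subseteq> X" and m: "fsupp m \<subseteq> X"
  shows "cmod (fform k l m) \<le> fnorm k l * fnorm k m"
proof -
  define A B b where "A = Re (fform k l l)" and "B = Re (fform k m m)" and "b = fform k l m"
  have pos: "0 \<le> A" "0 \<le> B" using fform_nonneg l m by (auto simp: A_def B_def)
  have ml: "fform k m l = cnj b" using fform_cnj[OF l m] by (simp add: b_def)
  have quad: "0 \<le> A + 2 * Re (cnj c * b) + (cmod c)\<^sup>2 * B" for c
  proof -
    have "0 \<le> Re (fform k (l @ fscale c m) (l @ fscale c m))"
      using l m by (intro fform_nonneg) auto
    also have "fform k (l @ fscale c m) (l @ fscale c m) = of_real A + cnj c * b + c * cnj b + c * cnj c * of_real B"
      using fform_real[OF l] fform_real[OF m]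
      by (simp add: ml A_def B_def b_def algebra_simps)
    also have "Re \<dots> = A + 2 * Re (cnj c * b) + (cmod c)\<^sup>2 * B"
      unfolding cmod_power2 by (simp add: power2_eq_square algebra_simps)
    finally show ?thesis .
  qed
  have "(cmod b)\<^sup>2 \<le> A * B"
  proof (cases "B = 0")
    case True
    have "(cmod b)\<^sup>2 * (2 * t) \<le> A" for t :: real
    proof -
      have "Re (cnj (- of_real t * b) * b) = - t * (cmod b)\<^sup>2"
        unfolding cmod_power2 by (simp add: power2_eq_square algebra_simps)
      then show ?thesis using quad[of "- of_real t * b"] True by (simp add: algebra_simps)
    qed
    from this[of "(A + 1) / (cmod b)\<^sup>2"] have "b = 0"
      using pos by (cases "b = 0") auto
    then show ?thesis using pos by simp
  next
    case False
    define c where "c = - b / of_real B"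
    have "Re (cnj c * b) = - (cmod b)\<^sup>2 / B"
      using False unfolding cmod_power2 c_def by (simp add: power2_eq_square field_simps)
    moreover have "(cmod c)\<^sup>2 * B = (cmod b)\<^sup>2 / B"
      using False by (simp add: c_def norm_divide power_divide power2_eq_square)
    ultimately have "0 \<le> A - (cmod b)\<^sup>2 / B" using quad[of c] by simp
    then show ?thesis using False pos by (simp add: field_simps)
  qed
  then have "cmod b \<le> sqrt (A * B)" by (rule real_le_rsqrt)
  then show ?thesis by (simp add: fnorm_def A_def B_def b_def real_sqrt_mult)
qed

lemma fnorm_append:
  assumes l: "fsupp l \<subseteq> X" and m: "fsupp m \<subseteq> X"
  shows "fnorm k (l @ m) \<le> fnorm k l + fnorm k m"
proof (rule power2_le_imp_le)
  have "(fnorm k (l @ m))\<^sup>2 = (fnorm k l)\<^sup>2 + 2 * Re (fform k l m) + (fnorm k m)\<^sup>2"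
    using l m fform_cnj[OF l m] by (simp add: fnorm_sq)
  also have "\<dots> \<le> (fnorm k l + fnorm k m)\<^sup>2"
    using fform_CS[OF l m] complex_Re_le_cmod[of "fform k l m"]
    by (simp add: power2_eq_square algebra_simps)
  finally show "(fnorm k (l @ m))\<^sup>2 \<le> (fnorm k l + fnorm k m)\<^sup>2" .
qed (use l m fnorm_nonneg in auto)

lemma fnorm_fscale: "fsupp l \<subseteq> X \<Longrightarrow> fnorm k (fscale c l) = cmod c * fnorm k l"
proof -
  assume l: "fsupp l \<subseteq> X"
  have "Re (fform k (fscale c l) (fscale c l)) = (cmod c)\<^sup>2 * Re (fform k l l)"
    using fform_Im[OF l] unfolding cmod_power2 by (simp add: power2_eq_square algebra_simps)
  then show ?thesis by (simp add: fnorm_def real_sqrt_mult)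
qed

lemma fnorm_fdiff_commute:
  "fsupp l \<subseteq> X \<Longrightarrow> fsupp m \<subseteq> X \<Longrightarrow> fnorm k (fdiff l m) = fnorm k (fdiff m l)"
  by (simp add: fnorm_def algebra_simps)

lemma fnorm_triangle:
  assumes "fsupp l \<subseteq> X" "fsupp m \<subseteq> X" "fsupp p \<subseteq> X"
  shows "fnorm k (fdiff l p) \<le> fnorm k (fdiff l m) + fnorm k (fdiff m p)"
proof -
  have "fnorm k (fdiff l p) = fnorm k (fdiff l m @ fdiff m p)"
    by (simp add: fnorm_def algebra_simps)
  also have "\<dots> \<le> fnorm k (fdiff l m) + fnorm k (fdiff m p)"
    using assms by (intro fnorm_append) auto
  finally show ?thesis .
qed

lemma fnorm_le_fdiff:
  assumes "fsupp l \<subseteq> X" "fsupp m \<subseteq> X"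
  shows "fnorm k l \<le> fnorm k (fdiff l m) + fnorm k m"
  using fnorm_triangle[of l m "[]"] assms by (simp add: fscale_def)

subsection \<open>The reproducing kernel Hilbert space\<close>

definition cauchy_lists :: "(nat \<Rightarrow> (complex \<times> 'a) list) \<Rightarrow> bool" where
  "cauchy_lists l \<longleftrightarrow> (\<forall>n. fsupp (l n) \<subseteq> X) \<and>
     (\<forall>e>0. \<exists>N. \<forall>m\<ge>N. \<forall>n\<ge>N. fnorm k (fdiff (l m) (l n)) < e)"

text \<open>Points of the completion are realised as functions on \<open>X\<close>: a Cauchy
  sequence of combinations is recorded by the limits of its inner products with the points of
  \<open>X\<close>. This takes the place of a quotient, since by \<open>represents_zero_null\<close>
  the function determines the sequence up to null sequences.\<close>

definition represents :: "(nat \<Rightarrow> (complex \<times> 'a) list) \<Rightarrow> ('a \<Rightarrow> complex) \<Rightarrow> bool" where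
  "represents l f \<longleftrightarrow> cauchy_lists l \<and>
     (\<forall>y\<in>X. (\<lambda>n. fform k (l n) [(1, y)]) \<longlonglongrightarrow> f y) \<and> (\<forall>y. y \<notin> X \<longrightarrow> f y = 0)"

lemma represents_cauchy: "represents l f \<Longrightarrow> cauchy_lists l"
  by (simp add: represents_def)

lemma represents_supp: "represents l f \<Longrightarrow> fsupp (l n) \<subseteq> X"
  by (simp add: represents_def cauchy_lists_def)

lemma represents_lim:
  "represents l f \<Longrightarrow> y \<in> X \<Longrightarrow> (\<lambda>n. fform k (l n) [(1, y)]) \<longlonglongrightarrow> f y"
  by (simp add: represents_def)

lemma cauchy_listsE:
  fixes e :: real
  assumes "cauchy_lists l" "0 < e"
  obtains N where "\<And>m n. m \<ge> N \<Longrightarrow> n \<ge> N \<Longrightarrow> fnorm k (fdiff (l m) (l n)) < e"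
proof -
  obtain N where "\<forall>m\<ge>N. \<forall>n\<ge>N. fnorm k (fdiff (l m) (l n)) < e"
    using assms unfolding cauchy_lists_def by blast
  then show ?thesis using that by blast
qed

definition rkhs :: "('a \<Rightarrow> complex) set" where
  "rkhs = {f. \<exists>l. represents l f}"

definition rep_of :: "('a \<Rightarrow> complex) \<Rightarrow> nat \<Rightarrow> (complex \<times> 'a) list" where
  "rep_of f = (SOME l. represents l f)"

definition rip :: "('a \<Rightarrow> complex) \<Rightarrow> ('a \<Rightarrow> complex) \<Rightarrow> complex" where
  "rip f g = lim (\<lambda>n. fform k (rep_of f n) (rep_of g n))"

definition kfun :: "(complex \<times> 'a) list \<Rightarrow> 'a \<Rightarrow> complex" where
  "kfun l y = (if y \<in> X then fform k l [(1, y)] else 0)"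

lemma represents_rep_of: "f \<in> rkhs \<Longrightarrow> represents (rep_of f) f"
  using someI_ex[of "\<lambda>l. represents l f"] by (simp add: rkhs_def rep_of_def)

lemma cauchy_lists_bounded:
  assumes "cauchy_lists l"
  obtains B where "0 < B" "\<And>n. fnorm k (l n) \<le> B"
proof -
  have supp: "fsupp (l n) \<subseteq> X" for n using assms by (simp add: cauchy_lists_def)
  obtain N where N: "\<And>m n. m \<ge> N \<Longrightarrow> n \<ge> N \<Longrightarrow> fnorm k (fdiff (l m) (l n)) < 1"
    using cauchy_listsE[OF assms, of 1] by auto
  define B where "B = 1 + (\<Sum>n\<le>N. fnorm k (l n))"
  have le: "fnorm k (l n) \<le> (\<Sum>n\<le>N. fnorm k (l n))" if "n \<le> N" for n
    using that supp fnorm_nonneg by (intro member_le_sum) auto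
  have "fnorm k (l n) \<le> B" for n
  proof (cases "n \<le> N")
    case True then show ?thesis using le[of n] by (simp add: B_def)
  next
    case False
    then have "fnorm k (l n) \<le> 1 + fnorm k (l N)"
      using fnorm_le_fdiff[OF supp supp, of n N] N[of n N] by simp
    then show ?thesis using le[of N] by (simp add: B_def)
  qed
  moreover have "0 < B"
    unfolding B_def using supp fnorm_nonneg by (intro add_pos_nonneg sum_nonneg) auto
  ultimately show ?thesis using that by blast
qed

lemma fform_diff_le:
  assumes "fsupp l \<subseteq> X" "fsupp m \<subseteq> X" "fsupp l' \<subseteq> X" "fsupp m' \<subseteq> X"
    and "fnorm k m \<le> C" "fnorm k l' \<le> B"
  shows "cmod (fform k l m - fform k l' m') \<le> fnorm k (fdiff l l') * C + B * fnorm k (fdiff m m')"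
proof -
  have "fform k l m - fform k l' m' = fform k (fdiff l l') m + fform k l' (fdiff m m')"
    by (simp add: algebra_simps)
  then have "cmod (fform k l m - fform k l' m') \<le> cmod (fform k (fdiff l l') m) + cmod (fform k l' (fdiff m m'))"
    by (simp only: norm_triangle_ineq)
  also have "\<dots> \<le> fnorm k (fdiff l l') * fnorm k m + fnorm k l' * fnorm k (fdiff m m')"
    using assms by (intro add_mono fform_CS) auto
  also have "\<dots> \<le> fnorm k (fdiff l l') * C + B * fnorm k (fdiff m m')"
    using assms by (intro add_mono mult_left_mono mult_right_mono fnorm_nonneg) auto
  finally show ?thesis .
qed

lemma cauchy_lists_convergent:
  assumes f: "cauchy_lists l" and g: "cauchy_lists m"
  shows "convergent (\<lambda>n. fform k (l n) (m n))"
proof -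
  have s: "fsupp (l n) \<subseteq> X" "fsupp (m n) \<subseteq> X" for n
    using f g by (auto simp: cauchy_lists_def)
  obtain B where B: "0 < B" "\<And>n. fnorm k (l n) \<le> B" using cauchy_lists_bounded[OF f] by metis
  obtain C where C: "0 < C" "\<And>n. fnorm k (m n) \<le> C" using cauchy_lists_bounded[OF g] by metis
  have "Cauchy (\<lambda>n. fform k (l n) (m n))"
  proof (rule metric_CauchyI)
    fix e :: real assume e: "e > 0"
    obtain N1 where N1: "\<And>p q. p \<ge> N1 \<Longrightarrow> q \<ge> N1 \<Longrightarrow> fnorm k (fdiff (l p) (l q)) < e / (2 * C)"
      using cauchy_listsE[OF f, of "e / (2 * C)"] e C(1) by auto
    obtain N2 where N2: "\<And>p q. p \<ge> N2 \<Longrightarrow> q \<ge> N2 \<Longrightarrow> fnorm k (fdiff (m p) (m q)) < e / (2 * B)"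
      using cauchy_listsE[OF g, of "e / (2 * B)"] e B(1) by auto
    have "dist (fform k (l p) (m p)) (fform k (l q) (m q)) < e" if "p \<ge> max N1 N2" "q \<ge> max N1 N2" for p q
    proof -
      have "dist (fform k (l p) (m p)) (fform k (l q) (m q))
          \<le> fnorm k (fdiff (l p) (l q)) * C + B * fnorm k (fdiff (m p) (m q))"
        unfolding dist_norm by (intro fform_diff_le s B C)
      also have "\<dots> < e / (2 * C) * C + B * (e / (2 * B))"
        using N1[of p q] N2[of p q] that B C by (intro add_strict_mono mult_strict_right_mono mult_strict_left_mono) auto
      also have "\<dots> = e" using B C by simp
      finally show ?thesis .
    qed
    then show "\<exists>M. \<forall>p\<ge>M. \<forall>q\<ge>M. dist (fform k (l p) (m p)) (fform k (l q) (m q)) < e" by blast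
  qed
  then show ?thesis by (rule Cauchy_convergent)
qed

lemma represents_add:
  assumes f: "represents l f" and g: "represents m g"
  shows "represents (\<lambda>n. l n @ m n) (\<lambda>x. f x + g x)"
proof -
  have sl: "fsupp (l n) \<subseteq> X" and sm: "fsupp (m n) \<subseteq> X" for n
    using f g by (auto dest: represents_supp)
  have "\<exists>N. \<forall>p\<ge>N. \<forall>q\<ge>N. fnorm k (fdiff (l p @ m p) (l q @ m q)) < e" if e: "e > 0" for e
  proof -
    obtain N1 where N1: "\<And>p q. p \<ge> N1 \<Longrightarrow> q \<ge> N1 \<Longrightarrow> fnorm k (fdiff (l p) (l q)) < e / 2"
      using cauchy_listsE[OF represents_cauchy[OF f], of "e / 2"] e by auto
    obtain N2 where N2: "\<And>p q. p \<ge> N2 \<Longrightarrow> q \<ge> N2 \<Longrightarrow> fnorm k (fdiff (m p) (m q)) < e / 2"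
      using cauchy_listsE[OF represents_cauchy[OF g], of "e / 2"] e by auto
    have "fnorm k (fdiff (l p @ m p) (l q @ m q)) < e" if "p \<ge> max N1 N2" "q \<ge> max N1 N2" for p q
    proof -
      have "fnorm k (fdiff (l p @ m p) (l q @ m q)) = fnorm k (fdiff (l p) (l q) @ fdiff (m p) (m q))"
        by (simp add: fnorm_def fscale_def algebra_simps)
      also have "\<dots> \<le> fnorm k (fdiff (l p) (l q)) + fnorm k (fdiff (m p) (m q))"
        using sl sm by (intro fnorm_append) auto
      also have "\<dots> < e" using N1[of p q] N2[of p q] that by simp
      finally show ?thesis .
    qed
    then show ?thesis by blast
  qed
  then show ?thesis
    using f g sl sm unfolding represents_def cauchy_lists_def by (auto intro!: tendsto_add simp: image_Un)
qed

lemma represents_scale: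
  assumes f: "represents l f"
  shows "represents (\<lambda>n. fscale c (l n)) (\<lambda>x. c * f x)"
proof -
  have sl: "fsupp (l n) \<subseteq> X" for n using f by (rule represents_supp)
  have "\<exists>N. \<forall>p\<ge>N. \<forall>q\<ge>N. fnorm k (fdiff (fscale c (l p)) (fscale c (l q))) < e" if e: "e > 0" for e
  proof -
    have "0 < e / (cmod c + 1)" using e by (simp add: add_nonneg_pos)
    then obtain N where N: "\<And>p q. p \<ge> N \<Longrightarrow> q \<ge> N \<Longrightarrow> fnorm k (fdiff (l p) (l q)) < e / (cmod c + 1)"
      using cauchy_listsE[OF represents_cauchy[OF f]] by metis
    have "fnorm k (fdiff (fscale c (l p)) (fscale c (l q))) < e" if "p \<ge> N" "q \<ge> N" for p q
    proof -
      have "fnorm k (fdiff (fscale c (l p)) (fscale c (l q))) = fnorm k (fscale c (fdiff (l p) (l q)))"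
        by (simp add: fnorm_def algebra_simps)
      also have "\<dots> = cmod c * fnorm k (fdiff (l p) (l q))" using sl by (intro fnorm_fscale) auto
      also have "\<dots> \<le> (cmod c + 1) * fnorm k (fdiff (l p) (l q))"
        using sl fnorm_nonneg by (intro mult_right_mono) auto
      also have "\<dots> < (cmod c + 1) * (e / (cmod c + 1))"
        using N[OF that] by (intro mult_strict_left_mono) (auto simp: add_nonneg_pos)
      also have "\<dots> = e" by (simp add: add_nonneg_eq_0_iff)
      finally show ?thesis .
    qed
    then show ?thesis by blast
  qed
  then show ?thesis
    using f sl unfolding represents_def cauchy_lists_def by (auto intro!: tendsto_mult_left)
qed

lemma represents_kfun: "fsupp l \<subseteq> X \<Longrightarrow> represents (\<lambda>_. l) (kfun l)"
  unfolding represents_def cauchy_lists_def kfun_def by (auto simp: fnorm_def)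

text \<open>Injectivity of the passage from Cauchy sequences to functions. The squared norm of
  \<open>d n\<close> is the product of \<open>d n\<close> with \<open>d N\<close> plus that with
  \<open>d n - d N\<close>; the first tends to 0 because \<open>d N\<close> is a fixed finite
  combination, and the second is small by the Cauchy property.\<close>

lemma represents_zero_null:
  assumes d: "represents d (\<lambda>_. 0)"
  shows "(\<lambda>n. fnorm k (d n)) \<longlonglongrightarrow> 0"
proof (rule LIMSEQ_I)
  fix e :: real assume e: "e > 0"
  have sd: "fsupp (d n) \<subseteq> X" for n using d by (rule represents_supp)
  obtain B where B: "0 < B" "\<And>n. fnorm k (d n) \<le> B" using cauchy_lists_bounded[OF represents_cauchy[OF d]] by metis
  define \<delta> where "\<delta> = e\<^sup>2 / (2 * B)"
  have \<delta>: "\<delta> > 0" using e B by (simp add: \<delta>_def)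
  obtain N where N: "\<And>p q. p \<ge> N \<Longrightarrow> q \<ge> N \<Longrightarrow> fnorm k (fdiff (d p) (d q)) < \<delta>"
    using cauchy_listsE[OF represents_cauchy[OF d] \<delta>] by metis
  have "(\<lambda>n. \<Sum>(b, y)\<leftarrow>m. cnj b * fform k (d n) [(1, y)]) \<longlonglongrightarrow> 0" if "fsupp m \<subseteq> X" for m
    using that
  proof (induction m)
    case (Cons p m)
    then have "(\<lambda>n. fform k (d n) [(1, snd p)]) \<longlonglongrightarrow> 0" using d by (auto simp: represents_def)
    then have "(\<lambda>n. cnj (fst p) * fform k (d n) [(1, snd p)]) \<longlonglongrightarrow> 0" by (rule tendsto_mult_right_zero)
    from tendsto_add[OF this Cons.IH] Cons.prems show ?case by (simp add: case_prod_unfold)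
  qed simp
  then have "(\<lambda>n. fform k (d n) (d N)) \<longlonglongrightarrow> 0"
    using sd[of N] by (subst fform_sum_list_right) auto
  then obtain M where M: "\<And>n. n \<ge> M \<Longrightarrow> cmod (fform k (d n) (d N)) < e\<^sup>2 / 2"
    using LIMSEQ_D[of "\<lambda>n. fform k (d n) (d N)" 0 "e\<^sup>2 / 2"] e by auto
  have "norm (fnorm k (d n) - 0) < e" if "n \<ge> max M N" for n
  proof -
    have "(fnorm k (d n))\<^sup>2 = Re (fform k (d n) (d N) + fform k (d n) (fdiff (d n) (d N)))"
      using sd by (simp add: fnorm_sq)
    also have "\<dots> \<le> cmod (fform k (d n) (d N)) + cmod (fform k (d n) (fdiff (d n) (d N)))"
      by (rule order_trans[OF complex_Re_le_cmod norm_triangle_ineq])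
    also have "\<dots> \<le> cmod (fform k (d n) (d N)) + fnorm k (d n) * fnorm k (fdiff (d n) (d N))"
      using sd by (intro add_left_mono fform_CS) auto
    also have "\<dots> \<le> cmod (fform k (d n) (d N)) + B * fnorm k (fdiff (d n) (d N))"
      using sd B fnorm_nonneg by (intro add_left_mono mult_right_mono) auto
    also have "\<dots> < e\<^sup>2 / 2 + B * \<delta>"
      using M[of n] N[of n N] that B by (intro add_strict_mono mult_strict_left_mono) auto
    also have "\<dots> = e\<^sup>2" using B by (simp add: \<delta>_def)
    finally have "fnorm k (d n) < e" using e by (simp add: power_less_imp_less_base)
    then show ?thesis using fnorm_nonneg[OF sd] by simp
  qed
  then show "\<exists>no. \<forall>n\<ge>no. norm (fnorm k (d n) - 0) < e" by blast
qed

lemma represents_unique_null: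
  assumes "represents l f" "represents m f"
  shows "(\<lambda>n. fnorm k (fdiff (l n) (m n))) \<longlonglongrightarrow> 0"
  using represents_zero_null[of "\<lambda>n. fdiff (l n) (m n)"]
    represents_add[OF assms(1) represents_scale[OF assms(2), of "- 1"]] by simp

text \<open>Frees \<open>rip\<close> from the choice made in \<open>rep_of\<close>: two
  representatives of the same function differ by a null sequence.\<close>

lemma rip_limit:
  assumes f: "represents l f" and g: "represents m g"
  shows "(\<lambda>n. fform k (l n) (m n)) \<longlonglongrightarrow> rip f g"
proof -
  have fr: "represents (rep_of f) f" and gr: "represents (rep_of g) g"
    using f g by (auto intro!: represents_rep_of simp: rkhs_def)
  define l' m' where "l' = rep_of f" and "m' = rep_of g"
  note fr = fr[folded l'_def] and gr = gr[folded m'_def]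
  have s: "fsupp (l n) \<subseteq> X" "fsupp (m n) \<subseteq> X" "fsupp (l' n) \<subseteq> X" "fsupp (m' n) \<subseteq> X" for n
    using f g fr gr by (auto dest: represents_supp)
  have lim': "(\<lambda>n. fform k (l' n) (m' n)) \<longlonglongrightarrow> rip f g"
    using cauchy_lists_convergent[OF fr[THEN represents_cauchy] gr[THEN represents_cauchy]] by (simp add: rip_def l'_def m'_def convergent_LIMSEQ_iff)
  obtain B where B: "\<And>n. fnorm k (l' n) \<le> B" using cauchy_lists_bounded[OF represents_cauchy[OF fr]] by metis
  obtain C where C: "\<And>n. fnorm k (m n) \<le> C" using cauchy_lists_bounded[OF represents_cauchy[OF g]] by metis
  have "(\<lambda>n. fform k (l n) (m n) - fform k (l' n) (m' n)) \<longlonglongrightarrow> 0"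
  proof (rule Lim_null_comparison)
    show "\<forall>\<^sub>F n in sequentially. norm (fform k (l n) (m n) - fform k (l' n) (m' n))
        \<le> fnorm k (fdiff (l n) (l' n)) * C + B * fnorm k (fdiff (m n) (m' n))"
      by (intro always_eventually allI fform_diff_le s B C)
    show "(\<lambda>n. fnorm k (fdiff (l n) (l' n)) * C + B * fnorm k (fdiff (m n) (m' n))) \<longlonglongrightarrow> 0"
      by (intro tendsto_add_zero tendsto_mult_left_zero tendsto_mult_right_zero
          represents_unique_null[OF g gr] represents_unique_null[OF f fr])
  qed
  from tendsto_add[OF this lim'] show ?thesis by simp
qed

lemma rkhsI: "represents l f \<Longrightarrow> f \<in> rkhs"
  by (auto simp: rkhs_def)

lemma rkhs_add: "f \<in> rkhs \<Longrightarrow> g \<in> rkhs \<Longrightarrow> (\<lambda>x. f x + g x) \<in> rkhs"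
  by (rule rkhsI[OF represents_add[OF represents_rep_of represents_rep_of]])

lemma rkhs_scale: "f \<in> rkhs \<Longrightarrow> (\<lambda>x. c * f x) \<in> rkhs"
  by (rule rkhsI[OF represents_scale[OF represents_rep_of]])

lemma rkhs_kfun: "fsupp l \<subseteq> X \<Longrightarrow> kfun l \<in> rkhs"
  by (meson rkhsI represents_kfun)

lemma rkhs_zero: "(\<lambda>x. 0) \<in> rkhs"
  using rkhs_kfun[of "[]"] by (simp add: kfun_def[abs_def] cong: if_cong)

lemma rkhs_outside: "f \<in> rkhs \<Longrightarrow> x \<notin> X \<Longrightarrow> f x = 0"
  by (auto simp: rkhs_def represents_def)

lemma rip_add_left:
  assumes "f \<in> rkhs" "g \<in> rkhs" "h \<in> rkhs"
  shows "rip (\<lambda>x. f x + g x) h = rip f h + rip g h"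
proof -
  note r = assms[THEN represents_rep_of]
  have "(\<lambda>n. fform k (rep_of f n @ rep_of g n) (rep_of h n)) \<longlonglongrightarrow> rip (\<lambda>x. f x + g x) h"
    by (rule rip_limit[OF represents_add[OF r(1,2)] r(3)])
  moreover have "(\<lambda>n. fform k (rep_of f n @ rep_of g n) (rep_of h n)) \<longlonglongrightarrow> rip f h + rip g h"
    by (simp add: tendsto_add rip_limit r)
  ultimately show ?thesis by (rule LIMSEQ_unique)
qed

lemma rip_scale_left:
  assumes "f \<in> rkhs" "h \<in> rkhs"
  shows "rip (\<lambda>x. c * f x) h = c * rip f h"
proof -
  note r = assms[THEN represents_rep_of]
  have "(\<lambda>n. fform k (fscale c (rep_of f n)) (rep_of h n)) \<longlonglongrightarrow> rip (\<lambda>x. c * f x) h"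
    by (rule rip_limit[OF represents_scale[OF r(1)] r(2)])
  moreover have "(\<lambda>n. fform k (fscale c (rep_of f n)) (rep_of h n)) \<longlonglongrightarrow> c * rip f h"
    by (simp add: tendsto_mult_left rip_limit r)
  ultimately show ?thesis by (rule LIMSEQ_unique)
qed

lemma rip_cnj:
  assumes "f \<in> rkhs" "h \<in> rkhs"
  shows "rip h f = cnj (rip f h)"
proof -
  note r = assms[THEN represents_rep_of]
  have "(\<lambda>n. cnj (fform k (rep_of f n) (rep_of h n))) \<longlonglongrightarrow> cnj (rip f h)"
    by (intro tendsto_cnj rip_limit r)
  moreover have "cnj (fform k (rep_of f n) (rep_of h n)) = fform k (rep_of h n) (rep_of f n)" for n
    using r by (subst fform_cnj) (auto simp: represents_supp)
  ultimately show ?thesis using LIMSEQ_unique[OF rip_limit[OF r(2,1)]] by simp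
qed

lemma rip_kfun: "f \<in> rkhs \<Longrightarrow> y \<in> X \<Longrightarrow> rip f (kfun [(1, y)]) = f y"
proof -
  assume f: "f \<in> rkhs" and y: "y \<in> X"
  note r = represents_rep_of[OF f]
  have "(\<lambda>n. fform k (rep_of f n) [(1, y)]) \<longlonglongrightarrow> rip f (kfun [(1, y)])"
    using rip_limit[OF r represents_kfun[of "[(1, y)]"]] y by simp
  then show ?thesis by (rule LIMSEQ_unique) (rule represents_lim[OF r y])
qed

lemma rip_kfun_kfun: "fsupp l \<subseteq> X \<Longrightarrow> fsupp m \<subseteq> X \<Longrightarrow> rip (kfun l) (kfun m) = fform k l m"
  using rip_limit[OF represents_kfun represents_kfun, of l m] by (simp add: LIMSEQ_const_iff)

lemma rip_self_limit:
  assumes "represents l f"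
  shows "(\<lambda>n. fnorm k (l n)) \<longlonglongrightarrow> sqrt (Re (rip f f))"
  unfolding fnorm_def by (intro tendsto_intros rip_limit assms)

lemma rip_nonneg: "f \<in> rkhs \<Longrightarrow> 0 \<le> Re (rip f f)"
proof -
  assume "f \<in> rkhs"
  note r = represents_rep_of[OF this]
  have "(\<lambda>n. Re (fform k (rep_of f n) (rep_of f n))) \<longlonglongrightarrow> Re (rip f f)"
    by (intro tendsto_intros rip_limit r)
  then show ?thesis
    by (rule LIMSEQ_le_const) (use r fform_nonneg in \<open>auto simp: represents_supp\<close>)
qed

text \<open>Evaluation at a point is bounded by a multiple of the norm, so a function of norm 0
  vanishes.\<close>

lemma rip_pos:
  assumes f: "f \<in> rkhs" and ne: "f \<noteq> (\<lambda>_. 0)"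
  shows "0 < Re (rip f f)"
proof (rule ccontr)
  assume "\<not> 0 < Re (rip f f)"
  then have z: "Re (rip f f) = 0" using rip_nonneg[OF f] by simp
  note r = represents_rep_of[OF f]
  have n0: "(\<lambda>n. fnorm k (rep_of f n)) \<longlonglongrightarrow> 0" using rip_self_limit[OF r] z by simp
  have "f y = 0" for y
  proof (cases "y \<in> X")
    case True
    have "(\<lambda>n. fform k (rep_of f n) [(1, y)]) \<longlonglongrightarrow> 0"
    proof (rule Lim_null_comparison)
      show "\<forall>\<^sub>F n in sequentially. norm (fform k (rep_of f n) [(1, y)]) \<le> fnorm k (rep_of f n) * fnorm k [(1, y)]"
        using r True by (intro always_eventually allI fform_CS) (auto simp: represents_supp)
      show "(\<lambda>n. fnorm k (rep_of f n) * fnorm k [(1, y)]) \<longlonglongrightarrow> 0"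
        using tendsto_mult_left_zero[OF n0] by simp
    qed
    from LIMSEQ_unique[OF represents_lim[OF r True] this] show ?thesis .
  qed (use rkhs_outside[OF f] in auto)
  then show False using ne by auto
qed

definition rnorm :: "('a \<Rightarrow> complex) \<Rightarrow> real" where
  "rnorm f = sqrt (Re (rip f f))"

lemma rkhs_diff: "f \<in> rkhs \<Longrightarrow> g \<in> rkhs \<Longrightarrow> (\<lambda>x. f x - g x) \<in> rkhs"
  using rkhs_add[OF _ rkhs_scale[of g "- 1"], of f] by simp

lemma represents_diff:
  "represents l f \<Longrightarrow> represents m g \<Longrightarrow> represents (\<lambda>n. fdiff (l n) (m n)) (\<lambda>x. f x - g x)"
  using represents_add[OF _ represents_scale[of m g "- 1"], of l f] by simp

lemma rnorm_diff_limit: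
  "represents l f \<Longrightarrow> represents m g \<Longrightarrow> (\<lambda>n. fnorm k (fdiff (l n) (m n))) \<longlonglongrightarrow> rnorm (\<lambda>x. f x - g x)"
  unfolding rnorm_def by (intro rip_self_limit represents_diff)

lemma rnorm_triangle:
  assumes "f \<in> rkhs" "g \<in> rkhs" "h \<in> rkhs"
  shows "rnorm (\<lambda>x. f x - h x) \<le> rnorm (\<lambda>x. f x - g x) + rnorm (\<lambda>x. g x - h x)"
proof -
  note r = assms[THEN represents_rep_of]
  show ?thesis
  proof (rule LIMSEQ_le)
    show "(\<lambda>n. fnorm k (fdiff (rep_of f n) (rep_of h n))) \<longlonglongrightarrow> rnorm (\<lambda>x. f x - h x)"
      by (intro rnorm_diff_limit r)
    show "(\<lambda>n. fnorm k (fdiff (rep_of f n) (rep_of g n)) + fnorm k (fdiff (rep_of g n) (rep_of h n)))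
        \<longlonglongrightarrow> rnorm (\<lambda>x. f x - g x) + rnorm (\<lambda>x. g x - h x)"
      by (intro tendsto_add rnorm_diff_limit r)
    show "\<exists>N. \<forall>n\<ge>N. fnorm k (fdiff (rep_of f n) (rep_of h n))
        \<le> fnorm k (fdiff (rep_of f n) (rep_of g n)) + fnorm k (fdiff (rep_of g n) (rep_of h n))"
      using r by (intro exI[of _ 0] allI impI fnorm_triangle) (auto simp: represents_supp)
  qed
qed

lemma kfun_diff: "fsupp l \<subseteq> X \<Longrightarrow> fsupp m \<subseteq> X \<Longrightarrow> (\<lambda>x. kfun l x - kfun m x) = kfun (fdiff l m)"
  by (auto simp: kfun_def)

lemma rnorm_kfun: "fsupp l \<subseteq> X \<Longrightarrow> rnorm (kfun l) = fnorm k l"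
  by (simp add: rnorm_def fnorm_def rip_kfun_kfun)

lemma rnorm_uminus: "f \<in> rkhs \<Longrightarrow> g \<in> rkhs \<Longrightarrow> rnorm (\<lambda>x. f x - g x) = rnorm (\<lambda>x. g x - f x)"
proof -
  assume f: "f \<in> rkhs" and g: "g \<in> rkhs"
  note d = rkhs_diff[OF f g]
  have "rip (\<lambda>x. (-1) * (f x - g x)) (\<lambda>x. (-1) * (f x - g x)) = rip (\<lambda>x. f x - g x) (\<lambda>x. f x - g x)"
    using rip_scale_left[OF d rkhs_scale[OF d], of "-1" "-1"] rip_scale_left[OF d d, of "-1"]
      rip_cnj[OF rkhs_scale[OF d] d, of "-1"] rip_cnj[OF d d] by simp
  then show ?thesis by (simp add: rnorm_def)
qed

lemma represents_kfun_limit: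
  assumes f: "represents l f"
  shows "(\<lambda>n. rnorm (\<lambda>x. kfun (l n) x - f x)) \<longlonglongrightarrow> 0"
proof (rule LIMSEQ_I)
  fix e :: real assume e: "e > 0"
  have s: "fsupp (l n) \<subseteq> X" for n using f by (rule represents_supp)
  obtain N where N: "\<And>p q. p \<ge> N \<Longrightarrow> q \<ge> N \<Longrightarrow> fnorm k (fdiff (l p) (l q)) < e / 2"
    using cauchy_listsE[OF represents_cauchy[OF f], of "e / 2"] e by auto
  have "norm (rnorm (\<lambda>x. kfun (l n) x - f x) - 0) < e" if "n \<ge> N" for n
  proof -
    have "(\<lambda>p. fnorm k (fdiff (l n) (l p))) \<longlonglongrightarrow> rnorm (\<lambda>x. kfun (l n) x - f x)"
      by (rule rnorm_diff_limit[OF represents_kfun[OF s] f])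
    then have "rnorm (\<lambda>x. kfun (l n) x - f x) \<le> e / 2"
      by (rule LIMSEQ_le_const2) (use N that less_imp_le in blast)
    moreover have "0 \<le> rnorm (\<lambda>x. kfun (l n) x - f x)"
      unfolding rnorm_def using rkhs_diff[OF rkhs_kfun[OF s] rkhsI[OF f]] rip_nonneg by simp
    ultimately show ?thesis using e by simp
  qed
  then show "\<exists>no. \<forall>n\<ge>no. norm (rnorm (\<lambda>x. kfun (l n) x - f x) - 0) < e" by blast
qed

text \<open>A diagonal argument: each \<open>F n\<close> is replaced by a finite combination at
  distance below \<open>1 / (n + 1)\<close>. These combinations form a Cauchy sequence, and the
  function it represents is the limit.\<close>

lemma rkhs_complete:
  assumes F: "\<And>n. F n \<in> rkhs"
    and Cauchy: "\<And>e. e > 0 \<Longrightarrow> \<exists>N. \<forall>m\<ge>N. \<forall>n\<ge>N. rnorm (\<lambda>x. F m x - F n x) < e"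
  shows "\<exists>f\<in>rkhs. (\<lambda>n. rnorm (\<lambda>x. F n x - f x)) \<longlonglongrightarrow> 0"
proof -
  have "\<exists>l. fsupp l \<subseteq> X \<and> rnorm (\<lambda>x. kfun l x - F n x) < 1 / (real n + 1)" for n
  proof -
    note r = represents_rep_of[OF F[of n]]
    obtain N where "\<And>p. p \<ge> N \<Longrightarrow> norm (rnorm (\<lambda>x. kfun (rep_of (F n) p) x - F n x) - 0) < 1 / (real n + 1)"
      using LIMSEQ_D[OF represents_kfun_limit[OF r], of "1 / (real n + 1)"] by auto
    from this[of N] have "rnorm (\<lambda>x. kfun (rep_of (F n) N) x - F n x) < 1 / (real n + 1)" by simp
    then show ?thesis using represents_supp[OF r] by blast
  qed
  then obtain l where l: "\<And>n. fsupp (l n) \<subseteq> X" "\<And>n. rnorm (\<lambda>x. kfun (l n) x - F n x) < 1 / (real n + 1)"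
    by metis
  have small: "(\<lambda>n. 1 / (real n + 1)) \<longlonglongrightarrow> 0"
    using LIMSEQ_inverse_real_of_nat by (simp add: inverse_eq_divide add.commute)
  have "\<exists>N. \<forall>p\<ge>N. \<forall>q\<ge>N. fnorm k (fdiff (l p) (l q)) < e" if e: "e > 0" for e
  proof -
    obtain N1 where N1: "\<And>n. n \<ge> N1 \<Longrightarrow> 1 / (real n + 1) < e / 3" using LIMSEQ_D[OF small, of "e / 3"] e by auto
    obtain N2 where N2: "\<And>m n. m \<ge> N2 \<Longrightarrow> n \<ge> N2 \<Longrightarrow> rnorm (\<lambda>x. F m x - F n x) < e / 3"
      using Cauchy[of "e / 3"] e by auto
    have "fnorm k (fdiff (l p) (l q)) < e" if "p \<ge> max N1 N2" "q \<ge> max N1 N2" for p q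
    proof -
      have "fnorm k (fdiff (l p) (l q)) = rnorm (\<lambda>x. kfun (l p) x - kfun (l q) x)"
        using l by (simp add: kfun_diff rnorm_kfun)
      also have "\<dots> \<le> rnorm (\<lambda>x. kfun (l p) x - F p x) + rnorm (\<lambda>x. F p x - kfun (l q) x)"
        using l F by (intro rnorm_triangle rkhs_kfun) auto
      also have "rnorm (\<lambda>x. F p x - kfun (l q) x) \<le> rnorm (\<lambda>x. F p x - F q x) + rnorm (\<lambda>x. F q x - kfun (l q) x)"
        using l F by (intro rnorm_triangle rkhs_kfun) auto
      also have "rnorm (\<lambda>x. F q x - kfun (l q) x) = rnorm (\<lambda>x. kfun (l q) x - F q x)"
        using l F by (intro rnorm_uminus rkhs_kfun) auto
      finally show ?thesis using N1[of p] N1[of q] N2[of p q] l(2)[of p] l(2)[of q] that by simp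
    qed
    then show ?thesis by blast
  qed
  then have lC: "cauchy_lists l" using l(1) by (simp add: cauchy_lists_def)
  define f where "f y = (if y \<in> X then lim (\<lambda>n. fform k (l n) [(1, y)]) else 0)" for y
  have "(\<lambda>n. fform k (l n) [(1, y)]) \<longlonglongrightarrow> f y" if y: "y \<in> X" for y
    using cauchy_lists_convergent[OF lC represents_cauchy[OF represents_kfun[of "[(1, y)]"]]] y
    by (simp add: f_def convergent_LIMSEQ_iff)
  then have rf: "represents l f" using lC by (simp add: represents_def f_def)
  have "(\<lambda>n. rnorm (\<lambda>x. F n x - f x)) \<longlonglongrightarrow> 0"
  proof (rule tendsto_sandwich)
    show "\<forall>\<^sub>F n in sequentially. 0 \<le> rnorm (\<lambda>x. F n x - f x)"
      using rip_nonneg rkhs_diff[OF F rkhsI[OF rf]] by (simp add: rnorm_def)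
    have "rnorm (\<lambda>x. F n x - f x) \<le> 1 / (real n + 1) + rnorm (\<lambda>x. kfun (l n) x - f x)" for n
    proof -
      have "rnorm (\<lambda>x. F n x - f x) \<le> rnorm (\<lambda>x. F n x - kfun (l n) x) + rnorm (\<lambda>x. kfun (l n) x - f x)"
        using F l rkhsI[OF rf] by (intro rnorm_triangle rkhs_kfun) auto
      also have "rnorm (\<lambda>x. F n x - kfun (l n) x) = rnorm (\<lambda>x. kfun (l n) x - F n x)"
        using l F by (intro rnorm_uminus rkhs_kfun) auto
      finally show ?thesis using l(2)[of n] by simp
    qed
    then show "\<forall>\<^sub>F n in sequentially. rnorm (\<lambda>x. F n x - f x) \<le> 1 / (real n + 1) + rnorm (\<lambda>x. kfun (l n) x - f x)"
      by simp
    from tendsto_add[OF small represents_kfun_limit[OF rf]]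
    show "(\<lambda>n. 1 / (real n + 1) + rnorm (\<lambda>x. kfun (l n) x - f x)) \<longlonglongrightarrow> 0" by simp
  qed simp
  then show ?thesis using rkhsI[OF rf] by blast
qed

end

section \<open>Convergence and closed subspaces in inner product spaces\<close>

context complex_inner_product_space
begin

abbreviation nrm :: "'h \<Rightarrow> real" where "nrm \<equiv> ip_norm H"

lemma ip_zero_right: "y \<in> carrier H \<Longrightarrow> ip H y \<zero> = 0"
  using ip_cnj[of \<zero> y] ip_zero_left[of y] by simp

lemma ip_uminus_left: "x \<in> carrier H \<Longrightarrow> z \<in> carrier H \<Longrightarrow> ip H (\<ominus> x) z = - ip H x z"
  using ip_add[of x "\<ominus> x" z] ip_zero_left[of z] by (simp add: M.r_neg add_eq_0_iff)

lemma ip_uminus_right: "x \<in> carrier H \<Longrightarrow> z \<in> carrier H \<Longrightarrow> ip H z (\<ominus> x) = - ip H z x"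
  using ip_cnj[of "\<ominus> x" z] ip_cnj[of x z] by (simp add: ip_uminus_left)

lemma ip_diff_left: "x \<in> carrier H \<Longrightarrow> y \<in> carrier H \<Longrightarrow> z \<in> carrier H \<Longrightarrow> ip H (x \<ominus> y) z = ip H x z - ip H y z"
  by (simp add: a_minus_def ip_add ip_uminus_left)

lemma ip_diff_right: "x \<in> carrier H \<Longrightarrow> y \<in> carrier H \<Longrightarrow> z \<in> carrier H \<Longrightarrow> ip H z (x \<ominus> y) = ip H z x - ip H z y"
  by (simp add: a_minus_def ip_add_right ip_uminus_right)

lemmas ip_simps = ip_zero_left ip_zero_right ip_uminus_left ip_uminus_right ip_diff_left ip_diff_right
  ip_add ip_add_right ip_smult ip_smult_right

lemma diff_closed [simp]: "x \<in> carrier H \<Longrightarrow> y \<in> carrier H \<Longrightarrow> x \<ominus> y \<in> carrier H"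
  by (simp add: a_minus_def)

lemma ip_self_0: "x \<in> carrier H \<Longrightarrow> ip H x x = 0 \<Longrightarrow> x = \<zero>"
  using ip_pos[of x] by fastforce

lemma diff_eq_0: "x \<in> carrier H \<Longrightarrow> y \<in> carrier H \<Longrightarrow> x \<ominus> y = \<zero> \<longleftrightarrow> x = y"
proof -
  assume c: "x \<in> carrier H" "y \<in> carrier H"
  then have "x = (x \<ominus> y) \<oplus> y" by (simp add: a_minus_def M.a_assoc M.l_neg)
  then show ?thesis using c by (metis M.l_zero a_minus_def M.r_neg)
qed

text \<open>The usual way to vector identities below: inner products with \<open>z\<close> turn them
  into identities of complex numbers, which \<open>ip_simps\<close> settles.\<close>

lemma ip_ext:
  assumes "x \<in> carrier H" "y \<in> carrier H" "\<And>z. z \<in> carrier H \<Longrightarrow> ip H x z = ip H y z"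
  shows "x = y"
proof -
  have "ip H (x \<ominus> y) (x \<ominus> y) = 0" using assms by (simp add: ip_diff_left)
  then show ?thesis using assms ip_self_0[of "x \<ominus> y"] diff_eq_0 by simp
qed

lemma zero_smult: "x \<in> carrier H \<Longrightarrow> 0 \<odot> x = \<zero>"
  by (intro ip_ext) (auto simp: ip_simps)

lemma nrm_sq: "x \<in> carrier H \<Longrightarrow> (nrm x)\<^sup>2 = Re (ip H x x)"
  by (simp add: ip_norm_def ip_nonneg)

lemma nrm_nonneg: "x \<in> carrier H \<Longrightarrow> 0 \<le> nrm x"
  by (simp add: ip_norm_def ip_nonneg)

lemma nrm_zero: "nrm \<zero> = 0"
  by (simp add: ip_norm_def ip_zero_left)

lemma ip_self: "x \<in> carrier H \<Longrightarrow> ip H x x = of_real ((nrm x)\<^sup>2)"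
  by (metis ip_real nrm_sq)

lemma nrm_smult: "x \<in> carrier H \<Longrightarrow> nrm (c \<odot> x) = cmod c * nrm x"
proof -
  assume x: "x \<in> carrier H"
  have "ip H (c \<odot> x) (c \<odot> x) = of_real ((cmod c)\<^sup>2) * ip H x x"
    using x by (simp add: ip_simps complex_norm_square flip: of_real_power)
  then have "Re (ip H (c \<odot> x) (c \<odot> x)) = (cmod c)\<^sup>2 * Re (ip H x x)" by simp
  then show ?thesis by (simp add: ip_norm_def real_sqrt_mult)
qed

lemma nrm_diff_commute: "x \<in> carrier H \<Longrightarrow> y \<in> carrier H \<Longrightarrow> nrm (x \<ominus> y) = nrm (y \<ominus> x)"
  by (simp add: ip_norm_def ip_simps algebra_simps)

lemma parallelogram:
  assumes "x \<in> carrier H" "y \<in> carrier H"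
  shows "(nrm (x \<oplus> y))\<^sup>2 + (nrm (x \<ominus> y))\<^sup>2 = 2 * (nrm x)\<^sup>2 + 2 * (nrm y)\<^sup>2"
  using assms by (simp add: nrm_sq ip_simps)

definition hconv :: "(nat \<Rightarrow> 'h) \<Rightarrow> 'h \<Rightarrow> bool" where
  "hconv s w \<longleftrightarrow> (\<forall>n. s n \<in> carrier H) \<and> w \<in> carrier H \<and> (\<lambda>n. nrm (s n \<ominus> w)) \<longlonglongrightarrow> 0"

lemma hconv_iff_limitin:
  assumes "\<And>n. s n \<in> carrier H"
  shows "hconv s w \<longleftrightarrow> limitin mtopology s w sequentially"
proof -
  have "ip_dist H (s n) w = nrm (s n \<ominus> w)" if "w \<in> carrier H" for n
    using that assms by (simp add: ip_dist_def)
  then show ?thesis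
    unfolding hconv_def limit_metric_sequentially LIMSEQ_def using assms nrm_nonneg
    by (auto simp: dist_real_def)
qed

lemma hconvI:
  assumes "\<And>n. s n \<in> carrier H" "w \<in> carrier H" "\<And>n. nrm (s n \<ominus> w) \<le> f n" "f \<longlonglongrightarrow> 0"
  shows "hconv s w"
  unfolding hconv_def
  using assms nrm_nonneg by (auto intro!: tendsto_sandwich[of "\<lambda>_. 0" "\<lambda>n. nrm (s n \<ominus> w)" sequentially f])

lemma hconv_closed: "hconv s w \<Longrightarrow> s n \<in> carrier H" "hconv s w \<Longrightarrow> w \<in> carrier H"
  by (auto simp: hconv_def)

lemma hconv_const: "w \<in> carrier H \<Longrightarrow> hconv (\<lambda>_. w) w"
  by (auto intro!: hconvI[where f = "\<lambda>_. 0"] simp: diff_eq_0[THEN iffD2] nrm_zero)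

lemma hconv_add:
  assumes "hconv s w" "hconv t v" shows "hconv (\<lambda>n. s n \<oplus> t n) (w \<oplus> v)"
proof (rule hconvI)
  have c: "s n \<in> carrier H" "t n \<in> carrier H" "w \<in> carrier H" "v \<in> carrier H" for n
    using assms by (auto simp: hconv_def)
  show "s n \<oplus> t n \<in> carrier H" "w \<oplus> v \<in> carrier H" for n using c by auto
  show "nrm ((s n \<oplus> t n) \<ominus> (w \<oplus> v)) \<le> nrm (s n \<ominus> w) + nrm (t n \<ominus> v)" for n
  proof -
    have "(s n \<oplus> t n) \<ominus> (w \<oplus> v) = (s n \<ominus> w) \<oplus> (t n \<ominus> v)"
      using c by (intro ip_ext) (auto simp: ip_simps)
    then show ?thesis using ip_norm_triangle[of "s n \<ominus> w" "t n \<ominus> v"] c by simp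
  qed
  show "(\<lambda>n. nrm (s n \<ominus> w) + nrm (t n \<ominus> v)) \<longlonglongrightarrow> 0"
    using assms tendsto_add[of "\<lambda>n. nrm (s n \<ominus> w)" 0 sequentially "\<lambda>n. nrm (t n \<ominus> v)" 0] by (simp add: hconv_def)
qed

lemma hconv_smult:
  assumes "hconv s w" shows "hconv (\<lambda>n. c \<odot> s n) (c \<odot> w)"
proof (rule hconvI)
  have c: "s n \<in> carrier H" "w \<in> carrier H" for n using assms by (auto simp: hconv_def)
  show "c \<odot> s n \<in> carrier H" "c \<odot> w \<in> carrier H" for n using c by auto
  have "c \<odot> s n \<ominus> c \<odot> w = c \<odot> (s n \<ominus> w)" for n
    using c by (intro ip_ext) (auto simp: ip_simps algebra_simps)
  then show "nrm (c \<odot> s n \<ominus> c \<odot> w) \<le> cmod c * nrm (s n \<ominus> w)" for n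
    using c by (simp add: nrm_smult)
  show "(\<lambda>n. cmod c * nrm (s n \<ominus> w)) \<longlonglongrightarrow> 0"
    using assms by (auto simp: hconv_def intro: tendsto_mult_right_zero)
qed

lemma hconv_ip:
  assumes s: "hconv s w" and t: "hconv t v"
  shows "(\<lambda>n. ip H (s n) (t n)) \<longlonglongrightarrow> ip H w v"
proof -
  have c: "s n \<in> carrier H" "t n \<in> carrier H" "w \<in> carrier H" "v \<in> carrier H" for n
    using assms by (auto simp: hconv_def)
  have "(\<lambda>n. ip H (s n) (t n) - ip H w v) \<longlonglongrightarrow> 0"
  proof (rule Lim_null_comparison)
    have "cmod (ip H (s n) (t n) - ip H w v) \<le>
      nrm (s n \<ominus> w) * nrm (t n \<ominus> v) + nrm (s n \<ominus> w) * nrm v + nrm w * nrm (t n \<ominus> v)" for n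
    proof -
      have "ip H (s n) (t n) - ip H w v = ip H (s n \<ominus> w) (t n \<ominus> v) + ip H (s n \<ominus> w) v + ip H w (t n \<ominus> v)"
        using c by (simp add: ip_simps)
      then show ?thesis
        using ip_Cauchy_Schwarz[of "s n \<ominus> w" "t n \<ominus> v"] ip_Cauchy_Schwarz[of "s n \<ominus> w" v]
          ip_Cauchy_Schwarz[of w "t n \<ominus> v"] c
          norm_triangle_ineq[of "ip H (s n \<ominus> w) (t n \<ominus> v) + ip H (s n \<ominus> w) v" "ip H w (t n \<ominus> v)"]
          norm_triangle_ineq[of "ip H (s n \<ominus> w) (t n \<ominus> v)" "ip H (s n \<ominus> w) v"] by simp
    qed
    then show "\<forall>\<^sub>F n in sequentially. norm (ip H (s n) (t n) - ip H w v) \<le>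
      nrm (s n \<ominus> w) * nrm (t n \<ominus> v) + nrm (s n \<ominus> w) * nrm v + nrm w * nrm (t n \<ominus> v)" by simp
    have "(\<lambda>n. nrm (s n \<ominus> w) * nrm (t n \<ominus> v) + nrm (s n \<ominus> w) * nrm v + nrm w * nrm (t n \<ominus> v))
      \<longlonglongrightarrow> 0 * 0 + 0 * nrm v + nrm w * 0"
      using assms by (intro tendsto_intros) (auto simp: hconv_def)
    then show "(\<lambda>n. nrm (s n \<ominus> w) * nrm (t n \<ominus> v) + nrm (s n \<ominus> w) * nrm v + nrm w * nrm (t n \<ominus> v)) \<longlonglongrightarrow> 0"
      by simp
  qed
  then show ?thesis by (simp add: LIM_zero_iff)
qed

lemma hconv_nrm: "hconv s w \<Longrightarrow> (\<lambda>n. nrm (s n)) \<longlonglongrightarrow> nrm w"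
  unfolding ip_norm_def by (intro tendsto_intros hconv_ip)

lemma hconv_unique: "hconv s w \<Longrightarrow> hconv s v \<Longrightarrow> w = v"
  by (meson hconv_closed hconv_const hconv_ip ip_ext LIMSEQ_unique)

lemma hclosed_iff:
  "closedin mtopology W \<longleftrightarrow> W \<subseteq> carrier H \<and> (\<forall>s w. (\<forall>n. s n \<in> W) \<and> hconv s w \<longrightarrow> w \<in> W)"
proof -
  have "(range s \<subseteq> W \<and> limitin mtopology s w sequentially) \<longleftrightarrow> ((\<forall>n. s n \<in> W) \<and> hconv s w)"
    if "W \<subseteq> carrier H" for s w
  proof -
    have "range s \<subseteq> W \<longleftrightarrow> (\<forall>n. s n \<in> W)" by auto
    moreover have "hconv s w \<longleftrightarrow> limitin mtopology s w sequentially" if "\<forall>n. s n \<in> W"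
      using that \<open>W \<subseteq> carrier H\<close> by (intro hconv_iff_limitin) auto
    ultimately show ?thesis by blast
  qed
  then show ?thesis unfolding metric_closedin_iff_sequentially_closed by blast
qed

lemma hsubspaceI:
  assumes "W \<subseteq> carrier H" "\<zero> \<in> W" "\<And>x y. x \<in> W \<Longrightarrow> y \<in> W \<Longrightarrow> x \<oplus> y \<in> W"
    "\<And>c x. x \<in> W \<Longrightarrow> c \<odot> x \<in> W"
  shows "subspace class_ring W H"
  unfolding subspace_def submodule_def
  using assms vectorspace_axioms module_axioms by auto

lemma hsubspaceD:
  assumes "subspace class_ring W H"
  shows "W \<subseteq> carrier H" "\<zero> \<in> W" "x \<in> W \<Longrightarrow> y \<in> W \<Longrightarrow> x \<oplus> y \<in> W" "x \<in> W \<Longrightarrow> c \<odot> x \<in> W"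
  using assms unfolding subspace_def submodule_def by auto

lemma hsubspace_diff:
  assumes W: "subspace class_ring W H" and x: "x \<in> W" and y: "y \<in> W" shows "x \<ominus> y \<in> W"
proof -
  have c: "x \<in> carrier H" "y \<in> carrier H" using hsubspaceD(1)[OF W] x y by auto
  have "x \<ominus> y = x \<oplus> (- 1) \<odot> y"
    using c by (intro ip_ext) (auto simp: ip_simps)
  then show ?thesis using hsubspaceD[OF W] x y by simp
qed

lemma carrier_hsubspace: "subspace class_ring (carrier H) H"
  by (rule hsubspaceI) auto

lemma carrier_hclosed: "closedin mtopology (carrier H)"
  by (auto simp: hclosed_iff hconv_closed)

definition ortho :: "'h set \<Rightarrow> 'h set" where
  "ortho W = {x \<in> carrier H. \<forall>u\<in>W. ip H x u = 0}"

lemma ortho_hsubspace: "W \<subseteq> carrier H \<Longrightarrow> subspace class_ring (ortho W) H"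
  by (rule hsubspaceI) (auto simp: ortho_def ip_simps subset_iff)

lemma ortho_hclosed: "W \<subseteq> carrier H \<Longrightarrow> closedin mtopology (ortho W)"
  unfolding hclosed_iff
proof (intro conjI allI impI)
  fix s w assume W: "W \<subseteq> carrier H" and s: "(\<forall>n. s n \<in> ortho W) \<and> hconv s w"
  have "ip H w u = 0" if "u \<in> W" for u
  proof -
    have "(\<lambda>n. ip H (s n) u) \<longlonglongrightarrow> ip H w u" using s that W by (intro hconv_ip hconv_const) auto
    moreover have "(\<lambda>n. ip H (s n) u) = (\<lambda>n. 0)" using s that by (auto simp: ortho_def)
    ultimately show ?thesis by (simp add: LIMSEQ_const_iff)
  qed
  then show "w \<in> ortho W" using s by (auto simp: ortho_def hconv_closed)
qed (auto simp: ortho_def)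

definition lvec :: "(complex \<times> 'h) list \<Rightarrow> 'h" where
  "lvec l = foldr (\<lambda>(a, x) v. a \<odot> x \<oplus> v) l \<zero>"

lemma lvec_simps [simp]: "lvec [] = \<zero>" "lvec ((a, x) # l) = a \<odot> x \<oplus> lvec l"
  by (simp_all add: lvec_def)

lemma lvec_closed: "fsupp l \<subseteq> carrier H \<Longrightarrow> lvec l \<in> carrier H"
  by (induction l) auto

lemma lvec_in_subspace: "subspace class_ring W H \<Longrightarrow> fsupp l \<subseteq> W \<Longrightarrow> lvec l \<in> W"
  by (induction l) (auto simp: hsubspaceD)

lemma lvec_append: "fsupp l \<subseteq> carrier H \<Longrightarrow> fsupp m \<subseteq> carrier H \<Longrightarrow> lvec (l @ m) = lvec l \<oplus> lvec m"
  by (induction l) (auto simp: lvec_closed M.a_assoc)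

lemma lvec_fscale: "fsupp l \<subseteq> carrier H \<Longrightarrow> lvec (fscale c l) = c \<odot> lvec l"
proof (induction l)
  case (Cons p l)
  then show ?case
    using smult_assoc1[of c "fst p" "snd p"] smult_r_distr[of c "fst p \<odot> snd p" "lvec l"]
    by (cases p) (auto simp: fscale_def lvec_closed class_ring_simps)
qed (simp add: fscale_def)

lemma ip_lvec: "fsupp l \<subseteq> carrier H \<Longrightarrow> fsupp m \<subseteq> carrier H \<Longrightarrow> ip H (lvec l) (lvec m) = fform (ip H) l m"
proof (induction l)
  case (Cons p l)
  have "ip H (lvec [p]) (lvec m) = fform (ip H) [p] m"
    using Cons.prems(2)
  proof (induction m)
    case (Cons q m)
    then show ?case using \<open>fsupp (p # l) \<subseteq> carrier H\<close>
      by (cases p, cases q, subst fform_Cons_right) (auto simp: ip_simps lvec_closed fform_single)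
  next
    case Nil then show ?case using \<open>fsupp (p # l) \<subseteq> carrier H\<close> by (cases p) (auto simp: ip_simps)
  qed
  then show ?case using Cons
    by (cases p, subst fform_Cons_left) (auto simp: ip_simps lvec_closed)
qed (auto simp: ip_simps lvec_closed)

lemma fform_map: "fform k (map (\<lambda>(a, x). (a, f x)) l) (map (\<lambda>(a, x). (a, f x)) m) = fform (\<lambda>x y. k (f x) (f y)) l m"
  by (simp add: fform_def o_def case_prod_unfold)

lemma fsupp_map: "fsupp (map (\<lambda>(a, x). (a, f x)) l) = f ` fsupp l"
  by (induction l) (auto simp: case_prod_unfold)

lemma pd_kernel_ip:
  assumes "f ` X \<subseteq> carrier H"
  shows "pd_kernel X (\<lambda>x y. ip H (f x) (f y))"
proof
  fix l assume l: "fsupp l \<subseteq> X"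
  let ?l = "map (\<lambda>(a, x). (a, f x)) l"
  have s: "fsupp ?l \<subseteq> carrier H" using l assms by (auto simp: fsupp_map)
  have e: "fform (\<lambda>x y. ip H (f x) (f y)) l l = ip H (lvec ?l) (lvec ?l)"
    using ip_lvec[OF s s] by (simp add: fform_map)
  show "Im (fform (\<lambda>x y. ip H (f x) (f y)) l l) = 0" "0 \<le> Re (fform (\<lambda>x y. ip H (f x) (f y)) l l)"
    unfolding e using ip_self[OF lvec_closed[OF s]] by simp_all
qed

end

section \<open>Vectors of minimal norm and orthogonal decomposition\<close>

context complex_hilbert_space
begin

lemma hcomplete:
  assumes "\<And>n. s n \<in> carrier H" "\<And>e. e > 0 \<Longrightarrow> \<exists>N. \<forall>m\<ge>N. \<forall>n\<ge>N. nrm (s m \<ominus> s n) < e"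
  shows "\<exists>w. hconv s w"
proof -
  have "MCauchy s" unfolding MCauchy_def using assms by (fastforce simp: ip_dist_def)
  then obtain w where "limitin mtopology s w sequentially" using complete by (auto simp: mcomplete_def)
  then have "hconv s w" using hconv_iff_limitin[of s w] assms(1) by simp
  then show ?thesis ..
qed

text \<open>The parallelogram law makes a minimising sequence Cauchy once midpoints stay in
  \<open>S\<close>. As \<open>S\<close> may fail to be closed, \<open>w\<close> is only a limit of
  points of \<open>S\<close>. This is applied to the translates \<open>x - W\<close> of a subspace
  and to the affine hull of an orbit.\<close>

lemma minimizing_sequence:
  assumes S: "S \<subseteq> carrier H" "S \<noteq> {}" and mid: "\<And>x y. x \<in> S \<Longrightarrow> y \<in> S \<Longrightarrow> (1/2) \<odot> (x \<oplus> y) \<in> S"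
  obtains s w where "\<And>n. s n \<in> S" "hconv s w" "\<And>x. x \<in> S \<Longrightarrow> nrm w \<le> nrm x"
proof -
  define d where "d = (INF x\<in>S. nrm x)"
  have bdd: "bdd_below (nrm ` S)" using S nrm_nonneg by (intro bdd_belowI[of _ 0]) auto
  have d: "d \<le> nrm x" if "x \<in> S" for x unfolding d_def using bdd that by (rule cINF_lower)
  have d0: "0 \<le> d" unfolding d_def using S nrm_nonneg by (intro cINF_greatest) auto
  have "\<exists>x\<in>S. nrm x < d + 1 / (real n + 1)" for n
  proof -
    have "d < d + 1 / (real n + 1)" by simp
    then show ?thesis unfolding d_def using cINF_less_iff[OF S(2) bdd] by blast
  qed
  then obtain s where s: "\<And>n. s n \<in> S" "\<And>n. nrm (s n) < d + 1 / (real n + 1)" by metis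
  have sc: "s n \<in> carrier H" for n using s S by auto
  have le: "(nrm (s m \<ominus> s n))\<^sup>2 \<le> 2 * (nrm (s m))\<^sup>2 + 2 * (nrm (s n))\<^sup>2 - 4 * d\<^sup>2" for m n
  proof -
    have "nrm ((1/2) \<odot> (s m \<oplus> s n)) = nrm (s m \<oplus> s n) / 2" using sc by (simp add: nrm_smult)
    then have "2 * d \<le> nrm (s m \<oplus> s n)" using d[OF mid[OF s(1)[of m] s(1)[of n]]] by simp
    then have "(2 * d)\<^sup>2 \<le> (nrm (s m \<oplus> s n))\<^sup>2" using d0 by (intro power_mono) auto
    then show ?thesis using parallelogram[OF sc[of m] sc[of n]] by simp
  qed
  have bound: "(nrm (s n))\<^sup>2 \<le> d\<^sup>2 + (2 * d + 1) / (real n + 1)" for n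
  proof -
    have "(nrm (s n))\<^sup>2 \<le> (d + 1 / (real n + 1))\<^sup>2"
      using s(2)[of n] nrm_nonneg[OF sc[of n]] by (intro power_mono) auto
    also have "\<dots> = d\<^sup>2 + 2 * d / (real n + 1) + 1 / (real n + 1) * (1 / (real n + 1))"
      by (simp add: power2_eq_square algebra_simps)
    also have "\<dots> \<le> d\<^sup>2 + 2 * d / (real n + 1) + 1 / (real n + 1) * 1"
      by (intro add_left_mono mult_left_mono) auto
    finally show ?thesis by (simp add: add_divide_distrib)
  qed
  have "\<exists>N. \<forall>m\<ge>N. \<forall>n\<ge>N. nrm (s m \<ominus> s n) < e" if e: "e > 0" for e
  proof -
    \<comment> \<open>With this bound each squared norm exceeds the square of \<open>d\<close> by
      less than a quarter of the square of \<open>e\<close>, and \<open>le\<close> counts both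
      excesses twice.\<close>
    define c where "c = e\<^sup>2 / (4 * (2 * d + 1))"
    have c: "c > 0" using e d0 by (simp add: c_def)
    obtain N where "inverse (real (Suc N)) < c" using reals_Archimedean[OF c] by blast
    then have N: "1 / (real N + 1) < c" by (simp add: inverse_eq_divide add.commute)
    have small: "(2 * d + 1) / (real n + 1) < e\<^sup>2 / 4" if "n \<ge> N" for n
    proof -
      have "(2 * d + 1) / (real n + 1) \<le> (2 * d + 1) * (1 / (real N + 1))"
        using that d0 by (simp add: frac_le)
      also have "\<dots> < (2 * d + 1) * c" using N d0 by (intro mult_strict_left_mono) auto
      also have "\<dots> = e\<^sup>2 / 4" using d0 by (simp add: c_def field_simps)
      finally show ?thesis .
    qed
    have "nrm (s m \<ominus> s n) < e" if "m \<ge> N" "n \<ge> N" for m n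
    proof -
      have "(nrm (s m \<ominus> s n))\<^sup>2 < e\<^sup>2"
        using le[of m n] bound[of m] bound[of n] small[OF that(1)] small[OF that(2)] by linarith
      then show ?thesis using e by (simp add: power_less_imp_less_base)
    qed
    then show ?thesis by blast
  qed
  then obtain w where w: "hconv s w" using hcomplete[of s] sc by auto
  have "nrm w \<le> d"
  proof (rule LIMSEQ_le[OF hconv_nrm[OF w]])
    show "\<exists>N. \<forall>n\<ge>N. nrm (s n) \<le> d + 1 / (real n + 1)" using s(2) less_imp_le by blast
    have "(\<lambda>n. 1 / (real n + 1)) \<longlonglongrightarrow> 0"
      using LIMSEQ_inverse_real_of_nat by (simp add: inverse_eq_divide add.commute)
    from tendsto_add[OF tendsto_const[of d] this] show "(\<lambda>n. d + 1 / (real n + 1)) \<longlonglongrightarrow> d" by simp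
  qed
  then show ?thesis using that[OF s(1) w] d by (meson order_trans)
qed

lemma orthogonal_decomposition:
  assumes W: "subspace class_ring W H" "closedin mtopology W" and x: "x \<in> carrier H"
  obtains w v where "w \<in> W" "v \<in> ortho W" "x = w \<oplus> v"
proof -
  note Wd = hsubspaceD[OF W(1)]
  have Wc: "u \<in> W \<Longrightarrow> u \<in> carrier H" for u using Wd(1) by auto
  define S where "S = (\<lambda>u. x \<ominus> u) ` W"
  have S: "S \<subseteq> carrier H" "S \<noteq> {}" using x Wc Wd(2) by (auto simp: S_def)
  have mid: "(1/2) \<odot> (a \<oplus> b) \<in> S" if ab: "a \<in> S" "b \<in> S" for a b
  proof -
    obtain u v where uv: "u \<in> W" "v \<in> W" "a = x \<ominus> u" "b = x \<ominus> v" using ab by (auto simp: S_def)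
    have "(1/2) \<odot> (a \<oplus> b) = x \<ominus> (1/2) \<odot> (u \<oplus> v)"
      using uv x Wc by (intro ip_ext) (auto simp: ip_simps algebra_simps)
    then show ?thesis using uv Wd unfolding S_def by auto
  qed
  obtain s v where s: "\<And>n. s n \<in> S" "hconv s v" "\<And>y. y \<in> S \<Longrightarrow> nrm v \<le> nrm y"
    using minimizing_sequence[OF S mid] by metis
  have vc: "v \<in> carrier H" using s(2) by (rule hconv_closed)
  have "\<exists>t. \<forall>n. t n \<in> W \<and> s n = x \<ominus> t n" using s(1) unfolding S_def by (intro choice) blast
  then obtain t where t: "\<And>n. t n \<in> W" "\<And>n. s n = x \<ominus> t n" by blast
  have "hconv t (x \<ominus> v)"
  proof -
    have "hconv (\<lambda>n. x \<oplus> (-1) \<odot> s n) (x \<oplus> (-1) \<odot> v)"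
      by (intro hconv_add hconv_smult hconv_const s x)
    moreover have "x \<oplus> (-1) \<odot> s n = t n" for n
      using x Wc t by (intro ip_ext) (auto simp: ip_simps)
    moreover have "x \<oplus> (-1) \<odot> v = x \<ominus> v"
      using x vc by (intro ip_ext) (auto simp: ip_simps)
    ultimately show ?thesis by simp
  qed
  then have xv: "x \<ominus> v \<in> W" using W(2) t(1) by (auto simp: hclosed_iff)
  have "ip H v u = 0" if u: "u \<in> W" for u
  proof (rule ccontr)
    define b where "b = ip H v u"
    assume "ip H v u \<noteq> 0"
    then have b: "b \<noteq> 0" by (simp add: b_def)
    define A where "A = (nrm u)\<^sup>2"
    have A: "A > 0"
      using b ip_norm_eq_0[OF Wc[OF u]] ip_zero_right[OF vc] by (auto simp: A_def b_def)
    \<comment> \<open>\<open>c \<odot> u\<close> is the projection of \<open>v\<close> onto the line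
      of \<open>u\<close>; subtracting it would shorten \<open>v\<close>, against
      minimality.\<close>
    define c where "c = b / of_real A"
    have "x \<ominus> ((x \<ominus> v) \<oplus> c \<odot> u) \<in> S" using xv u Wd by (auto simp: S_def)
    moreover have "x \<ominus> ((x \<ominus> v) \<oplus> c \<odot> u) = v \<ominus> c \<odot> u"
      using x vc Wc[OF u] by (intro ip_ext) (auto simp: ip_simps)
    ultimately have "nrm v \<le> nrm (v \<ominus> c \<odot> u)" using s(3) by metis
    then have "(nrm v)\<^sup>2 \<le> (nrm (v \<ominus> c \<odot> u))\<^sup>2" using vc nrm_nonneg by (intro power_mono) auto
    also have "ip H (v \<ominus> c \<odot> u) (v \<ominus> c \<odot> u) = of_real ((nrm v)\<^sup>2) - cnj c * b - c * cnj b + c * cnj c * of_real A"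
      using vc Wc[OF u] ip_cnj[OF vc Wc[OF u]] ip_self[OF vc] ip_self[OF Wc[OF u]]
      by (simp add: ip_simps b_def A_def algebra_simps)
    then have "(nrm (v \<ominus> c \<odot> u))\<^sup>2 = Re (of_real ((nrm v)\<^sup>2) - cnj c * b - c * cnj b + c * cnj c * of_real A)"
      using vc Wc[OF u] by (simp add: nrm_sq)
    also have "of_real ((nrm v)\<^sup>2) - cnj c * b - c * cnj b + c * cnj c * of_real A = of_real ((nrm v)\<^sup>2) - b * cnj b / of_real A"
      using A by (simp add: c_def field_simps)
    also have "\<dots> = of_real ((nrm v)\<^sup>2 - (cmod b)\<^sup>2 / A)"
      by (simp add: complex_norm_square[symmetric])
    finally have "(cmod b)\<^sup>2 / A \<le> 0" by simp
    moreover have "(cmod b)\<^sup>2 / A > 0" using A b by simp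
    ultimately show False by simp
  qed
  then have "v \<in> ortho W" using vc by (simp add: ortho_def)
  moreover have "x = (x \<ominus> v) \<oplus> v" using x vc by (intro ip_ext) (auto simp: ip_simps)
  ultimately show ?thesis using that xv by blast
qed

end

subsection \<open>Positive definite functions and unitary representations\<close>

context pd_kernel
begin

text \<open>The structure is transported along an injection \<open>j\<close> into the type
  \<open>'h\<close>, in which the vectors of the representations to be constructed must
  live.\<close>

definition rkhs_space :: "(('a \<Rightarrow> complex) \<Rightarrow> 'h) \<Rightarrow> 'h inner_product_struct" where
  "rkhs_space j = \<lparr>carrier = j ` rkhs, monoid.mult = undefined, one = undefined, ring.zero = j (\<lambda>_. 0),
     add = (\<lambda>u v. j (\<lambda>x. inv_into rkhs j u x + inv_into rkhs j v x)),
     module.smult = (\<lambda>c u. j (\<lambda>x. c * inv_into rkhs j u x)),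
     ip = (\<lambda>u v. rip (inv_into rkhs j u) (inv_into rkhs j v))\<rparr>"

context
  fixes j :: "('a \<Rightarrow> complex) \<Rightarrow> 'h"
  assumes j: "inj_on j rkhs"
begin

lemma rkhs_space_sel:
  "carrier (rkhs_space j) = j ` rkhs"
  "\<zero>\<^bsub>rkhs_space j\<^esub> = j (\<lambda>_. 0)"
  "f \<in> rkhs \<Longrightarrow> g \<in> rkhs \<Longrightarrow> j f \<oplus>\<^bsub>rkhs_space j\<^esub> j g = j (\<lambda>x. f x + g x)"
  "f \<in> rkhs \<Longrightarrow> c \<odot>\<^bsub>rkhs_space j\<^esub> j f = j (\<lambda>x. c * f x)"
  "f \<in> rkhs \<Longrightarrow> g \<in> rkhs \<Longrightarrow> ip (rkhs_space j) (j f) (j g) = rip f g"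
  using j by (simp_all add: rkhs_space_def)

lemma rkhs_inner_product_space: "complex_inner_product_space (rkhs_space j)"
proof -
  let ?H = "rkhs_space j"
  note sel = rkhs_space_sel
  have abg: "abelian_group ?H"
  proof (rule abelian_groupI)
    fix u v w assume "u \<in> carrier ?H"
    then obtain f where f: "f \<in> rkhs" "u = j f" by (auto simp: sel)
    show "\<zero>\<^bsub>?H\<^esub> \<oplus>\<^bsub>?H\<^esub> u = u" using f by (simp add: sel rkhs_zero)
    have "j (\<lambda>x. - 1 * f x) \<oplus>\<^bsub>?H\<^esub> j f = \<zero>\<^bsub>?H\<^esub>"
      by (subst sel(3)) (use f rkhs_scale[OF f(1), of "-1"] in \<open>auto simp: sel\<close>)
    then show "\<exists>y\<in>carrier ?H. y \<oplus>\<^bsub>?H\<^esub> u = \<zero>\<^bsub>?H\<^esub>"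
      using f rkhs_scale[OF f(1), of "-1"] unfolding sel(1) by blast
    assume "v \<in> carrier ?H"
    then obtain g where g: "g \<in> rkhs" "v = j g" by (auto simp: sel)
    show "u \<oplus>\<^bsub>?H\<^esub> v \<in> carrier ?H" using f g by (auto simp: sel rkhs_add)
    show "u \<oplus>\<^bsub>?H\<^esub> v = v \<oplus>\<^bsub>?H\<^esub> u" using f g by (simp add: sel add.commute)
    assume "w \<in> carrier ?H"
    then obtain h where h: "h \<in> rkhs" "w = j h" by (auto simp: sel)
    show "u \<oplus>\<^bsub>?H\<^esub> v \<oplus>\<^bsub>?H\<^esub> w = u \<oplus>\<^bsub>?H\<^esub> (v \<oplus>\<^bsub>?H\<^esub> w)"
      using f g h by (simp add: sel rkhs_add add.assoc)
  qed (auto simp: sel rkhs_zero)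
  have mod: "module class_ring ?H"
  proof (rule moduleI)
    show "cring (class_ring :: complex ring)" by (rule class_cring.is_cring)
    fix a b :: complex and u v
    assume "u \<in> carrier ?H"
    then obtain f where f: "f \<in> rkhs" "u = j f" by (auto simp: sel)
    show "a \<odot>\<^bsub>?H\<^esub> u \<in> carrier ?H" using f by (auto simp: sel rkhs_scale)
    show "(a \<oplus>\<^bsub>class_ring\<^esub> b) \<odot>\<^bsub>?H\<^esub> u = a \<odot>\<^bsub>?H\<^esub> u \<oplus>\<^bsub>?H\<^esub> b \<odot>\<^bsub>?H\<^esub> u"
      using f by (simp add: sel rkhs_scale distrib_right)
    show "(a \<otimes>\<^bsub>class_ring\<^esub> b) \<odot>\<^bsub>?H\<^esub> u = a \<odot>\<^bsub>?H\<^esub> (b \<odot>\<^bsub>?H\<^esub> u)"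
      using f by (simp add: sel rkhs_scale mult.assoc)
    show "\<one>\<^bsub>class_ring\<^esub> \<odot>\<^bsub>?H\<^esub> u = u" using f by (simp add: sel)
    assume "v \<in> carrier ?H"
    then obtain g where g: "g \<in> rkhs" "v = j g" by (auto simp: sel)
    show "a \<odot>\<^bsub>?H\<^esub> (u \<oplus>\<^bsub>?H\<^esub> v) = a \<odot>\<^bsub>?H\<^esub> u \<oplus>\<^bsub>?H\<^esub> a \<odot>\<^bsub>?H\<^esub> v"
      using f g by (simp add: sel rkhs_scale rkhs_add distrib_left)
  qed (rule abg)
  have vs: "vectorspace class_ring ?H"
    using mod class_field by (simp add: vectorspace_def)
  show ?thesis
  proof (intro complex_inner_product_space.intro vs complex_inner_product_space_axioms.intro)
    fix u v w and c :: complex assume "u \<in> carrier ?H" 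
    then obtain f where f: "f \<in> rkhs" "u = j f" by (auto simp: sel)
    {
      assume "u \<noteq> \<zero>\<^bsub>?H\<^esub>"
      then have "f \<noteq> (\<lambda>_. 0)" using f by (auto simp: sel)
      then show "0 < Re (ip ?H u u)" using rip_pos[OF f(1)] f by (simp add: sel)
    }
    assume "v \<in> carrier ?H"
    then obtain g where g: "g \<in> rkhs" "v = j g" by (auto simp: sel)
    show "ip ?H (c \<odot>\<^bsub>?H\<^esub> u) v = c * ip ?H u v" using f g by (simp add: sel rkhs_scale rip_scale_left)
    show "ip ?H v u = cnj (ip ?H u v)" using f g by (simp add: sel rip_cnj[symmetric])
    assume "w \<in> carrier ?H"
    then obtain h where h: "h \<in> rkhs" "w = j h" by (auto simp: sel)
    show "ip ?H (u \<oplus>\<^bsub>?H\<^esub> v) w = ip ?H u w + ip ?H v w"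
      using f g h by (simp add: sel rkhs_add rip_add_left)
  qed
qed

lemma rkhs_hilbert_space: "complex_hilbert_space (rkhs_space j)"
proof -
  let ?H = "rkhs_space j"
  interpret complex_inner_product_space ?H by (rule rkhs_inner_product_space)
  note sel = rkhs_space_sel
  have diff: "j f \<ominus>\<^bsub>?H\<^esub> j g = j (\<lambda>x. f x - g x)" if "f \<in> rkhs" "g \<in> rkhs" for f g
  proof (rule ip_ext)
    fix z assume "z \<in> carrier ?H"
    then obtain h where h: "h \<in> rkhs" "z = j h" by (auto simp: sel)
    have "rip (\<lambda>x. f x - g x) h = rip f h - rip g h"
      using rip_add_left[OF that(1) rkhs_scale[OF that(2)] h(1), of "-1"] rip_scale_left[OF that(2) h(1), of "-1"] by simp
    then show "ip ?H (j f \<ominus>\<^bsub>?H\<^esub> j g) z = ip ?H (j (\<lambda>x. f x - g x)) z"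
      using that h rkhs_diff[OF that] by (simp add: ip_diff_left sel)
  next
    have "j f \<in> carrier ?H" "j g \<in> carrier ?H" using that by (auto simp: sel)
    then show "j f \<ominus>\<^bsub>?H\<^esub> j g \<in> carrier ?H" by simp
    show "j (\<lambda>x. f x - g x) \<in> carrier ?H" using rkhs_diff[OF that] by (auto simp: sel)
  qed
  have nrm: "nrm (j f) = rnorm f" if "f \<in> rkhs" for f
    using that by (simp add: ip_norm_def rnorm_def sel)
  have "mcomplete" unfolding mcomplete_def
  proof (intro allI impI)
    fix \<sigma> assume "MCauchy \<sigma>"
    then have s: "\<And>n. \<sigma> n \<in> carrier ?H" "\<And>e. e > 0 \<Longrightarrow> \<exists>N. \<forall>m\<ge>N. \<forall>n\<ge>N. ip_dist ?H (\<sigma> m) (\<sigma> n) < e"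
      by (auto simp: MCauchy_def)
    define F where "F n = inv_into rkhs j (\<sigma> n)" for n
    have F: "F n \<in> rkhs" "\<sigma> n = j (F n)" for n
      using s(1)[of n] unfolding F_def by (auto simp: sel inv_into_into f_inv_into_f)
    have dist: "ip_dist ?H (\<sigma> m) (j f) = rnorm (\<lambda>x. F m x - f x)" if "f \<in> rkhs" for m f
      using F that rkhs_diff by (simp add: ip_dist_def diff nrm) (auto simp: sel)
    have "\<exists>f\<in>rkhs. (\<lambda>n. rnorm (\<lambda>x. F n x - f x)) \<longlonglongrightarrow> 0"
    proof (rule rkhs_complete)
      fix e :: real assume "e > 0"
      then show "\<exists>N. \<forall>m\<ge>N. \<forall>n\<ge>N. rnorm (\<lambda>x. F m x - F n x) < e"
        using s(2)[of e] dist[OF F(1)] by (simp flip: F(2))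
    qed (rule F)
    then obtain f where f: "f \<in> rkhs" "(\<lambda>n. rnorm (\<lambda>x. F n x - f x)) \<longlonglongrightarrow> 0" by blast
    then have "hconv \<sigma> (j f)"
      unfolding hconv_def using s(1) F(1) by (simp add: F(2) diff nrm rkhs_diff sel(1))
    then show "\<exists>x. limitin mtopology \<sigma> x sequentially"
      using hconv_iff_limitin[of \<sigma> "j f"] s(1) by blast
  qed
  then show ?thesis
    by (intro complex_hilbert_space.intro complex_hilbert_space_axioms.intro) unfold_locales
qed

end

end

lemma unitary_repI:
  fixes H :: "('h, 'x) inner_product_struct_scheme"
  assumes H: "complex_hilbert_space H" and G: "group G"
    and ext: "\<And>g. g \<in> carrier G \<Longrightarrow> \<rho> g \<in> extensional (carrier H)"
    and cl: "\<And>g u. g \<in> carrier G \<Longrightarrow> u \<in> carrier H \<Longrightarrow> \<rho> g u \<in> carrier H"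
    and add: "\<And>g u v. g \<in> carrier G \<Longrightarrow> u \<in> carrier H \<Longrightarrow> v \<in> carrier H \<Longrightarrow> \<rho> g (u \<oplus>\<^bsub>H\<^esub> v) = \<rho> g u \<oplus>\<^bsub>H\<^esub> \<rho> g v"
    and smult: "\<And>g u c. g \<in> carrier G \<Longrightarrow> u \<in> carrier H \<Longrightarrow> \<rho> g (c \<odot>\<^bsub>H\<^esub> u) = c \<odot>\<^bsub>H\<^esub> \<rho> g u"
    and ip: "\<And>g u v. g \<in> carrier G \<Longrightarrow> u \<in> carrier H \<Longrightarrow> v \<in> carrier H \<Longrightarrow> ip H (\<rho> g u) (\<rho> g v) = ip H u v"
    and mult: "\<And>g h u. g \<in> carrier G \<Longrightarrow> h \<in> carrier G \<Longrightarrow> u \<in> carrier H \<Longrightarrow> \<rho> (g \<otimes>\<^bsub>G\<^esub> h) u = \<rho> g (\<rho> h u)"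
    and one: "\<And>u. u \<in> carrier H \<Longrightarrow> \<rho> \<one>\<^bsub>G\<^esub> u = u"
  shows "unitary_rep G H \<rho>"
proof -
  interpret group G by (rule G)
  have inv: "\<rho> (inv\<^bsub>G\<^esub> g) (\<rho> g u) = u" "\<rho> g (\<rho> (inv\<^bsub>G\<^esub> g) u) = u" if "g \<in> carrier G" "u \<in> carrier H" for g u
    using mult[of "inv\<^bsub>G\<^esub> g" g u] mult[of g "inv\<^bsub>G\<^esub> g" u] one that by auto
  have bij: "\<rho> g \<in> Bij (carrier H)" if g: "g \<in> carrier G" for g
  proof -
    have "bij_betw (\<rho> g) (carrier H) (carrier H)"
      by (rule bij_betw_byWitness[where f' = "\<rho> (inv\<^bsub>G\<^esub> g)"]) (use g cl inv in auto)
    then show ?thesis using ext[OF g] by (simp add: Bij_def)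
  qed
  have car: "\<rho> g \<in> carrier (unitary_group H)" if "g \<in> carrier G" for g
    using bij[OF that] that cl add smult ip by (auto simp: unitary_group_def module_hom_def)
  have "\<rho> (g \<otimes>\<^bsub>G\<^esub> h) = \<rho> g \<otimes>\<^bsub>unitary_group H\<^esub> \<rho> h" if gh: "g \<in> carrier G" "h \<in> carrier G" for g h
  proof (rule extensionalityI[of _ "carrier H"])
    show "\<rho> (g \<otimes>\<^bsub>G\<^esub> h) \<in> extensional (carrier H)" using gh ext by simp
    show "\<rho> g \<otimes>\<^bsub>unitary_group H\<^esub> \<rho> h \<in> extensional (carrier H)"
      using bij gh by (simp add: unitary_group_def BijGroup_def)
    show "\<rho> (g \<otimes>\<^bsub>G\<^esub> h) u = (\<rho> g \<otimes>\<^bsub>unitary_group H\<^esub> \<rho> h) u" if "u \<in> carrier H" for u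
      using bij gh that mult by (simp add: unitary_group_def BijGroup_def compose_def)
  qed
  then show ?thesis unfolding unitary_rep_def using H car by (auto simp: hom_def)
qed

locale urep = G: group G + complex_hilbert_space H
  for G :: "('a, 'b) monoid_scheme" and H :: "('h, 'x) inner_product_struct_scheme" (structure) +
  fixes \<rho> :: "'a \<Rightarrow> 'h \<Rightarrow> 'h"
  assumes rep: "unitary_rep G H \<rho>"
begin

abbreviation gmult (infixl "\<cdot>" 70) where "x \<cdot> y \<equiv> x \<otimes>\<^bsub>G\<^esub> y"

abbreviation ginv where "ginv x \<equiv> inv\<^bsub>G\<^esub> x"

lemma act_carrier: "g \<in> carrier G \<Longrightarrow> \<rho> g \<in> carrier (unitary_group H)"
  using rep by (auto simp: unitary_rep_def hom_def)

lemma act_Bij: "g \<in> carrier G \<Longrightarrow> \<rho> g \<in> Bij (carrier H)"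
  using act_carrier by (simp add: unitary_group_def)

lemma act_closed [simp]: "g \<in> carrier G \<Longrightarrow> u \<in> carrier H \<Longrightarrow> \<rho> g u \<in> carrier H"
  using act_Bij[of g] by (auto simp: Bij_def dest: bij_betwE)

lemma act_ip: "g \<in> carrier G \<Longrightarrow> u \<in> carrier H \<Longrightarrow> v \<in> carrier H \<Longrightarrow> ip H (\<rho> g u) (\<rho> g v) = ip H u v"
  using act_carrier[of g] by (simp add: unitary_group_def)

lemma act_add: "g \<in> carrier G \<Longrightarrow> u \<in> carrier H \<Longrightarrow> v \<in> carrier H \<Longrightarrow> \<rho> g (u \<oplus> v) = \<rho> g u \<oplus> \<rho> g v"
  using act_carrier[of g] by (simp add: unitary_group_def module_hom_def)

lemma act_smult: "g \<in> carrier G \<Longrightarrow> u \<in> carrier H \<Longrightarrow> \<rho> g (c \<odot> u) = c \<odot> \<rho> g u"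
  using act_carrier[of g] by (simp add: unitary_group_def module_hom_def)

lemma act_mult:
  assumes "g \<in> carrier G" "h \<in> carrier G" "u \<in> carrier H"
  shows "\<rho> (g \<cdot> h) u = \<rho> g (\<rho> h u)"
proof -
  have "\<rho> (g \<cdot> h) = \<rho> g \<otimes>\<^bsub>unitary_group H\<^esub> \<rho> h"
    using rep assms by (simp add: unitary_rep_def hom_def)
  then show ?thesis
    using act_Bij assms by (simp add: unitary_group_def BijGroup_def compose_def)
qed

lemma act_one: "u \<in> carrier H \<Longrightarrow> \<rho> \<one>\<^bsub>G\<^esub> u = u"
proof -
  assume u: "u \<in> carrier H"
  have "\<rho> \<one>\<^bsub>G\<^esub> (\<rho> \<one>\<^bsub>G\<^esub> u) = \<rho> \<one>\<^bsub>G\<^esub> u" using act_mult[of "\<one>\<^bsub>G\<^esub>" "\<one>\<^bsub>G\<^esub>" u] u by simp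
  moreover have "inj_on (\<rho> \<one>\<^bsub>G\<^esub>) (carrier H)" using act_Bij[of "\<one>\<^bsub>G\<^esub>"] by (simp add: Bij_def bij_betw_def)
  ultimately show ?thesis using u by (simp add: inj_on_eq_iff)
qed

lemma act_inv: "g \<in> carrier G \<Longrightarrow> u \<in> carrier H \<Longrightarrow> \<rho> (ginv g) (\<rho> g u) = u"
  "g \<in> carrier G \<Longrightarrow> u \<in> carrier H \<Longrightarrow> \<rho> g (\<rho> (ginv g) u) = u"
  using act_mult[of "ginv g" g u] act_mult[of g "ginv g" u] act_one by auto

lemma act_adjoint:
  "g \<in> carrier G \<Longrightarrow> u \<in> carrier H \<Longrightarrow> v \<in> carrier H \<Longrightarrow> ip H (\<rho> g u) v = ip H u (\<rho> (ginv g) v)"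
  using act_ip[of g u "\<rho> (ginv g) v"] by (simp add: act_inv)

lemma act_zero: "g \<in> carrier G \<Longrightarrow> \<rho> g \<zero> = \<zero>"
  using act_smult[of g \<zero> 0] zero_smult by simp

lemma act_diff: "g \<in> carrier G \<Longrightarrow> u \<in> carrier H \<Longrightarrow> v \<in> carrier H \<Longrightarrow> \<rho> g (u \<ominus> v) = \<rho> g u \<ominus> \<rho> g v"
proof -
  assume a: "g \<in> carrier G" "u \<in> carrier H" "v \<in> carrier H"
  have m: "x \<ominus> y = x \<oplus> (- 1) \<odot> y" if "x \<in> carrier H" "y \<in> carrier H" for x y
    using that by (intro ip_ext) (auto simp: ip_simps)
  show ?thesis using a by (simp add: m act_add act_smult)
qed

lemma act_nrm: "g \<in> carrier G \<Longrightarrow> u \<in> carrier H \<Longrightarrow> nrm (\<rho> g u) = nrm u"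
  by (simp add: ip_norm_def act_ip)

lemma act_hconv: "g \<in> carrier G \<Longrightarrow> hconv s w \<Longrightarrow> hconv (\<lambda>n. \<rho> g (s n)) (\<rho> g w)"
  by (auto simp: hconv_def act_diff[symmetric] act_nrm)

lemma act_ortho:
  assumes "W \<subseteq> carrier H" "\<And>g. g \<in> carrier G \<Longrightarrow> \<rho> g ` W \<subseteq> W" "g \<in> carrier G"
  shows "\<rho> g ` ortho W \<subseteq> ortho W"
proof -
  have "ip H (\<rho> g v) u = 0" if "v \<in> ortho W" "u \<in> W" for v u
  proof -
    have "\<rho> (ginv g) u \<in> W" using assms(2)[of "ginv g"] assms(3) that by auto
    then show ?thesis using that assms by (auto simp: act_adjoint ortho_def)
  qed
  then show ?thesis using assms(3) by (auto simp: ortho_def)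
qed

end

lemma urepI: "group G \<Longrightarrow> unitary_rep G H \<rho> \<Longrightarrow> urep G H \<rho>"
  by (simp add: urep_def urep_axioms_def unitary_rep_def)

definition posdef :: "('a, 'b) monoid_scheme \<Rightarrow> ('a \<Rightarrow> complex) \<Rightarrow> bool" where
  "posdef G \<phi> \<longleftrightarrow> pd_kernel (carrier G) (\<lambda>x y. \<phi> (inv\<^bsub>G\<^esub> y \<otimes>\<^bsub>G\<^esub> x))"

text \<open>If \<open>\<phi>\<close> is the vector state of some vector, this is the inner product
  of the two corresponding combinations of its orbit.\<close>

abbreviation gform :: "('a, 'b) monoid_scheme \<Rightarrow> ('a \<Rightarrow> complex) \<Rightarrow> (complex \<times> 'a) list \<Rightarrow> (complex \<times> 'a) list \<Rightarrow> complex" where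
  "gform G \<phi> \<equiv> fform (\<lambda>x y. \<phi> (inv\<^bsub>G\<^esub> y \<otimes>\<^bsub>G\<^esub> x))"

definition ltrans :: "('a, 'b) monoid_scheme \<Rightarrow> 'a \<Rightarrow> (complex \<times> 'a) list \<Rightarrow> (complex \<times> 'a) list" where
  "ltrans G g = map (\<lambda>(a, x). (a, g \<otimes>\<^bsub>G\<^esub> x))"

context group
begin

lemma fsupp_ltrans: "fsupp (ltrans G g l) = (\<lambda>x. g \<otimes> x) ` fsupp l"
  by (induction l) (auto simp: ltrans_def case_prod_unfold)

lemma fsupp_ltrans_closed: "g \<in> carrier G \<Longrightarrow> fsupp l \<subseteq> carrier G \<Longrightarrow> fsupp (ltrans G g l) \<subseteq> carrier G"
  by (auto simp: fsupp_ltrans)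

lemma inv_mult_translate:
  "g \<in> carrier G \<Longrightarrow> x \<in> carrier G \<Longrightarrow> y \<in> carrier G \<Longrightarrow> inv (g \<otimes> y) \<otimes> (g \<otimes> x) = inv y \<otimes> x"
  by (simp add: inv_mult_group m_assoc) (simp add: m_assoc[symmetric])

lemma gform_ltrans:
  assumes "g \<in> carrier G" "fsupp l \<subseteq> carrier G" "fsupp m \<subseteq> carrier G"
  shows "gform G \<phi> (ltrans G g l) (ltrans G g m) = gform G \<phi> l m"
proof -
  have "gform G \<phi> (ltrans G g l) (ltrans G g m) = fform (\<lambda>x y. \<phi> (inv (g \<otimes> y) \<otimes> (g \<otimes> x))) l m"
    by (simp add: fform_def ltrans_def o_def case_prod_unfold)
  also have "\<dots> = gform G \<phi> l m"
    by (rule fform_cong) (use assms inv_mult_translate in \<open>auto simp: subset_iff\<close>)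
  finally show ?thesis .
qed

lemma ltrans_simps: "ltrans G g (l @ m) = ltrans G g l @ ltrans G g m"
  "ltrans G g (fscale c l) = fscale c (ltrans G g l)"
  by (simp_all add: ltrans_def fscale_def case_prod_unfold)

lemma posdef_coefficient:
  assumes "urep G H \<rho>" and u: "u \<in> carrier H"
  shows "posdef G (\<lambda>g. ip H (\<rho> g u) u)"
proof -
  interpret urep G H \<rho> by fact
  have "pd_kernel (carrier G) (\<lambda>x y. ip H (\<rho> x u) (\<rho> y u))"
    by (rule pd_kernel_ip) (use u in auto)
  moreover have "ip H (\<rho> (inv y \<otimes> x) u) u = ip H (\<rho> x u) (\<rho> y u)" if "x \<in> carrier G" "y \<in> carrier G" for x y
    using that u act_adjoint[of "inv y" "\<rho> x u" u] by (simp add: act_mult)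
  ultimately show ?thesis
    unfolding posdef_def by (rule pd_kernel_cong)
qed

lemma gform_coefficient:
  assumes "urep G H \<rho>" and u: "u \<in> carrier H" and l: "fsupp l \<subseteq> carrier G" "fsupp m \<subseteq> carrier G"
  shows "gform G (\<lambda>g. ip H (\<rho> g u) u) l m = fform (\<lambda>x y. ip H (\<rho> x u) (\<rho> y u)) l m"
proof (rule fform_cong)
  interpret urep G H \<rho> by fact
  fix x y assume "x \<in> fsupp l" "y \<in> fsupp m"
  then show "ip H (\<rho> (inv y \<otimes> x) u) u = ip H (\<rho> x u) (\<rho> y u)"
    using l u act_adjoint[of "inv y" "\<rho> x u" u] by (auto simp: act_mult subset_iff)
qed

end

text \<open>The Hilbert space is the reproducing kernel space of
  \<open>\<phi> (inv y \<otimes> x)\<close> and the group acts by left translation. Evaluation at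
  \<open>g\<close> is the inner product with \<open>\<sigma> g \<xi>\<close>, so
  \<open>\<xi>\<close> is cyclic. A closed invariant subspace splits \<open>\<xi>\<close>, and with
  it \<open>\<phi>\<close>, into two positive definite summands; extremality then makes the
  component of \<open>\<xi>\<close> in the subspace a multiple of \<open>\<xi>\<close>.\<close>

theorem gns_irreducible:
  fixes G :: "('a, 'b) monoid_scheme" and J :: "('a \<Rightarrow> complex) \<Rightarrow> 'h"
  assumes G: "group G" and pd: "posdef G \<phi>" and \<phi>1: "\<phi> \<one>\<^bsub>G\<^esub> = 1"
    and J: "inj_on J {f. \<forall>x. x \<notin> carrier G \<longrightarrow> f x = 0}"
    and extreme: "\<And>\<phi>1 \<phi>2. posdef G \<phi>1 \<Longrightarrow> posdef G \<phi>2 \<Longrightarrow> (\<And>g. g \<in> carrier G \<Longrightarrow> \<phi> g = \<phi>1 g + \<phi>2 g) \<Longrightarrow>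
        0 < Re (\<phi>1 \<one>\<^bsub>G\<^esub>) \<Longrightarrow> 0 < Re (\<phi>2 \<one>\<^bsub>G\<^esub>) \<Longrightarrow> \<exists>t. \<forall>g\<in>carrier G. \<phi>1 g = t * \<phi> g"
  obtains H :: "'h inner_product_struct" and \<sigma> \<xi>
  where "irreducible_unitary_rep G H \<sigma>" "\<xi> \<in> carrier H" "\<And>g. g \<in> carrier G \<Longrightarrow> ip H (\<sigma> g \<xi>) \<xi> = \<phi> g"
proof -
  interpret G: group G by (rule G)
  define k where "k x y = \<phi> (inv\<^bsub>G\<^esub> y \<otimes>\<^bsub>G\<^esub> x)" for x y
  interpret K: pd_kernel "carrier G" k using pd by (simp add: posdef_def k_def[abs_def])
  have j: "inj_on J K.rkhs"
    by (rule inj_on_subset[OF J]) (auto dest: K.rkhs_outside)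
  define H where "H = K.rkhs_space J"
  have H: "complex_hilbert_space H" unfolding H_def by (rule K.rkhs_hilbert_space[OF j])
  interpret complex_hilbert_space H by (rule H)
  note sel = K.rkhs_space_sel[OF j, folded H_def]
  define D where "D u = inv_into K.rkhs J u" for u
  have D: "D u \<in> K.rkhs" "u = J (D u)" if "u \<in> carrier H" for u
    using that by (auto simp: sel D_def inv_into_into f_inv_into_f)
  have DJ: "D (J f) = f" if "f \<in> K.rkhs" for f using that j by (simp add: D_def)
  define T where "T g f x = (if x \<in> carrier G then f (inv\<^bsub>G\<^esub> g \<otimes>\<^bsub>G\<^esub> x) else 0)" for g and f :: "'a \<Rightarrow> complex" and x
  have Trep: "K.represents (\<lambda>n. ltrans G g (l n)) (T g f)" if rl: "K.represents l f" and that: "g \<in> carrier G" for g f l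
  proof -
    note s = K.represents_supp[OF rl]
    have "fnorm k (fdiff (ltrans G g (l m)) (ltrans G g (l n))) = fnorm k (fdiff (l m) (l n))" for m n
      using G.gform_ltrans[OF that, of "fdiff (l m) (l n)" "fdiff (l m) (l n)" \<phi>] s[of m] s[of n]
      by (simp add: fnorm_def k_def[abs_def] G.ltrans_simps)
    moreover have "(\<lambda>n. fform k (ltrans G g (l n)) [(1, y)]) \<longlonglongrightarrow> T g f y" if y: "y \<in> carrier G" for y
    proof -
      have "fform k (ltrans G g (l n)) [(1, y)] = fform k (l n) [(1, inv\<^bsub>G\<^esub> g \<otimes>\<^bsub>G\<^esub> y)]" for n
        using G.gform_ltrans[OF \<open>g \<in> carrier G\<close> s[of n], of "[(1, inv\<^bsub>G\<^esub> g \<otimes>\<^bsub>G\<^esub> y)]" \<phi>] \<open>g \<in> carrier G\<close> y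
        by (simp add: k_def[abs_def] ltrans_def G.m_assoc[symmetric])
      then show ?thesis
        using K.represents_lim[OF rl, of "inv\<^bsub>G\<^esub> g \<otimes>\<^bsub>G\<^esub> y"] y \<open>g \<in> carrier G\<close> by (simp add: T_def)
    qed
    ultimately show ?thesis
      using rl that s G.fsupp_ltrans_closed unfolding K.represents_def K.cauchy_lists_def by (auto simp: T_def)
  qed
  have T: "T g f \<in> K.rkhs" if "f \<in> K.rkhs" "g \<in> carrier G" for g f
    using K.rkhsI[OF Trep[OF K.represents_rep_of[OF that(1)] that(2)]] .
  have Tip: "K.rip (T g f) (T g h) = K.rip f h" if f: "f \<in> K.rkhs" "h \<in> K.rkhs" and g: "g \<in> carrier G" for f g h
  proof -
    note r = K.represents_rep_of[OF f(1)] K.represents_rep_of[OF f(2)]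
    have "gform G \<phi> (ltrans G g (K.rep_of f n)) (ltrans G g (K.rep_of h n)) = gform G \<phi> (K.rep_of f n) (K.rep_of h n)" for n
      by (rule G.gform_ltrans[OF g K.represents_supp[OF r(1)] K.represents_supp[OF r(2)]])
    then show ?thesis
      using LIMSEQ_unique[OF K.rip_limit[OF Trep[OF r(1) g] Trep[OF r(2) g]]] K.rip_limit[OF r]
      by (simp add: k_def[abs_def])
  qed
  have Tmult: "T (g \<otimes>\<^bsub>G\<^esub> h) f = T g (T h f)" if "g \<in> carrier G" "h \<in> carrier G" for g h f
    using that by (auto simp: T_def fun_eq_iff G.inv_mult_group G.m_assoc)
  define \<sigma> where "\<sigma> g = restrict (\<lambda>u. J (T g (D u))) (carrier H)" for g
  have \<sigma>: "\<sigma> g (J f) = J (T g f)" if "f \<in> K.rkhs" for g f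
    using that by (simp add: \<sigma>_def DJ) (auto simp: sel)
  have JH: "J f \<in> carrier H" if "f \<in> K.rkhs" for f using that by (simp add: sel)
  have rep: "unitary_rep G H \<sigma>"
  proof (rule unitary_repI[OF H G])
    fix g u assume g: "g \<in> carrier G"
    show "\<sigma> g \<in> extensional (carrier H)" by (simp add: \<sigma>_def)
    assume "u \<in> carrier H"
    then obtain f where f: "f \<in> K.rkhs" "u = J f" by (auto simp: sel)
    show "\<sigma> g u \<in> carrier H" using f g by (simp add: \<sigma> JH T)
    show "\<sigma> g (c \<odot>\<^bsub>H\<^esub> u) = c \<odot>\<^bsub>H\<^esub> \<sigma> g u" for c
    proof -
      have "T g (\<lambda>x. c * f x) = (\<lambda>x. c * T g f x)" by (auto simp: T_def)
      then show ?thesis using f g by (simp add: sel \<sigma> K.rkhs_scale T)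
    qed
    show "\<sigma> (g \<otimes>\<^bsub>G\<^esub> h) u = \<sigma> g (\<sigma> h u)" if "h \<in> carrier G" for h
      using f g that by (simp add: \<sigma> T Tmult)
    fix v assume "v \<in> carrier H"
    then obtain f' where f': "f' \<in> K.rkhs" "v = J f'" by (auto simp: sel)
    have "T g (\<lambda>x. f x + f' x) = (\<lambda>x. T g f x + T g f' x)" by (auto simp: T_def)
    then show "\<sigma> g (u \<oplus>\<^bsub>H\<^esub> v) = \<sigma> g u \<oplus>\<^bsub>H\<^esub> \<sigma> g v" using f f' g by (simp add: sel \<sigma> K.rkhs_add T)
    show "ip H (\<sigma> g u) (\<sigma> g v) = ip H u v" using f f' g by (simp add: \<sigma> sel T Tip)
  next
    fix u assume "u \<in> carrier H"
    then obtain f where f: "f \<in> K.rkhs" "u = J f" by (auto simp: sel)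
    have "T \<one>\<^bsub>G\<^esub> f = f" using K.rkhs_outside[OF f(1)] by (auto simp: T_def fun_eq_iff)
    then show "\<sigma> \<one>\<^bsub>G\<^esub> u = u" using f by (simp add: \<sigma>)
  qed
  interpret urep G H \<sigma> by (rule urepI[OF G rep])
  define \<xi> where "\<xi> = J (K.kfun [(1, \<one>\<^bsub>G\<^esub>)])"
  have kf: "K.kfun [(1, x)] \<in> K.rkhs" if "x \<in> carrier G" for x using that by (intro K.rkhs_kfun) auto
  have \<xi>: "\<xi> \<in> carrier H" unfolding \<xi>_def by (intro JH kf) simp
  have \<sigma>\<xi>: "\<sigma> g \<xi> = J (K.kfun [(1, g)])" if "g \<in> carrier G" for g
  proof -
    have "T g (K.kfun [(1, \<one>\<^bsub>G\<^esub>)]) = K.kfun [(1, g)]"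
      using that by (auto simp: T_def K.kfun_def fun_eq_iff fform_single k_def G.inv_mult_group)
    then show ?thesis using kf[of "\<one>\<^bsub>G\<^esub>"] by (simp add: \<xi>_def \<sigma>)
  qed
  have ev: "ip H (J f) (\<sigma> g \<xi>) = f g" if "f \<in> K.rkhs" "g \<in> carrier G" for f g
    using that kf[of g] by (simp add: \<sigma>\<xi> sel K.rip_kfun)
  have coef: "ip H (\<sigma> g \<xi>) \<xi> = \<phi> g" if "g \<in> carrier G" for g
    using ev[OF kf[OF that], of "\<one>\<^bsub>G\<^esub>"] act_one[OF \<xi>] that by (simp add: \<sigma>\<xi> K.kfun_def fform_single k_def)
  have cyc: "u = \<zero>\<^bsub>H\<^esub>" if "u \<in> carrier H" "\<And>g. g \<in> carrier G \<Longrightarrow> ip H u (\<sigma> g \<xi>) = 0" for u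
  proof -
    obtain f where f: "f \<in> K.rkhs" "u = J f" using \<open>u \<in> carrier H\<close> by (auto simp: sel)
    have "f x = 0" for x using that(2)[of x] ev[OF f(1), of x] f(2) K.rkhs_outside[OF f(1), of x] by auto
    then have "f = (\<lambda>_. 0)" by auto
    then show ?thesis using f by (simp add: sel)
  qed
  have irr: "W = {\<zero>\<^bsub>H\<^esub>} \<or> W = carrier H"
    if W: "subspace class_ring W H" "closedin mtopology W" and inv: "\<And>g. g \<in> carrier G \<Longrightarrow> \<sigma> g ` W \<subseteq> W" for W
  proof -
    note Wd = hsubspaceD[OF W(1)]
    have Oc: "\<sigma> g v \<in> ortho W" if "g \<in> carrier G" "v \<in> ortho W" for g v
      using act_ortho[OF Wd(1) inv that(1)] that(2) by auto
    obtain w v where wv: "w \<in> W" "v \<in> ortho W" "\<xi> = w \<oplus>\<^bsub>H\<^esub> v"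
      using orthogonal_decomposition[OF W \<xi>] by metis
    have c: "w \<in> carrier H" "v \<in> carrier H" using wv Wd(1) by (auto simp: ortho_def)
    have iW: "\<sigma> g x \<in> W" if "x \<in> W" "g \<in> carrier G" for x g using inv that by auto
    have orth: "ip H v u = 0" "ip H u v = 0" if "v \<in> ortho W" "u \<in> W" for u v
    proof -
      show "ip H v u = 0" using that by (simp add: ortho_def)
      then show "ip H u v = 0" using that Wd(1) ip_cnj[of v u] by (auto simp: ortho_def)
    qed
    have \<xi>W: "W = carrier H" if "\<xi> \<in> W"
    proof
      show "W \<subseteq> carrier H" by (rule Wd)
      show "carrier H \<subseteq> W"
      proof
        fix x assume x: "x \<in> carrier H"
        obtain y z where yz: "y \<in> W" "z \<in> ortho W" "x = y \<oplus>\<^bsub>H\<^esub> z"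
          using orthogonal_decomposition[OF W x] by metis
        have "z = \<zero>\<^bsub>H\<^esub>"
        proof (rule cyc)
          show "z \<in> carrier H" using yz(2) by (simp add: ortho_def)
          show "ip H z (\<sigma> g \<xi>) = 0" if "g \<in> carrier G" for g
            by (rule orth(1)[OF yz(2) iW[OF \<open>\<xi> \<in> W\<close> that]])
        qed
        then show "x \<in> W" using yz Wd(1) by auto
      qed
    qed
    have \<xi>O: "W = {\<zero>\<^bsub>H\<^esub>}" if "\<xi> \<in> ortho W"
    proof -
      have "u = \<zero>\<^bsub>H\<^esub>" if u: "u \<in> W" for u
      proof (rule cyc)
        show "u \<in> carrier H" using u Wd(1) by auto
        show "ip H u (\<sigma> g \<xi>) = 0" if "g \<in> carrier G" for g
          by (rule orth(2)[OF Oc[OF that \<open>\<xi> \<in> ortho W\<close>] u])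
      qed
      then show ?thesis using Wd(2) by blast
    qed
    define \<phi>1 \<phi>2 where "\<phi>1 g = ip H (\<sigma> g w) w" and "\<phi>2 g = ip H (\<sigma> g v) v" for g
    have p1: "posdef G \<phi>1" and p2: "posdef G \<phi>2"
      unfolding \<phi>1_def[abs_def] \<phi>2_def[abs_def]
      by (rule G.posdef_coefficient[OF urep_axioms c(1)], rule G.posdef_coefficient[OF urep_axioms c(2)])
    have sum: "\<phi> g = \<phi>1 g + \<phi>2 g" if g: "g \<in> carrier G" for g
      using coef[OF g] orth(1)[OF Oc[OF g wv(2)] wv(1)] orth(2)[OF wv(2) iW[OF wv(1) g]] g c
      by (simp add: wv(3) \<phi>1_def \<phi>2_def act_add ip_simps)
    show ?thesis
    proof (cases "w = \<zero>\<^bsub>H\<^esub> \<or> v = \<zero>\<^bsub>H\<^esub>")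
      case True
      then show ?thesis using \<xi>W \<xi>O wv c by auto
    next
      case False
      then have "0 < Re (\<phi>1 \<one>\<^bsub>G\<^esub>)" "0 < Re (\<phi>2 \<one>\<^bsub>G\<^esub>)"
        using c ip_pos by (auto simp: \<phi>1_def \<phi>2_def act_one)
      then obtain t where t: "\<And>g. g \<in> carrier G \<Longrightarrow> \<phi>1 g = t * \<phi> g"
        using extreme[OF p1 p2 sum] by metis
      have t0: "t \<noteq> 0" using t[of "\<one>\<^bsub>G\<^esub>"] \<open>0 < Re (\<phi>1 \<one>\<^bsub>G\<^esub>)\<close> by auto
      have tc: "t \<odot>\<^bsub>H\<^esub> \<xi> \<in> carrier H" using \<xi> by simp
      \<comment> \<open>The two vectors have the same inner products with the orbit of
        \<open>\<xi>\<close>: since \<open>v\<close> is orthogonal to \<open>W\<close>, the product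
        of \<open>w\<close> with \<open>\<sigma> g \<xi>\<close> is \<open>\<phi>1 (inv g)\<close>,
        and \<open>\<phi>1\<close> is \<open>t\<close> times \<open>\<phi>\<close>.\<close>
      have "w \<ominus>\<^bsub>H\<^esub> t \<odot>\<^bsub>H\<^esub> \<xi> = \<zero>\<^bsub>H\<^esub>"
      proof (rule cyc)
        show "w \<ominus>\<^bsub>H\<^esub> t \<odot>\<^bsub>H\<^esub> \<xi> \<in> carrier H" using c tc by simp
        fix g assume g: "g \<in> carrier G"
        then have ig: "inv\<^bsub>G\<^esub> g \<in> carrier G" by simp
        have "ip H w (\<sigma> g \<xi>) = ip H (\<sigma> (inv\<^bsub>G\<^esub> g) w) \<xi>"
          using act_adjoint[OF ig c(1) \<xi>] g by simp
        also have "\<dots> = \<phi>1 (inv\<^bsub>G\<^esub> g)"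
          using orth(2)[OF wv(2) iW[OF wv(1) ig]] ig c by (simp add: wv(3) \<phi>1_def ip_simps)
        also have "\<dots> = t * ip H (\<sigma> (inv\<^bsub>G\<^esub> g) \<xi>) \<xi>" using t[OF ig] coef[OF ig] by simp
        also have "\<dots> = t * ip H \<xi> (\<sigma> g \<xi>)" using act_adjoint[OF ig \<xi> \<xi>] g by simp
        finally show "ip H (w \<ominus>\<^bsub>H\<^esub> t \<odot>\<^bsub>H\<^esub> \<xi>) (\<sigma> g \<xi>) = 0"
          using c \<xi> g tc by (simp add: ip_simps)
      qed
      then have "w = t \<odot>\<^bsub>H\<^esub> \<xi>" using diff_eq_0[OF c(1) tc] by simp
      then have "(1 / t) \<odot>\<^bsub>H\<^esub> w = \<xi>"
        using \<xi> t0 by (intro ip_ext) (auto simp: ip_simps)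
      then show ?thesis using \<xi>W Wd(4)[OF wv(1), of "1 / t"] by simp
    qed
  qed
  have "\<xi> \<noteq> \<zero>\<^bsub>H\<^esub>" using coef[of "\<one>\<^bsub>G\<^esub>"] \<phi>1 act_one[OF \<xi>] ip_zero_left[OF \<xi>] by auto
  then have "carrier H \<noteq> {\<zero>\<^bsub>H\<^esub>}" using \<xi> by auto
  then have "irreducible_unitary_rep G H \<sigma>"
    unfolding irreducible_unitary_rep_def using rep irr by blast
  then show ?thesis using that \<xi> coef by blast
qed

subsection \<open>Extreme states\<close>

lemma posdef_add:
  assumes "posdef G \<phi>" "posdef G \<psi>" shows "posdef G (\<lambda>x. \<phi> x + \<psi> x)"
  using assms by (simp add: posdef_def pd_kernel_def fform_kernel_add)

lemma posdef_scale:
  assumes "posdef G \<phi>" "0 \<le> t" shows "posdef G (\<lambda>x. of_real t * \<phi> x)"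
  using assms by (simp add: posdef_def pd_kernel_def fform_kernel_mult)

lemma posdef_gform:
  "posdef G \<phi> \<Longrightarrow> fsupp l \<subseteq> carrier G \<Longrightarrow> Im (gform G \<phi> l l) = 0"
  "posdef G \<phi> \<Longrightarrow> fsupp l \<subseteq> carrier G \<Longrightarrow> 0 \<le> Re (gform G \<phi> l l)"
  by (simp_all add: posdef_def pd_kernel_def)

definition state :: "('a, 'b) monoid_scheme \<Rightarrow> ('a \<Rightarrow> complex) \<Rightarrow> bool" where
  "state G \<phi> \<longleftrightarrow> posdef G \<phi> \<and> \<phi> \<one>\<^bsub>G\<^esub> = 1"

lemma state_convex:
  assumes "state G \<phi>" "state G \<psi>" "0 \<le> t" "t \<le> 1"
  shows "state G (\<lambda>x. of_real (1 - t) * \<phi> x + of_real t * \<psi> x)"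
  using assms unfolding state_def by (auto intro!: posdef_add posdef_scale simp del: of_real_diff) (simp add: algebra_simps)

context group
begin

lemma state_bound:
  assumes "state G \<phi>" "x \<in> carrier G" shows "cmod (\<phi> x) \<le> 1"
proof -
  let ?k = "\<lambda>x y. \<phi> (inv y \<otimes> x)"
  interpret pd_kernel "carrier G" ?k using assms by (simp add: state_def posdef_def)
  have "fnorm ?k [(1, y)] = 1" if "y \<in> carrier G" for y
    using that assms by (simp add: fnorm_def fform_single state_def)
  then show ?thesis
    using fform_CS[of "[(1, x)]" "[(1, \<one>)]"] assms by (simp add: fform_single)
qed

lemma posdef_limit:
  assumes "\<And>i. posdef G (\<phi> i)" "\<And>x. x \<in> carrier G \<Longrightarrow> (\<lambda>i::nat. \<phi> i x) \<longlonglongrightarrow> \<psi> x"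
  shows "posdef G \<psi>"
  unfolding posdef_def
proof
  fix l assume l: "fsupp l \<subseteq> carrier G"
  have lim: "(\<lambda>i. gform G (\<phi> i) l l) \<longlonglongrightarrow> gform G \<psi> l l"
    by (intro tendsto_fform assms) (use l in auto)
  show "Im (gform G \<psi> l l) = 0"
    using tendsto_Im[OF lim] posdef_gform(1)[OF assms(1) l] by (simp add: LIMSEQ_const_iff)
  show "0 \<le> Re (gform G \<psi> l l)"
    by (rule LIMSEQ_le_const[OF tendsto_Re[OF lim]]) (use posdef_gform(2)[OF assms(1) l] in auto)
qed

end

text \<open>Stated with midpoints, as supplied by \<open>extreme_point_avoiding\<close>;
  \<open>extreme_state_summand\<close> recovers arbitrary weights.\<close>

definition extreme_state :: "('a, 'b) monoid_scheme \<Rightarrow> ('a \<Rightarrow> complex) \<Rightarrow> bool" where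
  "extreme_state G \<phi> \<longleftrightarrow> state G \<phi> \<and> (\<forall>\<phi>1 \<phi>2. state G \<phi>1 \<and> state G \<phi>2 \<and>
     (\<forall>x\<in>carrier G. \<phi> x = (\<phi>1 x + \<phi>2 x) / 2) \<longrightarrow> (\<forall>x\<in>carrier G. \<phi>1 x = \<phi>2 x))"

text \<open>The weights turn pointwise convergence of states into norm convergence.\<close>

context
  fixes G :: "('a, 'b) monoid_scheme" and e :: "nat \<Rightarrow> 'a"
  assumes G: "group G" and e: "range e = carrier G"
begin

interpretation group G by (rule G)

definition encode :: "('a \<Rightarrow> complex) \<Rightarrow> nat \<Rightarrow>\<^sub>C complex" where
  "encode \<phi> = Bcontfun (\<lambda>n. \<phi> (e n) / 2 ^ n)"

lemma e_carrier [simp]: "e n \<in> carrier G"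
  using e by auto

lemma encode_apply: "state G \<phi> \<Longrightarrow> apply_bcontfun (encode \<phi>) n = \<phi> (e n) / 2 ^ n"
  and encode_bound: "state G \<phi> \<Longrightarrow> cmod (apply_bcontfun (encode \<phi>) n) \<le> 1 / 2 ^ n"
proof -
  assume s: "state G \<phi>"
  have b: "cmod (\<phi> (e n) / 2 ^ n) \<le> 1 / 2 ^ n" for n
    using state_bound[OF s e_carrier[of n]] by (simp add: norm_divide norm_power divide_right_mono)
  have "(\<lambda>n. \<phi> (e n) / 2 ^ n) \<in> bcontfun"
  proof (rule bcontfun_normI[where b = 1])
    show "cmod (\<phi> (e n) / 2 ^ n) \<le> 1" for n
      using b[of n] by (rule order_trans) (simp add: divide_simps)
  qed (simp add: continuous_on_discrete)
  then show eq: "apply_bcontfun (encode \<phi>) n = \<phi> (e n) / 2 ^ n" for n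
    by (simp add: encode_def Bcontfun_inverse)
  show "cmod (apply_bcontfun (encode \<phi>) n) \<le> 1 / 2 ^ n" using b eq by simp
qed

lemma encode_eqD: "state G \<phi> \<Longrightarrow> state G \<psi> \<Longrightarrow> encode \<phi> = encode \<psi> \<Longrightarrow> x \<in> carrier G \<Longrightarrow> \<phi> x = \<psi> x"
proof -
  assume a: "state G \<phi>" "state G \<psi>" "encode \<phi> = encode \<psi>" "x \<in> carrier G"
  obtain n where "x = e n" using a(4) e by auto
  then show ?thesis using encode_apply[OF a(1), of n] encode_apply[OF a(2), of n] a(3) by simp
qed

lemma encode_convex:
  assumes "state G \<phi>" "state G \<psi>" "0 \<le> t" "t \<le> 1"
  shows "(1 - t) *\<^sub>R encode \<phi> + t *\<^sub>R encode \<psi> = encode (\<lambda>x. of_real (1 - t) * \<phi> x + of_real t * \<psi> x)"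
proof (rule bcontfun_eqI)
  fix n
  show "apply_bcontfun ((1 - t) *\<^sub>R encode \<phi> + t *\<^sub>R encode \<psi>) n
      = apply_bcontfun (encode (\<lambda>x. of_real (1 - t) * \<phi> x + of_real t * \<psi> x)) n"
    unfolding encode_apply[OF state_convex[OF assms]]
    by (simp add: encode_apply assms scaleR_conv_of_real add_divide_distrib)
qed

lemma encode_tendsto:
  assumes s: "\<And>i. state G (\<phi> i)" "state G \<psi>" and lim: "\<And>x. x \<in> carrier G \<Longrightarrow> (\<lambda>i. \<phi> i x) \<longlonglongrightarrow> \<psi> x"
  shows "(\<lambda>i. encode (\<phi> i)) \<longlonglongrightarrow> encode \<psi>"
proof (rule metric_LIMSEQ_I)
  fix r :: real assume r: "r > 0"
  obtain N where N: "(1 / 2) ^ N < r / 4"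
    using real_arch_pow_inv[of "r / 4" "1 / 2"] r by auto
  have "\<forall>\<^sub>F i in sequentially. dist (\<phi> i (e n)) (\<psi> (e n)) < r / 2" for n
    using lim r by (intro tendstoD) auto
  then have "\<forall>\<^sub>F i in sequentially. \<forall>n\<in>{..<N}. dist (\<phi> i (e n)) (\<psi> (e n)) < r / 2"
    by (intro eventually_ball_finite) auto
  then obtain M where M: "\<And>i n. i \<ge> M \<Longrightarrow> n < N \<Longrightarrow> dist (\<phi> i (e n)) (\<psi> (e n)) < r / 2"
    by (auto simp: eventually_sequentially)
  have "dist (encode (\<phi> i)) (encode \<psi>) < r" if i: "i \<ge> M" for i
  proof -
    have "dist (apply_bcontfun (encode (\<phi> i)) n) (apply_bcontfun (encode \<psi>) n) \<le> r / 2" for n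
    proof (cases "n < N")
      case True
      have "dist (apply_bcontfun (encode (\<phi> i)) n) (apply_bcontfun (encode \<psi>) n) = dist (\<phi> i (e n)) (\<psi> (e n)) / 2 ^ n"
        by (simp add: encode_apply s dist_norm norm_divide norm_power flip: diff_divide_distrib)
      also have "\<dots> \<le> dist (\<phi> i (e n)) (\<psi> (e n)) / 1" by (intro divide_left_mono) auto
      finally show ?thesis using M[OF i True] by simp
    next
      case False
      have "dist (apply_bcontfun (encode (\<phi> i)) n) (apply_bcontfun (encode \<psi>) n)
        \<le> cmod (apply_bcontfun (encode (\<phi> i)) n) + cmod (apply_bcontfun (encode \<psi>) n)"
        unfolding dist_norm by (rule norm_triangle_ineq4)
      also have "\<dots> \<le> 1 / 2 ^ n + 1 / 2 ^ n" by (intro add_mono encode_bound s)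
      also have "\<dots> = 2 * (1 / 2) ^ n" by (simp add: power_divide)
      also have "\<dots> \<le> 2 * (1 / 2) ^ N" using False by (intro mult_left_mono power_decreasing) auto
      finally show ?thesis using N by simp
    qed
    then have "dist (encode (\<phi> i)) (encode \<psi>) \<le> r / 2" by (rule dist_bound)
    then show ?thesis using r by simp
  qed
  then show "\<exists>no. \<forall>n\<ge>no. dist (encode (\<phi> n)) (encode \<psi>) < r" by blast
qed

text \<open>The values of a state have modulus at most 1, so the sequences of values along the
  enumeration \<open>e\<close> lie in a countable product of discs, which is compact by Tychonoff's
  theorem and even sequentially compact.\<close>

lemma pointwise_subsequence:
  fixes \<phi> :: "nat \<Rightarrow> 'a \<Rightarrow> complex"
  assumes s: "\<And>i. state G (\<phi> i)"
  shows "\<exists>r \<psi>. strict_mono r \<and> state G \<psi> \<and> (\<forall>x\<in>carrier G. (\<lambda>i::nat. \<phi> (r i) x) \<longlonglongrightarrow> \<psi> x)"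
proof -
  have "compactin (product_topology (\<lambda>_::nat. euclidean) UNIV) (PiE UNIV (\<lambda>_. cball (0::complex) 1))"
    unfolding compactin_PiE by auto
  then have "compact (PiE UNIV (\<lambda>_::nat. cball (0::complex) 1))"
    by (simp add: euclidean_product_topology)
  then have sc: "seq_compact (PiE UNIV (\<lambda>_::nat. cball (0::complex) 1))"
    by (rule compact_imp_seq_compact)
  have mem: "\<forall>i. (\<lambda>n. \<phi> i (e n)) \<in> PiE UNIV (\<lambda>_. cball 0 1)"
    using state_bound[OF s] by auto
  obtain L r where L: "strict_mono r" "((\<lambda>i n. \<phi> i (e n)) \<circ> r) \<longlonglongrightarrow> L"
    using sc[unfolded seq_compact_def, THEN spec, THEN mp, OF mem] by blast
  have lim: "(\<lambda>i. \<phi> (r i) (e n)) \<longlonglongrightarrow> L n" for n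
  proof -
    have "continuous_on UNIV (\<lambda>f::nat \<Rightarrow> complex. f n)"
      by (rule continuous_on_product_then_coordinatewise[OF continuous_on_id])
    then have "(\<lambda>i. (\<lambda>f. f n) (((\<lambda>i n. \<phi> i (e n)) \<circ> r) i)) \<longlonglongrightarrow> (\<lambda>f. f n) L"
      by (rule continuous_on_tendsto_compose[OF _ L(2)]) auto
    then show ?thesis by (simp add: o_def)
  qed
  define \<psi> where "\<psi> x = L (SOME n. e n = x)" for x
  have lim\<psi>: "(\<lambda>i. \<phi> (r i) x) \<longlonglongrightarrow> \<psi> x" if "x \<in> carrier G" for x
  proof -
    have "\<exists>n. e n = x" using that e by (metis imageE)
    then have "e (SOME n. e n = x) = x" by (rule someI_ex)
    then show ?thesis using lim[of "SOME n. e n = x"] by (simp add: \<psi>_def)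
  qed
  have "posdef G \<psi>" by (rule posdef_limit[OF _ lim\<psi>]) (use s in \<open>auto simp: state_def\<close>)
  moreover have "\<psi> \<one>\<^bsub>G\<^esub> = 1" using lim\<psi>[of "\<one>\<^bsub>G\<^esub>"] s by (simp add: state_def LIMSEQ_const_iff)
  ultimately show ?thesis using L(1) lim\<psi> unfolding state_def by blast
qed

lemma compact_states: "compact (encode ` {\<phi>. state G \<phi>})"
  unfolding compact_def
proof (intro allI impI)
  fix f :: "nat \<Rightarrow> nat \<Rightarrow>\<^sub>C complex" assume "\<forall>n. f n \<in> encode ` {\<phi>. state G \<phi>}"
  then have "\<exists>\<phi>. \<forall>n. state G (\<phi> n) \<and> f n = encode (\<phi> n)" by (intro choice) auto
  then obtain \<phi> where \<phi>: "\<And>n. state G (\<phi> n)" "\<And>n. f n = encode (\<phi> n)" by blast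
  obtain r \<psi> where r: "strict_mono r" "state G \<psi>" "\<And>x. x \<in> carrier G \<Longrightarrow> (\<lambda>i. \<phi> (r i) x) \<longlonglongrightarrow> \<psi> x"
    using pointwise_subsequence[of \<phi>, OF \<phi>(1)] by blast
  have "(\<lambda>i. encode (\<phi> (r i))) \<longlonglongrightarrow> encode \<psi>"
    by (rule encode_tendsto) (use \<phi> r in auto)
  then have "(f \<circ> r) \<longlonglongrightarrow> encode \<psi>" by (simp add: o_def \<phi>(2))
  then show "\<exists>l\<in>encode ` {\<phi>. state G \<phi>}. \<exists>r. strict_mono r \<and> (f \<circ> r) \<longlonglongrightarrow> l"
    using r by blast
qed

lemma convex_states: "convex (encode ` {\<phi>. state G \<phi>})"
  unfolding convex_alt
proof (intro ballI allI impI, elim conjE)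
  fix x y and u :: real
  assume u: "0 \<le> u" "u \<le> 1" and "x \<in> encode ` {\<phi>. state G \<phi>}" "y \<in> encode ` {\<phi>. state G \<phi>}"
  then obtain \<phi> \<psi> where s: "state G \<phi>" "x = encode \<phi>" "state G \<psi>" "y = encode \<psi>" by auto
  show "(1 - u) *\<^sub>R x + u *\<^sub>R y \<in> encode ` {\<phi>. state G \<phi>}"
    unfolding s encode_convex[OF s(1,3) u] using state_convex[OF s(1,3) u] by blast
qed

text \<open>The strictly convex continuous function that \<open>extreme_point_avoiding\<close> asks
  for. It is the square of a weighted Hilbert norm, because the supremum norm of the ambient space
  is not strictly convex.\<close>

definition wnorm2 :: "(nat \<Rightarrow>\<^sub>C complex) \<Rightarrow> real" where
  "wnorm2 x = (\<Sum>n. (1/2)^n * (cmod (apply_bcontfun x n))\<^sup>2)"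

lemma wnorm2_summable: "summable (\<lambda>n. (1/2)^n * (cmod (apply_bcontfun x n))\<^sup>2)"
proof (rule summable_comparison_test)
  have "(1/2)^n * (cmod (apply_bcontfun x n))\<^sup>2 \<le> (1/2)^n * (norm x)\<^sup>2" for n
    by (intro mult_left_mono power_mono norm_bounded) auto
  then show "\<exists>N. \<forall>n\<ge>N. norm ((1/2)^n * (cmod (apply_bcontfun x n))\<^sup>2) \<le> (1/2)^n * (norm x)\<^sup>2"
    by auto
  show "summable (\<lambda>n. (1/2::real)^n * (norm x)\<^sup>2)" by (intro summable_mult2 summable_geometric) auto
qed

lemma wnorm2_continuous: "continuous_on (encode ` {\<phi>. state G \<phi>}) wnorm2"
proof -
  have ul: "uniform_limit (encode ` {\<phi>. state G \<phi>}) (\<lambda>m x. \<Sum>n<m. (1/2)^n * (cmod (apply_bcontfun x n))\<^sup>2)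
      (\<lambda>x. \<Sum>n. (1/2)^n * (cmod (apply_bcontfun x n))\<^sup>2) sequentially"
  proof (rule Weierstrass_m_test)
    show "summable (\<lambda>n. (1/2::real)^n)" by (intro summable_geometric) auto
    fix n x assume "x \<in> encode ` {\<phi>. state G \<phi>}"
    then obtain \<phi> where "state G \<phi>" "x = encode \<phi>" by auto
    then have "cmod (apply_bcontfun x n) \<le> 1 / 2 ^ n" using encode_bound by simp
    also have "\<dots> \<le> 1" by (simp add: divide_simps)
    finally have "(cmod (apply_bcontfun x n))\<^sup>2 \<le> 1" by (simp add: power_le_one)
    then have "(1/2)^n * (cmod (apply_bcontfun x n))\<^sup>2 \<le> (1/2)^n * 1" by (intro mult_left_mono) auto
    then show "norm ((1/2)^n * (cmod (apply_bcontfun x n))\<^sup>2) \<le> (1/2)^n" by simp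
  qed
  have "continuous_on S (\<lambda>x::nat \<Rightarrow>\<^sub>C complex. apply_bcontfun x n)" for S n
    unfolding continuous_on_iff using dist_bounded order_le_less_trans by blast
  then have "\<forall>\<^sub>F m in sequentially. continuous_on (encode ` {\<phi>. state G \<phi>})
      (\<lambda>x. \<Sum>n<m. (1/2)^n * (cmod (apply_bcontfun x n))\<^sup>2)"
    by (intro always_eventually allI continuous_intros)
  then show ?thesis
    unfolding wnorm2_def[abs_def] by (rule uniform_limit_theorem[OF _ ul trivial_limit_sequentially])
qed

text \<open>The parallelogram identity in each coordinate; the defect is a quarter of
  \<open>wnorm2 (a - b)\<close>.\<close>

lemma wnorm2_midpoint:
  assumes "a \<noteq> b"
  shows "wnorm2 ((1/2) *\<^sub>R a + (1/2) *\<^sub>R b) < (wnorm2 a + wnorm2 b) / 2"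
proof -
  obtain m where m: "apply_bcontfun (a - b) m \<noteq> 0"
    using assms bcontfun_eqI[of "a - b" 0] by auto
  have "wnorm2 ((1/2) *\<^sub>R a + (1/2) *\<^sub>R b) + wnorm2 (a - b) / 4
    = (\<Sum>n. (1/2)^n * (cmod (apply_bcontfun ((1/2) *\<^sub>R a + (1/2) *\<^sub>R b) n))\<^sup>2
        + (1/2)^n * (cmod (apply_bcontfun (a - b) n))\<^sup>2 / 4)"
    unfolding wnorm2_def suminf_divide[OF wnorm2_summable, symmetric]
    by (rule suminf_add[OF wnorm2_summable summable_divide[OF wnorm2_summable]])
  also have "\<dots> = (\<Sum>n. ((1/2)^n * (cmod (apply_bcontfun a n))\<^sup>2 + (1/2)^n * (cmod (apply_bcontfun b n))\<^sup>2) / 2)"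
  proof (intro arg_cong[where f = suminf] ext)
    fix n
    have "(cmod ((1/2) *\<^sub>R u + (1/2) *\<^sub>R v))\<^sup>2 + (cmod (u - v))\<^sup>2 / 4 = ((cmod u)\<^sup>2 + (cmod v)\<^sup>2) / 2" for u v
      unfolding cmod_power2 by (simp add: power2_eq_square field_simps)
    from this[of "apply_bcontfun a n" "apply_bcontfun b n"]
    show "(1/2)^n * (cmod (apply_bcontfun ((1/2) *\<^sub>R a + (1/2) *\<^sub>R b) n))\<^sup>2 + (1/2)^n * (cmod (apply_bcontfun (a - b) n))\<^sup>2 / 4
      = ((1/2)^n * (cmod (apply_bcontfun a n))\<^sup>2 + (1/2)^n * (cmod (apply_bcontfun b n))\<^sup>2) / 2"
      by (simp flip: distrib_left times_divide_eq_right)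
  qed
  also have "\<dots> = (wnorm2 a + wnorm2 b) / 2"
    unfolding wnorm2_def suminf_divide[OF summable_add[OF wnorm2_summable wnorm2_summable]]
    by (simp add: suminf_add[OF wnorm2_summable wnorm2_summable])
  finally have "wnorm2 ((1/2) *\<^sub>R a + (1/2) *\<^sub>R b) + wnorm2 (a - b) / 4 = (wnorm2 a + wnorm2 b) / 2" .
  moreover have "wnorm2 (a - b) > 0"
    unfolding wnorm2_def by (rule suminf_pos2[OF wnorm2_summable, where i = m]) (use m in auto)
  ultimately show ?thesis by simp
qed

theorem extreme_state_avoiding_enum:
  fixes B :: "nat \<Rightarrow> ('a \<Rightarrow> complex) \<Rightarrow> bool"
  assumes \<phi>0: "state G \<phi>0"
    and closed: "\<And>n \<phi> \<psi>. (\<And>i::nat. state G (\<phi> i) \<and> B n (\<phi> i)) \<Longrightarrow> state G \<psi> \<Longrightarrow>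
        (\<And>x. x \<in> carrier G \<Longrightarrow> (\<lambda>i. \<phi> i x) \<longlonglongrightarrow> \<psi> x) \<Longrightarrow> B n \<psi>"
    and convex: "\<And>n \<phi> \<psi> t. state G \<phi> \<Longrightarrow> state G \<psi> \<Longrightarrow> B n \<phi> \<Longrightarrow> B n \<psi> \<Longrightarrow> 0 \<le> t \<Longrightarrow> t \<le> 1 \<Longrightarrow>
        B n (\<lambda>x. of_real (1 - t) * \<phi> x + of_real t * \<psi> x)"
    and avoid: "\<And>n t \<phi> \<psi>. 0 < t \<Longrightarrow> t \<le> 1 \<Longrightarrow> state G \<phi> \<Longrightarrow> state G \<psi> \<Longrightarrow> B n \<psi> \<Longrightarrow>
        (\<And>x. x \<in> carrier G \<Longrightarrow> \<phi>0 x = of_real (1 - t) * \<phi> x + of_real t * \<psi> x) \<Longrightarrow> False"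
  shows "\<exists>\<phi>. extreme_state G \<phi> \<and> (\<forall>n. \<not> B n \<phi>)"
proof -
  define K where "K = encode ` {\<phi>. state G \<phi>}"
  define C where "C n = encode ` {\<phi>. state G \<phi> \<and> B n \<phi>}" for n
  \<comment> \<open>\<open>encode\<close> forgets the values off the carrier, so \<open>B n\<close>
    is carried over to \<open>\<phi>\<close> by closedness, applied to a constant sequence.\<close>
  have BC: "B n \<phi>" if \<phi>: "state G \<phi>" and C: "encode \<phi> \<in> C n" for n \<phi>
  proof -
    obtain \<psi> where \<psi>: "state G \<psi>" "B n \<psi>" "encode \<phi> = encode \<psi>" using C by (auto simp: C_def)
    show ?thesis
      by (rule closed[of "\<lambda>_. \<psi>"]) (use \<psi> \<phi> encode_eqD[OF \<psi>(1) \<phi> \<psi>(3)[symmetric]] in auto)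
  qed
  have "\<exists>x\<in>K. (\<forall>n. x \<notin> C n) \<and> (\<forall>a\<in>K. \<forall>b\<in>K. x = (1/2) *\<^sub>R a + (1/2) *\<^sub>R b \<longrightarrow> a = b)"
  proof (rule extreme_point_avoiding)
    show "compact K" "convex K" "encode \<phi>0 \<in> K" "continuous_on K wnorm2"
      using compact_states convex_states \<phi>0 wnorm2_continuous by (auto simp: K_def)
    show "wnorm2 ((1/2) *\<^sub>R a + (1/2) *\<^sub>R b) < (wnorm2 a + wnorm2 b) / 2" if "a \<noteq> b" for a b
      by (rule wnorm2_midpoint[OF that])
    show "convex (C n)" for n
      unfolding convex_alt
    proof (intro ballI allI impI, elim conjE)
      fix x y and u :: real
      assume u: "0 \<le> u" "u \<le> 1" and "x \<in> C n" "y \<in> C n"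
      then obtain \<phi> \<psi> where s: "state G \<phi>" "B n \<phi>" "x = encode \<phi>" "state G \<psi>" "B n \<psi>" "y = encode \<psi>"
        by (auto simp: C_def)
      show "(1 - u) *\<^sub>R x + u *\<^sub>R y \<in> C n"
        unfolding s encode_convex[OF s(1,4) u] C_def
        using state_convex[OF s(1,4) u] convex[OF s(1,4,2,5) u] by blast
    qed
    show "closed (C n)" for n
      unfolding closed_sequential_limits
    proof (intro allI impI, elim conjE)
      fix x l assume x: "\<forall>i. x i \<in> C n" "x \<longlonglongrightarrow> l"
      then have "\<exists>\<phi>. \<forall>i. state G (\<phi> i) \<and> B n (\<phi> i) \<and> x i = encode (\<phi> i)"
        by (intro choice) (auto simp: C_def)
      then obtain \<phi> where \<phi>: "\<And>i. state G (\<phi> i) \<and> B n (\<phi> i)" "\<And>i. x i = encode (\<phi> i)" by blast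
      obtain r \<psi> where r: "strict_mono r" "state G \<psi>" "\<And>y. y \<in> carrier G \<Longrightarrow> (\<lambda>i. \<phi> (r i) y) \<longlonglongrightarrow> \<psi> y"
        using pointwise_subsequence[of \<phi>, OF \<phi>(1)[THEN conjunct1]] by blast
      have "B n \<psi>" by (rule closed[of "\<lambda>i. \<phi> (r i)"]) (use \<phi>(1) r in auto)
      moreover have "(\<lambda>i. encode (\<phi> (r i))) \<longlonglongrightarrow> encode \<psi>"
        by (rule encode_tendsto) (use \<phi>(1) r in auto)
      moreover have "(\<lambda>i. encode (\<phi> (r i))) \<longlonglongrightarrow> l"
        using LIMSEQ_subseq_LIMSEQ[OF x(2) r(1)] by (simp add: o_def \<phi>(2))
      ultimately show "l \<in> C n" using r(2) LIMSEQ_unique unfolding C_def by blast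
    qed
    fix n and t :: real and a b assume t: "0 < t" "t \<le> 1" and ab: "a \<in> K" "b \<in> K" "b \<in> C n"
    obtain \<phi> \<psi> where \<phi>: "state G \<phi>" "a = encode \<phi>" and \<psi>: "state G \<psi>" "b = encode \<psi>"
      using ab by (auto simp: K_def)
    show "encode \<phi>0 \<noteq> (1 - t) *\<^sub>R a + t *\<^sub>R b"
    proof
      assume "encode \<phi>0 = (1 - t) *\<^sub>R a + t *\<^sub>R b"
      then have "encode \<phi>0 = encode (\<lambda>x. of_real (1 - t) * \<phi> x + of_real t * \<psi> x)"
        using encode_convex[OF \<phi>(1) \<psi>(1), of t] t \<phi> \<psi> by simp
      then show False
        using avoid[OF t \<phi>(1) \<psi>(1), of n] BC[OF \<psi>(1), of n] ab(3) \<psi>(2) t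
          encode_eqD[OF \<phi>0 state_convex[OF \<phi>(1) \<psi>(1)]] by simp
    qed
  qed
  then obtain \<phi> where \<phi>: "state G \<phi>" "\<And>n. encode \<phi> \<notin> C n"
    "\<And>a b. a \<in> K \<Longrightarrow> b \<in> K \<Longrightarrow> encode \<phi> = (1/2) *\<^sub>R a + (1/2) *\<^sub>R b \<Longrightarrow> a = b"
    by (auto simp: K_def)
  have "\<phi>1 x = \<phi>2 x" if s: "state G \<phi>1" "state G \<phi>2" and mid: "\<forall>x\<in>carrier G. \<phi> x = (\<phi>1 x + \<phi>2 x) / 2"
      and x: "x \<in> carrier G" for \<phi>1 \<phi>2 x
  proof -
    have "encode \<phi> = (1/2) *\<^sub>R encode \<phi>1 + (1/2) *\<^sub>R encode \<phi>2"
      by (rule bcontfun_eqI) (simp add: encode_apply s \<phi>(1) scaleR_conv_of_real mid[rule_format, OF e_carrier] add_divide_distrib)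
    then have "encode \<phi>1 = encode \<phi>2" using \<phi>(3)[of "encode \<phi>1" "encode \<phi>2"] s by (simp add: K_def)
    then show ?thesis using encode_eqD s x by blast
  qed
  moreover have "\<not> B n \<phi>" for n using \<phi>(1) \<phi>(2)[of n] by (auto simp: C_def)
  ultimately show ?thesis using \<phi>(1) unfolding extreme_state_def by blast
qed

end

theorem extreme_state_avoiding:
  fixes B :: "'j \<Rightarrow> ('a \<Rightarrow> complex) \<Rightarrow> bool"
  assumes G: "group G" "countable (carrier G)" and I: "countable I" "I \<noteq> {}"
    and \<phi>0: "state G \<phi>0"
    and closed: "\<And>n \<phi> \<psi>. n \<in> I \<Longrightarrow> (\<And>i::nat. state G (\<phi> i) \<and> B n (\<phi> i)) \<Longrightarrow> state G \<psi> \<Longrightarrow>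
        (\<And>x. x \<in> carrier G \<Longrightarrow> (\<lambda>i. \<phi> i x) \<longlonglongrightarrow> \<psi> x) \<Longrightarrow> B n \<psi>"
    and convex: "\<And>n \<phi> \<psi> t. n \<in> I \<Longrightarrow> state G \<phi> \<Longrightarrow> state G \<psi> \<Longrightarrow> B n \<phi> \<Longrightarrow> B n \<psi> \<Longrightarrow> 0 \<le> t \<Longrightarrow> t \<le> 1 \<Longrightarrow>
        B n (\<lambda>x. of_real (1 - t) * \<phi> x + of_real t * \<psi> x)"
    and avoid: "\<And>n t \<phi> \<psi>. n \<in> I \<Longrightarrow> 0 < t \<Longrightarrow> t \<le> 1 \<Longrightarrow> state G \<phi> \<Longrightarrow> state G \<psi> \<Longrightarrow> B n \<psi> \<Longrightarrow>
        (\<And>x. x \<in> carrier G \<Longrightarrow> \<phi>0 x = of_real (1 - t) * \<phi> x + of_real t * \<psi> x) \<Longrightarrow> False"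
  shows "\<exists>\<phi>. extreme_state G \<phi> \<and> (\<forall>n\<in>I. \<not> B n \<phi>)"
proof -
  interpret group G by (rule G)
  define e where "e = from_nat_into (carrier G)"
  have e: "range e = carrier G"
    unfolding e_def by (rule range_from_nat_into) (use G in auto)
  define f where "f = from_nat_into I"
  have f: "range f = I" unfolding f_def by (rule range_from_nat_into) (use I in auto)
  then have fI: "f n \<in> I" for n by auto
  have "\<exists>\<phi>. extreme_state G \<phi> \<and> (\<forall>n. \<not> B (f n) \<phi>)"
  proof (rule extreme_state_avoiding_enum[OF G(1) e \<phi>0], goal_cases)
    case 1
    then show ?case by (rule closed[OF fI])
  next
    case 2
    then show ?case by (rule convex[OF fI])
  next
    case 3
    then show ?case by (rule avoid[OF fI])
  qed
  then show ?thesis using f by blast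
qed

text \<open>After normalisation \<open>\<phi>\<close> is a convex combination of two states
  \<open>p\<close> and \<open>q\<close>. The one of smaller weight is mixed with part of the other
  until \<open>\<phi>\<close> becomes a midpoint, to which the definition of
  \<open>extreme_state\<close> applies.\<close>

lemma extreme_state_summand:
  assumes G: "group G" and ex: "extreme_state G \<phi>"
    and pd: "posdef G \<phi>1" "posdef G \<phi>2" and sum: "\<And>g. g \<in> carrier G \<Longrightarrow> \<phi> g = \<phi>1 g + \<phi>2 g"
    and pos: "0 < Re (\<phi>1 \<one>\<^bsub>G\<^esub>)" "0 < Re (\<phi>2 \<one>\<^bsub>G\<^esub>)"
  shows "\<exists>t. \<forall>g\<in>carrier G. \<phi>1 g = t * \<phi> g"
proof -
  interpret group G by (rule G)
  define a b where "a = Re (\<phi>1 \<one>\<^bsub>G\<^esub>)" and "b = Re (\<phi>2 \<one>\<^bsub>G\<^esub>)"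
  have real: "\<psi> \<one>\<^bsub>G\<^esub> = of_real (Re (\<psi> \<one>\<^bsub>G\<^esub>))" if "posdef G \<psi>" for \<psi>
    using posdef_gform(1)[OF that, of "[(1, \<one>\<^bsub>G\<^esub>)]"] by (simp add: fform_single complex_eq_iff)
  have s: "state G \<phi>" using ex by (simp add: extreme_state_def)
  have ab: "a > 0" "b > 0" using pos by (auto simp: a_def b_def)
  have one: "\<phi>1 \<one>\<^bsub>G\<^esub> = of_real a" "\<phi>2 \<one>\<^bsub>G\<^esub> = of_real b"
    unfolding a_def b_def by (rule real[OF pd(1)], rule real[OF pd(2)])
  have "of_real (a + b) = (1::complex)"
    using sum[of "\<one>\<^bsub>G\<^esub>"] s by (simp add: one state_def)
  then have ab1: "a + b = 1" by (metis of_real_eq_1_iff)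
  define p q where "p x = of_real (1 / a) * \<phi>1 x" and "q x = of_real (1 / b) * \<phi>2 x" for x
  have sp: "state G p"
    unfolding state_def p_def[abs_def]
    using posdef_scale[OF pd(1), of "1 / a"] ab by (simp add: one(1))
  have sq: "state G q"
    unfolding state_def q_def[abs_def]
    using posdef_scale[OF pd(2), of "1 / b"] ab by (simp add: one(2))
  have pq: "\<phi> x = of_real a * p x + of_real b * q x" if "x \<in> carrier G" for x
    using sum[OF that] ab by (simp add: p_def q_def)
  have main: "p x = q x" if x: "x \<in> carrier G" for x
  proof (cases "a \<le> 1 / 2")
    case True
    define r where "r x = of_real (1 - 2 * a) * q x + of_real (2 * a) * p x" for x
    have sr: "state G r" unfolding r_def[abs_def] using True ab by (intro state_convex sp sq) auto
    have "\<phi> y = (r y + q y) / 2" if "y \<in> carrier G" for y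
    proof -
      have b: "b = 1 - a" using ab1 by simp
      show ?thesis by (simp add: pq[OF that] r_def b field_simps)
    qed
    then have "r x = q x" using ex sr sq x unfolding extreme_state_def by blast
    then have "of_real (2 * a) * (p x - q x) = 0" by (simp add: r_def algebra_simps)
    then show ?thesis using ab by simp
  next
    case False
    define r where "r x = of_real (1 - 2 * b) * p x + of_real (2 * b) * q x" for x
    have sr: "state G r" unfolding r_def[abs_def] using False ab ab1 by (intro state_convex sp sq) auto
    have "\<phi> y = (r y + p y) / 2" if "y \<in> carrier G" for y
    proof -
      have a: "a = 1 - b" using ab1 by simp
      show ?thesis by (simp add: pq[OF that] r_def a field_simps)
    qed
    then have "r x = p x" using ex sr sp x unfolding extreme_state_def by blast
    then have "of_real (2 * b) * (q x - p x) = 0" by (simp add: r_def algebra_simps)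
    then show ?thesis using ab by simp
  qed
  have "\<phi>1 x = of_real a * \<phi> x" if x: "x \<in> carrier G" for x
  proof -
    have "\<phi> x = of_real (a + b) * p x" using pq[OF x] main[OF x] by (simp add: algebra_simps)
    then show ?thesis using ab ab1 by (simp add: p_def)
  qed
  then show ?thesis by blast
qed

section \<open>Normal subgroups, finite feet and conjugacy classes\<close>

context group
begin

abbreviation cj :: "'a \<Rightarrow> 'a \<Rightarrow> 'a" where "cj g x \<equiv> g \<otimes> x \<otimes> inv g"

lemma cancel_simps [simp]:
  "x \<in> carrier G \<Longrightarrow> y \<in> carrier G \<Longrightarrow> x \<otimes> (inv x \<otimes> y) = y"
  "x \<in> carrier G \<Longrightarrow> y \<in> carrier G \<Longrightarrow> inv x \<otimes> (x \<otimes> y) = y"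
  by (simp_all add: m_assoc[symmetric])

lemma cj_mult: "g \<in> carrier G \<Longrightarrow> x \<in> carrier G \<Longrightarrow> y \<in> carrier G \<Longrightarrow> cj g (x \<otimes> y) = cj g x \<otimes> cj g y"
  by (simp add: m_assoc)

lemma cj_inv: "g \<in> carrier G \<Longrightarrow> x \<in> carrier G \<Longrightarrow> cj g (inv x) = inv (cj g x)"
  by (simp add: inv_mult_group m_assoc)

lemma cj_comp: "g \<in> carrier G \<Longrightarrow> h \<in> carrier G \<Longrightarrow> x \<in> carrier G \<Longrightarrow> cj g (cj h x) = cj (g \<otimes> h) x"
  by (simp add: inv_mult_group m_assoc)

lemma commute_iff: "x \<in> carrier G \<Longrightarrow> y \<in> carrier G \<Longrightarrow> x \<otimes> y = y \<otimes> x \<longleftrightarrow> cj x y = y"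
  by (metis inv_closed inv_solve_right m_closed)

lemma eq_if_mult_inv_one:
  assumes "x \<in> carrier G" "y \<in> carrier G" "x \<otimes> inv y = \<one>" shows "x = y"
proof -
  have "x = x \<otimes> inv y \<otimes> y" using assms(1,2) by (simp add: m_assoc)
  then show ?thesis using assms by simp
qed

lemma eq_if_inv_mult_one:
  assumes "x \<in> carrier G" "y \<in> carrier G" "inv y \<otimes> x = \<one>" shows "x = y"
proof -
  have "x = y \<otimes> (inv y \<otimes> x)" using assms(1,2) by simp
  then show ?thesis using assms by simp
qed

lemma normalD:
  assumes "N \<lhd> G"
  shows "subgroup N G" "N \<subseteq> carrier G" "\<one> \<in> N" "x \<in> N \<Longrightarrow> y \<in> N \<Longrightarrow> x \<otimes> y \<in> N"
    "x \<in> N \<Longrightarrow> inv x \<in> N" "g \<in> carrier G \<Longrightarrow> x \<in> N \<Longrightarrow> cj g x \<in> N"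
  using assms normal_inv_iff[of N] by (auto simp: subgroup_def)

lemma normalI':
  assumes "N \<subseteq> carrier G" "\<one> \<in> N" "\<And>x y. x \<in> N \<Longrightarrow> y \<in> N \<Longrightarrow> x \<otimes> y \<in> N"
    "\<And>x. x \<in> N \<Longrightarrow> inv x \<in> N" "\<And>g x. g \<in> carrier G \<Longrightarrow> x \<in> N \<Longrightarrow> cj g x \<in> N"
  shows "N \<lhd> G"
  unfolding normal_inv_iff using assms by (auto intro: subgroup.intro)

lemma normal_Int: "M \<lhd> G \<Longrightarrow> N \<lhd> G \<Longrightarrow> M \<inter> N \<lhd> G"
  by (rule normalI') (auto dest: normalD)

lemma normal_one: "{\<one>} \<lhd> G"
  by (rule normalI') auto

lemma prodI: "x \<in> M \<Longrightarrow> y \<in> N \<Longrightarrow> a = x \<otimes> y \<Longrightarrow> a \<in> {x \<otimes> y |x y. x \<in> M \<and> y \<in> N}"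
  by blast

lemma normal_prod:
  assumes M: "M \<lhd> G" and N: "N \<lhd> G"
  shows "{x \<otimes> y |x y. x \<in> M \<and> y \<in> N} \<lhd> G" (is "?P \<lhd> G")
proof (rule normalI')
  note m = normalD[OF M] and n = normalD[OF N]
  have mc: "x \<in> M \<Longrightarrow> x \<in> carrier G" and nc: "y \<in> N \<Longrightarrow> y \<in> carrier G" for x y using m(2) n(2) by auto
  show "?P \<subseteq> carrier G" using mc nc by auto
  have "\<one> = \<one> \<otimes> \<one>" by simp
  then show "\<one> \<in> ?P" using m(3) n(3) by blast
  fix a assume "a \<in> ?P"
  then obtain x y where xy: "x \<in> M" "y \<in> N" "a = x \<otimes> y" by auto
  have "inv a = inv x \<otimes> cj x (inv y)" using xy mc nc by (simp add: inv_mult_group m_assoc)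
  then show "inv a \<in> ?P"
    using m(5)[OF xy(1)] n(6)[OF mc[OF xy(1)] n(5)[OF xy(2)]] by (intro prodI)
  show "cj g a \<in> ?P" if g: "g \<in> carrier G" for g
  proof -
    have "cj g a = cj g x \<otimes> cj g y" using xy mc nc g by (simp add: m_assoc)
    then show ?thesis using m(6)[OF g xy(1)] n(6)[OF g xy(2)] by (intro prodI)
  qed
  fix b assume "b \<in> ?P"
  then obtain u v where uv: "u \<in> M" "v \<in> N" "b = u \<otimes> v" by auto
  have "a \<otimes> b = (x \<otimes> cj y u) \<otimes> (y \<otimes> v)" using xy uv mc nc by (simp add: m_assoc)
  then show "a \<otimes> b \<in> ?P"
    using m(4)[OF xy(1) m(6)[OF nc[OF xy(2)] uv(1)]] n(4)[OF xy(2) uv(2)] by (intro prodI)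
qed

lemma prod_subset:
  assumes M: "M \<lhd> G" and N: "N \<lhd> G"
  shows "M \<subseteq> {x \<otimes> y |x y. x \<in> M \<and> y \<in> N}" "N \<subseteq> {x \<otimes> y |x y. x \<in> M \<and> y \<in> N}"
proof -
  note m = normalD[OF M] and n = normalD[OF N]
  show "M \<subseteq> {x \<otimes> y |x y. x \<in> M \<and> y \<in> N}"
  proof
    fix x assume x: "x \<in> M"
    then have "x = x \<otimes> \<one>" using m(2) by auto
    then show "x \<in> {x \<otimes> y |x y. x \<in> M \<and> y \<in> N}" using x n(3) by blast
  qed
  show "N \<subseteq> {x \<otimes> y |x y. x \<in> M \<and> y \<in> N}"
  proof
    fix x assume x: "x \<in> N"
    then have "x = \<one> \<otimes> x" using n(2) by auto
    then show "x \<in> {x \<otimes> y |x y. x \<in> M \<and> y \<in> N}" using x m(3) by blast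
  qed
qed

lemma finite_prod:
  assumes "finite M" "finite N"
  shows "finite {x \<otimes> y |x y. x \<in> M \<and> y \<in> N}"
proof -
  have "{x \<otimes> y |x y. x \<in> M \<and> y \<in> N} = (\<lambda>(x, y). x \<otimes> y) ` (M \<times> N)" by auto
  then show ?thesis using assms by simp
qed

lemma normal_generate_Union:
  assumes "\<And>M. M \<in> \<F> \<Longrightarrow> M \<lhd> G" shows "generate G (\<Union>\<F>) \<lhd> G"
proof (rule normal_generateI)
  show "\<Union>\<F> \<subseteq> carrier G" using normalD(2)[OF assms] by blast
  fix h g assume "h \<in> \<Union>\<F>" "g \<in> carrier G"
  then show "cj g h \<in> \<Union>\<F>" using normalD(6)[OF assms] by blast
qed

lemma conj_class_mem: "x \<in> carrier G \<Longrightarrow> x \<in> conj_class G x"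
  unfolding conj_class_def by (rule image_eqI[of _ _ \<one>]) auto

lemma normal_generate_conj_class: "x \<in> carrier G \<Longrightarrow> generate G (conj_class G x) \<lhd> G"
  by (rule normal_generateI) (auto simp: conj_class_def cj_comp)

lemma mem_generate_conj_class: "x \<in> carrier G \<Longrightarrow> x \<in> generate G (conj_class G x)"
  by (intro generate.incl conj_class_mem)

lemma generate_conj_class_subset: "N \<lhd> G \<Longrightarrow> x \<in> N \<Longrightarrow> generate G (conj_class G x) \<subseteq> N"
  by (rule generate_subgroup_incl) (auto simp: conj_class_def dest: normalD)

lemma mem_finite_normal:
  assumes F: "\<And>M. M \<in> \<F> \<Longrightarrow> M \<lhd> G \<and> finite M" and x: "x \<in> generate G (\<Union>\<F>)"
  shows "\<exists>Q. Q \<lhd> G \<and> finite Q \<and> x \<in> Q"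
  using x
proof (induction rule: generate.induct)
  case one
  then show ?case using normal_one by blast
next
  case (incl h)
  then show ?case using F by blast
next
  case (inv h)
  then show ?case using F normalD(5) by blast
next
  case (eng h1 h2)
  then obtain Q1 Q2 where Q: "Q1 \<lhd> G" "finite Q1" "h1 \<in> Q1" "Q2 \<lhd> G" "finite Q2" "h2 \<in> Q2" by blast
  then have "h1 \<otimes> h2 \<in> {x \<otimes> y |x y. x \<in> Q1 \<and> y \<in> Q2}" by blast
  then show ?case using normal_prod[OF Q(1,4)] finite_prod[OF Q(2,5)] by blast
qed

text \<open>Every element of the generated group lies in a product of finitely many of the finite
  normal subgroups. So \<open>L\<close> contains a finite nontrivial normal subgroup of
  \<open>G\<close>, and one of least order is a foot.\<close>

lemma finite_foot_below:
  assumes "\<And>M. M \<in> \<F> \<Longrightarrow> M \<lhd> G \<and> finite M" and L: "L \<lhd> G" "L \<subseteq> generate G (\<Union>\<F>)" "L \<noteq> {\<one>}"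
  shows "\<exists>M\<in>finite_feet G. M \<subseteq> L"
proof -
  obtain x where x: "x \<in> L" "x \<noteq> \<one>" using L normalD(3)[OF L(1)] by blast
  then obtain Q where Q: "Q \<lhd> G" "finite Q" "x \<in> Q"
    using mem_finite_normal[OF assms(1), of \<F> x] L(2) by blast
  define P where "P n \<longleftrightarrow> (\<exists>M. M \<lhd> G \<and> M \<noteq> {\<one>} \<and> M \<subseteq> L \<and> finite M \<and> card M = n)" for n
  have "P (card (L \<inter> Q))"
    unfolding P_def using normal_Int[OF L(1) Q(1)] x Q by (intro exI[of _ "L \<inter> Q"]) auto
  then have "P (LEAST n. P n)" by (rule LeastI)
  then obtain M where M: "M \<lhd> G" "M \<noteq> {\<one>}" "M \<subseteq> L" "finite M" "card M = (LEAST n. P n)"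
    unfolding P_def[of "LEAST n. P n"] by blast
  have "N = M \<or> N = {\<one>}" if N: "N \<lhd> G" "N \<subseteq> M" for N
  proof (cases "N = {\<one>}")
    case False
    have "P (card N)" unfolding P_def using N False M finite_subset[OF N(2) M(4)] by blast
    then have "card M \<le> card N" unfolding M(5) by (rule Least_le)
    then show ?thesis using card_seteq[OF M(4) N(2)] by blast
  qed simp
  then have "M \<in> finite_feet G" using M by (simp add: finite_feet_def foot_def)
  then show ?thesis using M(3) by blast
qed

lemma finite_feetD: "M \<in> finite_feet G \<Longrightarrow> M \<lhd> G \<and> finite M"
  by (simp add: finite_feet_def foot_def)

lemma footD: "foot G M \<Longrightarrow> N \<lhd> G \<Longrightarrow> N \<subseteq> M \<Longrightarrow> N \<noteq> {\<one>} \<Longrightarrow> N = M"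
  by (auto simp: foot_def)

lemma generate_commute:
  assumes S: "S \<subseteq> carrier G" and T: "T \<subseteq> carrier G"
    and c: "\<And>x y. x \<in> S \<Longrightarrow> y \<in> T \<Longrightarrow> x \<otimes> y = y \<otimes> x"
    and x: "x \<in> generate G S" and y: "y \<in> generate G T"
  shows "x \<otimes> y = y \<otimes> x"
proof -
  have cent: "subgroup {y \<in> carrier G. x \<otimes> y = y \<otimes> x} G" if x: "x \<in> carrier G" for x
  proof (rule subgroupI)
    show "{y \<in> carrier G. x \<otimes> y = y \<otimes> x} \<noteq> {}" using x by (auto intro!: exI[of _ \<one>])
    fix a assume a: "a \<in> {y \<in> carrier G. x \<otimes> y = y \<otimes> x}"
    have ac: "a \<in> carrier G" using a by simp
    have "inv a \<otimes> x = inv a \<otimes> (x \<otimes> a) \<otimes> inv a" using ac x by (simp add: m_assoc)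
    also have "\<dots> = inv a \<otimes> (a \<otimes> x) \<otimes> inv a" using a by simp
    also have "\<dots> = x \<otimes> inv a" using a x by simp
    finally show "inv a \<in> {y \<in> carrier G. x \<otimes> y = y \<otimes> x}" using a x by simp
    fix b assume b: "b \<in> {y \<in> carrier G. x \<otimes> y = y \<otimes> x}"
    have "x \<otimes> (a \<otimes> b) = a \<otimes> x \<otimes> b" using a b x by (simp add: m_assoc[symmetric])
    also have "\<dots> = a \<otimes> b \<otimes> x" using a b x by (simp add: m_assoc)
    finally show "a \<otimes> b \<in> {y \<in> carrier G. x \<otimes> y = y \<otimes> x}" using a b by simp
  qed auto
  have 1: "s \<otimes> y = y \<otimes> s" if "s \<in> S" for s
  proof -
    have "generate G T \<subseteq> {y \<in> carrier G. s \<otimes> y = y \<otimes> s}"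
      by (rule generate_subgroup_incl[OF _ cent]) (use that S T c in auto)
    then show ?thesis using y by auto
  qed
  have yc: "y \<in> carrier G" using generate_in_carrier[OF T y] .
  have "generate G S \<subseteq> {x \<in> carrier G. y \<otimes> x = x \<otimes> y}"
    by (rule generate_subgroup_incl[OF _ cent[OF yc]]) (use 1 S in auto)
  then show ?thesis using x by auto
qed

lemma comm_group_subgroup_iff:
  assumes "subgroup N G"
  shows "comm_group (G\<lparr>carrier := N\<rparr>) \<longleftrightarrow> (\<forall>x\<in>N. \<forall>y\<in>N. x \<otimes> y = y \<otimes> x)"
proof -
  interpret N: group "G\<lparr>carrier := N\<rparr>" by (rule subgroup_imp_group[OF assms])
  show ?thesis
  proof
    assume "comm_group (G\<lparr>carrier := N\<rparr>)"
    then interpret C: comm_group "G\<lparr>carrier := N\<rparr>" .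
    show "\<forall>x\<in>N. \<forall>y\<in>N. x \<otimes> y = y \<otimes> x" using C.m_comm by simp
  next
    assume "\<forall>x\<in>N. \<forall>y\<in>N. x \<otimes> y = y \<otimes> x"
    then show "comm_group (G\<lparr>carrier := N\<rparr>)" by (intro N.group_comm_groupI) auto
  qed
qed

lemma generate_Un_normal:
  assumes U: "U \<subseteq> carrier G" and X: "generate G U \<lhd> G" and S: "S \<lhd> G"
  shows "generate G (U \<union> S) = {x \<otimes> s |x s. x \<in> generate G U \<and> s \<in> S}" (is "?L = ?R")
proof
  have "U \<subseteq> generate G U" by (auto intro: generate.incl)
  then show "?L \<subseteq> ?R"
    using prod_subset[OF X S] by (intro generate_subgroup_incl normalD(1)[OF normal_prod[OF X S]]) auto
  have "generate G U \<subseteq> ?L" by (rule mono_generate) auto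
  then show "?R \<subseteq> ?L" by (auto intro!: generate.eng intro: generate.incl)
qed

text \<open>The commutator of \<open>x\<close> and \<open>y\<close> lies in both subgroups.\<close>

lemma disjoint_normal_commute:
  assumes M: "M \<lhd> G" and N: "N \<lhd> G" and "M \<inter> N = {\<one>}" and x: "x \<in> M" and y: "y \<in> N"
  shows "x \<otimes> y = y \<otimes> x"
proof -
  have c: "x \<in> carrier G" "y \<in> carrier G" using normalD(2) M N x y by blast+
  have e: "cj x y \<otimes> inv y = x \<otimes> cj y (inv x)" using c by (simp add: m_assoc)
  have "cj x y \<otimes> inv y \<in> N" using normalD[OF N] y c by simp
  moreover have "x \<otimes> cj y (inv x) \<in> M" using normalD[OF M] x c by simp
  ultimately have 1: "cj x y \<otimes> inv y = \<one>" using e assms(3) by auto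
  have "cj x y = y" by (rule eq_if_mult_inv_one[OF _ _ 1]) (use c in simp_all)
  then show ?thesis using commute_iff c by simp
qed

subsection \<open>Equivariant homomorphisms and cyclic finite abelian normal subgroups\<close>

text \<open>Extensional functions, so that these sets are finite for finite \<open>P\<close> and
  \<open>Q\<close> and can be counted.\<close>

definition eqhom :: "'a set \<Rightarrow> 'a set \<Rightarrow> ('a \<Rightarrow> 'a) set" where
  "eqhom P Q = {f \<in> P \<rightarrow>\<^sub>E Q. (\<forall>x\<in>P. \<forall>y\<in>P. f (x \<otimes> y) = f x \<otimes> f y) \<and>
     (\<forall>g\<in>carrier G. \<forall>x\<in>P. f (cj g x) = cj g (f x))}"

lemma eqhomD:
  assumes "f \<in> eqhom P Q"
  shows "x \<in> P \<Longrightarrow> f x \<in> Q" "x \<in> P \<Longrightarrow> y \<in> P \<Longrightarrow> f (x \<otimes> y) = f x \<otimes> f y"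
    "g \<in> carrier G \<Longrightarrow> x \<in> P \<Longrightarrow> f (cj g x) = cj g (f x)" "f \<in> extensional P"
  using assms by (auto simp: eqhom_def PiE_def)

lemma eqhom_one:
  assumes P: "P \<lhd> G" and Q: "Q \<lhd> G" and f: "f \<in> eqhom P Q" shows "f \<one> = \<one>"
proof -
  have "f \<one> \<otimes> f \<one> = f \<one>" using eqhomD(2)[OF f, of \<one> \<one>] normalD(3)[OF P] by simp
  moreover have "f \<one> \<in> carrier G" using eqhomD(1)[OF f normalD(3)[OF P]] normalD(2)[OF Q] by auto
  ultimately show ?thesis by (metis l_cancel_one')
qed

lemma eqhom_inv:
  assumes P: "P \<lhd> G" and Q: "Q \<lhd> G" and f: "f \<in> eqhom P Q" and x: "x \<in> P" shows "f (inv x) = inv (f x)"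
proof -
  have c: "x \<in> carrier G" "f x \<in> carrier G" "f (inv x) \<in> carrier G"
    using eqhomD(1)[OF f x] eqhomD(1)[OF f normalD(5)[OF P x]] normalD(2)[OF P] normalD(2)[OF Q] x by auto
  have "f (inv x) \<otimes> f x = \<one>"
    using eqhomD(2)[OF f, of "inv x" x] eqhom_one[OF P Q f] normalD(5)[OF P x] x c by simp
  then show ?thesis using inv_equality c by metis
qed

lemma eqhom_finite: "finite P \<Longrightarrow> finite Q \<Longrightarrow> finite (eqhom P Q)"
  by (rule finite_subset[OF _ finite_PiE[of P "\<lambda>_. Q"]]) (auto simp: eqhom_def)

lemma eqhom_trivial: "P \<lhd> G \<Longrightarrow> Q \<lhd> G \<Longrightarrow> (\<lambda>x\<in>P. \<one>) \<in> eqhom P Q"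
  using normalD(3)[of Q] normalD(4)[of P] normalD(6)[of P] by (auto simp: eqhom_def)

lemma eqhom_kernel_normal:
  assumes P: "P \<lhd> G" and Q: "Q \<lhd> G" and f: "f \<in> eqhom P Q"
  shows "{x \<in> P. f x = \<one>} \<lhd> G"
  by (rule normalI')
     (use normalD[OF P] eqhomD[OF f] eqhom_one[OF P Q f] eqhom_inv[OF P Q f] in auto)

lemma eqhom_image_normal:
  assumes P: "P \<lhd> G" and Q: "Q \<lhd> G" and f: "f \<in> eqhom P Q"
  shows "f ` P \<lhd> G"
proof (rule normalI')
  note p = normalD[OF P] and fd = eqhomD[OF f]
  show "f ` P \<subseteq> carrier G" using fd(1) normalD(2)[OF Q] by auto
  show "\<one> \<in> f ` P" using eqhom_one[OF P Q f] p(3) by (metis imageI)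
  fix x assume "x \<in> f ` P"
  then obtain a where a: "a \<in> P" "x = f a" by auto
  show "inv x \<in> f ` P" using a p(5) eqhom_inv[OF P Q f] by (metis imageI)
  show "cj g x \<in> f ` P" if "g \<in> carrier G" for g using a p(6) fd(3) that by (metis imageI)
  fix y assume "y \<in> f ` P"
  then obtain b where b: "b \<in> P" "y = f b" by auto
  show "x \<otimes> y \<in> f ` P" using a b p(4) fd(2) by (metis imageI)
qed

text \<open>A nontrivial equivariant homomorphism between feet is bijective, and composition with
  its inverse \<open>h\<close> on both sides turns homomorphisms from \<open>A\<close> to
  \<open>S\<close> into homomorphisms from \<open>S\<close> to \<open>A\<close>. If there is none,
  the left side is at most 1.\<close>

lemma eqhom_feet_card:
  assumes A: "foot G A" "finite A" and S: "foot G S" "finite S"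
  shows "card (eqhom A S) \<le> card (eqhom S A)"
proof -
  have An: "A \<lhd> G" and Sn: "S \<lhd> G" using A S by (auto simp: foot_def)
  note a = normalD[OF An] and s = normalD[OF Sn]
  show ?thesis
  proof (cases "\<exists>f\<in>eqhom A S. \<exists>x\<in>A. f x \<noteq> \<one>")
    case True
    then obtain f x where f: "f \<in> eqhom A S" "x \<in> A" "f x \<noteq> \<one>" by blast
    note fd = eqhomD[OF f(1)]
    have ker: "{y \<in> A. f y = \<one>} = {\<one>}"
      using footD[OF A(1) eqhom_kernel_normal[OF An Sn f(1)]] f by blast
    have im: "f ` A = S"
      by (rule footD[OF S(1) eqhom_image_normal[OF An Sn f(1)]]) (use f fd(1) in auto)
    have inj: "inj_on f A"
    proof (rule inj_onI)
      fix y z assume yz: "y \<in> A" "z \<in> A" "f y = f z"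
      have c: "y \<in> carrier G" "z \<in> carrier G" "f z \<in> carrier G" using yz a(2) fd(1) s(2) by blast+
      have "f (y \<otimes> inv z) = \<one>" using fd(2)[of y "inv z"] eqhom_inv[OF An Sn f(1)] yz a(5) c by simp
      then have "y \<otimes> inv z \<in> {y \<in> A. f y = \<one>}" using a(4,5) yz by simp
      then show "y = z" using ker eq_if_mult_inv_one[OF c(1,2)] by blast
    qed
    define h where "h = inv_into A f"
    have hA: "h t \<in> A" and fh: "f (h t) = t" if "t \<in> S" for t
      using that im by (auto simp: h_def inv_into_into f_inv_into_f)
    have hmult: "h (t \<otimes> u) = h t \<otimes> h u" if "t \<in> S" "u \<in> S" for t u
      using inj_onD[OF inj, of "h (t \<otimes> u)" "h t \<otimes> h u"] that hA fh fd(2) a(4) s(4) by simp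
    have hcj: "h (cj g t) = cj g (h t)" if "t \<in> S" "g \<in> carrier G" for t g
      using inj_onD[OF inj, of "h (cj g t)" "cj g (h t)"] that hA fh fd(3) a(6) s(6) by simp
    define \<Phi> where "\<Phi> k = (\<lambda>t\<in>S. h (k (h t)))" for k
    have "\<Phi> ` eqhom A S \<subseteq> eqhom S A"
    proof
      fix l assume "l \<in> \<Phi> ` eqhom A S"
      then obtain k where k: "k \<in> eqhom A S" "l = \<Phi> k" by auto
      note kd = eqhomD[OF k(1)]
      show "l \<in> eqhom S A" unfolding k(2) \<Phi>_def eqhom_def
        using hA hmult hcj kd s(4,6) by auto
    qed
    moreover have "inj_on \<Phi> (eqhom A S)"
    proof (rule inj_onI)
      fix k k' assume k: "k \<in> eqhom A S" "k' \<in> eqhom A S" "\<Phi> k = \<Phi> k'"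
      show "k = k'"
      proof (rule extensionalityI[of _ A])
        show "k \<in> extensional A" "k' \<in> extensional A" using eqhomD(4) k by blast+
        fix y assume y: "y \<in> A"
        have fy: "f y \<in> S" using fd(1) y .
        have hf: "h (f y) = y" using y inj by (simp add: h_def)
        have "h (k y) = h (k' y)" using fun_cong[OF k(3), of "f y"] fy by (simp add: \<Phi>_def hf)
        then have "f (h (k y)) = f (h (k' y))" by (rule arg_cong)
        then show "k y = k' y" unfolding fh[OF eqhomD(1)[OF k(1) y]] fh[OF eqhomD(1)[OF k(2) y]] .
      qed
    qed
    ultimately show ?thesis using card_inj_on_le eqhom_finite[OF S(2) A(2)] by blast
  next
    case False
    have "eqhom A S \<subseteq> {\<lambda>x\<in>A. \<one>}"
    proof
      fix f assume f: "f \<in> eqhom A S"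
      have "f = (\<lambda>x\<in>A. \<one>)"
        by (rule extensionalityI[of _ A]) (use False f eqhomD(4)[OF f] in auto)
      then show "f \<in> {\<lambda>x\<in>A. \<one>}" by simp
    qed
    then have "card (eqhom A S) \<le> 1" using card_mono[of "{\<lambda>x\<in>A. \<one>}"] by simp
    moreover have "card (eqhom S A) \<noteq> 0"
      using eqhom_trivial[OF Sn An] eqhom_finite[OF S(2) A(2)] by auto
    ultimately show ?thesis by simp
  qed
qed

text \<open>Restriction to both factors embeds the homomorphisms from \<open>P\<close>, and
  pointwise multiplication embeds pairs of homomorphisms into those to \<open>P\<close>. The
  products are homomorphisms because \<open>X\<close> and \<open>A\<close> commute elementwise, and
  they determine their factors because \<open>X\<close> and \<open>A\<close> meet trivially.\<close>

lemma eqhom_prod_card: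
  assumes X: "X \<lhd> G" "finite X" and A: "A \<lhd> G" "finite A" and S: "S \<lhd> G" "finite S"
    and XA: "X \<inter> A = {\<one>}"
    and leX: "card (eqhom X S) \<le> card (eqhom S X)" and leA: "card (eqhom A S) \<le> card (eqhom S A)"
  defines "P \<equiv> {x \<otimes> y |x y. x \<in> X \<and> y \<in> A}"
  shows "card (eqhom P S) \<le> card (eqhom S P)"
proof -
  note x = normalD[OF X(1)] and a = normalD[OF A(1)] and s = normalD[OF S(1)]
  have xc: "u \<in> X \<Longrightarrow> u \<in> carrier G" and ac: "v \<in> A \<Longrightarrow> v \<in> carrier G" for u v using x(2) a(2) by auto
  have Pn: "P \<lhd> G" and Pf: "finite P" unfolding P_def
    using normal_prod[OF X(1) A(1)] finite_prod[OF X(2) A(2)] by auto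
  have XP: "X \<subseteq> P" and AP: "A \<subseteq> P" unfolding P_def using prod_subset[OF X(1) A(1)] by auto
  have "card (eqhom P S) \<le> card (eqhom X S \<times> eqhom A S)"
  proof (rule card_inj_on_le[of "\<lambda>f. (restrict f X, restrict f A)"])
    show "inj_on (\<lambda>f. (restrict f X, restrict f A)) (eqhom P S)"
    proof (rule inj_onI)
      fix f f' assume f: "f \<in> eqhom P S" "f' \<in> eqhom P S"
        and eq: "(restrict f X, restrict f A) = (restrict f' X, restrict f' A)"
      have fX: "f u = f' u" if "u \<in> X" for u using eq that by (metis prod.inject restrict_apply')
      have fA: "f u = f' u" if "u \<in> A" for u using eq that by (metis prod.inject restrict_apply')
      show "f = f'"
      proof (rule extensionalityI[of _ P])
        show "f \<in> extensional P" "f' \<in> extensional P" using eqhomD(4) f by blast+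
        fix p assume "p \<in> P"
        then obtain u v where uv: "u \<in> X" "v \<in> A" "p = u \<otimes> v" by (auto simp: P_def)
        have "u \<in> P" "v \<in> P" using uv XP AP by blast+
        then show "f p = f' p"
          unfolding uv(3) using eqhomD(2)[OF f(1)] eqhomD(2)[OF f(2)] fX[OF uv(1)] fA[OF uv(2)] by simp
      qed
    qed
    show "(\<lambda>f. (restrict f X, restrict f A)) ` eqhom P S \<subseteq> eqhom X S \<times> eqhom A S"
      using XP AP x(4,6) a(4,6) by (auto simp: eqhom_def subset_iff)
    show "finite (eqhom X S \<times> eqhom A S)" using eqhom_finite X A S by simp
  qed
  also have "\<dots> \<le> card (eqhom S X \<times> eqhom S A)"
    using leX leA by (simp add: card_cartesian_product mult_le_mono)
  also have "\<dots> \<le> card (eqhom S P)"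
  proof (rule card_inj_on_le[of "\<lambda>(h, k). \<lambda>t\<in>S. h t \<otimes> k t"])
    show "inj_on (\<lambda>(h, k). \<lambda>t\<in>S. h t \<otimes> k t) (eqhom S X \<times> eqhom S A)"
    proof (rule inj_onI, clarify)
      fix h k h' k' assume h: "h \<in> eqhom S X" "h' \<in> eqhom S X" and k: "k \<in> eqhom S A" "k' \<in> eqhom S A"
        and eq: "(\<lambda>t\<in>S. h t \<otimes> k t) = (\<lambda>t\<in>S. h' t \<otimes> k' t)"
      have both: "h t = h' t \<and> k t = k' t" if t: "t \<in> S" for t
      proof -
        have m: "h t \<in> X" "h' t \<in> X" "k t \<in> A" "k' t \<in> A" using eqhomD(1) h k t by blast+
        have e: "h t \<otimes> k t = h' t \<otimes> k' t" using fun_cong[OF eq, of t] t by simp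
        have "inv (h' t) \<otimes> h t = inv (h' t) \<otimes> (h t \<otimes> k t) \<otimes> inv (k t)"
          using m xc ac by (simp add: m_assoc)
        also have "\<dots> = k' t \<otimes> inv (k t)" unfolding e using m xc ac by (simp add: m_assoc)
        finally have q: "inv (h' t) \<otimes> h t = k' t \<otimes> inv (k t)" .
        moreover have "inv (h' t) \<otimes> h t \<in> X" "k' t \<otimes> inv (k t) \<in> A" using m x(4,5) a(4,5) by auto
        ultimately have 1: "inv (h' t) \<otimes> h t = \<one>" using XA by auto
        have "h t = h' t" by (rule eq_if_inv_mult_one[OF xc[OF m(1)] xc[OF m(2)] 1])
        then show ?thesis using e ac[OF m(3)] ac[OF m(4)] xc[OF m(2)] by simp
      qed
      show "h = h' \<and> k = k'"
        using both eqhomD(4)[OF h(1)] eqhomD(4)[OF h(2)] eqhomD(4)[OF k(1)] eqhomD(4)[OF k(2)]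
        by (metis extensionalityI)
    qed
    show "(\<lambda>(h, k). \<lambda>t\<in>S. h t \<otimes> k t) ` (eqhom S X \<times> eqhom S A) \<subseteq> eqhom S P"
    proof clarify
      fix h k assume h: "h \<in> eqhom S X" and k: "k \<in> eqhom S A"
      have m: "h t \<in> X" "k t \<in> A" if "t \<in> S" for t using eqhomD(1) h k that by blast+
      have "h (t \<otimes> u) \<otimes> k (t \<otimes> u) = (h t \<otimes> k t) \<otimes> (h u \<otimes> k u)" if tu: "t \<in> S" "u \<in> S" for t u
      proof -
        have c: "k t \<otimes> h u = h u \<otimes> k t"
          using disjoint_normal_commute[OF X(1) A(1) XA m(1)[OF tu(2)] m(2)[OF tu(1)]] by simp
        have "(h t \<otimes> k t) \<otimes> (h u \<otimes> k u) = h t \<otimes> (k t \<otimes> h u) \<otimes> k u"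
          using m tu xc ac by (simp add: m_assoc)
        also have "\<dots> = h t \<otimes> h u \<otimes> (k t \<otimes> k u)" unfolding c using m tu xc ac by (simp add: m_assoc)
        finally show ?thesis using eqhomD(2)[OF h] eqhomD(2)[OF k] tu by simp
      qed
      moreover have "h (cj g t) \<otimes> k (cj g t) = cj g (h t \<otimes> k t)" if "t \<in> S" "g \<in> carrier G" for t g
        using that m xc ac eqhomD(3)[OF h] eqhomD(3)[OF k] by (simp add: m_assoc)
      moreover have "h t \<otimes> k t \<in> P" if "t \<in> S" for t using m that by (auto simp: P_def)
      ultimately show "(\<lambda>t\<in>S. h t \<otimes> k t) \<in> eqhom S P"
        using s(4,6) by (auto simp: eqhom_def)
    qed
    show "finite (eqhom S P)" using eqhom_finite S Pf by simp
  qed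
  finally show ?thesis .
qed

end

text \<open>Bessel's inequality for the orthogonal characters and the point mass at the identity.\<close>

lemma card_characters_le:
  assumes G: "group S" and fin: "finite (carrier S)"
    and X: "\<And>\<alpha>. \<alpha> \<in> X \<Longrightarrow> \<alpha> \<in> hom S circle_group \<and> \<alpha> \<in> extensional (carrier S)"
    and finX: "finite X"
  shows "card X \<le> card (carrier S)"
proof -
  interpret group S by (rule G)
  define n where "n = card (carrier S)"
  have n: "n > 0" using fin one_closed by (auto simp: n_def card_gt_0_iff)
  have mult: "\<alpha> (x \<otimes>\<^bsub>S\<^esub> y) = \<alpha> x * \<alpha> y" if "\<alpha> \<in> X" "x \<in> carrier S" "y \<in> carrier S" for \<alpha> x y
    using X[OF that(1)] that by (simp add: hom_def circle_group_def)
  have nrm: "cmod (\<alpha> x) = 1" if "\<alpha> \<in> X" "x \<in> carrier S" for \<alpha> x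
    using X[OF that(1)] that by (auto simp: hom_def circle_group_def)
  have one: "\<alpha> \<one>\<^bsub>S\<^esub> = 1" if "\<alpha> \<in> X" for \<alpha>
    using mult[OF that, of "\<one>\<^bsub>S\<^esub>" "\<one>\<^bsub>S\<^esub>"] nrm[OF that, of "\<one>\<^bsub>S\<^esub>"] by auto
  have self: "\<alpha> x * cnj (\<alpha> x) = 1" if "\<alpha> \<in> X" "x \<in> carrier S" for \<alpha> x
    using nrm[OF that] by (simp add: complex_norm_square[symmetric])
  have orth: "(\<Sum>x\<in>carrier S. \<alpha> x * cnj (\<beta> x)) = (if \<alpha> = \<beta> then of_nat n else 0 :: complex)" if "\<alpha> \<in> X" "\<beta> \<in> X" for \<alpha> \<beta>
  proof (cases "\<alpha> = \<beta>")
    case True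
    then show ?thesis using self[OF that(2)] by (simp add: n_def)
  next
    case False
    have "\<exists>g. g \<in> carrier S \<and> \<alpha> g \<noteq> \<beta> g"
      using False X[OF that(1)] X[OF that(2)] extensionalityI[of \<alpha> "carrier S" \<beta>] by blast
    then obtain g where g: "g \<in> carrier S" "\<alpha> g \<noteq> \<beta> g" by blast
    define s where "s = (\<Sum>x\<in>carrier S. \<alpha> x * cnj (\<beta> x))"
    have "s = (\<Sum>x\<in>carrier S. \<alpha> (g \<otimes>\<^bsub>S\<^esub> x) * cnj (\<beta> (g \<otimes>\<^bsub>S\<^esub> x)))"
      unfolding s_def
      by (rule sum.reindex_bij_witness[of _ "\<lambda>x. g \<otimes>\<^bsub>S\<^esub> x" "\<lambda>x. inv\<^bsub>S\<^esub> g \<otimes>\<^bsub>S\<^esub> x"]) (use g in \<open>auto simp: m_assoc[symmetric]\<close>)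
    also have "\<dots> = \<alpha> g * cnj (\<beta> g) * s"
      unfolding s_def sum_distrib_left using g that by (intro sum.cong) (auto simp: mult)
    finally have "(1 - \<alpha> g * cnj (\<beta> g)) * s = 0" by (simp add: algebra_simps)
    moreover have "\<alpha> g * cnj (\<beta> g) \<noteq> 1"
    proof
      assume "\<alpha> g * cnj (\<beta> g) = 1"
      then have "\<alpha> g * (cnj (\<beta> g) * \<beta> g) = \<beta> g" by (metis mult.assoc mult_1)
      then show False using self[OF that(2) g(1)] g(2) by (simp add: mult.commute)
    qed
    ultimately show ?thesis using False by (simp add: s_def)
  qed
  define c where "c = (card X :: real)"
  define F where "F x = (\<Sum>\<alpha>\<in>X. \<alpha> x)" for x
  have F1: "F \<one>\<^bsub>S\<^esub> = of_real c" unfolding F_def c_def by (simp add: one cong: sum.cong)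
  have FF: "(\<Sum>x\<in>carrier S. F x * cnj (F x)) = of_real (c * n)"
  proof -
    have "(\<Sum>x\<in>carrier S. F x * cnj (F x)) = (\<Sum>x\<in>carrier S. \<Sum>\<alpha>\<in>X. \<Sum>\<beta>\<in>X. \<alpha> x * cnj (\<beta> x))"
      by (simp add: F_def sum_product)
    also have "\<dots> = (\<Sum>\<alpha>\<in>X. \<Sum>\<beta>\<in>X. \<Sum>x\<in>carrier S. \<alpha> x * cnj (\<beta> x))"
      by (subst sum.swap, intro sum.cong refl sum.swap)
    also have "\<dots> = (\<Sum>\<alpha>\<in>X. \<Sum>\<beta>\<in>X. if \<alpha> = \<beta> then of_nat n else 0)"
      by (intro sum.cong refl orth)
    also have "\<dots> = of_real (c * n)" using finX by (simp add: c_def)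
    finally show ?thesis .
  qed
  \<comment> \<open>The sum \<open>F\<close> of the characters takes the value \<open>card X\<close>
    at the identity; this is one term of a sum whose total is \<open>card X\<close> times the order
    of the group.\<close>
  have "(cmod (F \<one>\<^bsub>S\<^esub>))\<^sup>2 \<le> (\<Sum>x\<in>carrier S. (cmod (F x))\<^sup>2)"
    by (rule member_le_sum) (use fin in auto)
  also have "(\<Sum>x\<in>carrier S. (cmod (F x))\<^sup>2) = c * n"
  proof -
    have "of_real (\<Sum>x\<in>carrier S. (cmod (F x))\<^sup>2) = (\<Sum>x\<in>carrier S. F x * cnj (F x))"
      by (simp add: complex_norm_square del: of_real_power)
    then show ?thesis unfolding FF by (metis of_real_eq_iff)
  qed
  finally have "c * c \<le> c * n" by (simp add: F1 power2_eq_square)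
  then show ?thesis by (cases "c = 0") (auto simp: c_def n_def mult_le_cancel_left)
qed

context group
begin

lemma abelian_finite_feetD:
  assumes "M \<in> abelian_finite_feet G"
  shows "foot G M" "M \<lhd> G" "finite M" "M \<noteq> {\<one>}" "x \<in> M \<Longrightarrow> y \<in> M \<Longrightarrow> x \<otimes> y = y \<otimes> x"
proof -
  show f: "foot G M" "M \<lhd> G" "finite M" "M \<noteq> {\<one>}"
    using assms by (auto simp: abelian_finite_feet_def finite_feet_def foot_def)
  show "x \<otimes> y = y \<otimes> x" if "x \<in> M" "y \<in> M"
    using assms that comm_group_subgroup_iff[OF normalD(1)[OF f(2)]]
    by (simp add: abelian_finite_feet_def)
qed

lemma nonabelian_finite_feetD:
  assumes "M \<in> nonabelian_finite_feet G"
  shows "foot G M" "M \<lhd> G" "finite M" "\<exists>x\<in>M. \<exists>y\<in>M. x \<otimes> y \<noteq> y \<otimes> x"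
proof -
  show f: "foot G M" "M \<lhd> G" "finite M"
    using assms by (auto simp: nonabelian_finite_feet_def finite_feet_def foot_def)
  show "\<exists>x\<in>M. \<exists>y\<in>M. x \<otimes> y \<noteq> y \<otimes> x"
    using assms comm_group_subgroup_iff[OF normalD(1)[OF f(2)]]
    by (auto simp: nonabelian_finite_feet_def abelian_finite_feet_def)
qed

lemma MS_normal: "MS G \<lhd> G" and MA_normal: "MA G \<lhd> G"
  unfolding MS_def MA_def
  by (rule normal_generate_Union, use finite_feetD in \<open>auto simp: abelian_finite_feet_def\<close>)+

lemma MA_commute:
  assumes A: "\<forall>i\<in>I. A i \<in> abelian_finite_feet G" and ds: "internal_direct_sum G I A (MA G)"
    and xy: "x \<in> MA G" "y \<in> MA G"
  shows "x \<otimes> y = y \<otimes> x"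
proof (rule generate_commute)
  have MA: "MA G = generate G (\<Union>i\<in>I. A i)" using ds by (simp add: internal_direct_sum_def)
  show "x \<in> generate G (\<Union>i\<in>I. A i)" "y \<in> generate G (\<Union>i\<in>I. A i)" using xy MA by simp_all
  show "(\<Union>i\<in>I. A i) \<subseteq> carrier G" using A abelian_finite_feetD(2) normalD(2) by blast
  then show "(\<Union>i\<in>I. A i) \<subseteq> carrier G" .
  fix a b assume "a \<in> (\<Union>i\<in>I. A i)" "b \<in> (\<Union>i\<in>I. A i)"
  then obtain i j where ij: "i \<in> I" "j \<in> I" "a \<in> A i" "b \<in> A j" by blast
  show "a \<otimes> b = b \<otimes> a"
  proof (cases "i = j")
    case True
    then show ?thesis using ij A abelian_finite_feetD(5)[of "A i" a b] by simp
  next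
    case False
    then show ?thesis using ij ds by (simp add: internal_direct_sum_def)
  qed
qed

lemma normal_image_of_equivariant:
  assumes S: "S \<lhd> G" and f: "\<And>t. t \<in> S \<Longrightarrow> f t \<in> carrier G"
    and m: "\<And>t u. t \<in> S \<Longrightarrow> u \<in> S \<Longrightarrow> f (t \<otimes> u) = f t \<otimes> f u"
    and c: "\<And>g t. g \<in> carrier G \<Longrightarrow> t \<in> S \<Longrightarrow> f (cj g t) = cj g (f t)"
  shows "f ` S \<lhd> G"
proof (rule eqhom_image_normal[of S "carrier G" "restrict f S", simplified])
  note s = normalD[OF S]
  show "carrier G \<lhd> G" by (rule normalI') auto
  show "restrict f S \<in> eqhom S (carrier G)" using assms s(4,6) by (auto simp: eqhom_def)
qed (rule S)

end

section \<open>Counting equivariant homomorphisms by means of a \<open>G\<close>-faithful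
  character\<close>

locale dual_normal = group G for G (structure) +
  fixes N :: "'a set" and \<theta> :: "'a \<Rightarrow> complex"
  assumes Nn: "N \<lhd> G" and Ncomm: "\<And>x y. x \<in> N \<Longrightarrow> y \<in> N \<Longrightarrow> x \<otimes> y = y \<otimes> x"
    and hom: "\<theta> \<in> hom (G\<lparr>carrier := N\<rparr>) circle_group"
    and faithful: "conj_faithful G N circle_group \<theta>"
begin

lemmas Nd = normalD[OF Nn]

lemma char_mult: "x \<in> N \<Longrightarrow> y \<in> N \<Longrightarrow> \<theta> (x \<otimes> y) = \<theta> x * \<theta> y"
  using hom by (simp add: hom_def circle_group_def)

lemma char_norm: "x \<in> N \<Longrightarrow> cmod (\<theta> x) = 1"
  using hom by (auto simp: hom_def circle_group_def)

lemma char_one: "\<theta> \<one> = 1"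
  using char_mult[of \<one> \<one>] char_norm[of \<one>] Nd(3) by auto

lemma char_inv: assumes "x \<in> N" shows "\<theta> (inv x) = inverse (\<theta> x)"
proof -
  have "\<theta> x * \<theta> (inv x) = 1" using char_mult[of x "inv x"] Nd(2,5) assms char_one by auto
  then show ?thesis by (simp add: inverse_unique)
qed

lemma char_trivial_normal:
  assumes M: "M \<lhd> G" "M \<subseteq> N" "\<And>x. x \<in> M \<Longrightarrow> \<theta> x = 1"
  shows "M = {\<one>}"
proof
  show "{\<one>} \<subseteq> M" using normalD(3)[OF M(1)] by simp
  show "M \<subseteq> {\<one>}"
  proof
    fix x assume x: "x \<in> M"
    have "x \<in> (\<Inter>g\<in>carrier G. kernel (G\<lparr>carrier := N\<rparr>) circle_group (\<lambda>n. \<theta> (cj g n)))"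
      using x M(2) M(3) normalD(6)[OF M(1)] by (auto simp: kernel_def circle_group_def)
    then show "x \<in> {\<one>}" using faithful unfolding conj_faithful_def by blast
  qed
qed

text \<open>The product of \<open>p\<close> and \<open>q\<close> is again an equivariant
  homomorphism, since \<open>N\<close> is abelian; its image is a normal subgroup of
  \<open>G\<close> on which \<open>\<theta>\<close> is trivial. With an inverse taken in
  \<open>q\<close> this says that composition with \<open>\<theta>\<close> separates equivariant
  homomorphisms.\<close>

lemma equivariant_trivial:
  assumes S: "S \<lhd> G" and c: "\<And>t. t \<in> S \<Longrightarrow> p t \<in> N" "\<And>t. t \<in> S \<Longrightarrow> q t \<in> N"
    and m: "\<And>t u. t \<in> S \<Longrightarrow> u \<in> S \<Longrightarrow> p (t \<otimes> u) = p t \<otimes> p u"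
      "\<And>t u. t \<in> S \<Longrightarrow> u \<in> S \<Longrightarrow> q (t \<otimes> u) = q t \<otimes> q u"
    and e: "\<And>g t. g \<in> carrier G \<Longrightarrow> t \<in> S \<Longrightarrow> p (cj g t) = cj g (p t)"
      "\<And>g t. g \<in> carrier G \<Longrightarrow> t \<in> S \<Longrightarrow> q (cj g t) = cj g (q t)"
    and \<theta>: "\<And>t. t \<in> S \<Longrightarrow> \<theta> (p t) * \<theta> (q t) = 1" and t: "t \<in> S"
  shows "p t \<otimes> q t = \<one>"
proof -
  have pq: "p t \<in> carrier G" "q t \<in> carrier G" if "t \<in> S" for t using c Nd(2) that by blast+
  have "(\<lambda>t. p t \<otimes> q t) ` S \<lhd> G"
  proof (rule normal_image_of_equivariant[OF S])
    fix t u assume tu: "t \<in> S" "u \<in> S"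
    have "p u \<otimes> q t = q t \<otimes> p u" using Ncomm c tu by simp
    then have "p u \<otimes> (q t \<otimes> q u) = q t \<otimes> (p u \<otimes> q u)" using pq tu by (simp add: m_assoc[symmetric])
    then show "p (t \<otimes> u) \<otimes> q (t \<otimes> u) = (p t \<otimes> q t) \<otimes> (p u \<otimes> q u)"
      using m tu pq by (simp add: m_assoc)
  qed (use pq e in \<open>auto simp: cj_mult\<close>)
  then have "(\<lambda>t. p t \<otimes> q t) ` S = {\<one>}"
    by (rule char_trivial_normal) (use c Nd(4) char_mult \<theta> in auto)
  then show ?thesis using t by blast
qed

text \<open>Composition with \<open>\<theta>\<close> embeds the homomorphisms from \<open>S\<close>
  to \<open>P\<close> into the characters of \<open>S\<close>, of which there are at most
  \<open>card S\<close>. Were there as many homomorphisms, every character would arise, also the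
  inverse of \<open>\<theta>\<close> on \<open>S\<close>; but then \<open>h t\<close> is the inverse
  of \<open>t\<close>, which places \<open>S\<close> inside \<open>P\<close>.\<close>

lemma card_eqhom_less:
  assumes S: "S \<lhd> G" "finite S" "S \<subseteq> N" "S \<noteq> {\<one>}" and P: "P \<lhd> G" "finite P" "P \<subseteq> N" "P \<inter> S = {\<one>}"
  shows "card (eqhom S P) < card S"
proof (rule ccontr)
  assume "\<not> ?thesis"
  then have ge: "card S \<le> card (eqhom S P)" by simp
  note s = normalD[OF S(1)] and p = normalD[OF P(1)]
  have sN: "t \<in> S \<Longrightarrow> t \<in> N" and pN: "t \<in> P \<Longrightarrow> t \<in> N" and Nc: "t \<in> N \<Longrightarrow> t \<in> carrier G" for t
    using S P Nd(2) by auto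
  define \<Phi> where "\<Phi> h = (\<lambda>t\<in>S. \<theta> (h t))" for h
  define \<psi> where "\<psi> = (\<lambda>t\<in>S. inverse (\<theta> t))"
  have ih: "h t \<in> N" if "h \<in> eqhom S P" "t \<in> S" for h t using eqhomD(1)[OF that] pN by simp
  have char: "\<Phi> h \<in> hom (G\<lparr>carrier := S\<rparr>) circle_group" if h: "h \<in> eqhom S P" for h
    using ih[OF h] eqhomD(2)[OF h] s(4) char_mult char_norm
    by (auto simp: \<Phi>_def hom_def circle_group_def)
  have charpsi: "\<psi> \<in> hom (G\<lparr>carrier := S\<rparr>) circle_group"
    using sN s(4) char_mult char_norm by (auto simp: \<psi>_def hom_def circle_group_def norm_inverse)
  have inj: "inj_on \<Phi> (eqhom S P)"
  proof (rule inj_onI)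
    fix h k assume h: "h \<in> eqhom S P" and k: "k \<in> eqhom S P" and eq: "\<Phi> h = \<Phi> k"
    have e: "\<theta> (h t) = \<theta> (k t)" if "t \<in> S" for t using fun_cong[OF eq, of t] that by (simp add: \<Phi>_def)
    have triv: "h t \<otimes> inv (k t) = \<one>" if "t \<in> S" for t
    proof (rule equivariant_trivial[OF S(1) _ _ _ _ _ _ _ that])
      fix t u assume tu: "t \<in> S" "u \<in> S"
      have "k (t \<otimes> u) = k u \<otimes> k t" using eqhomD(2)[OF k tu] Ncomm ih[OF k] tu by simp
      then show "inv (k (t \<otimes> u)) = inv (k t) \<otimes> inv (k u)" using ih[OF k] tu Nc by (simp add: inv_mult_group)
    next
      fix t assume t: "t \<in> S"
      show "\<theta> (h t) * \<theta> (inv (k t)) = 1"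
        using char_norm[OF ih[OF k t]] char_inv[OF ih[OF k t]] e[OF t] by (auto intro: right_inverse)
    qed (use ih h k eqhomD(2,3)[OF h] eqhomD(3)[OF k] Nd(5) Nc in \<open>auto simp: cj_inv\<close>)
    show "h = k"
    proof (rule extensionalityI[of _ S])
      show "h \<in> extensional S" "k \<in> extensional S" using eqhomD(4) h k by blast+
      fix t assume t: "t \<in> S"
      then show "h t = k t" using triv[OF t] eq_if_mult_inv_one Nc ih[OF h t] ih[OF k t] by blast
    qed
  qed
  have grp: "group (G\<lparr>carrier := S\<rparr>)" by (rule subgroup_imp_group[OF s(1)])
  have "\<psi> \<in> \<Phi> ` eqhom S P"
  proof (rule ccontr)
    assume n: "\<psi> \<notin> \<Phi> ` eqhom S P"
    have f: "finite (\<Phi> ` eqhom S P)" using eqhom_finite S(2) P(2) by simp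
    have "card (insert \<psi> (\<Phi> ` eqhom S P)) \<le> card (carrier (G\<lparr>carrier := S\<rparr>))"
      by (rule card_characters_le[OF grp])
        (use S(2) f char charpsi in \<open>auto simp: \<Phi>_def \<psi>_def\<close>)
    moreover have "card (insert \<psi> (\<Phi> ` eqhom S P)) = Suc (card (eqhom S P))"
      using f n card_image[OF inj] by simp
    ultimately show False using ge by simp
  qed
  then obtain h where h: "h \<in> eqhom S P" and ps: "\<psi> = \<Phi> h" by blast
  have e: "\<theta> (h t) = inverse (\<theta> t)" if "t \<in> S" for t
    using fun_cong[OF ps, of t] that by (simp add: \<Phi>_def \<psi>_def)
  have triv: "h t \<otimes> t = \<one>" if "t \<in> S" for t
  proof (rule equivariant_trivial[OF S(1) _ _ _ _ _ _ _ that])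
    fix t assume t: "t \<in> S"
    show "\<theta> (h t) * \<theta> t = 1" using char_norm[OF sN[OF t]] e[OF t] by (auto intro: left_inverse)
  qed (use ih h sN eqhomD(2,3)[OF h] in auto)
  have "S \<subseteq> P"
  proof
    fix t assume t: "t \<in> S"
    have "t \<otimes> h t = \<one>" using triv[OF t] Ncomm[OF ih[OF h t] sN[OF t]] by simp
    then have "inv (h t) = t" by (rule inv_equality) (use Nc ih[OF h t] sN[OF t] in auto)
    then show "t \<in> P" using p(5) eqhomD(1)[OF h t] by metis
  qed
  then show False using P(4) S(4) by blast
qed

text \<open>The subgroup \<open>Q t\<close> generated by the class of \<open>x \<otimes> t\<close>
  either contains the foot \<open>S\<close>, and then also \<open>X\<close>, or meets
  \<open>S\<close> trivially. In the second case it is the graph of an equivariant homomorphism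
  \<open>f t\<close> from \<open>X\<close> to \<open>S\<close> with \<open>f t x = t\<close>. So
  distinct \<open>t\<close> give distinct homomorphisms, more than \<open>less\<close>
  allows.\<close>

lemma generated_extend:
  assumes X: "finite X" "X \<subseteq> N" "x \<in> carrier G" "X = generate G (conj_class G x)"
    and S: "foot G S" "finite S" "S \<subseteq> N" and XS: "X \<inter> S = {\<one>}"
    and less: "card (eqhom X S) < card S"
  shows "\<exists>s\<in>S. generate G (conj_class G (x \<otimes> s)) = {y \<otimes> s |y s. y \<in> X \<and> s \<in> S}"
proof (rule ccontr)
  assume no: "\<not> ?thesis"
  have Xn: "X \<lhd> G" using normal_generate_conj_class X(3,4) by simp
  have xX: "x \<in> X" using mem_generate_conj_class X(3,4) by simp
  have Sn: "S \<lhd> G" using S(1) by (simp add: foot_def)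
  note s = normalD[OF Sn] and xn = normalD[OF Xn]
  have sN: "t \<in> S \<Longrightarrow> t \<in> N" and xN: "t \<in> X \<Longrightarrow> t \<in> N" and Nc: "t \<in> N \<Longrightarrow> t \<in> carrier G" for t
    using S X Nd(2) by auto
  define Q where "Q t = generate G (conj_class G (x \<otimes> t))" for t
  have Qn: "Q t \<lhd> G" and Qx: "x \<otimes> t \<in> Q t" if "t \<in> S" for t
    unfolding Q_def using that Nc sN X(3)
    by (auto intro!: normal_generate_conj_class mem_generate_conj_class)
  have QS: "Q t \<inter> S = {\<one>}" if t: "t \<in> S" for t
  proof (rule ccontr)
    assume "Q t \<inter> S \<noteq> {\<one>}"
    then have SQ: "S \<subseteq> Q t" using footD[OF S(1) normal_Int[OF Qn[OF t] Sn]] by blast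
    note q = normalD[OF Qn[OF t]]
    have "x = (x \<otimes> t) \<otimes> inv t" using t Nc sN X(3) by (simp add: m_assoc)
    moreover have "x \<otimes> t \<otimes> inv t \<in> Q t" using q(4)[OF Qx[OF t] q(5)] SQ t by blast
    ultimately have "x \<in> Q t" by simp
    then have "X \<subseteq> Q t" unfolding X(4) by (rule generate_conj_class_subset[OF Qn[OF t]])
    then have "{y \<otimes> s |y s. y \<in> X \<and> s \<in> S} \<subseteq> Q t" using SQ q(4) by blast
    moreover have "Q t \<subseteq> {y \<otimes> s |y s. y \<in> X \<and> s \<in> S}"
      unfolding Q_def using xX t
      by (intro generate_conj_class_subset[OF normal_prod[OF Xn Sn]]) blast
    ultimately show False using no t unfolding Q_def by blast
  qed
  \<comment> \<open>The \<open>X\<close>-components occurring in \<open>Q t\<close> form a normal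
    subgroup of \<open>G\<close> that contains \<open>x\<close>, whose class generates
    \<open>X\<close>.\<close>
  have ex: "\<exists>u\<in>S. y \<otimes> u \<in> Q t" if t: "t \<in> S" and y: "y \<in> X" for t y
  proof -
    note q = normalD[OF Qn[OF t]]
    have "{y \<in> X. \<exists>u\<in>S. y \<otimes> u \<in> Q t} \<lhd> G" (is "?Y \<lhd> G")
    proof (rule normalI')
      show "?Y \<subseteq> carrier G" using xn(2) by auto
      show "\<one> \<in> ?Y" using xn(3) s(3) q(3) by (auto intro!: bexI[of _ \<one>])
      fix y assume "y \<in> ?Y"
      then obtain u where u: "y \<in> X" "u \<in> S" "y \<otimes> u \<in> Q t" by auto
      have c: "y \<in> carrier G" "u \<in> carrier G" using u xN sN Nc by auto
      have "inv y \<otimes> inv u = inv (y \<otimes> u)"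
        using Ncomm[OF xN[OF u(1)] sN[OF u(2)]] c by (simp add: inv_mult_group[symmetric])
      then have "inv y \<otimes> inv u \<in> Q t" using q(5)[OF u(3)] by simp
      then show "inv y \<in> ?Y" using xn(5)[OF u(1)] s(5)[OF u(2)] by blast
      show "cj g y \<in> ?Y" if "g \<in> carrier G" for g
        using q(6)[OF that u(3)] xn(6)[OF that u(1)] s(6)[OF that u(2)] cj_mult[OF that c] by auto
      fix z assume "z \<in> ?Y"
      then obtain v where v: "z \<in> X" "v \<in> S" "z \<otimes> v \<in> Q t" by auto
      have d: "z \<in> carrier G" "v \<in> carrier G" using v xN sN Nc by auto
      have "z \<otimes> u = u \<otimes> z" using Ncomm[OF xN[OF v(1)] sN[OF u(2)]] .
      then have "z \<otimes> (u \<otimes> v) = u \<otimes> (z \<otimes> v)" using c d by (simp add: m_assoc[symmetric])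
      then have "(y \<otimes> z) \<otimes> (u \<otimes> v) = (y \<otimes> u) \<otimes> (z \<otimes> v)" using c d by (simp add: m_assoc)
      then have "(y \<otimes> z) \<otimes> (u \<otimes> v) \<in> Q t" using q(4)[OF u(3) v(3)] by simp
      then show "y \<otimes> z \<in> ?Y"
        using xn(4)[OF u(1) v(1)] s(4)[OF u(2) v(2)] by blast
    qed
    moreover have "x \<in> ?Y" using xX Qx[OF t] t by auto
    ultimately have "X \<subseteq> ?Y" unfolding X(4) by (intro generate_conj_class_subset) auto
    then show ?thesis using y by blast
  qed
  have uniq: "u = v" if "t \<in> S" "y \<in> X" "u \<in> S" "v \<in> S" "y \<otimes> u \<in> Q t" "y \<otimes> v \<in> Q t" for t y u v
  proof -
    note q = normalD[OF Qn[OF that(1)]]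
    have c: "y \<in> carrier G" "u \<in> carrier G" "v \<in> carrier G" using that xN sN Nc by auto
    have "inv v \<otimes> u = inv (y \<otimes> v) \<otimes> (y \<otimes> u)" using c by (simp add: inv_mult_group m_assoc)
    then have "inv v \<otimes> u \<in> Q t" using q(4)[OF q(5)[OF that(6)] that(5)] by simp
    moreover have "inv v \<otimes> u \<in> S" using that s(4,5) by simp
    ultimately have "inv v \<otimes> u = \<one>" using QS[OF that(1)] by blast
    then show ?thesis using eq_if_inv_mult_one c by blast
  qed
  define f where "f t = (\<lambda>y\<in>X. SOME u. u \<in> S \<and> y \<otimes> u \<in> Q t)" for t
  have f: "f t y \<in> S \<and> y \<otimes> f t y \<in> Q t" if t: "t \<in> S" and y: "y \<in> X" for t y
  proof -
    have "\<exists>u. u \<in> S \<and> y \<otimes> u \<in> Q t" using ex[OF t y] by blast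
    then have "(SOME u. u \<in> S \<and> y \<otimes> u \<in> Q t) \<in> S \<and> y \<otimes> (SOME u. u \<in> S \<and> y \<otimes> u \<in> Q t) \<in> Q t"
      by (rule someI_ex)
    then show ?thesis using y by (simp add: f_def)
  qed
  have "f t \<in> eqhom X S" if t: "t \<in> S" for t
  proof -
    note q = normalD[OF Qn[OF t]]
    have "f t (y \<otimes> z) = f t y \<otimes> f t z" if y: "y \<in> X" and z: "z \<in> X" for y z
    proof (rule uniq[OF t xn(4)[OF y z]])
      have d: "z \<in> carrier G" "f t z \<in> carrier G" "y \<in> carrier G" "f t y \<in> carrier G"
        using f[OF t] y z xN sN Nc by auto
      have "z \<otimes> f t y = f t y \<otimes> z" using Ncomm[OF xN[OF z] sN] f[OF t y] by blast
      then have "z \<otimes> (f t y \<otimes> f t z) = f t y \<otimes> (z \<otimes> f t z)" using d by (simp add: m_assoc[symmetric])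
      then have "(y \<otimes> z) \<otimes> (f t y \<otimes> f t z) = (y \<otimes> f t y) \<otimes> (z \<otimes> f t z)" using d by (simp add: m_assoc)
      then show "(y \<otimes> z) \<otimes> (f t y \<otimes> f t z) \<in> Q t" using q(4) f[OF t y] f[OF t z] by simp
    qed (use f[OF t] y z xn(4) s(4) in auto)
    moreover have "f t (cj g y) = cj g (f t y)" if g: "g \<in> carrier G" and y: "y \<in> X" for g y
    proof (rule uniq[OF t xn(6)[OF g y]])
      have d: "y \<in> carrier G" "f t y \<in> carrier G"
        using f[OF t] y xN sN Nc by auto
      show "cj g y \<otimes> cj g (f t y) \<in> Q t" unfolding cj_mult[OF g d, symmetric] using q(6)[OF g] f[OF t y] by blast
    qed (use f[OF t] y g xn(6) s(6) in auto)
    ultimately show ?thesis using f[OF t] by (auto simp: eqhom_def f_def)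
  qed
  moreover have "inj_on f S"
  proof (rule inj_onI)
    fix t u assume tu: "t \<in> S" "u \<in> S" "f t = f u"
    have "f v x = v" if v: "v \<in> S" for v
      by (rule uniq[OF v xX]) (use f[OF v xX] Qx[OF v] v in auto)
    then show "t = u" using tu by metis
  qed
  ultimately have "card S \<le> card (eqhom X S)"
    using eqhom_finite[OF X(1) S(2)] by (intro card_inj_on_le[of f]) auto
  then show False using less by simp
qed

text \<open>The comparison of homomorphism counts has to be carried along the induction: for the
  next foot it combines with \<open>card_eqhom_less\<close> into the strict inequality that
  \<open>generated_extend\<close> requires, and \<open>eqhom_prod_card\<close> propagates
  it.\<close>

lemma abelian_sum_generated:
  assumes N: "N = MA G" and A: "\<forall>i\<in>I. A i \<in> abelian_finite_feet G" and ds: "internal_direct_sum G I A (MA G)"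
    and E: "finite E" "E \<subseteq> I"
  shows "(\<exists>x\<in>carrier G. generate G (\<Union>i\<in>E. A i) = generate G (conj_class G x)) \<and>
    finite (generate G (\<Union>i\<in>E. A i)) \<and> generate G (\<Union>i\<in>E. A i) \<subseteq> N \<and>
    (\<forall>S. foot G S \<and> finite S \<longrightarrow>
      card (eqhom (generate G (\<Union>i\<in>E. A i)) S) \<le> card (eqhom S (generate G (\<Union>i\<in>E. A i))))"
  using E
proof (induction E rule: finite_induct)
  case empty
  have g0: "generate G {} = {\<one>}" using generate_empty by simp
  have "generate G (conj_class G \<one>) = {\<one>}" using generate_one by (auto simp: conj_class_def image_constant_conv)
  then have 1: "\<exists>x\<in>carrier G. {\<one>} = generate G (conj_class G x)" by (intro bexI[of _ \<one>]) auto
  have 2: "card (eqhom {\<one>} S) \<le> card (eqhom S {\<one>})" if S: "foot G S" "finite S" for S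
  proof -
    have Sn: "S \<lhd> G" using S(1) by (simp add: foot_def)
    have "eqhom {\<one>} S \<subseteq> {\<lambda>x\<in>{\<one>}. \<one>}"
    proof
      fix f assume f: "f \<in> eqhom {\<one>} S"
      have "f = (\<lambda>x\<in>{\<one>}. \<one>)"
        by (rule extensionalityI[of _ "{\<one>}"])
          (use eqhomD(4)[OF f] eqhom_one[OF normal_one Sn f] in auto)
      then show "f \<in> {\<lambda>x\<in>{\<one>}. \<one>}" by simp
    qed
    then have "card (eqhom {\<one>} S) \<le> 1" using card_mono[of "{\<lambda>x\<in>{\<one>}. \<one>}"] by simp
    moreover have "card (eqhom S {\<one>}) \<noteq> 0"
      using eqhom_trivial[OF Sn normal_one] eqhom_finite[OF S(2)] by auto
    ultimately show ?thesis by simp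
  qed
  show ?case using 1 2 Nd(3) by (simp add: g0)
next
  case (insert j E)
  define U where "U = (\<Union>i\<in>E. A i)"
  define X where "X = generate G U"
  have fj: "A j \<in> abelian_finite_feet G" using A insert by auto
  note Aj = abelian_finite_feetD[OF fj]
  have AjN: "A j \<subseteq> N" unfolding N MA_def using fj by (auto intro: generate.incl)
  have IH: "\<exists>x\<in>carrier G. X = generate G (conj_class G x)" "finite X" "X \<subseteq> N"
    "\<And>S. foot G S \<Longrightarrow> finite S \<Longrightarrow> card (eqhom X S) \<le> card (eqhom S X)"
    using insert.IH insert.prems unfolding X_def U_def by blast+
  obtain x where x: "x \<in> carrier G" "X = generate G (conj_class G x)" using IH(1) by blast
  have Xn: "X \<lhd> G" using normal_generate_conj_class x by simp
  have Uc: "U \<subseteq> carrier G"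
    unfolding U_def using A insert.prems abelian_finite_feetD(2) normalD(2) by blast
  have eq: "(\<Union>i\<in>insert j E. A i) = U \<union> A j" by (auto simp: U_def)
  have P: "generate G (\<Union>i\<in>insert j E. A i) = {y \<otimes> s |y s. y \<in> X \<and> s \<in> A j}"
    unfolding eq using generate_Un_normal[OF Uc _ Aj(2)] Xn by (simp add: X_def)
  have "X \<subseteq> generate G (\<Union>i\<in>I - {j}. A i)"
    unfolding X_def U_def using insert by (intro mono_generate) auto
  moreover have "\<forall>j\<in>I. A j \<inter> generate G (\<Union>i\<in>I - {j}. A i) = {\<one>}"
    using ds by (simp add: internal_direct_sum_def)
  then have "A j \<inter> generate G (\<Union>i\<in>I - {j}. A i) = {\<one>}" using insert.prems by simp
  ultimately have XS: "X \<inter> A j = {\<one>}" using normalD(3)[OF Xn] normalD(3)[OF Aj(2)] by blast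
  have "card (eqhom X (A j)) < card (A j)"
    using IH(4)[OF Aj(1,3)] card_eqhom_less[OF Aj(2,3) AjN Aj(4) Xn IH(2,3) XS] by simp
  then obtain s where s: "s \<in> A j" "generate G (conj_class G (x \<otimes> s)) = {y \<otimes> s |y s. y \<in> X \<and> s \<in> A j}"
    using generated_extend[OF IH(2,3) x Aj(1,3) AjN XS] by blast
  have "x \<otimes> s \<in> carrier G" using x s normalD(2)[OF Aj(2)] by auto
  moreover have "{y \<otimes> s |y s. y \<in> X \<and> s \<in> A j} \<subseteq> N" using IH(3) AjN Nd(4) by blast
  moreover have "finite {y \<otimes> s |y s. y \<in> X \<and> s \<in> A j}" by (rule finite_prod[OF IH(2) Aj(3)])
  moreover have "card (eqhom {y \<otimes> s |y s. y \<in> X \<and> s \<in> A j} S) \<le> card (eqhom S {y \<otimes> s |y s. y \<in> X \<and> s \<in> A j})"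
    if S: "foot G S" "finite S" for S
    by (rule eqhom_prod_card[OF Xn IH(2) Aj(2,3) _ S(2) XS IH(4)[OF S] eqhom_feet_card[OF Aj(1,3) S]])
      (use S in \<open>simp add: foot_def\<close>)
  ultimately show ?case unfolding P using s(2)[symmetric] by (intro conjI bexI[of _ "x \<otimes> s"]) simp_all
qed

end

context group
begin

lemma generated_by_conj_classI:
  "x \<in> carrier G \<Longrightarrow> P = generate G (conj_class G x) \<Longrightarrow> generated_by_conj_class G P"
  unfolding generated_by_conj_class_def using mem_generate_conj_class[of x] by blast

theorem abelian_sums_conj_generatedI:
  assumes A: "\<forall>i\<in>I. A i \<in> abelian_finite_feet G" and ds: "internal_direct_sum G I A (MA G)"
    and "MA_has_conj_faithful_character G"
  shows "abelian_sums_conj_generated G I A"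
proof -
  obtain \<theta> where \<theta>: "\<theta> \<in> hom (G\<lparr>carrier := MA G\<rparr>) circle_group" "conj_faithful G (MA G) circle_group \<theta>"
    using assms(3) unfolding MA_has_conj_faithful_character_def by blast
  interpret dual_normal G "MA G" \<theta>
    by (intro dual_normal.intro dual_normal_axioms.intro is_group MA_normal MA_commute[OF A ds] \<theta>)
  show ?thesis unfolding abelian_sums_conj_generated_def
  proof (intro allI impI)
    fix E assume E: "finite E \<and> E \<subseteq> I"
    obtain x where "x \<in> carrier G" "generate G (\<Union>i\<in>E. A i) = generate G (conj_class G x)"
      using abelian_sum_generated[OF refl A ds conjunct1[OF E] conjunct2[OF E], THEN conjunct1] by (rule bexE)
    then show "generated_by_conj_class G (generate G (\<Union>i\<in>E. A i))" by (rule generated_by_conj_classI)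
  qed
qed

theorem mixed_sums_conj_generatedI:
  assumes A: "\<forall>i\<in>I. A i \<in> abelian_finite_feet G"
    and ds: "internal_direct_sum G (I <+> nonabelian_finite_feet G) (case_sum A (\<lambda>H. H)) (MS G)"
    and gen: "abelian_sums_conj_generated G I A"
  shows "mixed_sums_conj_generated G I A"
  unfolding mixed_sums_conj_generated_def
proof clarify
  fix E F assume E: "finite E" "E \<subseteq> I" and F: "finite F" "F \<subseteq> nonabelian_finite_feet G"
  show "generated_by_conj_class G (generate G ((\<Union>i\<in>E. A i) \<union> \<Union>F))" using F
  proof (induction F rule: finite_induct)
    case empty
    then show ?case using gen E unfolding abelian_sums_conj_generated_def by simp
  next
    case (insert H F)
    define U where "U = (\<Union>i\<in>E. A i) \<union> \<Union>F"
    define X where "X = generate G U"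
    have "generated_by_conj_class G X" using insert unfolding X_def U_def by blast
    then obtain x where x: "x \<in> X" "X = generate G (conj_class G x)"
      unfolding generated_by_conj_class_def by blast
    have HF: "H \<in> nonabelian_finite_feet G" using insert by blast
    note h = nonabelian_finite_feetD[OF HF]
    note hn = normalD[OF h(2)]
    have Uc: "U \<subseteq> carrier G"
    proof -
      have "A i \<subseteq> carrier G" if "i \<in> E" for i using that E A abelian_finite_feetD(2) normalD(2) by blast
      moreover have "K \<subseteq> carrier G" if "K \<in> F" for K
        using that insert nonabelian_finite_feetD(2) normalD(2) by blast
      ultimately show ?thesis unfolding U_def by blast
    qed
    have xc: "x \<in> carrier G" using x(1) generate_in_carrier[OF Uc] by (simp add: X_def)
    have Xn: "X \<lhd> G" using normal_generate_conj_class xc x(2) by simp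
    have eq: "(\<Union>i\<in>E. A i) \<union> \<Union>(insert H F) = U \<union> H" by (auto simp: U_def)
    have P: "generate G ((\<Union>i\<in>E. A i) \<union> \<Union>(insert H F)) = {y \<otimes> s |y s. y \<in> X \<and> s \<in> H}"
      unfolding eq using generate_Un_normal[OF Uc _ h(2)] Xn by (simp add: X_def)
    let ?K = "case_sum A (\<lambda>H. H)" and ?J = "I <+> nonabelian_finite_feet G"
    have "U \<subseteq> (\<Union>j\<in>?J - {Inr H}. ?K j)"
    proof
      fix u assume "u \<in> U"
      then consider i where "i \<in> E" "u \<in> A i" | K where "K \<in> F" "u \<in> K" by (auto simp: U_def)
      then show "u \<in> (\<Union>j\<in>?J - {Inr H}. ?K j)"
      proof cases
        case 1
        then show ?thesis using E by (intro UN_I[of "Inl i"]) auto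
      next
        case 2
        then show ?thesis using insert by (intro UN_I[of "Inr K"]) auto
      qed
    qed
    then have "X \<subseteq> generate G (\<Union>j\<in>?J - {Inr H}. ?K j)" unfolding X_def by (rule mono_generate)
    moreover have "\<forall>j\<in>?J. ?K j \<inter> generate G (\<Union>i\<in>?J - {j}. ?K i) = {\<one>}"
      using ds by (simp add: internal_direct_sum_def)
    then have "?K (Inr H) \<inter> generate G (\<Union>j\<in>?J - {Inr H}. ?K j) = {\<one>}" using HF by blast
    ultimately have XH: "X \<inter> H = {\<one>}" using normalD(3)[OF Xn] hn(3) by auto
    obtain a b where ab: "a \<in> H" "b \<in> H" "a \<otimes> b \<noteq> b \<otimes> a" using h(4) by blast
    have c: "a \<in> carrier G" "b \<in> carrier G" using ab hn(2) by auto
    define Q where "Q = generate G (conj_class G (x \<otimes> a))"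
    have xac: "x \<otimes> a \<in> carrier G" using xc c by simp
    have Qn: "Q \<lhd> G" and Qx: "x \<otimes> a \<in> Q"
      unfolding Q_def using normal_generate_conj_class[OF xac] mem_generate_conj_class[OF xac] by auto
    note q = normalD[OF Qn]
    have xb: "x \<otimes> b = b \<otimes> x" using disjoint_normal_commute[OF Xn h(2) XH x(1) ab(2)] .
    \<comment> \<open>The commutator of \<open>x \<otimes> a\<close> and \<open>b\<close>. As
      \<open>x\<close> commutes with \<open>H\<close>, it equals the commutator of \<open>a\<close>
      and \<open>b\<close>, a nontrivial element of the foot \<open>H\<close>; so \<open>Q\<close>
      contains \<open>H\<close>.\<close>
    define k where "k = x \<otimes> a \<otimes> cj b (inv (x \<otimes> a))"
    have "inv x = inv (cj b x)" using xb commute_iff[OF c(2) xc] by simp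
    also have "\<dots> = cj b (inv x)" using c xc by (simp add: cj_inv)
    finally have xb': "cj b (inv x) = inv x" by simp
    have "k = x \<otimes> a \<otimes> (cj b (inv a) \<otimes> cj b (inv x))"
      unfolding k_def using c xc by (simp add: inv_mult_group cj_mult)
    also have "\<dots> = x \<otimes> (a \<otimes> cj b (inv a)) \<otimes> inv x" unfolding xb' using c xc by (simp add: m_assoc)
    also have "\<dots> = a \<otimes> cj b (inv a)"
    proof -
      have "a \<otimes> cj b (inv a) \<in> H" using ab hn(4,5,6)[of a] hn c by simp
      then have "x \<otimes> (a \<otimes> cj b (inv a)) = (a \<otimes> cj b (inv a)) \<otimes> x"
        by (rule disjoint_normal_commute[OF Xn h(2) XH x(1)])
      then show ?thesis using c xc by (simp add: m_assoc)
    qed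
    finally have k: "k = a \<otimes> cj b (inv a)" .
    have kH: "k \<in> H" unfolding k using ab hn c by simp
    have kQ: "k \<in> Q" unfolding k_def using Qx q(4,5,6) c(2) by blast
    have k1: "k \<noteq> \<one>"
    proof
      assume "k = \<one>"
      then have e: "a \<otimes> inv (cj b a) = \<one>" unfolding k using c by (simp add: cj_inv)
      have "a = cj b a" by (rule eq_if_mult_inv_one[OF _ _ e]) (use c in auto)
      then have "b \<otimes> a = a \<otimes> b" using commute_iff[OF c(2) c(1)] by simp
      then show False using ab(3) by simp
    qed
    have HQ: "H \<subseteq> Q" using footD[OF h(1) normal_Int[OF Qn h(2)]] kH kQ k1 by blast
    have "x = (x \<otimes> a) \<otimes> inv a" using c xc by (simp add: m_assoc)
    moreover have "x \<otimes> a \<otimes> inv a \<in> Q" using q(4)[OF Qx q(5)] HQ ab(1) by blast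
    ultimately have "x \<in> Q" by simp
    then have "X \<subseteq> Q" unfolding x(2) by (rule generate_conj_class_subset[OF Qn])
    then have "{y \<otimes> s |y s. y \<in> X \<and> s \<in> H} \<subseteq> Q" using HQ q(4) by blast
    moreover have "Q \<subseteq> {y \<otimes> s |y s. y \<in> X \<and> s \<in> H}"
      unfolding Q_def using x(1) ab(1)
      by (intro generate_conj_class_subset[OF normal_prod[OF Xn h(2)]]) blast
    ultimately have "{y \<otimes> s |y s. y \<in> X \<and> s \<in> H} = generate G (conj_class G (x \<otimes> a))"
      unfolding Q_def by blast
    then show ?case unfolding P by (rule generated_by_conj_classI[OF xac])
  qed
qed

end

text \<open>A function is coded by the rationals below its real and imaginary parts at the points of
  \<open>X\<close>, that is by a set of natural numbers; there are as many such sets as real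
  numbers.\<close>

lemma countable_support_functions_embed:
  assumes X: "countable X" and R: "(UNIV :: real set) \<lesssim> (UNIV :: 'h set)"
  shows "\<exists>J :: ('a \<Rightarrow> complex) \<Rightarrow> 'h. inj_on J {f. \<forall>x. x \<notin> X \<longrightarrow> f x = 0}"
proof -
  define part where "part b z = (if b then Re z else Im z)" for b z
  define code where "code f = {to_nat (to_nat_on X x, b, q) |x b q. x \<in> X \<and> of_rat q < part b (f x)}"
    for f :: "'a \<Rightarrow> complex"
  have mem: "to_nat (to_nat_on X x, b, q) \<in> code f \<longleftrightarrow> of_rat q < part b (f x)"
    if x: "x \<in> X" for x b q and f :: "'a \<Rightarrow> complex"
  proof
    assume "to_nat (to_nat_on X x, b, q) \<in> code f"
    then obtain x' b' q' where "to_nat (to_nat_on X x, b, q) = to_nat (to_nat_on X x', b', q')"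
      "x' \<in> X" "of_rat q' < part b' (f x')" unfolding code_def by blast
    then show "of_rat q < part b (f x)" using inj_onD[OF inj_on_to_nat_on[OF X] _ x, of x'] by simp
  qed (use x in \<open>auto simp: code_def\<close>)
  have inj: "inj_on code {f. \<forall>x. x \<notin> X \<longrightarrow> f x = 0}"
  proof (rule inj_onI, rule ext)
    fix f g :: "'a \<Rightarrow> complex" and x
    assume f: "f \<in> {f. \<forall>x. x \<notin> X \<longrightarrow> f x = 0}" "g \<in> {f. \<forall>x. x \<notin> X \<longrightarrow> f x = 0}" and eq: "code f = code g"
    show "f x = g x"
    proof (cases "x \<in> X")
      case True
      have le: "part b (f' x) \<le> part b (g' x)" if e: "code f' = code g'" for b and f' g' :: "'a \<Rightarrow> complex"
      proof (rule ccontr)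
        assume "\<not> ?thesis"
        then obtain q where "part b (g' x) < of_rat q" "of_rat q < part b (f' x)"
          using of_rat_dense by (metis not_le)
        then show False using mem[OF True, of b q f'] mem[OF True, of b q g'] e by simp
      qed
      have "part b (f x) = part b (g x)" for b
        by (rule antisym) (rule le[OF eq], rule le[OF eq[symmetric]])
      from this[of True] this[of False] show ?thesis by (simp add: part_def complex_eq_iff)
    qed (use f in simp)
  qed
  have "(UNIV :: nat set set) \<lesssim> (UNIV :: 'h set)"
    using eqpoll_imp_lepoll[OF nat_sets_eqpoll_reals] R by (rule lepoll_trans)
  then obtain k :: "nat set \<Rightarrow> 'h" where k: "inj k" by (auto simp: lepoll_def)
  have "inj_on (k \<circ> code) {f. \<forall>x. x \<notin> X \<longrightarrow> f x = 0}"
    by (rule comp_inj_on[OF inj inj_on_subset[OF k]]) simp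
  then show ?thesis by blast
qed

theorem extreme_state_representation:
  fixes G :: "('a, 'b) monoid_scheme"
  assumes G: "group G" "countable (carrier G)" and R: "(UNIV :: real set) \<lesssim> (UNIV :: 'h set)"
    and ex: "extreme_state G \<phi>"
  shows "\<exists>(H :: 'h inner_product_struct) \<sigma> \<xi>. irreducible_unitary_rep G H \<sigma> \<and> \<xi> \<in> carrier H \<and>
    (\<forall>g\<in>carrier G. ip H (\<sigma> g \<xi>) \<xi> = \<phi> g)"
proof -
  obtain J :: "('a \<Rightarrow> complex) \<Rightarrow> 'h" where J: "inj_on J {f. \<forall>x. x \<notin> carrier G \<longrightarrow> f x = 0}"
    using countable_support_functions_embed[OF G(2) R] by blast
  have st: "posdef G \<phi>" "\<phi> \<one>\<^bsub>G\<^esub> = 1" using ex by (auto simp: extreme_state_def state_def)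
  show ?thesis
    by (rule gns_irreducible[OF G(1) st J])
      (use extreme_state_summand[OF G(1) ex] in blast)+
qed

section \<open>Fixed vectors and combinations of orbits\<close>

context urep
begin

definition fixed :: "'a set \<Rightarrow> 'h set" where
  "fixed N = {v \<in> carrier H. \<forall>n\<in>N. \<rho> n v = v}"

lemma fixed_hsubspace: "N \<subseteq> carrier G \<Longrightarrow> subspace class_ring (fixed N) H"
  by (rule hsubspaceI) (auto simp: fixed_def act_zero act_add act_smult subset_iff)

lemma fixed_hclosed: "N \<subseteq> carrier G \<Longrightarrow> closedin mtopology (fixed N)"
  unfolding hclosed_iff
proof (intro conjI allI impI)
  fix s w assume N: "N \<subseteq> carrier G" and s: "(\<forall>n. s n \<in> fixed N) \<and> hconv s w"
  have "\<rho> n w = w" if "n \<in> N" for n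
  proof (rule hconv_unique[of s])
    have "\<rho> n (s k) = s k" for k using s that by (simp add: fixed_def)
    moreover have "hconv (\<lambda>k. \<rho> n (s k)) (\<rho> n w)" using act_hconv N s that by blast
    ultimately show "hconv s (\<rho> n w)" by simp
    show "hconv s w" using s by simp
  qed
  then show "w \<in> fixed N" using s hconv_closed(2) by (auto simp: fixed_def)
qed (auto simp: fixed_def)

lemma fixed_invariant:
  assumes N: "N \<lhd> G" and g: "g \<in> carrier G"
  shows "\<rho> g ` fixed N \<subseteq> fixed N"
proof -
  have "\<rho> n (\<rho> g v) = \<rho> g v" if v: "v \<in> fixed N" and n: "n \<in> N" for v n
  proof -
    have nc: "n \<in> carrier G" and vc: "v \<in> carrier H" using G.normalD(2)[OF N] n v by (auto simp: fixed_def)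
    have m: "ginv g \<cdot> n \<cdot> g \<in> N" using G.normalD(6)[OF N, of "ginv g" n] g n by simp
    have "n \<cdot> g = g \<cdot> (ginv g \<cdot> n \<cdot> g)" using g nc by (simp add: G.m_assoc)
    then have "\<rho> n (\<rho> g v) = \<rho> g (\<rho> (ginv g \<cdot> n \<cdot> g) v)"
      using g nc vc by (simp add: act_mult[symmetric])
    then show ?thesis using v m by (simp add: fixed_def)
  qed
  then show ?thesis using g by (auto simp: fixed_def)
qed

text \<open>Normality of \<open>N\<close> makes its fixed vectors a closed subspace invariant under
  all of \<open>G\<close>, and an element of \<open>N\<close> that moves a vector keeps this
  subspace from being everything.\<close>

lemma irreducible_fixed_trivial:
  assumes irr: "irreducible_unitary_rep G H \<rho>" and N: "N \<lhd> G"
    and n: "n \<in> N" "v \<in> carrier H" "\<rho> n v \<noteq> v"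
  shows "fixed N = {\<zero>}"
proof -
  note N' = G.normalD(2)[OF N]
  have "fixed N = {\<zero>} \<or> fixed N = carrier H"
    using irr fixed_hsubspace[OF N'] fixed_hclosed[OF N'] fixed_invariant[OF N]
    unfolding irreducible_unitary_rep_def by blast
  moreover have "v \<notin> fixed N" using n by (auto simp: fixed_def)
  ultimately show ?thesis using n(2) by blast
qed

lemma one_unitary_group: "\<one>\<^bsub>unitary_group H\<^esub> = (\<lambda>x\<in>carrier H. x)"
  by (simp add: unitary_group_def BijGroup_def)

lemma act_eq_one_iff:
  assumes "g \<in> carrier G"
  shows "\<rho> g = \<one>\<^bsub>unitary_group H\<^esub> \<longleftrightarrow> (\<forall>v\<in>carrier H. \<rho> g v = v)"
proof
  assume "\<forall>v\<in>carrier H. \<rho> g v = v"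
  then show "\<rho> g = \<one>\<^bsub>unitary_group H\<^esub>"
    unfolding one_unitary_group using act_Bij[OF assms]
    by (intro extensionalityI[of _ "carrier H"]) (auto simp: Bij_def)
qed (simp add: one_unitary_group)

lemma faithful_moves:
  assumes f: "faithful_irreducible_unitary_rep G H \<rho>" and g: "g \<in> carrier G" "g \<noteq> \<one>\<^bsub>G\<^esub>"
  shows "\<exists>v\<in>carrier H. \<rho> g v \<noteq> v"
proof (rule ccontr)
  assume "\<not> ?thesis"
  then have "\<rho> g = \<one>\<^bsub>unitary_group H\<^esub>" using act_eq_one_iff[OF g(1)] by blast
  moreover have "\<rho> \<one>\<^bsub>G\<^esub> = \<one>\<^bsub>unitary_group H\<^esub>" using act_eq_one_iff[of "\<one>\<^bsub>G\<^esub>"] act_one by simp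
  ultimately show False
    using f g inj_onD[of \<rho> "carrier G" g "\<one>\<^bsub>G\<^esub>"] by (simp add: faithful_irreducible_unitary_rep_def)
qed

lemma faithfulI:
  assumes irr: "irreducible_unitary_rep G H \<rho>"
    and m: "\<And>g. g \<in> carrier G \<Longrightarrow> g \<noteq> \<one>\<^bsub>G\<^esub> \<Longrightarrow> \<exists>v\<in>carrier H. \<rho> g v \<noteq> v"
  shows "faithful_irreducible_unitary_rep G H \<rho>"
  unfolding faithful_irreducible_unitary_rep_def
proof (intro conjI irr inj_onI)
  fix g h assume gh: "g \<in> carrier G" "h \<in> carrier G" "\<rho> g = \<rho> h"
  have "\<rho> (ginv h \<cdot> g) v = v" if "v \<in> carrier H" for v using gh that act_inv by (simp add: act_mult)
  then have "ginv h \<cdot> g = \<one>\<^bsub>G\<^esub>" using m[of "ginv h \<cdot> g"] gh by blast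
  then show "g = h" using G.eq_if_inv_mult_one gh by blast
qed

lemma faithful_fixed_trivial:
  assumes f: "faithful_irreducible_unitary_rep G H \<rho>" and N: "N \<lhd> G" "N \<noteq> {\<one>\<^bsub>G\<^esub>}"
  shows "fixed N = {\<zero>}"
proof -
  obtain n where n: "n \<in> N" "n \<noteq> \<one>\<^bsub>G\<^esub>" using N G.normalD(3)[OF N(1)] by blast
  then obtain v where "v \<in> carrier H" "\<rho> n v \<noteq> v"
    using faithful_moves[OF f] G.normalD(2)[OF N(1)] by blast
  then show ?thesis
    using irreducible_fixed_trivial[OF _ N(1) n(1)] f by (simp add: faithful_irreducible_unitary_rep_def)
qed

text \<open>The image of a formal combination of group elements in the orbit of \<open>v\<close>. It
  turns the form \<open>gform\<close> of the vector state of \<open>v\<close> into the inner product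
  of \<open>H\<close>.\<close>

definition orbit_vec :: "'h \<Rightarrow> (complex \<times> 'a) list \<Rightarrow> 'h" where
  "orbit_vec v l = lvec (map (\<lambda>(a, x). (a, \<rho> x v)) l)"

lemma orbit_supp: "v \<in> carrier H \<Longrightarrow> fsupp l \<subseteq> carrier G \<Longrightarrow> fsupp (map (\<lambda>(a, x). (a, \<rho> x v)) l) \<subseteq> carrier H"
  by (auto simp: fsupp_map)

lemma orbit_vec_closed: "v \<in> carrier H \<Longrightarrow> fsupp l \<subseteq> carrier G \<Longrightarrow> orbit_vec v l \<in> carrier H"
  unfolding orbit_vec_def by (intro lvec_closed orbit_supp)

lemma gform_orbit_vec:
  assumes v: "v \<in> carrier H" and l: "fsupp l \<subseteq> carrier G" "fsupp m \<subseteq> carrier G"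
  shows "gform G (\<lambda>g. ip H (\<rho> g v) v) l m = ip H (orbit_vec v l) (orbit_vec v m)"
proof -
  have "gform G (\<lambda>g. ip H (\<rho> g v) v) l m = fform (\<lambda>x y. ip H (\<rho> x v) (\<rho> y v)) l m"
    by (rule G.gform_coefficient[OF urep_axioms v l])
  also have "\<dots> = fform (ip H) (map (\<lambda>(a, x). (a, \<rho> x v)) l) (map (\<lambda>(a, x). (a, \<rho> x v)) m)"
    by (simp add: fform_map)
  also have "\<dots> = ip H (orbit_vec v l) (orbit_vec v m)"
    unfolding orbit_vec_def using orbit_supp v l by (intro ip_lvec[symmetric])
  finally show ?thesis .
qed

lemma ip_orbit_vec:
  assumes "v \<in> carrier H" "z \<in> carrier H" "fsupp l \<subseteq> carrier G"
  shows "ip H (orbit_vec v l) z = (\<Sum>(a, x)\<leftarrow>l. a * ip H (\<rho> x v) z)"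
  using assms(3)
proof (induction l)
  case (Cons p l)
  obtain a x where p: "p = (a, x)" by (cases p)
  then have c: "x \<in> carrier G" "orbit_vec v l \<in> carrier H" using Cons.prems orbit_vec_closed[OF assms(1)] by auto
  have "orbit_vec v (p # l) = a \<odot> \<rho> x v \<oplus> orbit_vec v l" by (simp add: p orbit_vec_def)
  then show ?case using Cons c assms p by (simp add: ip_simps)
qed (simp add: orbit_vec_def ip_simps assms)

lemma average_fixed:
  assumes M: "subgroup M G" and ms: "set ms = M" "distinct ms" and v: "v \<in> carrier H"
  shows "orbit_vec v (map (\<lambda>m. (1, m)) ms) \<in> fixed M" (is "?w \<in> _")
proof -
  have Mc: "m \<in> M \<Longrightarrow> m \<in> carrier G" for m using subgroup.subset[OF M] by blast
  have supp: "fsupp (map (\<lambda>m. (1, m)) ms) \<subseteq> carrier G" using Mc ms by (auto simp: fsupp_def)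
  have w: "?w \<in> carrier H" by (rule orbit_vec_closed[OF v supp])
  have ipw: "ip H ?w z = (\<Sum>m\<in>M. ip H (\<rho> m v) z)" if "z \<in> carrier H" for z
    using ip_orbit_vec[OF v that supp] ms by (simp add: o_def sum_list_distinct_conv_sum_set)
  have "\<rho> k ?w = ?w" if k: "k \<in> M" for k
  proof (rule ip_ext)
    show "\<rho> k ?w \<in> carrier H" "?w \<in> carrier H" using w k Mc by auto
    fix z assume z: "z \<in> carrier H"
    have ki: "ginv k \<in> M" by (rule subgroup.m_inv_closed[OF M k])
    have "ip H (\<rho> k ?w) z = (\<Sum>m\<in>M. ip H (\<rho> m v) (\<rho> (ginv k) z))"
      using w k z Mc[OF k] by (simp add: act_adjoint ipw)
    also have "\<dots> = (\<Sum>m\<in>M. ip H (\<rho> (k \<cdot> m) v) z)"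
      using k z v Mc by (intro sum.cong refl) (simp add: act_mult act_adjoint)
    also have "\<dots> = (\<Sum>m\<in>M. ip H (\<rho> m v) z)"
      by (rule sum.reindex_bij_witness[of _ "\<lambda>m. ginv k \<cdot> m" "\<lambda>m. k \<cdot> m"])
        (use k ki subgroup.m_closed[OF M] Mc in \<open>auto simp: G.m_assoc[symmetric]\<close>)
    finally show "ip H (\<rho> k ?w) z = ip H ?w z" using z by (simp add: ipw)
  qed
  then show ?thesis using w by (simp add: fixed_def)
qed

lemma unit_vector:
  assumes "carrier H \<noteq> {\<zero>}"
  shows "\<exists>v\<in>carrier H. nrm v = 1"
proof -
  have "\<zero> \<in> carrier H" by simp
  then obtain u where u: "u \<in> carrier H" "u \<noteq> \<zero>" using assms by blast
  have "nrm u \<noteq> 0" using ip_norm_eq_0 u by blast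
  then have "nrm (of_real (1 / nrm u) \<odot> u) = 1" using u nrm_nonneg[of u] by (simp add: nrm_smult norm_divide)
  moreover have "of_real (1 / nrm u) \<odot> u \<in> carrier H" using u by simp
  ultimately show ?thesis by blast
qed

lemma state_coefficient: "v \<in> carrier H \<Longrightarrow> nrm v = 1 \<Longrightarrow> state G (\<lambda>g. ip H (\<rho> g v) v)"
  unfolding state_def using G.posdef_coefficient[OF urep_axioms] by (simp add: act_one ip_self)

end

section \<open>From a faithful irreducible representation to (P2) and (P3)\<close>

lemma urep_restrict:
  assumes "urep G H \<rho>" "subgroup N G"
  shows "urep (G\<lparr>carrier := N\<rparr>) H \<rho>"
proof -
  interpret urep G H \<rho> by fact
  have "\<rho> \<in> hom (G\<lparr>carrier := N\<rparr>) (unitary_group H)"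
    using rep subgroup.subset[OF assms(2)] by (auto simp: unitary_rep_def hom_def)
  then show ?thesis
    using G.subgroup_imp_group[OF assms(2)] complex_hilbert_space_axioms
    by (intro urepI) (auto simp: unitary_rep_def)
qed

lemma (in group) restrict_inv [simp]:
  "N \<lhd> G \<Longrightarrow> x \<in> N \<Longrightarrow> inv\<^bsub>G\<lparr>carrier := N\<rparr>\<^esub> x = inv x"
  by (rule m_inv_consistent) (rule normalD(1))

text \<open>For a finite foot \<open>M\<close> the sum of the translates of \<open>\<xi>\<close>
  under \<open>M\<close> is fixed by \<open>M\<close>, hence 0, so the form of
  \<open>\<phi>0\<close> vanishes on the formal sum over \<open>M\<close>. A state equal to 1 on
  \<open>M\<close> gives this formal sum the square of \<open>card M\<close>, which is positive, and
  so is no convex summand of \<open>\<phi>0\<close>.\<close>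

theorem extreme_state_on_normal_subgroup:
  fixes G :: "('a, 'b) monoid_scheme" (structure) and H :: "('h, 'x) inner_product_struct_scheme"
  assumes G: "group G" "countable (carrier G)" and rep: "faithful_irreducible_unitary_rep G H \<rho>"
    and N: "N \<lhd> G"
  shows "\<exists>\<phi>. extreme_state (G\<lparr>carrier := N\<rparr>) \<phi> \<and> (\<forall>M\<in>finite_feet G. M \<subseteq> N \<longrightarrow> (\<exists>m\<in>M. \<phi> m \<noteq> 1))"
proof -
  interpret group G by (rule G)
  have irr: "irreducible_unitary_rep G H \<rho>" using rep by (simp add: faithful_irreducible_unitary_rep_def)
  interpret R: urep G H \<rho>
    by (rule urepI[OF G(1)]) (use irr in \<open>simp add: irreducible_unitary_rep_def\<close>)
  let ?S = "G\<lparr>carrier := N\<rparr>"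
  note n = normalD[OF N]
  have S: "group ?S" by (rule subgroup_imp_group[OF n(1)])
  interpret S: group ?S by (rule S)
  interpret RS: urep ?S H \<rho> by (rule urep_restrict[OF R.urep_axioms n(1)])
  have inv: "inv\<^bsub>?S\<^esub> x = inv x" if "x \<in> N" for x using N that by simp
  obtain \<xi> where \<xi>: "\<xi> \<in> carrier H" "ip_norm H \<xi> = 1"
    using R.unit_vector irr by (auto simp: irreducible_unitary_rep_def)
  define \<phi>0 where "\<phi>0 g = ip H (\<rho> g \<xi>) \<xi>" for g
  have st0: "state ?S \<phi>0" unfolding \<phi>0_def by (rule RS.state_coefficient[OF \<xi>])
  \<comment> \<open>The empty set is a dummy index that keeps the family nonempty when
    \<open>N\<close> contains no finite foot; no function satisfies \<open>B {}\<close>.\<close>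
  define I where "I = insert {} {M \<in> finite_feet G. M \<subseteq> N}"
  define B where "B M \<phi> \<longleftrightarrow> M \<noteq> {} \<and> (\<forall>m\<in>M. \<phi> m = 1)" for M :: "'a set" and \<phi> :: "'a \<Rightarrow> complex"
  have Ne: "M \<noteq> {}" if "M \<in> finite_feet G" for M using normalD(3) finite_feetD[OF that] by blast
  have "\<exists>\<phi>. extreme_state ?S \<phi> \<and> (\<forall>M\<in>I. \<not> B M \<phi>)"
  proof (rule extreme_state_avoiding[OF S _ _ _ st0])
    show "countable (carrier ?S)" using countable_subset[OF n(2) G(2)] by simp
    have "I \<subseteq> {M. finite M \<and> M \<subseteq> N}" using finite_feetD by (auto simp: I_def)
    then show "countable I"
      using countable_Collect_finite_subset[OF countable_subset[OF n(2) G(2)]] countable_subset by blast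
    show "I \<noteq> {}" by (simp add: I_def)
  next
    fix M \<phi> \<psi>
    assume M: "M \<in> I" and st: "\<And>i::nat. state ?S (\<phi> i) \<and> B M (\<phi> i)"
      and lim: "\<And>x. x \<in> carrier ?S \<Longrightarrow> (\<lambda>i. \<phi> i x) \<longlonglongrightarrow> \<psi> x"
    have "\<psi> m = 1" if m: "m \<in> M" for m
    proof -
      have "(\<lambda>i. \<phi> i m) \<longlonglongrightarrow> \<psi> m" using lim M m by (auto simp: I_def)
      moreover have "(\<lambda>i. \<phi> i m) = (\<lambda>i. 1)" using st m by (auto simp: B_def)
      ultimately show ?thesis using LIMSEQ_unique tendsto_const by metis
    qed
    then show "B M \<psi>" using st by (auto simp: B_def)
  next
    fix M \<phi> \<psi> and t :: real
    assume "B M \<phi>" "B M \<psi>"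
    then show "B M (\<lambda>x. of_real (1 - t) * \<phi> x + of_real t * \<psi> x)" by (simp add: B_def)
  next
    fix M \<phi> \<psi> and t :: real
    assume M: "M \<in> I" and t: "0 < t" "t \<le> 1" and st: "state ?S \<phi>" "state ?S \<psi>" and B: "B M \<psi>"
      and eq: "\<And>x. x \<in> carrier ?S \<Longrightarrow> \<phi>0 x = of_real (1 - t) * \<phi> x + of_real t * \<psi> x"
    have Mf: "M \<in> finite_feet G" "M \<subseteq> N" using M B by (auto simp: I_def B_def)
    then have Mn: "M \<lhd> G" "finite M" using finite_feetD by auto
    note m = normalD[OF Mn(1)]
    obtain ms where ms: "set ms = M" "distinct ms" using finite_distinct_list[OF Mn(2)] by blast
    define l where "l = map (\<lambda>m. (1 :: complex, m)) ms"
    have l: "fsupp l = M" using ms by (simp add: l_def fsupp_def image_image)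
    have ls: "fsupp l \<subseteq> carrier ?S" using l Mf by simp
    have sM: "subgroup M ?S" using m(3,4,5) Mf(2) inv by (intro S.subgroupI) auto
    have "R.fixed M = {\<zero>\<^bsub>H\<^esub>}"
      by (rule R.faithful_fixed_trivial[OF rep Mn(1)]) (use Mf(1) in \<open>simp add: finite_feet_def foot_def\<close>)
    moreover have "R.fixed = RS.fixed" by (simp add: R.fixed_def RS.fixed_def fun_eq_iff)
    ultimately have "RS.orbit_vec \<xi> l = \<zero>\<^bsub>H\<^esub>"
      using RS.average_fixed[OF sM ms \<xi>(1)] unfolding l_def by simp
    then have 0: "gform ?S \<phi>0 l l = 0"
      unfolding \<phi>0_def using RS.gform_orbit_vec[OF \<xi>(1) ls ls] by (simp add: R.ip_simps)
    have "gform ?S \<psi> l l = fform (\<lambda>x y. 1) l l"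
    proof (rule fform_cong)
      fix x y assume "x \<in> fsupp l" "y \<in> fsupp l"
      then have "x \<in> M" "y \<in> M" using l by auto
      then show "\<psi> (inv\<^bsub>?S\<^esub> y \<otimes>\<^bsub>?S\<^esub> x) = 1" using B m(4,5) Mf(2) inv by (auto simp: B_def)
    qed
    also have "\<dots> = of_nat (length ms) * of_nat (length ms)"
      unfolding fform_def l_def by (simp add: o_def sum_list_triv)
    finally have 1: "gform ?S \<psi> l l = of_nat (length ms) * of_nat (length ms)" .
    have "ms \<noteq> []" using ms(1) m(3) by auto
    then have pos: "0 < Re (gform ?S \<psi> l l)" unfolding 1 by simp
    have "gform ?S \<phi>0 l l = fform (\<lambda>x y. of_real (1 - t) * \<phi> (inv\<^bsub>?S\<^esub> y \<otimes>\<^bsub>?S\<^esub> x) + of_real t * \<psi> (inv\<^bsub>?S\<^esub> y \<otimes>\<^bsub>?S\<^esub> x)) l l"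
      by (rule fform_cong) (use ls eq in \<open>auto simp: subset_iff n(4,5) inv\<close>)
    also have "\<dots> = of_real (1 - t) * gform ?S \<phi> l l + of_real t * gform ?S \<psi> l l"
      by (simp only: fform_kernel_add fform_kernel_mult)
    finally have "0 = (1 - t) * Re (gform ?S \<phi> l l) + t * Re (gform ?S \<psi> l l)"
      unfolding 0 by (simp add: complex_eq_iff)
    moreover have "0 \<le> (1 - t) * Re (gform ?S \<phi> l l)"
      using posdef_gform(2)[OF _ ls] st(1) t by (simp add: state_def)
    moreover have "0 < t * Re (gform ?S \<psi> l l)" using t pos by simp
    ultimately show False by linarith
  qed
  then obtain \<phi> where \<phi>: "extreme_state ?S \<phi>" "\<And>M. M \<in> I \<Longrightarrow> \<not> B M \<phi>" by blast
  have "\<exists>m\<in>M. \<phi> m \<noteq> 1" if M: "M \<in> finite_feet G" "M \<subseteq> N" for M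
    using \<phi>(2)[of M] Ne[OF M(1)] M by (auto simp: I_def B_def)
  then show ?thesis using \<phi>(1) by blast
qed

text \<open>\<open>P\<close> stands for triviality of \<open>\<sigma>\<close> on an element, so that
  characters and unitary representations are treated alike. The intersection \<open>L\<close> of the
  conjugated kernels is normal in \<open>G\<close>; were it nontrivial, it would contain a finite
  foot, all of whose elements satisfy \<open>P\<close>.\<close>

lemma (in group) conj_faithfulI:
  assumes F: "\<And>M. M \<in> \<F> \<Longrightarrow> M \<lhd> G \<and> finite M" and N: "N = generate G (\<Union>\<F>)"
    and P: "\<And>x. x \<in> N \<Longrightarrow> \<sigma> x = \<one>\<^bsub>U\<^esub> \<longleftrightarrow> P x"
    and P1: "P \<one>" and Pm: "\<And>x y. x \<in> N \<Longrightarrow> y \<in> N \<Longrightarrow> P x \<Longrightarrow> P y \<Longrightarrow> P (x \<otimes> y)"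
    and Pi: "\<And>x. x \<in> N \<Longrightarrow> P x \<Longrightarrow> P (inv x)"
    and avoid: "\<And>M. M \<in> finite_feet G \<Longrightarrow> M \<subseteq> N \<Longrightarrow> \<exists>m\<in>M. \<not> P m"
  shows "conj_faithful G N U \<sigma>"
proof -
  have Nn: "N \<lhd> G" unfolding N using F by (intro normal_generate_Union) blast
  note n = normalD[OF Nn]
  define L where "L = {x \<in> N. \<forall>g\<in>carrier G. P (cj g x)}"
  have Ln: "L \<lhd> G"
  proof (rule normalI')
    show "L \<subseteq> carrier G" using n(2) by (auto simp: L_def)
    show "\<one> \<in> L" using n(3) P1 by (simp add: L_def)
    fix x assume x: "x \<in> L"
    then have xN: "x \<in> N" "x \<in> carrier G" using n(2) by (auto simp: L_def)
    show "inv x \<in> L" using x n(5,6) Pi xN by (auto simp: L_def cj_inv)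
    show "cj g x \<in> L" if g: "g \<in> carrier G" for g
      using x n(6) g xN by (auto simp: L_def cj_comp)
    fix y assume y: "y \<in> L"
    then have yN: "y \<in> N" "y \<in> carrier G" using n(2) by (auto simp: L_def)
    have "P (cj g (x \<otimes> y))" if g: "g \<in> carrier G" for g
      unfolding cj_mult[OF g xN(2) yN(2)] using x y g n(6)[OF g]
      by (intro Pm[of "cj g x" "cj g y"]) (auto simp: L_def)
    then show "x \<otimes> y \<in> L" using n(4) xN yN by (simp add: L_def)
  qed
  have L1: "L = {\<one>}"
  proof (rule ccontr)
    assume "L \<noteq> {\<one>}"
    moreover have "L \<subseteq> generate G (\<Union>\<F>)" using N by (auto simp: L_def)
    ultimately obtain M where M: "M \<in> finite_feet G" "M \<subseteq> L"
      using finite_foot_below[OF F Ln] by blast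
    moreover have "L \<subseteq> N" by (auto simp: L_def)
    ultimately obtain m where m: "m \<in> M" "\<not> P m" using avoid by blast
    then have "m \<in> L" using M by blast
    then have "\<forall>g\<in>carrier G. P (cj g m)" and mc: "m \<in> carrier G" using n(2) by (auto simp: L_def)
    then have "P (cj \<one> m)" using one_closed by blast
    moreover have "cj \<one> m = m" using mc by simp
    ultimately show False using m by simp
  qed
  have "(\<Inter>g\<in>carrier G. kernel (G\<lparr>carrier := N\<rparr>) U (\<lambda>n. \<sigma> (cj g n))) = L"
    using n(6) P one_closed by (auto simp: kernel_def L_def)
  then show ?thesis using L1 by (simp add: conj_faithful_def)
qed

theorem MS_has_conj_faithful_irrepI:
  fixes G :: "('a, 'b) monoid_scheme" (structure) and H :: "('k, 'x) inner_product_struct_scheme"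
  assumes G: "group G" "countable (carrier G)" and R: "(UNIV :: real set) \<lesssim> (UNIV :: 'h set)"
    and rep: "faithful_irreducible_unitary_rep G H \<rho>"
  shows "MS_has_conj_faithful_irrep TYPE('h) G"
proof -
  interpret group G by (rule G)
  let ?S = "G\<lparr>carrier := MS G\<rparr>"
  note n = normalD[OF MS_normal]
  have S: "group ?S" by (rule subgroup_imp_group[OF n(1)])
  have Sc: "countable (carrier ?S)" using countable_subset[OF n(2) G(2)] by simp
  obtain \<phi> where \<phi>: "extreme_state ?S \<phi>" "\<And>M. M \<in> finite_feet G \<Longrightarrow> M \<subseteq> MS G \<Longrightarrow> \<exists>m\<in>M. \<phi> m \<noteq> 1"
    using extreme_state_on_normal_subgroup[OF G rep MS_normal] by blast
  obtain K :: "'h inner_product_struct" and \<sigma> \<xi> where K: "irreducible_unitary_rep ?S K \<sigma>" "\<xi> \<in> carrier K"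
      "\<And>g. g \<in> carrier ?S \<Longrightarrow> ip K (\<sigma> g \<xi>) \<xi> = \<phi> g"
    using extreme_state_representation[OF S Sc R \<phi>(1)] by blast
  interpret K: urep ?S K \<sigma>
    by (rule urepI[OF S]) (use K(1) in \<open>simp add: irreducible_unitary_rep_def\<close>)
  have "conj_faithful G (MS G) (unitary_group K) \<sigma>"
  proof (rule conj_faithfulI[OF finite_feetD MS_def, where P = "\<lambda>x. \<forall>v\<in>carrier K. \<sigma> x v = v"])
    show "\<sigma> x = \<one>\<^bsub>unitary_group K\<^esub> \<longleftrightarrow> (\<forall>v\<in>carrier K. \<sigma> x v = v)" if "x \<in> MS G" for x
      using K.act_eq_one_iff that by simp
    show "\<forall>v\<in>carrier K. \<sigma> \<one> v = v" using K.act_one by simp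
    show "\<forall>v\<in>carrier K. \<sigma> (x \<otimes> y) v = v"
      if "x \<in> MS G" "y \<in> MS G" "\<forall>v\<in>carrier K. \<sigma> x v = v" "\<forall>v\<in>carrier K. \<sigma> y v = v" for x y
      using that K.act_mult[of x y] by simp
    show "\<forall>v\<in>carrier K. \<sigma> (inv x) v = v" if "x \<in> MS G" "\<forall>v\<in>carrier K. \<sigma> x v = v" for x
      using that K.act_inv(1)[of x] restrict_inv[OF MS_normal that(1)] by simp
    fix M assume M: "M \<in> finite_feet G" "M \<subseteq> MS G"
    then obtain m where m: "m \<in> M" "\<phi> m \<noteq> 1" using \<phi>(2) by blast
    have "ip K (\<sigma> \<one> \<xi>) \<xi> = 1" using K(3)[of \<one>] n(3) \<phi>(1) by (simp add: extreme_state_def state_def)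
    then have "ip K \<xi> \<xi> = 1" using K.act_one[OF K(2)] by simp
    moreover have "ip K (\<sigma> m \<xi>) \<xi> \<noteq> 1" using K(3)[of m] m M(2) by auto
    ultimately have "\<sigma> m \<xi> \<noteq> \<xi>" by auto
    then show "\<exists>m\<in>M. \<not> (\<forall>v\<in>carrier K. \<sigma> m v = v)" using m(1) K(2) by blast
  qed
  then show ?thesis using K(1) unfolding MS_has_conj_faithful_irrep_def by blast
qed

text \<open>In an abelian group, replacing each combination \<open>l\<close> by \<open>l\<close>
  plus \<open>c\<close> times its translate by \<open>x\<close> turns the form of
  \<open>\<phi>\<close> into that of another positive definite function \<open>\<psi> c\<close>. For
  \<open>c\<close> and \<open>- c\<close> these add up to a multiple of \<open>\<phi>\<close>, so by
  extremality each is a multiple of \<open>\<phi>\<close>. The choices \<open>1/2\<close> and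
  \<open>\<i>/2\<close> separate translation by \<open>x\<close> from translation by
  \<open>inv x\<close>.\<close>

lemma extreme_state_abelian:
  fixes G :: "('a, 'b) monoid_scheme" (structure)
  assumes G: "group G" and comm: "\<And>x y. x \<in> carrier G \<Longrightarrow> y \<in> carrier G \<Longrightarrow> x \<otimes>\<^bsub>G\<^esub> y = y \<otimes>\<^bsub>G\<^esub> x"
    and ex: "extreme_state G \<phi>" and x: "x \<in> carrier G" and g: "g \<in> carrier G"
  shows "\<phi> (x \<otimes>\<^bsub>G\<^esub> g) = \<phi> x * \<phi> g"
proof -
  interpret group G by (rule G)
  have st: "state G \<phi>" using ex by (simp add: extreme_state_def)
  then have pd: "posdef G \<phi>" and \<phi>1: "\<phi> \<one> = 1" by (auto simp: state_def)
  interpret P: pd_kernel "carrier G" "\<lambda>x y. \<phi> (inv y \<otimes> x)" using pd by (simp add: posdef_def)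
  have xi: "\<phi> (inv x) = cnj (\<phi> x)" using P.kernel_cnj[OF x one_closed] x by simp
  \<comment> \<open>The factor 5/4 is 1 plus the squared modulus of \<open>c\<close>. Modulus 1/2
    instead of 1 keeps the value at the identity strictly positive.\<close>
  define \<psi> where "\<psi> c g = 5/4 * \<phi> g + (c * \<phi> (x \<otimes> g) + cnj c * \<phi> (inv x \<otimes> g))" for c g
  have gf: "gform G (\<psi> c) l l = gform G \<phi> (l @ fscale c (ltrans G x l)) (l @ fscale c (ltrans G x l))"
    if l: "fsupp l \<subseteq> carrier G" and c: "cmod c = 1/2" for c l
  proof -
    have 1: "gform G \<phi> (ltrans G x l) l = fform (\<lambda>z y. \<phi> (x \<otimes> (inv y \<otimes> z))) l l"
    proof -
      have "gform G \<phi> (ltrans G x l) l = fform (\<lambda>z y. \<phi> (inv y \<otimes> (x \<otimes> z))) l l"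
        by (simp add: fform_def ltrans_def o_def case_prod_unfold)
      also have "\<dots> = fform (\<lambda>z y. \<phi> (x \<otimes> (inv y \<otimes> z))) l l"
      proof (rule fform_cong)
        fix z y assume "z \<in> fsupp l" "y \<in> fsupp l"
        then have c: "z \<in> carrier G" "y \<in> carrier G" using l by auto
        have "inv y \<otimes> x = x \<otimes> inv y" using comm x c by simp
        then have "inv y \<otimes> (x \<otimes> z) = x \<otimes> (inv y \<otimes> z)" using x c by (simp add: m_assoc[symmetric])
        then show "\<phi> (inv y \<otimes> (x \<otimes> z)) = \<phi> (x \<otimes> (inv y \<otimes> z))" by simp
      qed
      finally show ?thesis .
    qed
    have 2: "gform G \<phi> l (ltrans G x l) = fform (\<lambda>z y. \<phi> (inv x \<otimes> (inv y \<otimes> z))) l l"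
    proof -
      have "gform G \<phi> l (ltrans G x l) = fform (\<lambda>z y. \<phi> (inv (x \<otimes> y) \<otimes> z)) l l"
        by (simp add: fform_def ltrans_def o_def case_prod_unfold)
      also have "\<dots> = fform (\<lambda>z y. \<phi> (inv x \<otimes> (inv y \<otimes> z))) l l"
      proof (rule fform_cong)
        fix z y assume "z \<in> fsupp l" "y \<in> fsupp l"
        then have c: "z \<in> carrier G" "y \<in> carrier G" using l by auto
        have "inv (x \<otimes> y) = inv x \<otimes> inv y" using comm[OF x c(2)] x c by (simp add: inv_mult_group)
        then show "\<phi> (inv (x \<otimes> y) \<otimes> z) = \<phi> (inv x \<otimes> (inv y \<otimes> z))" using x c by (simp add: m_assoc)
      qed
      finally show ?thesis .
    qed
    have "c * cnj c = of_real ((1/2)\<^sup>2)" unfolding c[symmetric] by (rule complex_norm_square[symmetric])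
    then have cc: "c * cnj c = 1/4" by (simp add: power2_eq_square)
    have "gform G \<phi> (l @ fscale c (ltrans G x l)) (l @ fscale c (ltrans G x l))
        = gform G \<phi> l l + c * cnj c * gform G \<phi> l l + c * gform G \<phi> (ltrans G x l) l + cnj c * gform G \<phi> l (ltrans G x l)"
      using gform_ltrans[OF x l l] by (simp add: algebra_simps)
    also have "\<dots> = gform G (\<psi> c) l l"
      unfolding 1 2 cc \<psi>_def by (simp only: fform_kernel_add fform_kernel_mult) simp
    finally show ?thesis by simp
  qed
  have pd\<psi>: "posdef G (\<psi> c)" if c: "cmod c = 1/2" for c
    unfolding posdef_def
  proof
    fix l assume l: "fsupp l \<subseteq> carrier G"
    have s: "fsupp (l @ fscale c (ltrans G x l)) \<subseteq> carrier G" using l fsupp_ltrans_closed[OF x l] by simp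
    show "Im (gform G (\<psi> c) l l) = 0" "0 \<le> Re (gform G (\<psi> c) l l)"
      unfolding gf[OF l c] by (rule P.fform_Im[OF s], rule P.fform_nonneg[OF s])
  qed
  have \<psi>1: "0 < Re (\<psi> c \<one>)" if c: "cmod c = 1/2" for c
  proof -
    have "\<psi> c \<one> = 5/4 + (c * \<phi> x + cnj (c * \<phi> x))" using x by (simp add: \<psi>_def \<phi>1 xi)
    then have "Re (\<psi> c \<one>) = 5/4 + 2 * Re (c * \<phi> x)" by simp
    moreover have "\<bar>Re (c * \<phi> x)\<bar> \<le> 1/2"
      using abs_Re_le_cmod[of "c * \<phi> x"] state_bound[OF st x] c by (simp add: norm_mult)
    ultimately show ?thesis by linarith
  qed
  have key: "\<exists>s. \<forall>g\<in>carrier G. c * \<phi> (x \<otimes> g) + cnj c * \<phi> (inv x \<otimes> g) = s * \<phi> g" if c: "cmod c = 1/2" for c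
  proof -
    have c': "cmod (- c) = 1/2" using c by simp
    \<comment> \<open>\<open>\<psi> c\<close> and \<open>\<psi> (- c)\<close> add up to 5/2 times
      \<open>\<phi>\<close>, hence the factor 2/5.\<close>
    have "\<exists>t. \<forall>g\<in>carrier G. of_real (2/5) * \<psi> c g = t * \<phi> g"
    proof (rule extreme_state_summand[OF G ex])
      show "posdef G (\<lambda>g. of_real (2/5) * \<psi> c g)" "posdef G (\<lambda>g. of_real (2/5) * \<psi> (- c) g)"
        by (intro posdef_scale pd\<psi> c c'; simp)+
      show "0 < Re (of_real (2/5) * \<psi> c \<one>)" "0 < Re (of_real (2/5) * \<psi> (- c) \<one>)"
        using \<psi>1[OF c] \<psi>1[OF c'] by simp_all
      show "\<phi> g = of_real (2/5) * \<psi> c g + of_real (2/5) * \<psi> (- c) g" for g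
        by (simp add: \<psi>_def algebra_simps)
    qed
    then obtain t where t: "\<And>g. g \<in> carrier G \<Longrightarrow> of_real (2/5) * \<psi> c g = t * \<phi> g" by blast
    have "c * \<phi> (x \<otimes> g) + cnj c * \<phi> (inv x \<otimes> g) = (5/2 * t - 5/4) * \<phi> g" if "g \<in> carrier G" for g
    proof -
      have "5/2 * (of_real (2/5) * z) = z" for z :: complex by simp
      then have "c * \<phi> (x \<otimes> g) + cnj c * \<phi> (inv x \<otimes> g) = 5/2 * (of_real (2/5) * \<psi> c g) - 5/4 * \<phi> g"
        by (simp only: \<psi>_def) simp
      also have "\<dots> = (5/2 * t - 5/4) * \<phi> g" unfolding t[OF that] by (simp add: algebra_simps)
      finally show ?thesis .
    qed
    then show ?thesis by blast
  qed
  have "cmod (1/2) = 1/2" "cmod (\<i>/2) = 1/2" by (simp_all add: norm_divide)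
  then obtain s u where
    s: "\<And>g. g \<in> carrier G \<Longrightarrow> 1/2 * \<phi> (x \<otimes> g) + cnj (1/2) * \<phi> (inv x \<otimes> g) = s * \<phi> g" and
    u: "\<And>g. g \<in> carrier G \<Longrightarrow> \<i>/2 * \<phi> (x \<otimes> g) + cnj (\<i>/2) * \<phi> (inv x \<otimes> g) = u * \<phi> g"
    using key[of "1/2"] key[of "\<i>/2"] by blast
  have all: "\<phi> (x \<otimes> g) = (s - \<i> * u) * \<phi> g" if "g \<in> carrier G" for g
  proof -
    have "(s - \<i> * u) * \<phi> g = s * \<phi> g - \<i> * (u * \<phi> g)" by (simp add: algebra_simps)
    also have "\<dots> = \<phi> (x \<otimes> g)"
      unfolding s[OF that, symmetric] u[OF that, symmetric] by (simp add: algebra_simps)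
    finally show ?thesis by simp
  qed
  have "s - \<i> * u = \<phi> x" using all[OF one_closed] x \<phi>1 by simp
  then show ?thesis using all[OF g] by simp
qed

theorem MA_has_conj_faithful_characterI:
  fixes G :: "('a, 'b) monoid_scheme" (structure) and H :: "('k, 'x) inner_product_struct_scheme"
  assumes G: "group G" "countable (carrier G)"
    and A: "\<forall>i\<in>I. A i \<in> abelian_finite_feet G" and ds: "internal_direct_sum G I A (MA G)"
    and rep: "faithful_irreducible_unitary_rep G H \<rho>"
  shows "MA_has_conj_faithful_character G"
proof -
  interpret group G by (rule G)
  let ?S = "G\<lparr>carrier := MA G\<rparr>"
  note n = normalD[OF MA_normal]
  have S: "group ?S" by (rule subgroup_imp_group[OF n(1)])
  interpret S: group ?S by (rule S)
  obtain \<phi> where \<phi>: "extreme_state ?S \<phi>" "\<And>M. M \<in> finite_feet G \<Longrightarrow> M \<subseteq> MA G \<Longrightarrow> \<exists>m\<in>M. \<phi> m \<noteq> 1"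
    using extreme_state_on_normal_subgroup[OF G rep MA_normal] by blast
  have st: "state ?S \<phi>" using \<phi>(1) by (simp add: extreme_state_def)
  then have \<phi>1: "\<phi> \<one> = 1" by (simp add: state_def)
  have mult: "\<phi> (x \<otimes> y) = \<phi> x * \<phi> y" if "x \<in> MA G" "y \<in> MA G" for x y
    using extreme_state_abelian[OF S _ \<phi>(1), of x y] MA_commute[OF A ds] that by simp
  have inv: "\<phi> (inv x) = inverse (\<phi> x)" if "x \<in> MA G" for x
    using mult[of x "inv x"] that n(2,5) \<phi>1 inverse_unique[of "\<phi> x" "\<phi> (inv x)"] by auto
  have "cmod (\<phi> x) = 1" if x: "x \<in> MA G" for x
  proof -
    have "\<phi> x * \<phi> (inv x) = 1" using mult[of x "inv x"] x n(2,5) \<phi>1 by auto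
    then have p: "cmod (\<phi> x) * cmod (\<phi> (inv x)) = 1" by (metis norm_mult norm_one)
    have le: "cmod (\<phi> x) \<le> 1" "cmod (\<phi> (inv x)) \<le> 1" using S.state_bound[OF st] x n(5) by auto
    have "1 \<le> cmod (\<phi> x)" using mult_left_mono[OF le(2), of "cmod (\<phi> x)"] p by simp
    then show ?thesis using le by simp
  qed
  then have "\<phi> \<in> hom ?S circle_group" using mult by (auto simp: hom_def circle_group_def)
  moreover have "conj_faithful G (MA G) circle_group \<phi>"
  proof (rule conj_faithfulI[OF _ MA_def, where P = "\<lambda>x. \<phi> x = 1"])
    show "M \<lhd> G \<and> finite M" if "M \<in> abelian_finite_feet G" for M using abelian_finite_feetD that by blast
  qed (use \<phi>1 mult inv \<phi>(2) in \<open>auto simp: circle_group_def\<close>)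
  ultimately show ?thesis unfolding MA_has_conj_faithful_character_def by blast
qed

subsection \<open>Schur's lemma\<close>

text \<open>The coefficients of the binomial series of \<open>sqrt (1 - x)\<close>, which converges absolutely on the
  closed unit disc.\<close>

definition sqrt_coeff :: "nat \<Rightarrow> real" where
  "sqrt_coeff k = (1/2 gchoose k) * (- 1) ^ k"

lemma sqrt_coeff_0: "sqrt_coeff 0 = 1"
  by (simp add: sqrt_coeff_def)

lemma signed_gbinomial_Suc:
  fixes a :: real
  shows "(a gchoose Suc k) * (- 1) ^ Suc k = (a gchoose k) * (- 1) ^ k * ((k - a) / (k + 1))"
proof -
  have "(a gchoose Suc k) * (k + 1) = (a gchoose k) * (a - k)"
    using gbinomial_mult_1[of a k] by (simp add: algebra_simps)
  then have e: "a gchoose Suc k = (a gchoose k) * (a - k) / (k + 1)" by (simp add: eq_divide_eq)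
  show ?thesis unfolding e by (simp add: divide_simps algebra_simps)
qed

lemma sqrt_coeff_nonpos: "sqrt_coeff (Suc k) \<le> 0"
proof (induction k)
  case 0
  then show ?case by (simp add: sqrt_coeff_def)
next
  case (Suc k)
  have "sqrt_coeff (Suc (Suc k)) = sqrt_coeff (Suc k) * ((real (Suc k) - 1/2) / (real (Suc k) + 1))"
    unfolding sqrt_coeff_def by (rule signed_gbinomial_Suc)
  moreover have "0 \<le> (real (Suc k) - 1/2) / (real (Suc k) + 1)" by simp
  ultimately show ?case using Suc mult_nonpos_nonneg by metis
qed

text \<open>Summing the coefficients amounts to dividing the series by \<open>1 - x\<close>, so the
  nonempty partial sums are the coefficients of \<open>1 / sqrt (1 - x)\<close>, and these are
  nonnegative.\<close>

lemma sqrt_coeff_partial_sum: "0 \<le> (\<Sum>k<n. sqrt_coeff k)"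
proof (cases n)
  case (Suc m)
  have "0 \<le> (- (1/2) gchoose k) * (- 1 :: real) ^ k" for k
  proof (induction k)
    case (Suc k)
    moreover have "0 \<le> (real k - (- (1/2))) / (real k + 1)" by simp
    ultimately show ?case unfolding signed_gbinomial_Suc by (rule mult_nonneg_nonneg)
  qed simp
  from this[of m] show ?thesis
    using gbinomial_sum_lower_neg[of "1/2 :: real" m] unfolding Suc lessThan_Suc_atMost sqrt_coeff_def
    by (simp add: mult.commute)
qed simp

text \<open>Only the coefficient of index 0 is positive, so the absolute sum is at most 2 minus the
  plain partial sum, which is nonnegative.\<close>

lemma sqrt_coeff_abs_partial_sum: "(\<Sum>k<n. \<bar>sqrt_coeff k\<bar>) \<le> 2"
proof -
  have "\<bar>sqrt_coeff k\<bar> = (if k = 0 then 2 else 0) - sqrt_coeff k" for k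
    using sqrt_coeff_nonpos[of "k - 1"] by (cases k) (auto simp: sqrt_coeff_0)
  then have "(\<Sum>k<n. \<bar>sqrt_coeff k\<bar>) = (\<Sum>k<n. if k = 0 then 2 else 0) - (\<Sum>k<n. sqrt_coeff k)"
    by (simp add: sum_subtractf)
  moreover have "(\<Sum>k<n. if k = 0 then 2 else 0 :: real) \<le> 2" by (cases n) auto
  ultimately show ?thesis using sqrt_coeff_partial_sum[of n] by linarith
qed

lemma sqrt_coeff_summable: "summable (\<lambda>k. \<bar>sqrt_coeff k\<bar>)"
  by (rule summableI_nonneg_bounded[of _ 2]) (use sqrt_coeff_abs_partial_sum in auto)

text \<open>Vandermonde's identity for \<open>1/2 + 1/2 = 1\<close>: the square of the series is
  \<open>1 - x\<close>.\<close>

lemma sqrt_coeff_convolution: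
  "(\<Sum>i\<le>k. sqrt_coeff i * sqrt_coeff (k - i)) = (if k = 0 then 1 else if k = 1 then - 1 else 0)"
proof -
  have "(\<Sum>i\<le>k. sqrt_coeff i * sqrt_coeff (k - i))
      = (\<Sum>i\<le>k. (1/2 gchoose i) * (1/2 gchoose (k - i)) * (- 1) ^ k)"
    unfolding sqrt_coeff_def by (intro sum.cong refl) (simp add: power_add[symmetric] mult.assoc mult.left_commute)
  also have "\<dots> = (1/2 + 1/2 gchoose k) * (- 1) ^ k"
    unfolding gbinomial_Vandermonde[symmetric] by (simp add: sum_distrib_right atLeast0AtMost)
  also have "\<dots> = of_nat (1 choose k) * (- 1) ^ k" by (simp add: binomial_gbinomial)
  also have "\<dots> = (if k = 0 then 1 else if k = 1 then - 1 else 0)"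
    by (cases "k \<le> 1") (auto simp: le_Suc_eq)
  finally show ?thesis .
qed

text \<open>With \<open>a k\<close> in the place of the power \<open>x ^ k\<close>, again the
  statement that the square of the series is \<open>1 - x\<close>. Over the triangle
  \<open>i + j < n\<close> the sum equals the limit exactly once \<open>n \<ge> 2\<close>. The rest
  of the square is dominated by the same rest for the absolute series, whose sums over squares and
  over triangles have a common limit.\<close>

lemma sqrt_coeff_double_sum:
  fixes a :: "nat \<Rightarrow> complex"
  assumes a: "\<And>k. cmod (a k) \<le> C"
  shows "(\<lambda>n. \<Sum>i<n. \<Sum>j<n. of_real (sqrt_coeff i * sqrt_coeff j) * a (i + j)) \<longlonglongrightarrow> a 0 - a 1"
proof -
  let ?d = sqrt_coeff
  let ?Q = "\<lambda>n::nat. {..<n} \<times> {..<n}" and ?T = "\<lambda>n::nat. {(i, j). i + j < n}"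
  have T: "?T n \<subseteq> ?Q n" "finite (?Q n)" for n by auto
  define f where "f = (\<lambda>(i, j). of_real (?d i * ?d j) * a (i + j))"
  define g where "g = (\<lambda>(i, j). \<bar>?d i\<bar> * \<bar>?d j\<bar>)"
  have tri: "sum f (?T n) = a 0 - a 1" if n: "n \<ge> 2" for n
  proof -
    have "sum f (?T n) = (\<Sum>k<n. \<Sum>i\<le>k. of_real (?d i * ?d (k - i)) * a (i + (k - i)))"
      unfolding f_def by (rule sum.triangle_reindex)
    also have "\<dots> = (\<Sum>k<n. of_real (\<Sum>i\<le>k. ?d i * ?d (k - i)) * a k)"
      unfolding of_real_sum sum_distrib_right by (intro sum.cong refl) auto
    also have "\<dots> = (\<Sum>k<n. (if k = 0 then a 0 else 0) + (if k = 1 then - a 1 else 0))"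
      unfolding sqrt_coeff_convolution by (intro sum.cong refl) auto
    also have "\<dots> = a 0 - a 1" using n by (simp add: sum.distrib)
    finally show ?thesis .
  qed
  define S where "S = (\<Sum>k. \<bar>?d k\<bar>)"
  have s: "(\<lambda>n. \<Sum>k<n. \<bar>?d k\<bar>) \<longlonglongrightarrow> S"
    unfolding S_def by (rule summable_LIMSEQ[OF sqrt_coeff_summable])
  have "(\<lambda>n. sum g (?Q n)) \<longlonglongrightarrow> S * S"
    using tendsto_mult[OF s s] by (simp add: g_def sum.cartesian_product[symmetric] sum_product)
  moreover have "(\<lambda>n. sum g (?T n)) \<longlonglongrightarrow> S * S"
    using Cauchy_product_sums[of "\<lambda>k. \<bar>?d k\<bar>" "\<lambda>k. \<bar>?d k\<bar>"] sqrt_coeff_summable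
    unfolding sums_def S_def g_def sum.triangle_reindex by simp
  ultimately have lim0: "(\<lambda>n. C * (sum g (?Q n) - sum g (?T n))) \<longlonglongrightarrow> 0"
    using tendsto_mult_right_zero[of "\<lambda>n. sum g (?Q n) - sum g (?T n)" sequentially C] tendsto_diff by fastforce
  have C: "0 \<le> C" using a[of 0] norm_ge_zero order_trans by blast
  have bound: "cmod (sum f (?Q n) - (a 0 - a 1)) \<le> C * (sum g (?Q n) - sum g (?T n))" if n: "n \<ge> 2" for n
  proof -
    have "cmod (sum f (?Q n) - (a 0 - a 1)) = cmod (sum f (?Q n - ?T n))"
      unfolding tri[OF n, symmetric] using T by (subst sum_diff) auto
    also have "\<dots> \<le> (\<Sum>p\<in>?Q n - ?T n. g p * C)"
      by (rule sum_norm_le) (auto simp: f_def g_def norm_mult abs_mult intro!: mult_left_mono a)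
    also have "\<dots> = C * (sum g (?Q n) - sum g (?T n))"
      using T by (simp add: sum_diff sum_distrib_right[symmetric])
    finally show ?thesis .
  qed
  have "(\<lambda>n. sum f (?Q n) - (a 0 - a 1)) \<longlonglongrightarrow> 0"
    by (rule Lim_null_comparison[OF _ lim0]) (use bound in \<open>auto simp: eventually_sequentially\<close>)
  then have "(\<lambda>n. sum f (?Q n)) \<longlonglongrightarrow> a 0 - a 1" by (simp add: LIM_zero_iff)
  then show ?thesis by (simp add: f_def sum.cartesian_product)
qed

section \<open>Bounded self-adjoint operators and their absolute values\<close>

context complex_inner_product_space
begin

lemma ip_lvec_map:
  assumes "\<And>k. k \<in> set ks \<Longrightarrow> f k \<in> carrier H" "z \<in> carrier H"
  shows "ip H (lvec (map (\<lambda>k. (c k, f k)) ks)) z = (\<Sum>k\<leftarrow>ks. c k * ip H (f k) z)"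
    "lvec (map (\<lambda>k. (c k, f k)) ks) \<in> carrier H"
proof -
  have "ip H (lvec (map (\<lambda>k. (c k, f k)) ks)) z = (\<Sum>k\<leftarrow>ks. c k * ip H (f k) z) \<and>
      lvec (map (\<lambda>k. (c k, f k)) ks) \<in> carrier H"
    using assms(1) by (induction ks) (auto simp: ip_simps assms(2))
  then show "ip H (lvec (map (\<lambda>k. (c k, f k)) ks)) z = (\<Sum>k\<leftarrow>ks. c k * ip H (f k) z)"
    "lvec (map (\<lambda>k. (c k, f k)) ks) \<in> carrier H" by blast+
qed

lemma nrm_lvec_map:
  assumes "\<And>k. k \<in> set ks \<Longrightarrow> f k \<in> carrier H" "\<And>k. k \<in> set ks \<Longrightarrow> nrm (f k) \<le> B"
  shows "nrm (lvec (map (\<lambda>k. (c k, f k)) ks)) \<le> (\<Sum>k\<leftarrow>ks. cmod (c k)) * B"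
  using assms
proof (induction ks)
  case (Cons k ks)
  let ?l = "lvec (map (\<lambda>k. (c k, f k)) ks)"
  have f: "f k \<in> carrier H" and l: "?l \<in> carrier H" using Cons.prems(1) by (auto intro!: ip_lvec_map(2)[of _ _ \<zero>])
  have "nrm (c k \<odot> f k \<oplus> ?l) \<le> cmod (c k) * nrm (f k) + nrm ?l"
    using ip_norm_triangle[of "c k \<odot> f k" ?l] f l by (simp add: nrm_smult)
  also have "\<dots> \<le> cmod (c k) * B + (\<Sum>k\<leftarrow>ks. cmod (c k)) * B"
    using Cons by (intro add_mono mult_left_mono) auto
  finally show ?case by (simp add: distrib_right)
qed (simp add: nrm_zero)

text \<open>Symmetry entails linearity.\<close>

definition sa_op :: "('h \<Rightarrow> 'h) \<Rightarrow> real \<Rightarrow> bool" where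
  "sa_op T C \<longleftrightarrow> (\<forall>v\<in>carrier H. T v \<in> carrier H \<and> nrm (T v) \<le> C * nrm v) \<and>
     (\<forall>u\<in>carrier H. \<forall>v\<in>carrier H. ip H (T u) v = ip H u (T v))"

lemma sa_opD:
  assumes "sa_op T C"
  shows "v \<in> carrier H \<Longrightarrow> T v \<in> carrier H" "v \<in> carrier H \<Longrightarrow> nrm (T v) \<le> C * nrm v"
    "u \<in> carrier H \<Longrightarrow> v \<in> carrier H \<Longrightarrow> ip H (T u) v = ip H u (T v)"
    "u \<in> carrier H \<Longrightarrow> v \<in> carrier H \<Longrightarrow> T (u \<oplus> v) = T u \<oplus> T v"
    "u \<in> carrier H \<Longrightarrow> v \<in> carrier H \<Longrightarrow> T (u \<ominus> v) = T u \<ominus> T v"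
    "v \<in> carrier H \<Longrightarrow> T (c \<odot> v) = c \<odot> T v"
    "T \<zero> = \<zero>"
proof -
  show c: "v \<in> carrier H \<Longrightarrow> T v \<in> carrier H" and "v \<in> carrier H \<Longrightarrow> nrm (T v) \<le> C * nrm v" for v
    using assms by (auto simp: sa_op_def)
  show s: "u \<in> carrier H \<Longrightarrow> v \<in> carrier H \<Longrightarrow> ip H (T u) v = ip H u (T v)" for u v
    using assms by (auto simp: sa_op_def)
  show "u \<in> carrier H \<Longrightarrow> v \<in> carrier H \<Longrightarrow> T (u \<oplus> v) = T u \<oplus> T v"
    "u \<in> carrier H \<Longrightarrow> v \<in> carrier H \<Longrightarrow> T (u \<ominus> v) = T u \<ominus> T v"
    "v \<in> carrier H \<Longrightarrow> T (c \<odot> v) = c \<odot> T v" "T \<zero> = \<zero>"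
    by (rule ip_ext; simp add: c s ip_simps)+
qed

lemma sa_op_hconv:
  assumes T: "sa_op T C" and s: "hconv s w"
  shows "hconv (\<lambda>n. T (s n)) (T w)"
proof (rule hconvI)
  note t = sa_opD[OF T] and sc = hconv_closed[OF s]
  show "T (s n) \<in> carrier H" "T w \<in> carrier H" for n using t sc by auto
  show "nrm (T (s n) \<ominus> T w) \<le> C * nrm (s n \<ominus> w)" for n
    using t(2)[of "s n \<ominus> w"] t(5) sc by simp
  show "(\<lambda>n. C * nrm (s n \<ominus> w)) \<longlonglongrightarrow> 0"
    by (rule tendsto_mult_right_zero) (use s in \<open>simp add: hconv_def\<close>)
qed

end

context complex_hilbert_space
begin

text \<open>The operator \<open>R\<close> is the absolute value of \<open>T\<close>, obtained as \<open>sqrt (1 - A)\<close> for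
  \<open>A = 1 - T\<^sup>2\<close>.\<close>

lemma absolute_value:
  assumes T: "sa_op T 1"
  obtains R where "\<And>u. u \<in> carrier H \<Longrightarrow> R u \<in> carrier H"
    "\<And>u v. u \<in> carrier H \<Longrightarrow> v \<in> carrier H \<Longrightarrow> ip H (R u) v = ip H u (R v)"
    "\<And>u v. u \<in> carrier H \<Longrightarrow> v \<in> carrier H \<Longrightarrow> ip H (R u) (R v) = ip H (T u) (T v)"
    "\<And>v. v \<in> carrier H \<Longrightarrow> 0 \<le> Re (ip H (R v) v)"
    "\<And>S S' u. (\<And>u. u \<in> carrier H \<Longrightarrow> S u \<in> carrier H \<and> S' u \<in> carrier H \<and> T (S u) = S (T u)) \<Longrightarrow>
        (\<And>u v. u \<in> carrier H \<Longrightarrow> v \<in> carrier H \<Longrightarrow> ip H (S u) v = ip H u (S' v)) \<Longrightarrow>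
        (\<And>u v. u \<in> carrier H \<Longrightarrow> v \<in> carrier H \<Longrightarrow> S (u \<ominus> v) = S u \<ominus> S v) \<Longrightarrow>
        u \<in> carrier H \<Longrightarrow> R (S u) = S (R u)"
    "\<And>E. subspace class_ring E H \<Longrightarrow> closedin mtopology E \<Longrightarrow> T ` E \<subseteq> E \<Longrightarrow> R ` E \<subseteq> E"
proof -
  note t = sa_opD[OF T]
  define A where "A v = v \<ominus> T (T v)" for v
  have Ac: "v \<in> carrier H \<Longrightarrow> A v \<in> carrier H" for v using t(1) by (simp add: A_def)
  have As: "ip H (A u) v = ip H u (A v)" if "u \<in> carrier H" "v \<in> carrier H" for u v
    using that t(1,3) by (simp add: A_def ip_simps)
  \<comment> \<open>The squared norm of \<open>A v\<close> is that of \<open>v\<close>, minus twice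
    that of \<open>T v\<close>, plus that of \<open>T (T v)\<close>; the last is at most that of
    \<open>T v\<close>.\<close>
  have Ab: "nrm (A v) \<le> nrm v" if v: "v \<in> carrier H" for v
  proof (rule power2_le_imp_le)
    have "ip H (T (T v)) v = ip H (T v) (T v)" "ip H v (T (T v)) = ip H (T v) (T v)"
      using t(1,3) v by simp_all
    then have "ip H (A v) (A v) = ip H v v - 2 * ip H (T v) (T v) + ip H (T (T v)) (T (T v))"
      using v t(1) by (simp add: A_def ip_simps)
    then have "(nrm (A v))\<^sup>2 = (nrm v)\<^sup>2 - 2 * (nrm (T v))\<^sup>2 + (nrm (T (T v)))\<^sup>2"
      using v t(1) Ac by (simp add: nrm_sq)
    moreover have "(nrm (T (T v)))\<^sup>2 \<le> (nrm (T v))\<^sup>2"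
      using t(2)[of "T v"] t(1) v nrm_nonneg by (intro power_mono) auto
    moreover have "0 \<le> (nrm (T v))\<^sup>2" by simp
    ultimately show "(nrm (A v))\<^sup>2 \<le> (nrm v)\<^sup>2" by linarith
  qed (rule nrm_nonneg[OF v])
  define P where "P k = A ^^ k" for k
  have P0: "P 0 v = v" and PS: "P (Suc k) v = A (P k v)" for k v by (simp_all add: P_def)
  have Pc: "v \<in> carrier H \<Longrightarrow> P k v \<in> carrier H" for k v by (induction k) (auto simp: P0 PS Ac)
  have PSr: "P (Suc k) v = P k (A v)" for k v by (simp add: P_def funpow_swap1)
  have Ps: "u \<in> carrier H \<Longrightarrow> v \<in> carrier H \<Longrightarrow> ip H (P k u) v = ip H u (P k v)" for k u v
  proof (induction k arbitrary: v)
    case (Suc k)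
    have "ip H (P (Suc k) u) v = ip H (P k u) (A v)" unfolding PS using As Pc Suc.prems by simp
    then show ?case unfolding PSr[of k v] using Suc Ac by simp
  qed (simp add: P0)
  have Pb: "v \<in> carrier H \<Longrightarrow> nrm (P k v) \<le> nrm v" for k v
    by (induction k) (auto simp: P0 PS intro: order_trans[OF Ab[OF Pc]])
  have Padd: "P (i + j) v = P i (P j v)" for i j v by (simp add: P_def funpow_add)
  let ?d = "\<lambda>k. of_real (sqrt_coeff k) :: complex"
  define s where "s v n = lvec (map (\<lambda>k. (?d k, P k v)) [0..<n])" for v n
  have sc: "v \<in> carrier H \<Longrightarrow> s v n \<in> carrier H" for v n
    unfolding s_def by (rule ip_lvec_map(2)[of _ _ \<zero>]) (simp_all add: Pc)
  have ips: "ip H (s v n) u = (\<Sum>k<n. ?d k * ip H (P k v) u)" if "v \<in> carrier H" "u \<in> carrier H" for v u n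
    unfolding s_def using ip_lvec_map(1)[of "[0..<n]" "\<lambda>k. P k v" u ?d] that Pc
    by (simp add: sum_list_distinct_conv_sum_set atLeast0LessThan)
  have ips': "ip H u (s v n) = (\<Sum>k<n. ?d k * ip H u (P k v))" if "v \<in> carrier H" "u \<in> carrier H" for v u n
  proof -
    have "ip H u (s v n) = cnj (ip H (s v n) u)" using that sc ip_cnj by blast
    also have "\<dots> = (\<Sum>k<n. ?d k * cnj (ip H (P k v) u))" unfolding ips[OF that] by simp
    also have "\<dots> = (\<Sum>k<n. ?d k * ip H u (P k v))"
      using that Pc by (intro sum.cong refl) (metis ip_cnj)
    finally show ?thesis .
  qed
  define a where "a v u k = ip H (P k v) u" for v u k
  have ab: "cmod (a v u k) \<le> nrm v * nrm u" if "v \<in> carrier H" "u \<in> carrier H" for v u k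
    unfolding a_def using ip_Cauchy_Schwarz[OF Pc[OF that(1)] that(2), of k] Pb[OF that(1), of k] nrm_nonneg[OF that(2)]
    by (meson mult_right_mono order_trans)
  have "\<exists>w. hconv (s v) w" if v: "v \<in> carrier H" for v
  proof (rule hcomplete)
    show "s v n \<in> carrier H" for n by (rule sc[OF v])
    fix e :: real assume e: "e > 0"
    have diff: "nrm (s v m \<ominus> s v n) \<le> (\<Sum>k=n..<m. \<bar>sqrt_coeff k\<bar>) * nrm v" if nm: "n \<le> m" for m n
    proof -
      let ?t = "lvec (map (\<lambda>k. (?d k, P k v)) [n..<m])"
      have tc: "?t \<in> carrier H" by (rule ip_lvec_map(2)[of _ _ \<zero>]) (simp_all add: Pc v)
      have "s v m \<ominus> s v n = ?t"
      proof (rule ip_ext)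
        fix z assume z: "z \<in> carrier H"
        have "ip H ?t z = (\<Sum>k=n..<m. ?d k * ip H (P k v) z)"
          using ip_lvec_map(1)[of "[n..<m]" "\<lambda>k. P k v" z ?d] z v Pc by (simp add: sum_list_distinct_conv_sum_set)
        moreover have "(\<Sum>k<m. ?d k * ip H (P k v) z) = (\<Sum>k<n. ?d k * ip H (P k v) z) + (\<Sum>k=n..<m. ?d k * ip H (P k v) z)"
          using nm sum.atLeastLessThan_concat[of 0 n m "\<lambda>k. ?d k * ip H (P k v) z"] by (simp add: atLeast0LessThan)
        ultimately show "ip H (s v m \<ominus> s v n) z = ip H ?t z"
          using z v sc by (simp add: ip_simps ips)
      qed (use sc v tc in auto)
      moreover have "nrm ?t \<le> (\<Sum>k\<leftarrow>[n..<m]. cmod (?d k)) * nrm v"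
        by (rule nrm_lvec_map) (simp_all add: Pc Pb v)
      ultimately show ?thesis by (simp add: sum_list_distinct_conv_sum_set)
    qed
    obtain N where N: "\<And>m n. n \<ge> N \<Longrightarrow> \<bar>\<Sum>k=n..<m. \<bar>sqrt_coeff k\<bar>\<bar> < e / (nrm v + 1)"
    proof -
      have "0 < e / (nrm v + 1)" using e nrm_nonneg[OF v] by simp
      then have "\<exists>N. \<forall>n\<ge>N. \<forall>m. norm (\<Sum>k=n..<m. \<bar>sqrt_coeff k\<bar>) < e / (nrm v + 1)"
        using sqrt_coeff_summable unfolding summable_Cauchy by blast
      then show ?thesis using that unfolding real_norm_def by blast
    qed
    have main: "nrm (s v m \<ominus> s v n) < e" if nm: "N \<le> n" "n \<le> m" for m n
    proof -
      have "(\<Sum>k=n..<m. \<bar>sqrt_coeff k\<bar>) * nrm v \<le> e / (nrm v + 1) * nrm v"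
        using N[OF nm(1), of m] nrm_nonneg[OF v] by (intro mult_right_mono) auto
      also have "\<dots> < e" using e nrm_nonneg[OF v] by (simp add: divide_simps)
      finally show ?thesis using diff[OF nm(2)] by simp
    qed
    show "\<exists>N. \<forall>m\<ge>N. \<forall>n\<ge>N. nrm (s v m \<ominus> s v n) < e"
    proof (intro exI allI impI)
      fix m n assume "N \<le> m" "N \<le> n"
      then show "nrm (s v m \<ominus> s v n) < e"
        using main[of n m] main[of m n] nrm_diff_commute[OF sc[OF v] sc[OF v], of m n] by (cases "n \<le> m") auto
    qed
  qed
  then have "\<exists>R. \<forall>v\<in>carrier H. hconv (s v) (R v)" by (intro bchoice) blast
  then obtain R where R: "\<And>v. v \<in> carrier H \<Longrightarrow> hconv (s v) (R v)" by blast
  have Rc: "v \<in> carrier H \<Longrightarrow> R v \<in> carrier H" for v using hconv_closed(2)[OF R] .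
  have ipR: "(\<lambda>n. \<Sum>k<n. ?d k * a v u k) \<longlonglongrightarrow> ip H (R v) u" if "v \<in> carrier H" "u \<in> carrier H" for v u
    using hconv_ip[OF R[OF that(1)] hconv_const[OF that(2)]] unfolding ips[OF that] a_def .
  have 1: "ip H (R u) v = ip H u (R v)" if uv: "u \<in> carrier H" "v \<in> carrier H" for u v
  proof (rule LIMSEQ_unique[OF ipR[OF uv]])
    have "(\<lambda>n. \<Sum>k<n. ?d k * ip H u (P k v)) \<longlonglongrightarrow> ip H u (R v)"
      using hconv_ip[OF hconv_const[OF uv(1)] R[OF uv(2)]] unfolding ips'[OF uv(2,1)] .
    then show "(\<lambda>n. \<Sum>k<n. ?d k * a u v k) \<longlonglongrightarrow> ip H u (R v)" unfolding a_def Ps[OF uv] .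
  qed
  have 2: "ip H (R u) (R v) = ip H (T u) (T v)" if uv: "u \<in> carrier H" "v \<in> carrier H" for u v
  proof (rule LIMSEQ_unique)
    show "(\<lambda>n. ip H (s u n) (s v n)) \<longlonglongrightarrow> ip H (R u) (R v)" by (rule hconv_ip[OF R[OF uv(1)] R[OF uv(2)]])
    have "ip H (s u n) (s v n) = (\<Sum>i<n. \<Sum>j<n. of_real (sqrt_coeff i * sqrt_coeff j) * a u v (j + i))" for n
    proof -
      have e: "ip H (P i u) (P j v) = a u v (j + i)" for i j
        unfolding a_def Padd using Ps[OF Pc[OF uv(1)] uv(2)] by simp
      show ?thesis
        using ips[OF uv(1) sc[OF uv(2)], of n] ips'[OF uv(2) Pc[OF uv(1)], of _ n]
        by (simp add: e sum_distrib_left mult.assoc)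
    qed
    moreover have "a u v 0 - a u v 1 = ip H (T u) (T v)"
      using uv t(1,3) by (simp add: a_def P0 PS A_def ip_simps)
    ultimately show "(\<lambda>n. ip H (s u n) (s v n)) \<longlonglongrightarrow> ip H (T u) (T v)"
      using sqrt_coeff_double_sum[of "a u v", OF ab[OF uv]] by (simp add: add.commute)
  qed
  \<comment> \<open>All coefficients after the first are nonpositive and \<open>Re (a v v k)\<close>
    is largest at \<open>k = 0\<close>. So the sum is at least the squared norm of \<open>v\<close>
    times a partial sum of the coefficients, which is nonnegative.\<close>
  have 3: "0 \<le> Re (ip H (R v) v)" if v: "v \<in> carrier H" for v
  proof (rule LIMSEQ_le_const[OF tendsto_Re[OF ipR[OF v v]]], intro exI allI impI)
    fix n :: nat
    have "Re (a v v 0) = (nrm v)\<^sup>2" using v by (simp add: a_def P0 nrm_sq)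
    moreover have "Re (a v v k) \<le> (nrm v)\<^sup>2" for k
      using ab[OF v v, of k] complex_Re_le_cmod[of "a v v k"] by (simp add: power2_eq_square)
    ultimately have "sqrt_coeff k * (nrm v)\<^sup>2 \<le> sqrt_coeff k * Re (a v v k)" for k
      by (cases k) (auto intro!: mult_left_mono_neg sqrt_coeff_nonpos)
    then have "(\<Sum>k<n. sqrt_coeff k * (nrm v)\<^sup>2) \<le> (\<Sum>k<n. sqrt_coeff k * Re (a v v k))"
      by (intro sum_mono)
    moreover have "0 \<le> (\<Sum>k<n. sqrt_coeff k) * (nrm v)\<^sup>2" using sqrt_coeff_partial_sum by simp
    ultimately show "0 \<le> Re (\<Sum>k<n. ?d k * a v v k)" by (simp add: sum_distrib_right)
  qed
  \<comment> \<open>The adjoint \<open>S'\<close> carries \<open>S\<close> to the other side of the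
    inner product, so the series is interchanged with \<open>S\<close> through convergence of inner
    products alone.\<close>
  have 4: "R (S u) = S (R u)"
    if S: "\<And>u. u \<in> carrier H \<Longrightarrow> S u \<in> carrier H \<and> S' u \<in> carrier H \<and> T (S u) = S (T u)"
      and adj: "\<And>u v. u \<in> carrier H \<Longrightarrow> v \<in> carrier H \<Longrightarrow> ip H (S u) v = ip H u (S' v)"
      and dif: "\<And>u v. u \<in> carrier H \<Longrightarrow> v \<in> carrier H \<Longrightarrow> S (u \<ominus> v) = S u \<ominus> S v"
      and u: "u \<in> carrier H" for S S' u
  proof (rule ip_ext)
    show "R (S u) \<in> carrier H" "S (R u) \<in> carrier H" using S Rc u by auto
    have PScomm: "P k (S v) = S (P k v)" if v: "v \<in> carrier H" for k v
    proof (induction k)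
      case (Suc k)
      have "A (S w) = S (A w)" if "w \<in> carrier H" for w using that S t(1) dif by (simp add: A_def)
      then show ?case using Suc Pc[OF v] by (simp add: PS)
    qed (simp add: P0)
    fix z assume z: "z \<in> carrier H"
    have Sz: "S' z \<in> carrier H" "S u \<in> carrier H" using S z u by auto
    have "a u (S' z) = a (S u) z" unfolding a_def PScomm[OF u] using adj Pc[OF u] z by simp
    then show "ip H (R (S u)) z = ip H (S (R u)) z"
      using LIMSEQ_unique[OF ipR[OF Sz(2) z]] ipR[OF u Sz(1)] adj[OF Rc[OF u] z] by simp
  qed
  have 5: "R ` E \<subseteq> E" if E: "subspace class_ring E H" "closedin mtopology E" "T ` E \<subseteq> E" for E
  proof
    fix w assume "w \<in> R ` E"
    then obtain v where v: "v \<in> E" "w = R v" by blast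
    have vc: "v \<in> carrier H" using v hsubspaceD(1)[OF E(1)] by blast
    have "P k v \<in> E" for k
    proof (induction k)
      case (Suc k)
      have "T (T (P k v)) \<in> E" using E(3) Suc by blast
      then show ?case using hsubspace_diff[OF E(1) Suc] by (simp add: PS A_def)
    qed (simp add: P0 v)
    then have "s v n \<in> E" for n
      unfolding s_def by (intro lvec_in_subspace[OF E(1)]) (auto simp: fsupp_def)
    then show "w \<in> E" using E(2) R[OF vc] v(2) unfolding hclosed_iff by blast
  qed
  show ?thesis by (rule that[OF Rc 1 2 3 4 5])
qed

end

context urep
begin

text \<open>Let \<open>R\<close> be the absolute value of the rescaled \<open>T\<close>. The part of
  \<open>E\<close> on which \<open>R\<close> and \<open>T1\<close> agree is closed and invariant,
  hence 0 or \<open>E\<close>. It contains \<open>R v + T1 v\<close> for each \<open>v\<close> in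
  \<open>E\<close>, because \<open>R\<close> and \<open>T1\<close> commute and have the same square;
  so if it is 0 then \<open>T1 = - R\<close> on \<open>E\<close>.\<close>

lemma schur_sign:
  assumes T: "sa_op T C" and C: "C > 0" and S: "S \<subseteq> carrier G"
    and comm: "\<And>g v. g \<in> S \<Longrightarrow> v \<in> carrier H \<Longrightarrow> T (\<rho> g v) = \<rho> g (T v)"
    and E: "subspace class_ring E H" "closedin mtopology E" "T ` E \<subseteq> E"
    and SE: "\<And>g. g \<in> S \<Longrightarrow> \<rho> g ` E \<subseteq> E"
    and irr: "\<And>W. subspace class_ring W H \<Longrightarrow> closedin mtopology W \<Longrightarrow> W \<subseteq> E \<Longrightarrow>
        (\<And>g. g \<in> S \<Longrightarrow> \<rho> g ` W \<subseteq> W) \<Longrightarrow> W = {\<zero>} \<or> W = E"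
  shows "(\<forall>v\<in>E. 0 \<le> Re (ip H (T v) v)) \<or> (\<forall>v\<in>E. Re (ip H (T v) v) \<le> 0)"
proof -
  note t = sa_opD[OF T] and e = hsubspaceD[OF E(1)]
  have ec: "v \<in> E \<Longrightarrow> v \<in> carrier H" for v using e(1) by blast
  \<comment> \<open>Rescaled to norm at most 1, the domain of the series behind
    \<open>absolute_value\<close>.\<close>
  define T1 where "T1 v = of_real (1 / C) \<odot> T v" for v
  have ip1: "ip H (T1 v) u = of_real (1 / C) * ip H (T v) u" "ip H u (T1 v) = of_real (1 / C) * ip H u (T v)"
    if "v \<in> carrier H" "u \<in> carrier H" for u v using that t(1) by (simp_all add: T1_def ip_simps)
  have T1: "sa_op T1 1"
    unfolding sa_op_def
  proof (intro conjI ballI)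
    fix v assume v: "v \<in> carrier H"
    show "T1 v \<in> carrier H" using v t(1) by (simp add: T1_def)
    show "nrm (T1 v) \<le> 1 * nrm v"
      using v t(1) t(2)[OF v] C by (simp add: T1_def nrm_smult norm_divide field_simps)
    show "ip H (T1 u) v = ip H u (T1 v)" if "u \<in> carrier H" for u
      using v that t(3) by (simp add: ip1)
  qed
  note t1 = sa_opD[OF T1]
  have T1E: "T1 ` E \<subseteq> E" using E(3) e(4) by (auto simp: T1_def)
  have T1g: "T1 (\<rho> g v) = \<rho> g (T1 v)" if "g \<in> S" "v \<in> carrier H" for g v
    using that S comm t(1) act_smult[of g "T v"] by (auto simp: T1_def)
  obtain R where Rc: "\<And>u. u \<in> carrier H \<Longrightarrow> R u \<in> carrier H"
    and Rs: "\<And>u v. u \<in> carrier H \<Longrightarrow> v \<in> carrier H \<Longrightarrow> ip H (R u) v = ip H u (R v)"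
    and RT: "\<And>u v. u \<in> carrier H \<Longrightarrow> v \<in> carrier H \<Longrightarrow> ip H (R u) (R v) = ip H (T1 u) (T1 v)"
    and Rpos: "\<And>v. v \<in> carrier H \<Longrightarrow> 0 \<le> Re (ip H (R v) v)"
    and Rcomm: "\<And>S S' u. (\<And>u. u \<in> carrier H \<Longrightarrow> S u \<in> carrier H \<and> S' u \<in> carrier H \<and> T1 (S u) = S (T1 u)) \<Longrightarrow>
        (\<And>u v. u \<in> carrier H \<Longrightarrow> v \<in> carrier H \<Longrightarrow> ip H (S u) v = ip H u (S' v)) \<Longrightarrow>
        (\<And>u v. u \<in> carrier H \<Longrightarrow> v \<in> carrier H \<Longrightarrow> S (u \<ominus> v) = S u \<ominus> S v) \<Longrightarrow>
        u \<in> carrier H \<Longrightarrow> R (S u) = S (R u)"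
    and RE: "\<And>E. subspace class_ring E H \<Longrightarrow> closedin mtopology E \<Longrightarrow> T1 ` E \<subseteq> E \<Longrightarrow> R ` E \<subseteq> E"
  proof (rule absolute_value[OF T1], goal_cases)
    case (1 R)
    show ?case by (rule that[of R]) (fact 1)+
  qed
  note RE = RE[OF E(1,2) T1E]
  have R: "sa_op R 1"
    unfolding sa_op_def
  proof (intro conjI ballI)
    fix v assume v: "v \<in> carrier H"
    show "R v \<in> carrier H" by (rule Rc[OF v])
    have "nrm (R v) = nrm (T1 v)" using RT[OF v v] by (simp add: ip_norm_def)
    then show "nrm (R v) \<le> 1 * nrm v" using t1(2)[OF v] by simp
    show "ip H (R u) v = ip H u (R v)" if "u \<in> carrier H" for u using Rs that v .
  qed
  note r = sa_opD[OF R]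
  have R1: "R (T1 u) = T1 (R u)" if "u \<in> carrier H" for u
    by (rule Rcomm[of T1 T1]) (use t1 that in auto)
  have Rg: "R (\<rho> g u) = \<rho> g (R u)" if "g \<in> S" "u \<in> carrier H" for g u
    by (rule Rcomm[of "\<rho> g" "\<rho> (ginv g)"])
      (use S that T1g act_adjoint act_diff in \<open>auto simp: subset_iff\<close>)
  have R2: "R (R u) = T1 (T1 u)" if u: "u \<in> carrier H" for u
    by (rule ip_ext) (use u Rc t1(1,3) Rs RT in auto)
  define W where "W = {v \<in> E. R v = T1 v}"
  have W: "subspace class_ring W H"
    using e ec r(4,6,7) t1(4,6,7) by (intro hsubspaceI) (auto simp: W_def)
  have "closedin mtopology W"
    unfolding hclosed_iff
  proof (intro conjI allI impI)
    fix s w assume s: "(\<forall>n. s n \<in> W) \<and> hconv s w"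
    then have "R (s n) = T1 (s n)" "s n \<in> E" for n by (auto simp: W_def)
    then have "R w = T1 w" using s sa_op_hconv[OF R, of s w] sa_op_hconv[OF T1, of s w] hconv_unique by auto
    moreover have "w \<in> E" using s \<open>\<And>n. s n \<in> E\<close> E(2) unfolding hclosed_iff by blast
    ultimately show "w \<in> W" by (simp add: W_def)
  qed (use ec in \<open>auto simp: W_def\<close>)
  moreover have "\<rho> g ` W \<subseteq> W" if g: "g \<in> S" for g
    using SE[OF g] Rg[OF g] T1g[OF g] ec by (auto simp: W_def)
  ultimately have "W = {\<zero>} \<or> W = E" using irr[OF W] by (auto simp: W_def)
  then have "(\<forall>v\<in>E. T1 v = R v) \<or> (\<forall>v\<in>E. T1 v = \<ominus> R v)"
  proof
    assume W0: "W = {\<zero>}"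
    have "T1 v = \<ominus> R v" if v: "v \<in> E" for v
    proof -
      have vc: "v \<in> carrier H" using ec v .
      have "R (R v \<oplus> T1 v) = T1 (R v \<oplus> T1 v)"
        using vc r(1,4) t1(1,4) R1 R2 by (simp add: M.a_comm)
      moreover have "R v \<oplus> T1 v \<in> E" using e(3) RE T1E v by blast
      ultimately have 0: "R v \<oplus> T1 v = \<zero>" using W0 by (auto simp: W_def)
      have "ip H (R v) z + ip H (T1 v) z = 0" if "z \<in> carrier H" for z
        using ip_add[of "R v" "T1 v" z] 0 that vc r(1) t1(1) by (simp add: ip_simps)
      then show ?thesis using vc r(1) t1(1) by (intro ip_ext) (auto simp: ip_simps eq_neg_iff_add_eq_0 add.commute)
    qed
    then show ?thesis by blast
  next
    assume "W = E"
    then have "R v = T1 v" if "v \<in> E" for v using that by (auto simp: W_def)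
    then show ?thesis by simp
  qed
  moreover have "ip H (T v) v = of_real C * ip H (T1 v) v" if "v \<in> carrier H" for v
    using ip1(1)[OF that that] C by simp
  ultimately show ?thesis using Rpos C ec r(1) by (auto simp: ip_simps)
qed

text \<open>\<open>schur_sign\<close> applied to \<open>T\<close> minus a real number
  \<open>r\<close> says that the Rayleigh quotient of \<open>T\<close> on \<open>E\<close> does not
  take values on both sides of \<open>r\<close>. As \<open>r\<close> is arbitrary the quotient is
  constant, and a symmetric operator with constant Rayleigh quotient is a scalar.\<close>

theorem schur:
  assumes T: "sa_op T C" and S: "S \<subseteq> carrier G"
    and comm: "\<And>g v. g \<in> S \<Longrightarrow> v \<in> carrier H \<Longrightarrow> T (\<rho> g v) = \<rho> g (T v)"
    and E: "subspace class_ring E H" "closedin mtopology E" "T ` E \<subseteq> E"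
    and SE: "\<And>g. g \<in> S \<Longrightarrow> \<rho> g ` E \<subseteq> E"
    and irr: "\<And>W. subspace class_ring W H \<Longrightarrow> closedin mtopology W \<Longrightarrow> W \<subseteq> E \<Longrightarrow>
        (\<And>g. g \<in> S \<Longrightarrow> \<rho> g ` W \<subseteq> W) \<Longrightarrow> W = {\<zero>} \<or> W = E"
  shows "\<exists>c::real. \<forall>v\<in>E. T v = of_real c \<odot> v"
proof (cases "\<forall>v\<in>E. nrm v = 0")
  case True
  have "T v = of_real 0 \<odot> v" if v: "v \<in> E" for v proof -
    have "v = \<zero>" using True v ip_norm_eq_0 hsubspaceD(1)[OF E(1)] by blast
    then show ?thesis using sa_opD(7)[OF T] zero_smult[of \<zero>] by simp
  qed
  then show ?thesis by blast
next
  case False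
  note t = sa_opD[OF T] and e = hsubspaceD[OF E(1)]
  have ec: "v \<in> E \<Longrightarrow> v \<in> carrier H" for v using e(1) by blast
  obtain v0 where v0: "v0 \<in> E" "nrm v0 \<noteq> 0" using False by blast
  have n0: "0 < (nrm v0)\<^sup>2" using v0 by simp
  define c where "c = Re (ip H (T v0) v0) / (nrm v0)\<^sup>2"
  have sign: "(\<forall>v\<in>E. r * (nrm v)\<^sup>2 \<le> Re (ip H (T v) v)) \<or> (\<forall>v\<in>E. Re (ip H (T v) v) \<le> r * (nrm v)\<^sup>2)" for r
  proof -
    define D where "D v = T v \<ominus> of_real r \<odot> v" for v
    have Dip: "ip H (D v) u = ip H (T v) u - of_real r * ip H v u" "ip H u (D v) = ip H u (T v) - of_real r * ip H u v"
      if "v \<in> carrier H" "u \<in> carrier H" for u v using that t(1) by (simp_all add: D_def ip_simps)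
    \<comment> \<open>The added 1 makes the bound positive, as \<open>schur_sign\<close>
      demands.\<close>
    have D: "sa_op D (\<bar>C\<bar> + \<bar>r\<bar> + 1)"
      unfolding sa_op_def
    proof (intro conjI ballI)
      fix v assume v: "v \<in> carrier H"
      show "D v \<in> carrier H" using v t(1) by (simp add: D_def)
      have "nrm (D v) \<le> nrm (T v) + \<bar>r\<bar> * nrm v"
        using ip_norm_triangle[of "T v" "\<ominus> (of_real r \<odot> v)"] v t(1)
        by (simp add: D_def a_minus_def ip_norm_uminus nrm_smult)
      also have "\<dots> \<le> (\<bar>C\<bar> + \<bar>r\<bar> + 1) * nrm v"
        using t(2)[OF v] nrm_nonneg[OF v] abs_ge_self[of "C * nrm v"] by (simp add: abs_mult algebra_simps)
      finally show "nrm (D v) \<le> (\<bar>C\<bar> + \<bar>r\<bar> + 1) * nrm v" .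
      show "ip H (D u) v = ip H u (D v)" if "u \<in> carrier H" for u using that v t(3) by (simp add: Dip)
    qed
    have Dg: "D (\<rho> g v) = \<rho> g (D v)" if "g \<in> S" "v \<in> carrier H" for g v
      using that S comm t(1) act_smult act_diff by (auto simp: D_def subset_iff)
    have DE: "D ` E \<subseteq> E" using E(3) e(4) hsubspace_diff[OF E(1)] by (auto simp: D_def)
    have "(\<forall>v\<in>E. 0 \<le> Re (ip H (D v) v)) \<or> (\<forall>v\<in>E. Re (ip H (D v) v) \<le> 0)"
      by (rule schur_sign[OF D _ S Dg E(1,2) DE SE irr]) linarith+
    moreover have "Re (ip H (D v) v) = Re (ip H (T v) v) - r * (nrm v)\<^sup>2" if "v \<in> E" for v
      using Dip(1)[OF ec[OF that] ec[OF that]] ec[OF that] by (simp add: nrm_sq)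
    ultimately show ?thesis by auto
  qed
  have eq: "Re (ip H (T v) v) = c * (nrm v)\<^sup>2" if v: "v \<in> E" for v
  proof (rule ccontr)
    define x y where "x = Re (ip H (T v) v) - c * (nrm v)\<^sup>2" and "y = (nrm v)\<^sup>2"
    \<comment> \<open>For \<open>y > 0\<close> this lies strictly between the Rayleigh quotients
      \<open>c\<close> of \<open>v0\<close> and \<open>c + x / y\<close> of \<open>v\<close>. The
      added 1 covers \<open>y = 0\<close>.\<close>
    define r where "r = c + x / (2 * (y + 1))"
    assume "\<not> ?thesis"
    then have x: "x \<noteq> 0" and y: "0 \<le> y" by (auto simp: x_def y_def)
    have Tv0: "Re (ip H (T v0) v0) = c * (nrm v0)\<^sup>2" using n0 by (simp add: c_def)
    have k: "r * y = c * y + x * (y / (2 * (y + 1)))" "0 \<le> y / (2 * (y + 1))" "y / (2 * (y + 1)) < 1"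
      using y by (simp_all add: r_def algebra_simps divide_simps)
    consider "x > 0" | "x < 0" using x by linarith
    then show False
    proof cases
      case 1
      then have "c < r" using y by (simp add: r_def add_nonneg_pos)
      moreover have "x * (y / (2 * (y + 1))) < x * 1" using 1 k(3) by (rule mult_strict_left_mono[rotated])
      ultimately show False using sign[of r] v v0(1) k(1) n0 Tv0 unfolding x_def y_def
        by (smt (verit) mult_less_cancel_right)
    next
      case 2
      then have "r < c" using y by (simp add: r_def divide_neg_pos add_nonneg_pos)
      moreover have "x * 1 < x * (y / (2 * (y + 1)))" using 2 k(3) by (rule mult_strict_left_mono_neg[rotated])
      ultimately show False using sign[of r] v v0(1) k(1) n0 Tv0 unfolding x_def y_def
        by (smt (verit) mult_less_cancel_right)
    qed
  qed
  have "T v = of_real c \<odot> v" if v: "v \<in> E" for v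
  proof -
    \<comment> \<open>The constancy of the Rayleigh quotient, tested at \<open>v \<oplus> w\<close>
      with the error vector \<open>w\<close> itself, shows that \<open>w\<close> has norm 0.\<close>
    define w where "w = T v \<ominus> of_real c \<odot> v"
    have vc: "v \<in> carrier H" and wE: "w \<in> E"
      using v ec E(3) e(4) hsubspace_diff[OF E(1)] by (auto simp: w_def)
    have wc: "w \<in> carrier H" using ec wE .
    have "v \<oplus> w \<in> E" using e(3) v wE .
    moreover have "Re (ip H (T (v \<oplus> w)) (v \<oplus> w)) = Re (ip H (T v) v) + 2 * Re (ip H (T v) w) + Re (ip H (T w) w)"
    proof -
      have "ip H (T w) v = cnj (ip H (T v) w)" using t(1,3) vc wc ip_cnj by metis
      then show ?thesis using vc wc t(1,4) by (simp add: ip_simps)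
    qed
    moreover have "(nrm (v \<oplus> w))\<^sup>2 = (nrm v)\<^sup>2 + 2 * Re (ip H v w) + (nrm w)\<^sup>2"
    proof -
      have "ip H w v = cnj (ip H v w)" using vc wc ip_cnj by metis
      then show ?thesis using vc wc by (simp add: nrm_sq ip_simps)
    qed
    ultimately have "Re (ip H (T v) w) = c * Re (ip H v w)"
      using eq[of "v \<oplus> w"] eq[OF v] eq[OF wE] by (simp add: algebra_simps)
    then have "Re (ip H w w) = 0" using vc wc t(1) by (subst (1) w_def) (simp add: ip_simps)
    then have "w = \<zero>" using ip_pos[OF wc] by fastforce
    then show ?thesis using diff_eq_0[of "T v" "of_real c \<odot> v"] vc t(1) by (simp add: w_def)
  qed
  then show ?thesis by blast
qed

end

subsection \<open>Irreducible representations of virtually abelian groups\<close>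

context complex_hilbert_space
begin

definition proj :: "'a set \<Rightarrow> 'a \<Rightarrow> 'a" where
  "proj W v = (SOME w. w \<in> W \<and> v \<ominus> w \<in> ortho W)"

context
  fixes W :: "'a set"
  assumes W: "subspace class_ring W H" "closedin mtopology W"
begin

lemma proj_mem: "v \<in> carrier H \<Longrightarrow> proj W v \<in> W" and proj_ortho: "v \<in> carrier H \<Longrightarrow> v \<ominus> proj W v \<in> ortho W"
proof -
  assume v: "v \<in> carrier H"
  note w = hsubspaceD[OF W(1)]
  obtain a b where ab: "a \<in> W" "b \<in> ortho W" "v = a \<oplus> b" using orthogonal_decomposition[OF W v] .
  have c: "a \<in> carrier H" "b \<in> carrier H" using ab w(1) by (auto simp: ortho_def)
  have "v \<ominus> a = b" using ab(3) c by (intro ip_ext) (auto simp: ip_simps)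
  then have "a \<in> W \<and> v \<ominus> a \<in> ortho W" using ab by simp
  then have "proj W v \<in> W \<and> v \<ominus> proj W v \<in> ortho W" unfolding proj_def by (rule someI)
  then show "proj W v \<in> W" "v \<ominus> proj W v \<in> ortho W" by blast+
qed

lemma proj_closed [simp]: "v \<in> carrier H \<Longrightarrow> proj W v \<in> carrier H"
  using proj_mem hsubspaceD(1)[OF W(1)] by blast

lemma proj_unique: assumes v: "v \<in> carrier H" and w: "w \<in> W" "v \<ominus> w \<in> ortho W" shows "proj W v = w"
proof -
  have wc: "w \<in> carrier H" using w hsubspaceD(1)[OF W(1)] by blast
  let ?d = "proj W v \<ominus> w"
  have d: "?d \<in> W" using hsubspace_diff[OF W(1) proj_mem[OF v] w(1)] .
  have "ip H ?d ?d = ip H (v \<ominus> w) ?d - ip H (v \<ominus> proj W v) ?d"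
    using v wc by (simp add: ip_simps)
  also have "\<dots> = 0" using d w(2) proj_ortho[OF v] by (auto simp: ortho_def)
  finally have "?d = \<zero>" using v wc by (intro ip_self_0) auto
  then show ?thesis using diff_eq_0 v wc by simp
qed

lemma ip_proj:
  assumes "u \<in> carrier H" "v \<in> carrier H"
  shows "ip H (proj W u) v = ip H (proj W u) (proj W v)" "ip H u (proj W v) = ip H (proj W u) (proj W v)"
proof -
  have 1: "ip H (u \<ominus> proj W u) (proj W v) = 0" "ip H (v \<ominus> proj W v) (proj W u) = 0"
    using proj_ortho proj_mem assms by (auto simp: ortho_def)
  show "ip H u (proj W v) = ip H (proj W u) (proj W v)" using 1(1) assms by (simp add: ip_simps)
  have "ip H v (proj W u) = ip H (proj W v) (proj W u)" using 1(2) assms by (simp add: ip_simps)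
  then show "ip H (proj W u) v = ip H (proj W u) (proj W v)"
    using ip_cnj[of v "proj W u"] ip_cnj[of "proj W v" "proj W u"] assms by simp
qed

lemma nrm_proj: assumes v: "v \<in> carrier H" shows "nrm (proj W v) \<le> nrm v"
proof (cases "nrm (proj W v) = 0")
  case False
  have p: "0 < nrm (proj W v)" using False nrm_nonneg[of "proj W v"] v by simp
  have "(nrm (proj W v))\<^sup>2 = Re (ip H (proj W v) v)"
    using v nrm_sq[of "proj W v"] ip_proj(1)[OF v v] by simp
  also have "\<dots> \<le> nrm (proj W v) * nrm v"
    using ip_Cauchy_Schwarz[of "proj W v" v] complex_Re_le_cmod order_trans v by (meson proj_closed)
  finally show ?thesis using p by (simp add: power2_eq_square)
qed (simp add: nrm_nonneg v)

end

text \<open>Pythagoras for the splitting of \<open>W\<close> into \<open>V\<close> and the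
  orthogonal complement of \<open>V\<close> in \<open>W\<close>; this is what makes
  \<open>weight\<close> additive.\<close>

lemma proj_split:
  assumes W: "subspace class_ring W H" "closedin mtopology W"
    and V: "subspace class_ring V H" "closedin mtopology V" "V \<subseteq> W" and v: "v \<in> carrier H"
  shows "subspace class_ring (W \<inter> ortho V) H" "closedin mtopology (W \<inter> ortho V)"
    "(nrm (proj W v))\<^sup>2 = (nrm (proj V v))\<^sup>2 + (nrm (proj (W \<inter> ortho V) v))\<^sup>2"
proof -
  note wd = hsubspaceD[OF W(1)] and vd = hsubspaceD[OF V(1)]
  note od = hsubspaceD[OF ortho_hsubspace[OF vd(1)]]
  show U: "subspace class_ring (W \<inter> ortho V) H" "closedin mtopology (W \<inter> ortho V)"
    using wd od ortho_hclosed[OF vd(1)] W(2) by (auto intro!: hsubspaceI closedin_Int)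
  let ?w = "proj W v" and ?u = "proj V v"
  have c: "?w \<in> carrier H" "?u \<in> carrier H" using v W V by auto
  have uV: "?u \<in> V" using proj_mem[OF V(1,2) v] .
  have wW: "?w \<in> W" using proj_mem[OF W v] .
  have ow: "v \<ominus> ?w \<in> ortho W" and ou: "v \<ominus> ?u \<in> ortho V" using proj_ortho v W V by auto
  have "?w \<ominus> ?u \<in> ortho V"
  proof -
    have "ip H (?w \<ominus> ?u) x = 0" if x: "x \<in> V" for x
    proof -
      have xc: "x \<in> carrier H" and "x \<in> W" using x V(3) vd(1) by auto
      then have "ip H (v \<ominus> ?w) x = 0" "ip H (v \<ominus> ?u) x = 0" using ow ou x by (auto simp: ortho_def)
      then show ?thesis using c v xc by (simp add: ip_simps)
    qed
    then show ?thesis using c by (simp add: ortho_def)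
  qed
  moreover have "?w \<ominus> ?u \<in> W" using hsubspace_diff[OF W(1) wW] uV V(3) by blast
  moreover have "v \<ominus> (?w \<ominus> ?u) \<in> ortho (W \<inter> ortho V)"
  proof -
    have "ip H (v \<ominus> (?w \<ominus> ?u)) x = 0" if x: "x \<in> W" "x \<in> ortho V" for x
    proof -
      have xc: "x \<in> carrier H" using x wd(1) by auto
      have "ip H (v \<ominus> ?w) x = 0" using ow x by (simp add: ortho_def)
      moreover have "ip H x ?u = 0" using x uV by (simp add: ortho_def)
      then have "ip H ?u x = 0" using ip_cnj[OF xc c(2)] by simp
      ultimately show ?thesis using c v xc by (simp add: ip_simps)
    qed
    then show ?thesis using c v by (simp add: ortho_def)
  qed
  ultimately have e: "proj (W \<inter> ortho V) v = ?w \<ominus> ?u" using proj_unique[OF U v] by blast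
  have 0: "ip H (?w \<ominus> ?u) ?u = 0" using \<open>?w \<ominus> ?u \<in> ortho V\<close> uV by (simp add: ortho_def)
  then have 1: "ip H ?u (?w \<ominus> ?u) = 0" using ip_cnj[of "?w \<ominus> ?u" ?u] c by simp
  have "(nrm ?w)\<^sup>2 = Re (ip H ((?w \<ominus> ?u) \<oplus> ?u) ((?w \<ominus> ?u) \<oplus> ?u))"
  proof -
    have "(?w \<ominus> ?u) \<oplus> ?u = ?w" using c by (intro ip_ext) (auto simp: ip_simps)
    then show ?thesis using nrm_sq[OF c(1)] by simp
  qed
  also have "\<dots> = Re (ip H (?w \<ominus> ?u) (?w \<ominus> ?u)) + Re (ip H ?u ?u)"
    using c 0 1 by (simp add: ip_add ip_add_right)
  finally show "(nrm ?w)\<^sup>2 = (nrm ?u)\<^sup>2 + (nrm (proj (W \<inter> ortho V) v))\<^sup>2"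
    unfolding e using c by (simp add: nrm_sq)
qed

lemma span_least: "subspace class_ring W H \<Longrightarrow> A \<subseteq> W \<Longrightarrow> span A \<subseteq> W"
  by (rule span_is_subset) (simp_all add: subspace_def)

text \<open>A finite orthonormal basis of \<open>V\<close>: for unit vectors in \<open>V\<close>,
  Parseval's identity entails that distinct ones are orthogonal.\<close>

definition parseval_set :: "'a set \<Rightarrow> 'a set \<Rightarrow> bool" where
  "parseval_set V B \<longleftrightarrow> finite B \<and> B \<subseteq> V \<and> (\<forall>b\<in>B. nrm b = 1) \<and>
    (\<forall>u\<in>V. \<forall>w\<in>carrier H. ip H u w = (\<Sum>b\<in>B. ip H u b * ip H b w))"

lemma parseval_setD:
  assumes "parseval_set V B"
  shows "finite B" "B \<subseteq> V" "b \<in> B \<Longrightarrow> nrm b = 1"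
    "u \<in> V \<Longrightarrow> w \<in> carrier H \<Longrightarrow> ip H u w = (\<Sum>b\<in>B. ip H u b * ip H b w)"
  using assms by (auto simp: parseval_set_def)

lemma parseval_proj:
  assumes V: "subspace class_ring V H" and B: "parseval_set V B" and v: "v \<in> carrier H"
  shows "\<exists>p\<in>V. \<forall>z\<in>carrier H. ip H p z = (\<Sum>b\<in>B. ip H v b * ip H b z)"
proof -
  note B = parseval_setD[OF B]
  obtain bs where bs: "set bs = B" "distinct bs" using finite_distinct_list[OF B(1)] by blast
  have Bc: "b \<in> set bs \<Longrightarrow> b \<in> carrier H" for b using B(2) hsubspaceD(1)[OF V] bs(1) by blast
  have "lvec (map (\<lambda>b. (ip H v b, b)) bs) \<in> V"
    using B(2) bs(1) by (intro lvec_in_subspace[OF V]) (auto simp: fsupp_def)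
  moreover have "ip H (lvec (map (\<lambda>b. (ip H v b, b)) bs)) z = (\<Sum>b\<in>B. ip H v b * ip H b z)"
    if "z \<in> carrier H" for z
    using ip_lvec_map(1)[of bs "\<lambda>b. b" z "ip H v"] Bc that bs by (simp add: sum_list_distinct_conv_sum_set)
  ultimately show ?thesis by blast
qed

text \<open>The Gram-Schmidt process: \<open>q\<close> is the part of \<open>a\<close> orthogonal to
  the span of \<open>A\<close>, and \<open>b\<close> is its normalisation.\<close>

lemma parseval:
  assumes "finite A" "A \<subseteq> carrier H"
  shows "\<exists>B. parseval_set (span A) B"
  using assms
proof (induction A rule: finite_induct)
  case empty
  have "subspace class_ring {\<zero>} H" by (rule hsubspaceI) auto
  then have "span {} \<subseteq> {\<zero>}" by (intro span_least) auto
  then have "parseval_set (span {}) {}" by (auto simp: parseval_set_def ip_zero_left)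
  then show ?case by blast
next
  case (insert a A)
  have Ac: "A \<subseteq> carrier H" "a \<in> carrier H" "insert a A \<subseteq> carrier H" using insert.prems by auto
  obtain B where Bp: "parseval_set (span A) B" using insert.IH[OF Ac(1)] by blast
  note B = parseval_setD[OF Bp] and spA = span_is_subspace[OF Ac(1)]
  note sp' = span_is_subspace[OF Ac(3)]
  note d = hsubspaceD[OF spA] and d' = hsubspaceD[OF sp']
  have own: "A \<subseteq> span (insert a A)" "a \<in> span (insert a A)" using in_own_span[OF Ac(3)] by auto
  then have sub: "span A \<subseteq> span (insert a A)" by (intro span_least sp')
  have BH: "b \<in> B \<Longrightarrow> b \<in> carrier H" for b using B(2) d(1) by blast
  obtain p where p: "p \<in> span A" "\<And>z. z \<in> carrier H \<Longrightarrow> ip H p z = (\<Sum>b\<in>B. ip H a b * ip H b z)"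
    using parseval_proj[OF spA Bp Ac(2)] by blast
  have pc: "p \<in> carrier H" using p(1) d(1) by blast
  define q where "q = a \<ominus> p"
  have qc: "q \<in> carrier H" using pc Ac(2) by (simp add: q_def)
  have apq: "a = p \<oplus> q" using Ac(2) pc by (intro ip_ext) (auto simp: q_def ip_simps)
  have orth: "ip H q u = 0" "ip H u q = 0" if "u \<in> span A" for u
  proof -
    have uc: "u \<in> carrier H" using that d(1) by blast
    have "ip H p u = cnj (ip H u a)"
      unfolding p(2)[OF uc] B(4)[OF that Ac(2)] cnj_sum
    proof (rule sum.cong[OF refl])
      fix b assume "b \<in> B"
      then show "ip H a b * ip H b u = cnj (ip H u b * ip H b a)"
        using ip_cnj[of b a] ip_cnj[of u b] BH uc Ac(2) by simp
    qed
    then show "ip H q u = 0" using ip_cnj[OF uc Ac(2)] uc pc Ac(2) by (simp add: q_def ip_simps)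
    then show "ip H u q = 0" using ip_cnj[OF qc uc] by simp
  qed
  \<comment> \<open>The identity is linear in \<open>u\<close>, so it passes from the generators to
    their span.\<close>
  have extend: "\<exists>B. parseval_set (span (insert a A)) B"
    if B': "finite B'" "B' \<subseteq> span (insert a A)" "\<And>b. b \<in> B' \<Longrightarrow> nrm b = 1"
      and A': "\<And>u w. u \<in> insert a A \<Longrightarrow> w \<in> carrier H \<Longrightarrow> ip H u w = (\<Sum>b\<in>B'. ip H u b * ip H b w)" for B'
  proof -
    have Bc: "b \<in> B' \<Longrightarrow> b \<in> carrier H" for b using B'(2) d'(1) by blast
    have "ip H u w = (\<Sum>b\<in>B'. ip H u b * ip H b w)" if u: "u \<in> span (insert a A)" and w: "w \<in> carrier H" for u w
    proof -
      have "subspace class_ring {u \<in> carrier H. ip H u w = (\<Sum>b\<in>B'. ip H u b * ip H b w)} H"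
        using w Bc
        by (intro hsubspaceI)
          (auto simp: ip_simps sum.distrib sum_distrib_left distrib_right mult.assoc cong: sum.cong)
      moreover have "insert a A \<subseteq> {u \<in> carrier H. ip H u w = (\<Sum>b\<in>B'. ip H u b * ip H b w)}"
        using A'[OF _ w] Ac(3) by blast
      ultimately have "span (insert a A) \<subseteq> {u \<in> carrier H. ip H u w = (\<Sum>b\<in>B'. ip H u b * ip H b w)}"
        by (rule span_least)
      then show ?thesis using u by blast
    qed
    then have "parseval_set (span (insert a A)) B'" using B' unfolding parseval_set_def by blast
    then show ?thesis by blast
  qed
  show ?case
  proof (cases "q = \<zero>")
    case True
    then have "a = p" using apq pc by simp
    show ?thesis
    proof (rule extend[OF B(1) order_trans[OF B(2) sub] B(3)])
      fix u w assume "u \<in> insert a A" "w \<in> carrier H"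
      moreover have "u \<in> insert a A \<Longrightarrow> u \<in> span A" using \<open>a = p\<close> p(1) in_own_span[OF Ac(1)] by blast
      ultimately show "ip H u w = (\<Sum>b\<in>B. ip H u b * ip H b w)" using B(4) by blast
    qed
  next
    case False
    define r where "r = nrm q"
    have r: "r > 0" using ip_norm_eq_0[OF qc] nrm_nonneg[OF qc] False by (auto simp: r_def less_le)
    define b where "b = of_real (1/r) \<odot> q"
    have bc: "b \<in> carrier H" using qc by (simp add: b_def)
    have bn: "nrm b = 1" using qc r by (simp add: b_def nrm_smult norm_divide r_def[symmetric])
    have qs: "q \<in> span (insert a A)"
      unfolding q_def by (rule hsubspace_diff[OF sp' own(2) subsetD[OF sub p(1)]])
    have bs: "b \<in> span (insert a A)" unfolding b_def by (rule d'(4)[OF qs])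
    have borth: "ip H u b = 0" if "u \<in> span A" for u
      using orth(2)[OF that] d(1) that qc by (auto simp: b_def ip_smult_right subset_iff)
    have bB: "b \<notin> B"
    proof
      assume "b \<in> B"
      then have "ip H b b = 0" using borth B(2) by blast
      then show False using bn bc by (simp add: ip_norm_def)
    qed
    have qb: "ip H q b * ip H b w = ip H q w" if w: "w \<in> carrier H" for w
      using qc w r by (simp add: b_def ip_smult ip_smult_right ip_self r_def[symmetric] power2_eq_square)
    show ?thesis
    proof (rule extend[of "insert b B"])
      fix u w assume u: "u \<in> insert a A" and w: "w \<in> carrier H"
      show "ip H u w = (\<Sum>b\<in>insert b B. ip H u b * ip H b w)"
      proof (cases "u = a")
        case True
        have "ip H a b = ip H q b" unfolding apq using borth[OF p(1)] pc qc bc by (simp add: ip_add)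
        moreover have "(\<Sum>c\<in>B. ip H a c * ip H c w) = (\<Sum>c\<in>B. ip H p c * ip H c w)"
          unfolding apq using orth(1) B(2) pc qc BH by (intro sum.cong refl) (auto simp: ip_add subset_iff)
        ultimately have "(\<Sum>b\<in>insert b B. ip H a b * ip H b w) = ip H q w + ip H p w"
          using B(1) bB qb[OF w] B(4)[OF p(1) w] by simp
        then show ?thesis unfolding True apq using pc qc w by (simp add: ip_add)
      next
        case False
        then have "u \<in> span A" using u in_own_span[OF Ac(1)] by blast
        then show ?thesis using B(1) bB borth B(4)[OF _ w] by simp
      qed
    qed (use B(1,3) B(2) bn bs sub in auto)
  qed
qed

text \<open>By Parseval's identity a vector of the span is determined by finitely many inner
  products, which are continuous. So the limit of a sequence in the span equals the vector
  \<open>p\<close> of the span built from the coefficients of the limit.\<close>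

lemma hclosed_span:
  assumes "finite A" "A \<subseteq> carrier H"
  shows "closedin mtopology (span A)"
  unfolding hclosed_iff
proof (intro conjI allI impI)
  note sp = span_is_subspace[OF assms(2)]
  note d = hsubspaceD[OF sp]
  show "span A \<subseteq> carrier H" by (rule d(1))
  fix s w assume s: "(\<forall>n. s n \<in> span A) \<and> hconv s w"
  then have wc: "w \<in> carrier H" by (auto simp: hconv_closed)
  obtain B where Bp: "parseval_set (span A) B" using parseval[OF assms] by blast
  note B = parseval_setD[OF Bp]
  have Bc: "b \<in> B \<Longrightarrow> b \<in> carrier H" for b using B(2) d(1) by blast
  obtain p where p: "p \<in> span A" "\<And>z. z \<in> carrier H \<Longrightarrow> ip H p z = (\<Sum>b\<in>B. ip H w b * ip H b z)"
    using parseval_proj[OF sp Bp wc] by blast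
  have "ip H w z = ip H p z" if z: "z \<in> carrier H" for z
  proof (rule LIMSEQ_unique)
    show "(\<lambda>n. ip H (s n) z) \<longlonglongrightarrow> ip H w z" using s z by (intro hconv_ip hconv_const) auto
    have "(\<lambda>n. \<Sum>b\<in>B. ip H (s n) b * ip H b z) \<longlonglongrightarrow> ip H p z"
      unfolding p(2)[OF z] using s Bc by (intro tendsto_sum tendsto_mult_right hconv_ip hconv_const) auto
    then show "(\<lambda>n. ip H (s n) z) \<longlonglongrightarrow> ip H p z" using s B(4) z by simp
  qed
  then have "w = p" using wc p(1) d(1) by (intro ip_ext) auto
  then show "w \<in> span A" using p(1) by simp
qed

end

context urep
begin

lemma proj_act:
  assumes W: "subspace class_ring W H" "closedin mtopology W"
    and g: "g \<in> carrier G" and inv: "\<rho> g ` W \<subseteq> W" "\<rho> (ginv g) ` W \<subseteq> W" and v: "v \<in> carrier H"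
  shows "proj W (\<rho> g v) = \<rho> g (proj W v)"
proof (rule proj_unique[OF W])
  have pc: "proj W v \<in> carrier H" using proj_closed[OF W v] .
  show "\<rho> g (proj W v) \<in> W" using inv(1) proj_mem[OF W v] by blast
  have "ip H (\<rho> g (v \<ominus> proj W v)) x = 0" if x: "x \<in> W" for x
  proof -
    have "\<rho> (ginv g) x \<in> W" using inv(2) x by blast
    then show ?thesis
      using proj_ortho[OF W v] g pc v x hsubspaceD(1)[OF W(1)] by (auto simp: act_adjoint ortho_def)
  qed
  then show "\<rho> g v \<ominus> \<rho> g (proj W v) \<in> ortho W"
    using g v pc by (simp add: act_diff[symmetric] ortho_def)
qed (use g v in auto)

definition closed_invariant :: "'a set \<Rightarrow> 'h set \<Rightarrow> bool" where
  "closed_invariant K W \<longleftrightarrow> subspace class_ring W H \<and> closedin mtopology W \<and> (\<forall>g\<in>K. \<rho> g ` W \<subseteq> W)"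

lemma irreducible_closed_invariant:
  "irreducible_unitary_rep G H \<rho> \<Longrightarrow> closed_invariant (carrier G) W \<Longrightarrow> W = {\<zero>} \<or> W = carrier H"
  unfolding irreducible_unitary_rep_def closed_invariant_def by blast

text \<open>Averaging the projection onto a \<open>K\<close>-invariant subspace over the cosets of \<open>K\<close> gives a scalar,
  which is additive in the subspace and at least 1 unless the subspace is trivial. Hence there is a
  minimal subspace.\<close>

context
  fixes K :: "'a set" and u0 :: 'h
  assumes irr: "irreducible_unitary_rep G H \<rho>"
    and K: "subgroup K G" and fin: "finite (rcosets\<^bsub>G\<^esub> K)" and u0: "u0 \<in> carrier H" "nrm u0 = 1"
begin

definition rp :: "'a set \<Rightarrow> 'a" where
  "rp C = (SOME x. x \<in> C)"

lemma Kc: "k \<in> K \<Longrightarrow> k \<in> carrier G"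
  using subgroup.subset[OF K] by blast

lemma rp_coset: "x \<in> carrier G \<Longrightarrow> \<exists>k\<in>K. rp (K #>\<^bsub>G\<^esub> x) = k \<cdot> x"
proof -
  assume x: "x \<in> carrier G"
  have "x \<in> K #>\<^bsub>G\<^esub> x" by (rule G.rcos_self[OF x K])
  then have "rp (K #>\<^bsub>G\<^esub> x) \<in> K #>\<^bsub>G\<^esub> x" unfolding rp_def by (rule someI)
  then show ?thesis by (auto simp: r_coset_def)
qed

lemma rp_closed: "C \<in> rcosets\<^bsub>G\<^esub> K \<Longrightarrow> rp C \<in> carrier G"
  using rp_coset Kc by (fastforce simp: RCOSETS_def)

text \<open>Right translation permutes the right cosets of \<open>K\<close>, and the invariance of
  \<open>f\<close> under \<open>K\<close> absorbs the change of representatives.\<close>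

lemma coset_sum_translate:
  assumes g: "g \<in> carrier G"
    and f: "\<And>k x. k \<in> K \<Longrightarrow> x \<in> carrier G \<Longrightarrow> f (k \<cdot> x) = (f x :: complex)"
  shows "(\<Sum>C\<in>rcosets\<^bsub>G\<^esub> K. f (rp C \<cdot> g)) = (\<Sum>C\<in>rcosets\<^bsub>G\<^esub> K. f (rp C))"
proof -
  have Ks: "K \<subseteq> carrier G" using Kc by blast
  have rpf: "f (rp (K #>\<^bsub>G\<^esub> x)) = f x" if "x \<in> carrier G" for x using rp_coset[OF that] f that by auto
  have tr: "C #>\<^bsub>G\<^esub> g \<in> rcosets\<^bsub>G\<^esub> K \<and> f (rp (C #>\<^bsub>G\<^esub> g)) = f (rp C \<cdot> g) \<and> C #>\<^bsub>G\<^esub> g #>\<^bsub>G\<^esub> ginv g = C"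
    if C: "C \<in> rcosets\<^bsub>G\<^esub> K" and g: "g \<in> carrier G" for C g
  proof -
    obtain x where x: "x \<in> carrier G" "C = K #>\<^bsub>G\<^esub> x" using C by (auto simp: RCOSETS_def)
    have e: "C #>\<^bsub>G\<^esub> g = K #>\<^bsub>G\<^esub> (x \<cdot> g)" unfolding x(2) by (rule G.coset_mult_assoc[OF Ks x(1) g])
    obtain k where k: "k \<in> K" "rp C = k \<cdot> x" using rp_coset[OF x(1)] x(2) by blast
    have "f (rp C \<cdot> g) = f (k \<cdot> (x \<cdot> g))" using k x g Kc by (simp add: G.m_assoc)
    also have "\<dots> = f (x \<cdot> g)" using f k x g by simp
    finally have "f (rp (C #>\<^bsub>G\<^esub> g)) = f (rp C \<cdot> g)" unfolding e using rpf x g by simp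
    moreover have "C #>\<^bsub>G\<^esub> g #>\<^bsub>G\<^esub> ginv g = C"
      unfolding e using G.coset_mult_assoc[OF Ks, of "x \<cdot> g" "ginv g"] x g by (simp add: G.m_assoc)
    moreover have "C #>\<^bsub>G\<^esub> g \<in> rcosets\<^bsub>G\<^esub> K" unfolding e using G.rcosetsI[OF Ks] x g by simp
    ultimately show ?thesis by blast
  qed
  show ?thesis
    by (rule sum.reindex_bij_witness[of _ "\<lambda>C. C #>\<^bsub>G\<^esub> ginv g" "\<lambda>C. C #>\<^bsub>G\<^esub> g"])
      (use tr[OF _ g] tr[of _ "ginv g"] g in auto)
qed

text \<open>The quadratic form at \<open>u0\<close> of the averaged projection \<open>T\<close> of
  \<open>weight_ge_1\<close>. Since \<open>T\<close> is a scalar and \<open>u0\<close> a unit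
  vector, the weight is this scalar.\<close>

definition weight :: "'h set \<Rightarrow> real" where
  "weight W = (\<Sum>C\<in>rcosets\<^bsub>G\<^esub> K. (nrm (proj W (\<rho> (rp C) u0)))\<^sup>2)"

lemma weight_split:
  assumes W: "closed_invariant K W" and V: "closed_invariant K V" "V \<subseteq> W"
  shows "weight W = weight V + weight (W \<inter> ortho V)"
  unfolding weight_def sum.distrib[symmetric]
  by (intro sum.cong refl proj_split(3)) (use W V rp_closed u0 in \<open>auto simp: closed_invariant_def\<close>)

lemma closed_invariant_split:
  assumes W: "closed_invariant K W" and V: "closed_invariant K V" "V \<subseteq> W"
  shows "closed_invariant K (W \<inter> ortho V)"
  unfolding closed_invariant_def
proof (intro conjI ballI)
  show "subspace class_ring (W \<inter> ortho V) H" "closedin mtopology (W \<inter> ortho V)"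
    using proj_split(1,2)[OF _ _ _ _ V(2) u0(1)] W V(1) by (simp_all add: closed_invariant_def)
  fix g assume g: "g \<in> K"
  have Vc: "V \<subseteq> carrier H" using V(1) hsubspaceD(1) by (simp add: closed_invariant_def)
  interpret RK: urep "G\<lparr>carrier := K\<rparr>" H \<rho> by (rule urep_restrict[OF urep_axioms K])
  have "\<rho> g ` ortho V \<subseteq> ortho V"
    using RK.act_ortho[OF Vc, of g] V(1) g by (simp add: closed_invariant_def)
  then show "\<rho> g ` (W \<inter> ortho V) \<subseteq> W \<inter> ortho V" using W g unfolding closed_invariant_def by blast
qed

text \<open>\<open>T\<close> sums the conjugates of the projection onto \<open>W\<close> by the
  coset representatives. Invariance of \<open>W\<close> under \<open>K\<close> frees the summands
  from the choice of representatives, so \<open>T\<close> commutes with \<open>G\<close> and Schur's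
  lemma applies. On a vector of \<open>W\<close> the coset \<open>K\<close> alone contributes the
  full squared norm, so the scalar is at least 1.\<close>

lemma weight_ge_1:
  assumes W: "closed_invariant K W" and ne: "W \<noteq> {\<zero>}"
  shows "1 \<le> weight W"
proof -
  have Ws: "subspace class_ring W H" "closedin mtopology W" and Wi: "\<And>g. g \<in> K \<Longrightarrow> \<rho> g ` W \<subseteq> W"
    using W by (auto simp: closed_invariant_def)
  note pc = proj_closed[OF Ws]
  define F where "F v u x = ip H (proj W (\<rho> x v)) (proj W (\<rho> x u))" for v u x
  have FK: "F v u (k \<cdot> x) = F v u x"
    if k: "k \<in> K" and x: "x \<in> carrier G" and v: "v \<in> carrier H" and u: "u \<in> carrier H" for v u k x
  proof -
    have "proj W (\<rho> (k \<cdot> x) w) = \<rho> k (proj W (\<rho> x w))" if w: "w \<in> carrier H" for w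
      using k Kc x w Wi[OF k] Wi[OF subgroup.m_inv_closed[OF K k]]
      by (simp add: act_mult proj_act[OF Ws])
    then show ?thesis using k x v u Kc pc by (simp add: F_def act_ip)
  qed
  obtain cs where cs: "set cs = rcosets\<^bsub>G\<^esub> K" "distinct cs" using finite_distinct_list[OF fin] by blast
  define T where "T v = lvec (map (\<lambda>C. (1, \<rho> (ginv (rp C)) (proj W (\<rho> (rp C) v)))) cs)" for v
  have mc: "\<rho> (ginv (rp C)) (proj W (\<rho> (rp C) v)) \<in> carrier H" if "C \<in> set cs" "v \<in> carrier H" for C v
    using that rp_closed pc cs(1) by simp
  have Tc: "T v \<in> carrier H" if "v \<in> carrier H" for v
    unfolding T_def by (rule ip_lvec_map(2)[of _ _ \<zero>]) (use mc that in auto)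
  have ipT: "ip H (T v) u = (\<Sum>C\<in>rcosets\<^bsub>G\<^esub> K. F v u (rp C))" if v: "v \<in> carrier H" and u: "u \<in> carrier H" for v u
  proof -
    have "ip H (T v) u = (\<Sum>C\<leftarrow>cs. 1 * ip H (\<rho> (ginv (rp C)) (proj W (\<rho> (rp C) v))) u)"
      unfolding T_def by (rule ip_lvec_map(1)) (use mc v u in auto)
    also have "\<dots> = (\<Sum>C\<in>rcosets\<^bsub>G\<^esub> K. ip H (\<rho> (ginv (rp C)) (proj W (\<rho> (rp C) v))) u)"
      using cs by (simp add: sum_list_distinct_conv_sum_set)
    also have "\<dots> = (\<Sum>C\<in>rcosets\<^bsub>G\<^esub> K. F v u (rp C))"
    proof (rule sum.cong[OF refl])
      fix C assume "C \<in> rcosets\<^bsub>G\<^esub> K"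
      then have r: "rp C \<in> carrier G" by (rule rp_closed)
      have "ip H (\<rho> (ginv (rp C)) (proj W (\<rho> (rp C) v))) u = ip H (proj W (\<rho> (rp C) v)) (\<rho> (rp C) u)"
        using r v u pc by (simp add: act_adjoint)
      also have "\<dots> = F v u (rp C)" unfolding F_def using ip_proj(1)[OF Ws] r v u by simp
      finally show "ip H (\<rho> (ginv (rp C)) (proj W (\<rho> (rp C) v))) u = F v u (rp C)" .
    qed
    finally show ?thesis .
  qed
  have sa: "sa_op T (real (length cs))"
    unfolding sa_op_def
  proof (intro conjI ballI)
    fix v assume v: "v \<in> carrier H"
    show "T v \<in> carrier H" by (rule Tc[OF v])
    have "nrm (T v) \<le> (\<Sum>C\<leftarrow>cs. cmod 1) * nrm v"
      unfolding T_def
    proof (rule nrm_lvec_map)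
      fix C assume C: "C \<in> set cs"
      show "\<rho> (ginv (rp C)) (proj W (\<rho> (rp C) v)) \<in> carrier H" by (rule mc[OF C v])
      have r: "rp C \<in> carrier G" using C cs rp_closed by simp
      then show "nrm (\<rho> (ginv (rp C)) (proj W (\<rho> (rp C) v))) \<le> nrm v"
        using nrm_proj[OF Ws, of "\<rho> (rp C) v"] v pc by (simp add: act_nrm)
    qed
    then show "nrm (T v) \<le> real (length cs) * nrm v" by (simp add: sum_list_triv)
    show "ip H (T u) v = ip H u (T v)" if u: "u \<in> carrier H" for u
    proof -
      have "ip H u (T v) = cnj (ip H (T v) u)" using ip_cnj[OF Tc[OF v] u] .
      also have "\<dots> = ip H (T u) v"
        unfolding ipT[OF v u] ipT[OF u v] cnj_sum F_def
        using pc rp_closed u v by (intro sum.cong refl) (metis act_closed ip_cnj)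
      finally show ?thesis by simp
    qed
  qed
  have comm: "T (\<rho> g v) = \<rho> g (T v)" if g: "g \<in> carrier G" and v: "v \<in> carrier H" for g v
  proof (rule ip_ext)
    show "T (\<rho> g v) \<in> carrier H" "\<rho> g (T v) \<in> carrier H" using Tc g v by auto
    fix z assume z: "z \<in> carrier H"
    let ?z = "\<rho> (ginv g) z"
    have zc: "?z \<in> carrier H" using g z by simp
    have "ip H (T (\<rho> g v)) z = (\<Sum>C\<in>rcosets\<^bsub>G\<^esub> K. F v ?z (rp C \<cdot> g))"
      using g v z rp_closed by (simp add: ipT) (simp add: F_def act_mult act_inv)
    also have "\<dots> = (\<Sum>C\<in>rcosets\<^bsub>G\<^esub> K. F v ?z (rp C))"
      by (rule coset_sum_translate[OF g]) (use FK v zc in auto)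
    also have "\<dots> = ip H (\<rho> g (T v)) z" using ipT[OF v zc] act_adjoint g z Tc[OF v] by simp
    finally show "ip H (T (\<rho> g v)) z = ip H (\<rho> g (T v)) z" .
  qed
  have "\<exists>c::real. \<forall>v\<in>carrier H. T v = of_real c \<odot> v"
  proof (rule schur[OF sa subset_refl comm carrier_hsubspace carrier_hclosed])
    show "T ` carrier H \<subseteq> carrier H" using Tc by blast
    show "\<rho> g ` carrier H \<subseteq> carrier H" if "g \<in> carrier G" for g using act_closed[OF that] by blast
    fix V assume "subspace class_ring V H" "closedin mtopology V" "\<And>g. g \<in> carrier G \<Longrightarrow> \<rho> g ` V \<subseteq> V"
    then show "V = {\<zero>} \<or> V = carrier H"
      by (intro irreducible_closed_invariant[OF irr]) (simp add: closed_invariant_def)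
  qed
  then obtain c :: real where c: "\<And>v. v \<in> carrier H \<Longrightarrow> T v = of_real c \<odot> v" by blast
  have norm: "c * (nrm v)\<^sup>2 = (\<Sum>C\<in>rcosets\<^bsub>G\<^esub> K. (nrm (proj W (\<rho> (rp C) v)))\<^sup>2)" if v: "v \<in> carrier H" for v
  proof -
    have "c * (nrm v)\<^sup>2 = Re (ip H (T v) v)" using c[OF v] v by (simp add: ip_smult nrm_sq)
    also have "\<dots> = (\<Sum>C\<in>rcosets\<^bsub>G\<^esub> K. Re (F v v (rp C)))" using ipT[OF v v] by simp
    also have "\<dots> = (\<Sum>C\<in>rcosets\<^bsub>G\<^esub> K. (nrm (proj W (\<rho> (rp C) v)))\<^sup>2)"
      unfolding F_def using rp_closed v pc by (intro sum.cong refl) (simp add: nrm_sq)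
    finally show ?thesis .
  qed
  have "\<zero> \<in> W" using hsubspaceD(2)[OF Ws(1)] .
  then obtain w where w: "w \<in> W" "w \<noteq> \<zero>" using ne by blast
  have wc: "w \<in> carrier H" using w hsubspaceD(1)[OF Ws(1)] by blast
  have nw: "0 < (nrm w)\<^sup>2" using ip_norm_eq_0[OF wc] w by simp
  have "K \<in> rcosets\<^bsub>G\<^esub> K" using G.rcosetsI[of K "\<one>\<^bsub>G\<^esub>"] subgroup.subset[OF K] by simp
  have rK: "rp K \<in> K" using someI[of "\<lambda>x. x \<in> K"] subgroup.one_closed[OF K] by (auto simp: rp_def)
  then have rw: "\<rho> (rp K) w \<in> W" using Wi w by blast
  then have "proj W (\<rho> (rp K) w) = \<rho> (rp K) w"
  proof (intro proj_unique[OF Ws _ rw])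
    have "\<rho> (rp K) w \<ominus> \<rho> (rp K) w = \<zero>" using Kc[OF rK] wc diff_eq_0 by simp
    then show "\<rho> (rp K) w \<ominus> \<rho> (rp K) w \<in> ortho W"
      using hsubspaceD(2)[OF ortho_hsubspace[OF hsubspaceD(1)[OF Ws(1)]]] by simp
  qed (use Kc[OF rK] wc in simp)
  then have "(nrm w)\<^sup>2 = (nrm (proj W (\<rho> (rp K) w)))\<^sup>2" using act_nrm[OF Kc[OF rK] wc] by simp
  also have "\<dots> \<le> c * (nrm w)\<^sup>2"
    unfolding norm[OF wc] by (rule member_le_sum[OF \<open>K \<in> rcosets\<^bsub>G\<^esub> K\<close>]) (use fin in auto)
  finally have "1 \<le> c" using nw by simp
  then show ?thesis using norm[OF u0(1)] u0(2) by (simp add: weight_def)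
qed

lemma minimal_closed_invariant:
  "\<exists>E. closed_invariant K E \<and> E \<noteq> {\<zero>} \<and> (\<forall>W. closed_invariant K W \<and> W \<subseteq> E \<longrightarrow> W = {\<zero>} \<or> W = E)"
proof -
  define X where "X = {W. closed_invariant K W \<and> W \<noteq> {\<zero>}}"
  have "carrier H \<noteq> {\<zero>}" using irr by (simp add: irreducible_unitary_rep_def)
  then have "carrier H \<in> X"
    using carrier_hsubspace carrier_hclosed Kc by (auto simp: X_def closed_invariant_def)
  then have "weight ` X \<noteq> {}" by blast
  \<comment> \<open>The margin 1 is the lower bound of \<open>weight_ge_1\<close>: a proper nonzero
    subspace of \<open>E\<close> has weight at least the infimum and its complement in
    \<open>E\<close> weight at least 1, which together exceed the weight of
    \<open>E\<close>.\<close>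
  then obtain E where E: "E \<in> X" "weight E < Inf (weight ` X) + 1"
    using cInf_lessD[of "weight ` X" "Inf (weight ` X) + 1"] by auto
  have bdd: "bdd_below (weight ` X)" using weight_ge_1 by (intro bdd_belowI[of _ 1]) (auto simp: X_def)
  have Ei: "closed_invariant K E" "E \<noteq> {\<zero>}" using E(1) by (auto simp: X_def)
  have "W = {\<zero>} \<or> W = E" if W: "closed_invariant K W" "W \<subseteq> E" for W
  proof (rule ccontr)
    assume a: "\<not> ?thesis"
    have Es: "subspace class_ring E H" and Ws: "subspace class_ring W H" "closedin mtopology W"
      using Ei W by (auto simp: closed_invariant_def)
    have "E \<inter> ortho W \<noteq> {\<zero>}"
    proof
      assume 0: "E \<inter> ortho W = {\<zero>}"
      have "E \<subseteq> W"
      proof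
        fix v assume v: "v \<in> E"
        have vc: "v \<in> carrier H" using v hsubspaceD(1)[OF Es] by blast
        have "v \<ominus> proj W v \<in> E" using hsubspace_diff[OF Es v] proj_mem[OF Ws vc] W(2) by blast
        then have "v \<ominus> proj W v = \<zero>" using 0 proj_ortho[OF Ws vc] by blast
        then show "v \<in> W" using diff_eq_0[OF vc proj_closed[OF Ws vc]] proj_mem[OF Ws vc] by simp
      qed
      then show False using a W(2) by blast
    qed
    then have "1 \<le> weight (E \<inter> ortho W)" using weight_ge_1 closed_invariant_split[OF Ei(1) W] by blast
    moreover have "Inf (weight ` X) \<le> weight W" using bdd W(1) a by (intro cInf_lower) (auto simp: X_def)
    ultimately show False using weight_split[OF Ei(1) W] E(2) by simp
  qed
  then show ?thesis using Ei by blast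
qed

text \<open>As \<open>\<rho> k\<close> may fail to be self-adjoint, Schur's lemma is applied to
  \<open>a\<close> times \<open>\<rho> k\<close> plus the adjoint of this operator, which commutes
  with \<open>K\<close>. The choices \<open>a = 1\<close> and \<open>a = \<i>\<close> recover
  \<open>\<rho> k\<close>.\<close>

lemma abelian_minimal_scalar:
  assumes comm: "\<And>x y. x \<in> K \<Longrightarrow> y \<in> K \<Longrightarrow> x \<cdot> y = y \<cdot> x"
    and E: "closed_invariant K E" and min: "\<And>W. closed_invariant K W \<Longrightarrow> W \<subseteq> E \<Longrightarrow> W = {\<zero>} \<or> W = E"
    and k: "k \<in> K"
  shows "\<exists>c. \<forall>v\<in>E. \<rho> k v = c \<odot> v"
proof -
  have Es: "subspace class_ring E H" "closedin mtopology E" and Ei: "\<And>g. g \<in> K \<Longrightarrow> \<rho> g ` E \<subseteq> E"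
    using E by (auto simp: closed_invariant_def)
  note e = hsubspaceD[OF Es(1)]
  have ki: "ginv k \<in> K" using subgroup.m_inv_closed[OF K k] .
  have kc: "k \<in> carrier G" "ginv k \<in> carrier G" using Kc k ki by auto
  have swap: "\<rho> g (\<rho> h v) = \<rho> h (\<rho> g v)" if "g \<in> K" "h \<in> K" "v \<in> carrier H" for g h v
    using that comm[OF that(1,2)] Kc by (simp add: act_mult[symmetric])
  have schurK: "\<exists>c::real. \<forall>v\<in>E. a \<odot> \<rho> k v \<oplus> cnj a \<odot> \<rho> (ginv k) v = of_real c \<odot> v" for a
  proof (rule schur)
    show "sa_op (\<lambda>v. a \<odot> \<rho> k v \<oplus> cnj a \<odot> \<rho> (ginv k) v) (2 * cmod a)"
      unfolding sa_op_def
    proof (intro conjI ballI)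
      fix v assume v: "v \<in> carrier H"
      show "nrm (a \<odot> \<rho> k v \<oplus> cnj a \<odot> \<rho> (ginv k) v) \<le> 2 * cmod a * nrm v"
        using ip_norm_triangle[of "a \<odot> \<rho> k v" "cnj a \<odot> \<rho> (ginv k) v"] v kc by (simp add: nrm_smult act_nrm)
      show "ip H (a \<odot> \<rho> k u \<oplus> cnj a \<odot> \<rho> (ginv k) u) v = ip H u (a \<odot> \<rho> k v \<oplus> cnj a \<odot> \<rho> (ginv k) v)"
        if "u \<in> carrier H" for u
        using that v kc by (simp add: ip_simps act_adjoint)
    qed (use kc in auto)
    show "K \<subseteq> carrier G" using Kc by blast
    show "a \<odot> \<rho> k (\<rho> g v) \<oplus> cnj a \<odot> \<rho> (ginv k) (\<rho> g v) = \<rho> g (a \<odot> \<rho> k v \<oplus> cnj a \<odot> \<rho> (ginv k) v)"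
      if g: "g \<in> K" and v: "v \<in> carrier H" for g v
      using v kc Kc[OF g] swap[OF k g v] swap[OF ki g v] by (simp add: act_add act_smult)
    show "(\<lambda>v. a \<odot> \<rho> k v \<oplus> cnj a \<odot> \<rho> (ginv k) v) ` E \<subseteq> E"
      using Ei[OF k] Ei[OF ki] e(3,4) by blast
    show "\<rho> g ` E \<subseteq> E" if "g \<in> K" for g by (rule Ei[OF that])
    show "W = {\<zero>} \<or> W = E" if "subspace class_ring W H" "closedin mtopology W" "W \<subseteq> E" "\<And>g. g \<in> K \<Longrightarrow> \<rho> g ` W \<subseteq> W" for W
      using min[of W] that by (simp add: closed_invariant_def)
  qed (rule Es)+
  obtain c :: real where c: "\<And>v. v \<in> E \<Longrightarrow> 1 \<odot> \<rho> k v \<oplus> cnj 1 \<odot> \<rho> (ginv k) v = of_real c \<odot> v" using schurK[of 1] by blast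
  obtain d :: real where d: "\<And>v. v \<in> E \<Longrightarrow> \<i> \<odot> \<rho> k v \<oplus> cnj \<i> \<odot> \<rho> (ginv k) v = of_real d \<odot> v" using schurK[of \<i>] by blast
  have "\<rho> k v = ((of_real c - \<i> * of_real d) / 2) \<odot> v" if v: "v \<in> E" for v
  proof (rule ip_ext)
    have vc: "v \<in> carrier H" using v e(1) by blast
    then show "\<rho> k v \<in> carrier H" "((of_real c - \<i> * of_real d) / 2) \<odot> v \<in> carrier H" using kc by auto
    fix z assume z: "z \<in> carrier H"
    have "ip H (\<rho> k v) z + ip H (\<rho> (ginv k) v) z = of_real c * ip H v z"
      using arg_cong[OF c[OF v], of "\<lambda>x. ip H x z"] vc z kc by (simp add: ip_simps)
    moreover have "\<i> * ip H (\<rho> k v) z - \<i> * ip H (\<rho> (ginv k) v) z = of_real d * ip H v z"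
      using arg_cong[OF d[OF v], of "\<lambda>x. ip H x z"] vc z kc by (simp add: ip_simps)
    ultimately have "(of_real c - \<i> * of_real d) * ip H v z
        = (ip H (\<rho> k v) z + ip H (\<rho> (ginv k) v) z) - \<i> * (\<i> * ip H (\<rho> k v) z - \<i> * ip H (\<rho> (ginv k) v) z)"
      by (simp add: algebra_simps)
    also have "\<dots> = 2 * ip H (\<rho> k v) z" by (simp add: algebra_simps)
    finally show "ip H (\<rho> k v) z = ip H (((of_real c - \<i> * of_real d) / 2) \<odot> v) z"
      using vc z by (simp add: ip_smult)
  qed
  then show ?thesis by blast
qed

text \<open>\<open>K\<close> only rescales \<open>v0\<close>, so the whole orbit of
  \<open>v0\<close> lies in the span of finitely many translates, one for each coset. This span is
  invariant and, being finite dimensional, closed.\<close>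

lemma eigenvector_fin_dim:
  assumes v0: "v0 \<in> carrier H" "v0 \<noteq> \<zero>" and ev: "\<And>k. k \<in> K \<Longrightarrow> \<exists>c. \<rho> k v0 = c \<odot> v0"
  shows fin_dim
proof -
  define A where "A = (\<lambda>C. \<rho> (ginv (rp C)) v0) ` (rcosets\<^bsub>G\<^esub> K)"
  have A: "finite A" "A \<subseteq> carrier H" using fin rp_closed v0 by (auto simp: A_def)
  note sp = span_is_subspace[OF A(2)]
  note s = hsubspaceD[OF sp] and own = in_own_span[OF A(2)]
  have act: "\<rho> x v0 \<in> span A" if x: "x \<in> carrier G" for x
  proof -
    \<comment> \<open>With right cosets \<open>K x\<close>, an element of \<open>G\<close> becomes
      an inverse representative times an element of \<open>K\<close> by looking at the coset of its
      inverse.\<close>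
    let ?C = "K #>\<^bsub>G\<^esub> ginv x"
    have C: "?C \<in> rcosets\<^bsub>G\<^esub> K" using G.rcosetsI subgroup.subset[OF K] x by simp
    obtain k where k: "k \<in> K" "rp ?C = k \<cdot> ginv x" using rp_coset[of "ginv x"] x by auto
    have kc: "k \<in> carrier G" using Kc k by simp
    have "x = ginv (rp ?C) \<cdot> k" unfolding k(2) using kc x by (simp add: G.inv_mult_group G.m_assoc)
    then have e: "\<rho> x v0 = \<rho> (ginv (rp ?C)) (\<rho> k v0)"
      using rp_closed[OF C] kc v0 by (metis G.inv_closed act_mult)
    obtain c where c: "\<rho> k v0 = c \<odot> v0" using ev[OF k(1)] by blast
    have "\<rho> x v0 = c \<odot> \<rho> (ginv (rp ?C)) v0" unfolding e c using act_smult rp_closed[OF C] v0 by simp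
    moreover have "\<rho> (ginv (rp ?C)) v0 \<in> span A" using own C by (auto simp: A_def)
    ultimately show ?thesis using s(4) by simp
  qed
  have inv: "\<rho> g ` span A \<subseteq> span A" if g: "g \<in> carrier G" for g
  proof -
    have V: "subspace class_ring {v \<in> carrier H. \<rho> g v \<in> span A} H"
      using s g by (intro hsubspaceI) (auto simp: act_zero act_add act_smult)
    have "A \<subseteq> {v \<in> carrier H. \<rho> g v \<in> span A}"
    proof
      fix a assume "a \<in> A"
      then obtain C where C: "C \<in> rcosets\<^bsub>G\<^esub> K" "a = \<rho> (ginv (rp C)) v0" by (auto simp: A_def)
      have "\<rho> g a = \<rho> (g \<cdot> ginv (rp C)) v0" using C rp_closed g v0 by (simp add: act_mult)
      then show "a \<in> {v \<in> carrier H. \<rho> g v \<in> span A}"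
        using act[of "g \<cdot> ginv (rp C)"] g rp_closed C v0 by simp
    qed
    then have "span A \<subseteq> {v \<in> carrier H. \<rho> g v \<in> span A}" by (rule span_least[OF V])
    then show ?thesis by blast
  qed
  have "closed_invariant (carrier G) (span A)"
    using sp hclosed_span[OF A] inv by (simp add: closed_invariant_def)
  then have "span A = {\<zero>} \<or> span A = carrier H" by (rule irreducible_closed_invariant[OF irr])
  moreover have "v0 \<in> span A" using act[of "\<one>\<^bsub>G\<^esub>"] act_one v0 by simp
  ultimately have "span A = carrier H" using v0(2) by blast
  then show ?thesis unfolding fin_dim_def using A by blast
qed

end

theorem virtually_abelian_fin_dim:
  assumes irr: "irreducible_unitary_rep G H \<rho>" and va: "virtually_abelian G"
  shows fin_dim
proof -
  obtain K where K: "subgroup K G" "comm_group (G\<lparr>carrier := K\<rparr>)" "finite (rcosets\<^bsub>G\<^esub> K)"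
    using va unfolding virtually_abelian_def by blast
  have comm: "x \<cdot> y = y \<cdot> x" if "x \<in> K" "y \<in> K" for x y
    using G.comm_group_subgroup_iff[OF K(1)] K(2) that by blast
  obtain u0 where u0: "u0 \<in> carrier H" "nrm u0 = 1"
    using unit_vector irr by (auto simp: irreducible_unitary_rep_def)
  obtain E where E: "closed_invariant K E" "E \<noteq> {\<zero>}"
    and min: "\<And>W. closed_invariant K W \<Longrightarrow> W \<subseteq> E \<Longrightarrow> W = {\<zero>} \<or> W = E"
    using minimal_closed_invariant[OF irr K(1,3) u0] by blast
  have Es: "subspace class_ring E H" using E by (simp add: closed_invariant_def)
  obtain v0 where v0: "v0 \<in> E" "v0 \<noteq> \<zero>" using E(2) hsubspaceD(2)[OF Es] by blast
  have v0c: "v0 \<in> carrier H" using v0 hsubspaceD(1)[OF Es] by blast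
  show ?thesis
  proof (rule eigenvector_fin_dim[OF irr K(1,3) u0 v0c v0(2)])
    fix k assume "k \<in> K"
    then show "\<exists>c. \<rho> k v0 = c \<odot> v0"
      using abelian_minimal_scalar[OF irr K(1,3) u0 comm E(1) min] v0(1) by blast
  qed
qed

end

subsection \<open>Infinite dimensional representations of groups that are not virtually abelian\<close>

lemma finite_image_factor:
  assumes "finite (F ` X)" "\<And>x y. x \<in> X \<Longrightarrow> y \<in> X \<Longrightarrow> F x = F y \<Longrightarrow> f x = f y"
  shows "finite (f ` X)"
proof (rule finite_subset)
  have "f x = f (inv_into X F (F x))" if x: "x \<in> X" for x
    by (rule assms(2)[OF x]) (use x in \<open>simp_all add: inv_into_into f_inv_into_f\<close>)
  then show "f ` X \<subseteq> (\<lambda>s. f (inv_into X F s)) ` (F ` X)" by fastforce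
  show "finite ((\<lambda>s. f (inv_into X F s)) ` (F ` X))" using assms(1) by simp
qed

text \<open>Gaussian elimination: a multiple of some \<open>d0\<close> with nonzero value at
  \<open>q\<close> is subtracted from every member to clear the coordinate \<open>q\<close>. The
  spanning functions are taken from the family itself because
  \<open>centralizer_finite_index\<close> needs group elements in \<open>D\<close>.\<close>

lemma finite_spanning_family:
  fixes f :: "'d \<Rightarrow> 'p \<Rightarrow> complex"
  assumes "finite P"
  shows "\<exists>E. finite E \<and> E \<subseteq> D \<and> (\<forall>d\<in>D. \<exists>c. \<forall>p\<in>P. f d p = (\<Sum>e\<in>E. c e * f e p))"
  using assms
proof (induction P arbitrary: f rule: finite_induct)
  case empty
  then show ?case by (intro exI[of _ "{}"]) simp
next
  case (insert q P)
  show ?case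
  proof (cases "\<exists>d0\<in>D. f d0 q \<noteq> 0")
    case False
    obtain E where E: "finite E" "E \<subseteq> D" "\<forall>d\<in>D. \<exists>c. \<forall>p\<in>P. f d p = (\<Sum>e\<in>E. c e * f e p)"
      using insert.IH[of f] by blast
    have "(\<Sum>e\<in>E. c e * f e q) = 0" for c using False E(2) by (intro sum.neutral) auto
    then have "\<forall>d\<in>D. \<exists>c. \<forall>p\<in>insert q P. f d p = (\<Sum>e\<in>E. c e * f e p)" using E(3) False by (metis insert_iff)
    then show ?thesis using E by blast
  next
    case True
    then obtain d0 where d0: "d0 \<in> D" "f d0 q \<noteq> 0" by blast
    define r where "r d = f d q / f d0 q" for d
    obtain E where E: "finite E" "E \<subseteq> D"
      "\<forall>d\<in>D. \<exists>c. \<forall>p\<in>P. f d p - r d * f d0 p = (\<Sum>e\<in>E. c e * (f e p - r e * f d0 p))"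
      using insert.IH[of "\<lambda>d p. f d p - r d * f d0 p"] by blast
    have "\<exists>c. \<forall>p\<in>insert q P. f d p = (\<Sum>e\<in>insert d0 E. c e * f e p)" if d: "d \<in> D" for d
    proof -
      obtain c where c: "\<And>p. p \<in> P \<Longrightarrow> f d p - r d * f d0 p = (\<Sum>e\<in>E. c e * (f e p - r e * f d0 p))"
        using E(3) d by blast
      have q: "f e q - r e * f d0 q = 0" for e using d0(2) by (simp add: r_def)
      have eq: "f d p = (\<Sum>e\<in>E. c e * f e p) + (r d - (\<Sum>e\<in>E. c e * r e)) * f d0 p" if p: "p \<in> insert q P" for p
      proof -
        have "f d p - r d * f d0 p = (\<Sum>e\<in>E. c e * (f e p - r e * f d0 p))"
        proof (cases "p = q")
          case True
          have "(\<Sum>e\<in>E. c e * (f e q - r e * f d0 q)) = 0" by (simp only: q mult_zero_right sum.neutral_const)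
          then show ?thesis unfolding True q by (rule sym)
        next
          case False
          then show ?thesis using c p by blast
        qed
        also have "\<dots> = (\<Sum>e\<in>E. c e * f e p) - (\<Sum>e\<in>E. c e * r e) * f d0 p"
          by (simp add: sum_subtractf sum_distrib_right right_diff_distrib mult.assoc)
        finally show ?thesis by (simp add: algebra_simps)
      qed
      define k where "k = r d - (\<Sum>e\<in>E. c e * r e)"
      \<comment> \<open>\<open>d0\<close> may already belong to \<open>E\<close>; its two
        coefficients then add up.\<close>
      have "(\<Sum>e\<in>insert d0 E. ((if e \<in> E then c e else 0) + (if e = d0 then k else 0)) * f e p)
          = (\<Sum>e\<in>E. c e * f e p) + k * f d0 p" for p
      proof -
        have "(\<Sum>e\<in>insert d0 E. ((if e \<in> E then c e else 0) + (if e = d0 then k else 0)) * f e p)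
            = (\<Sum>e\<in>insert d0 E. if e \<in> E then c e * f e p else 0) + (\<Sum>e\<in>insert d0 E. if e = d0 then k * f e p else 0)"
          unfolding sum.distrib[symmetric] by (intro sum.cong) (auto simp: algebra_simps)
        also have "(\<Sum>e\<in>insert d0 E. if e \<in> E then c e * f e p else 0) = (\<Sum>e\<in>E. c e * f e p)"
          using E(1) by (intro sum.mono_neutral_cong_right) auto
        also have "(\<Sum>e\<in>insert d0 E. if e = d0 then k * f e p else 0) = k * f d0 p" using E(1) by simp
        finally show ?thesis .
      qed
      then show ?thesis
        using eq[folded k_def]
        by (intro exI[of _ "\<lambda>e. (if e \<in> E then c e else 0) + (if e = d0 then k else 0)"] ballI) (simp only:)
    qed
    then show ?thesis using E d0(1) by (intro exI[of _ "insert d0 E"]) auto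
  qed
qed

lemma fform_filter:
  "fform k (filter (\<lambda>p. P (snd p)) l) (filter (\<lambda>p. P (snd p)) m) = fform (\<lambda>x y. if P x \<and> P y then k x y else 0) l m"
  unfolding fform_def sum_list_map_filter'
  by (intro arg_cong[of _ _ sum_list] map_cong refl) (auto simp: case_prod_unfold intro!: arg_cong[of _ _ sum_list])

lemma fform_kernel_sum: "finite S \<Longrightarrow> fform (\<lambda>x y. \<Sum>s\<in>S. k s x y) l m = (\<Sum>s\<in>S. fform (k s) l m)"
proof (induction S rule: finite_induct)
  case empty
  have "fform (\<lambda>x y. 0) l m = 0 * fform (\<lambda>x y. 0) l m" by (subst fform_kernel_mult[symmetric]) simp
  then show ?case by simp
qed (simp add: fform_kernel_add)

text \<open>The truncated form is the sum of the original form over the blocks of the list. With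
  cosets of a normal subgroup as blocks, it shows that a positive definite function restricted to
  that subgroup and extended by 0 stays positive definite.\<close>

lemma pd_kernel_partition:
  assumes "pd_kernel X k"
  shows "pd_kernel X (\<lambda>x y. if c x = c y then k x y else 0)"
proof -
  interpret pd_kernel X k by fact
  have "fform (\<lambda>x y. if c x = c y then k x y else 0) l l
      = (\<Sum>s\<in>c ` fsupp l. fform k (filter (\<lambda>p. c (snd p) = s) l) (filter (\<lambda>p. c (snd p) = s) l))" for l
  proof -
    have fin: "finite (c ` fsupp l)" by (simp add: fsupp_def)
    have "fform k (filter (\<lambda>p. c (snd p) = s) l) (filter (\<lambda>p. c (snd p) = s) l)
        = fform (\<lambda>x y. if c x = s \<and> c y = s then k x y else 0) l l" for s
      by (rule fform_filter[where P = "\<lambda>x. c x = s"])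
    then have "(\<Sum>s\<in>c ` fsupp l. fform k (filter (\<lambda>p. c (snd p) = s) l) (filter (\<lambda>p. c (snd p) = s) l))
        = fform (\<lambda>x y. \<Sum>s\<in>c ` fsupp l. if c x = s \<and> c y = s then k x y else 0) l l"
      by (simp only: fform_kernel_sum[OF fin])
    moreover have "fform (\<lambda>x y. if c x = c y then k x y else 0) l l
        = fform (\<lambda>x y. \<Sum>s\<in>c ` fsupp l. if c x = s \<and> c y = s then k x y else 0) l l"
    proof (rule fform_cong)
      fix x y assume xy: "x \<in> fsupp l" "y \<in> fsupp l"
      have "(\<Sum>s\<in>c ` fsupp l. if c x = s \<and> c y = s then k x y else 0)
          = (\<Sum>s\<in>c ` fsupp l. if s = c x then (if c x = c y then k x y else 0) else 0)"
        by (intro sum.cong) auto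
      also have "\<dots> = (if c x = c y then k x y else 0)" using fin xy by simp
      finally show "(if c x = c y then k x y else 0) = (\<Sum>s\<in>c ` fsupp l. if c x = s \<and> c y = s then k x y else 0)" by simp
    qed
    ultimately show ?thesis by simp
  qed
  moreover have "fsupp (filter P l) \<subseteq> X" if "fsupp l \<subseteq> X" for P l using that by (auto simp: fsupp_def)
  ultimately show ?thesis
    by (intro pd_kernel.intro) (simp_all add: fform_Im sum_nonneg fform_nonneg)
qed

lemma fform_unit_list:
  "distinct ys \<Longrightarrow> fform k (map (\<lambda>y. (1, y)) ys) (map (\<lambda>y. (1, y)) ys) = (\<Sum>x\<in>set ys. \<Sum>y\<in>set ys. k x y)"
  by (simp add: fform_def o_def sum_list_distinct_conv_sum_set)

section \<open>The FC-centre and elements acting close to the identity\<close>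

context group
begin

lemma coset_eq_iff:
  assumes "subgroup K G" "x \<in> carrier G" "y \<in> carrier G"
  shows "K #> x = K #> y \<longleftrightarrow> x \<otimes> inv y \<in> K"
proof -
  have Ks: "K \<subseteq> carrier G" using subgroup.subset[OF assms(1)] .
  have c: "x \<otimes> inv y \<in> carrier G" using assms by simp
  show ?thesis
    using coset_mult_inv1[OF _ assms(2,3) Ks] coset_mult_inv2[OF _ assms(2,3) Ks]
      coset_join1[OF _ c assms(1)] coset_join2[OF c assms(1)] by blast
qed

lemma normal_coset_eq_iff:
  assumes N: "N \<lhd> G" and c: "x \<in> carrier G" "y \<in> carrier G"
  shows "N #> x = N #> y \<longleftrightarrow> inv y \<otimes> x \<in> N"
proof -
  note n = normalD[OF N]
  have "x \<otimes> inv y = cj y (inv y \<otimes> x)" "inv y \<otimes> x = cj (inv y) (x \<otimes> inv y)"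
    using c by (simp_all add: m_assoc)
  then have "x \<otimes> inv y \<in> N \<longleftrightarrow> inv y \<otimes> x \<in> N" using n(6) c inv_closed by metis
  then show ?thesis using coset_eq_iff[OF n(1) c] by simp
qed

lemma rcosets_image: "rcosets K = (\<lambda>x. K #> x) ` carrier G"
  by (auto simp: RCOSETS_def)

definition fc_center :: "'a set" where
  "fc_center = {g \<in> carrier G. finite (conj_class G g)}"

lemma fc_center_normal: "fc_center \<lhd> G"
proof (rule normalI')
  have "conj_class G \<one> \<subseteq> {\<one>}" by (auto simp: conj_class_def)
  then show "\<one> \<in> fc_center" using finite_subset by (auto simp: fc_center_def)
  fix x assume x: "x \<in> fc_center"
  then have xc: "x \<in> carrier G" and xf: "finite (conj_class G x)" by (auto simp: fc_center_def)
  have "conj_class G (inv x) \<subseteq> m_inv G ` conj_class G x" using xc by (auto simp: conj_class_def cj_inv)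
  then show "inv x \<in> fc_center" using xc xf finite_surj by (auto simp: fc_center_def)
  show "cj g x \<in> fc_center" if g: "g \<in> carrier G" for g
  proof -
    have "conj_class G (cj g x) \<subseteq> conj_class G x" using xc g by (auto simp: conj_class_def cj_comp)
    then show ?thesis using xc g xf finite_subset by (auto simp: fc_center_def)
  qed
  fix y assume y: "y \<in> fc_center"
  then have yc: "y \<in> carrier G" and yf: "finite (conj_class G y)" by (auto simp: fc_center_def)
  have "conj_class G (x \<otimes> y) \<subseteq> (\<lambda>(a, b). a \<otimes> b) ` (conj_class G x \<times> conj_class G y)"
    using xc yc by (auto simp: conj_class_def cj_mult)
  then have "finite (conj_class G (x \<otimes> y))" using xf yf finite_subset by blast
  then show "x \<otimes> y \<in> fc_center" using xc yc by (simp add: fc_center_def)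
qed (auto simp: fc_center_def)

definition centralizer_of :: "'a set \<Rightarrow> 'a set" where
  "centralizer_of D = {x \<in> carrier G. \<forall>d\<in>D. cj x d = d}"

lemma centralizer_subgroup: assumes "D \<subseteq> carrier G" shows "subgroup (centralizer_of D) G"
proof (rule subgroupI)
  have Dc: "d \<in> D \<Longrightarrow> d \<in> carrier G" for d using assms by blast
  show "centralizer_of D \<noteq> {}" using Dc by (auto simp: centralizer_of_def intro!: exI[of _ \<one>])
  fix x assume x: "x \<in> centralizer_of D"
  then have xc: "x \<in> carrier G" and xd: "\<And>d. d \<in> D \<Longrightarrow> cj x d = d" by (auto simp: centralizer_of_def)
  have "cj (inv x) d = d" if d: "d \<in> D" for d
  proof -
    have "cj (inv x) d = cj (inv x) (cj x d)" using xd[OF d] by simp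
    also have "\<dots> = d" using xc Dc[OF d] by (simp add: m_assoc)
    finally show ?thesis .
  qed
  then show "inv x \<in> centralizer_of D" using xc by (simp add: centralizer_of_def)
  fix y assume y: "y \<in> centralizer_of D"
  then have yc: "y \<in> carrier G" and yd: "\<And>d. d \<in> D \<Longrightarrow> cj y d = d" by (auto simp: centralizer_of_def)
  have "cj (x \<otimes> y) d = d" if d: "d \<in> D" for d
    using cj_comp[OF xc yc Dc[OF d]] xd[OF d] yd[OF d] by simp
  then show "x \<otimes> y \<in> centralizer_of D" using xc yc by (simp add: centralizer_of_def)
qed (auto simp: centralizer_of_def)

text \<open>The centraliser of \<open>fc_center\<close> meets \<open>fc_center\<close> in an abelian
  subgroup, whose index would be finite if both indices were.\<close>

lemma infinite_fc_center_cosets: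
  assumes nva: "\<not> virtually_abelian G" and fin: "finite ((\<lambda>x. centralizer_of fc_center #> x) ` carrier G)"
  shows "infinite ((\<lambda>x. fc_center #> x) ` carrier G)"
proof
  let ?C = "centralizer_of fc_center"
  note d = normalD[OF fc_center_normal]
  assume f: "finite ((\<lambda>x. fc_center #> x) ` carrier G)"
  have C: "subgroup ?C G" by (rule centralizer_subgroup[OF d(2)])
  have K: "subgroup (?C \<inter> fc_center) G" by (rule subgroups_Inter_pair[OF C d(1)])
  have "finite ((\<lambda>x. (?C #> x, fc_center #> x)) ` carrier G)"
    by (rule finite_subset[OF _ finite_cartesian_product[OF fin f]]) auto
  then have "finite ((\<lambda>x. (?C \<inter> fc_center) #> x) ` carrier G)"
    by (rule finite_image_factor) (simp add: coset_eq_iff[OF C] coset_eq_iff[OF d(1)] coset_eq_iff[OF K])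
  moreover have "x \<otimes> y = y \<otimes> x" if "x \<in> ?C \<inter> fc_center" "y \<in> ?C \<inter> fc_center" for x y
    using that commute_iff d(2) by (auto simp: centralizer_of_def)
  then have "comm_group (G\<lparr>carrier := ?C \<inter> fc_center\<rparr>)" using comm_group_subgroup_iff[OF K] by blast
  ultimately show False using nva K unfolding virtually_abelian_def rcosets_image by blast
qed

lemma ltrans_comp:
  "g \<in> carrier G \<Longrightarrow> h \<in> carrier G \<Longrightarrow> fsupp l \<subseteq> carrier G \<Longrightarrow> ltrans G g (ltrans G h l) = ltrans G (g \<otimes> h) l"
  by (induction l) (auto simp: ltrans_def case_prod_unfold m_assoc)

lemma ltrans_one: "fsupp l \<subseteq> carrier G \<Longrightarrow> ltrans G \<one> l = l"
  by (induction l) (auto simp: ltrans_def case_prod_unfold)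

context
  fixes \<psi> :: "'a \<Rightarrow> complex"
  assumes st: "state G \<psi>"
begin

interpretation P: pd_kernel "carrier G" "\<lambda>x y. \<psi> (inv y \<otimes> x)"
  using st by (simp add: state_def posdef_def)

definition snorm :: "(complex \<times> 'a) list \<Rightarrow> real" where
  "snorm = fnorm (\<lambda>x y. \<psi> (inv y \<otimes> x))"

text \<open>In the GNS representation of \<open>\<psi>\<close> this bounds the operator norm of
  \<open>g\<close> minus the identity by \<open>e\<close>.\<close>

definition near_one :: "real \<Rightarrow> 'a \<Rightarrow> bool" where
  "near_one e g \<longleftrightarrow> (\<forall>l. fsupp l \<subseteq> carrier G \<longrightarrow> snorm (fdiff (ltrans G g l) l) \<le> e * snorm l)"

lemma state_cnj: "x \<in> carrier G \<Longrightarrow> \<psi> (inv x) = cnj (\<psi> x)"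
  using P.kernel_cnj[of x \<one>] by simp

text \<open>In the GNS space \<open>\<psi> m = 1\<close> means that \<open>m\<close> fixes the
  cyclic vector: the combination \<open>m - \<one>\<close> has norm 0 and is orthogonal to
  everything.\<close>

lemma state_one_mult:
  assumes m: "m \<in> carrier G" "\<psi> m = 1" and y: "y \<in> carrier G"
  shows "\<psi> (y \<otimes> m) = \<psi> y"
proof -
  let ?l = "fdiff [(1, m)] [(1, \<one>)]"
  have "fform (\<lambda>x y. \<psi> (inv y \<otimes> x)) ?l ?l = 0"
    using m st state_cnj[OF m(1)] by (simp add: fform_def fscale_def state_def)
  then have "cmod (fform (\<lambda>x y. \<psi> (inv y \<otimes> x)) ?l [(1, inv y)]) \<le> 0"
    using P.fform_CS[of ?l "[(1, inv y)]"] m y by (simp add: fnorm_def)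
  then show ?thesis using y by (simp add: fform_def fscale_def)
qed

lemma state_kernel_normal: "{m \<in> carrier G. \<forall>x\<in>carrier G. \<psi> (cj x m) = 1} \<lhd> G"
proof (rule normalI')
  show "\<one> \<in> {m \<in> carrier G. \<forall>x\<in>carrier G. \<psi> (cj x m) = 1}" using st by (simp add: state_def)
  fix m assume "m \<in> {m \<in> carrier G. \<forall>x\<in>carrier G. \<psi> (cj x m) = 1}"
  then have m: "m \<in> carrier G" "\<And>x. x \<in> carrier G \<Longrightarrow> \<psi> (cj x m) = 1" by auto
  show "inv m \<in> {m \<in> carrier G. \<forall>x\<in>carrier G. \<psi> (cj x m) = 1}"
    using m state_cnj by (simp add: cj_inv)
  show "cj g m \<in> {m \<in> carrier G. \<forall>x\<in>carrier G. \<psi> (cj x m) = 1}" if g: "g \<in> carrier G" for g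
    using m g by (simp add: cj_comp)
  fix n assume "n \<in> {m \<in> carrier G. \<forall>x\<in>carrier G. \<psi> (cj x m) = 1}"
  then have n: "n \<in> carrier G" "\<And>x. x \<in> carrier G \<Longrightarrow> \<psi> (cj x n) = 1" by auto
  have "\<psi> (cj x (m \<otimes> n)) = 1" if x: "x \<in> carrier G" for x
    unfolding cj_mult[OF x m(1) n(1)] using state_one_mult[of "cj x n" "cj x m"] x m n by simp
  then show "m \<otimes> n \<in> {m \<in> carrier G. \<forall>x\<in>carrier G. \<psi> (cj x m) = 1}" using m n by simp
qed auto

lemma snorm_ltrans: "g \<in> carrier G \<Longrightarrow> fsupp l \<subseteq> carrier G \<Longrightarrow> snorm (ltrans G g l) = snorm l"
  by (simp add: snorm_def fnorm_def gform_ltrans)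

lemma snorm_fdiff_sq:
  assumes "fsupp l \<subseteq> carrier G" "fsupp m \<subseteq> carrier G"
  shows "(snorm (fdiff l m))\<^sup>2 = (snorm l)\<^sup>2 + (snorm m)\<^sup>2 - 2 * Re (fform (\<lambda>x y. \<psi> (inv y \<otimes> x)) l m)"
proof -
  have "fsupp (fdiff l m) \<subseteq> carrier G" using assms by simp
  then show ?thesis
    using P.fnorm_sq[of "fdiff l m"] P.fnorm_sq[OF assms(1)] P.fnorm_sq[OF assms(2)] P.fform_cnj[OF assms]
    by (simp add: snorm_def algebra_simps)
qed

text \<open>The GNS vectors of \<open>y\<close> and \<open>g \<otimes> y\<close> are unit vectors
  with inner product \<open>\<psi> (cj (inv y) g)\<close>, so this real part is controlled by their
  distance.\<close>

lemma near_single: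
  assumes g: "g \<in> carrier G" "near_one e g" and y: "y \<in> carrier G"
  shows "1 - e\<^sup>2 / 2 \<le> Re (\<psi> (cj (inv y) g))"
proof -
  let ?l = "[(1, y)]"
  have l: "fsupp ?l \<subseteq> carrier G" "fsupp (fdiff (ltrans G g ?l) ?l) \<subseteq> carrier G"
    using y g by (auto simp: fsupp_ltrans)
  have "snorm ?l = 1" using st y by (simp add: snorm_def fnorm_def fform_def state_def)
  moreover have "fform (\<lambda>x y. \<psi> (inv y \<otimes> x)) (ltrans G g ?l) ?l = \<psi> (cj (inv y) g)"
    using g y by (simp add: fform_def ltrans_def m_assoc)
  ultimately have "(snorm (fdiff (ltrans G g ?l) ?l))\<^sup>2 = 2 - 2 * Re (\<psi> (cj (inv y) g))"
    using snorm_fdiff_sq[OF fsupp_ltrans_closed[OF g(1) l(1)] l(1)] snorm_ltrans[OF g(1) l(1)] by simp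
  moreover have "snorm (fdiff (ltrans G g ?l) ?l) \<le> e" using g(2) l(1) \<open>snorm ?l = 1\<close> unfolding near_one_def by fastforce
  then have "(snorm (fdiff (ltrans G g ?l) ?l))\<^sup>2 \<le> e\<^sup>2"
    using P.fnorm_nonneg[OF l(2)] by (intro power_mono) (auto simp: snorm_def)
  ultimately show ?thesis by simp
qed

lemma near_mult:
  assumes g: "g \<in> carrier G" "near_one e g" and h: "h \<in> carrier G" "near_one d h"
  shows "near_one (e + d) (g \<otimes> h)"
  unfolding near_one_def
proof (intro allI impI)
  fix l assume l: "fsupp l \<subseteq> carrier G"
  let ?h = "ltrans G h l" and ?g = "ltrans G g l"
  have s: "fsupp ?h \<subseteq> carrier G" "fsupp ?g \<subseteq> carrier G" "fsupp (ltrans G g ?h) \<subseteq> carrier G"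
    using fsupp_ltrans_closed g h l by auto
  have "snorm (fdiff (ltrans G (g \<otimes> h) l) l) \<le> snorm (fdiff (ltrans G g ?h) ?h) + snorm (fdiff ?h l)"
    using P.fnorm_triangle[OF s(3,1) l] ltrans_comp[OF g(1) h(1) l] by (simp add: snorm_def)
  also have "\<dots> \<le> e * snorm ?h + d * snorm l" using g(2) h(2) s l unfolding near_one_def by (intro add_mono) auto
  finally show "snorm (fdiff (ltrans G (g \<otimes> h) l) l) \<le> (e + d) * snorm l"
    using snorm_ltrans[OF h(1) l] by (simp add: distrib_right)
qed

lemma near_conj:
  assumes g: "g \<in> carrier G" "near_one e g" and x: "x \<in> carrier G"
  shows "near_one e (cj x g)"
  unfolding near_one_def
proof (intro allI impI)
  fix l assume l: "fsupp l \<subseteq> carrier G"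
  let ?m = "ltrans G (inv x) l"
  have m: "fsupp ?m \<subseteq> carrier G" "fsupp (ltrans G g ?m) \<subseteq> carrier G" using fsupp_ltrans_closed g x l by auto
  have "fdiff (ltrans G (cj x g) l) l = ltrans G x (fdiff (ltrans G g ?m) ?m)"
    using g x l m by (simp add: ltrans_simps ltrans_comp ltrans_one m_assoc)
  then have "snorm (fdiff (ltrans G (cj x g) l) l) = snorm (fdiff (ltrans G g ?m) ?m)" using snorm_ltrans[OF x] m by simp
  also have "\<dots> \<le> e * snorm ?m" using g(2) m(1) unfolding near_one_def by blast
  finally show "snorm (fdiff (ltrans G (cj x g) l) l) \<le> e * snorm l" using snorm_ltrans l x by simp
qed

lemma near_inv:
  assumes g: "g \<in> carrier G" "near_one e g"
  shows "near_one e (inv g)"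
  unfolding near_one_def
proof (intro allI impI)
  fix l assume l: "fsupp l \<subseteq> carrier G"
  let ?m = "ltrans G (inv g) l"
  have m: "fsupp ?m \<subseteq> carrier G" using fsupp_ltrans_closed g l by auto
  have "snorm (fdiff ?m l) = snorm (fdiff (ltrans G g ?m) ?m)"
    using P.fnorm_fdiff_commute[OF m l] g l by (simp add: snorm_def ltrans_comp ltrans_one)
  also have "\<dots> \<le> e * snorm ?m" using g(2) m unfolding near_one_def by blast
  finally show "snorm (fdiff ?m l) \<le> e * snorm l" using snorm_ltrans l g by simp
qed

text \<open>If all powers of \<open>z\<close> are close to the identity then so are their averages, which map
  \<open>u = z l - l\<close> to almost 0.\<close>

lemma near_powers_trivial:
  assumes z: "z \<in> carrier G" and near_one: "\<And>k::nat. near_one (1/4) (z [^] k)" and y: "y \<in> carrier G"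
  shows "\<psi> (cj y z) = 1"
proof -
  let ?k = "\<lambda>x y. \<psi> (inv y \<otimes> x)"
  let ?l = "[(1, inv y)]"
  define u where "u = fdiff (ltrans G z ?l) ?l"
  have l: "fsupp ?l \<subseteq> carrier G" using y by simp
  have u: "fsupp u \<subseteq> carrier G" using y z by (auto simp: u_def fsupp_ltrans)
  define s where "s k = Re (fform ?k (ltrans G (z [^] k) ?l) u)" for k :: nat
  have zk: "z [^] k \<in> carrier G" for k :: nat using z by simp
  \<comment> \<open>The difference is the inner product of the \<open>k\<close>-th translate of
    \<open>u\<close> with \<open>u\<close>, at least 31/32 of the squared norm by nearness. The
    cruder factor 1/2 already makes \<open>s\<close> grow linearly unless \<open>u\<close> has norm
    0, while \<open>s\<close> is bounded.\<close>
  have step: "(snorm u)\<^sup>2 / 2 \<le> s (Suc k) - s k" for k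
  proof -
    let ?v = "ltrans G (z [^] k) u"
    have v: "fsupp ?v \<subseteq> carrier G" by (rule fsupp_ltrans_closed[OF zk u])
    have d: "fsupp (fdiff ?v u) \<subseteq> carrier G" using v u by simp
    have "ltrans G (z [^] k) (ltrans G z ?l) = ltrans G (z [^] Suc k) ?l"
      using ltrans_comp[OF zk z l] by simp
    then have sv: "s (Suc k) - s k = Re (fform ?k ?v u)"
      by (simp add: s_def u_def ltrans_simps)
    have "snorm (fdiff ?v u) \<le> 1/4 * snorm u" using near_one u unfolding near_one_def by blast
    then have "(snorm (fdiff ?v u))\<^sup>2 \<le> (1/4 * snorm u)\<^sup>2"
      using P.fnorm_nonneg[OF d] by (intro power_mono) (auto simp: snorm_def)
    moreover note snorm_fdiff_sq[OF v u]
    ultimately have "(snorm u)\<^sup>2 + (snorm u)\<^sup>2 - 2 * Re (fform ?k ?v u) \<le> (snorm u)\<^sup>2 / 16"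
      using snorm_ltrans[OF zk u] by (simp add: power_mult_distrib power2_eq_square)
    moreover have "0 \<le> (snorm u)\<^sup>2" by simp
    ultimately show ?thesis unfolding sv by linarith
  qed
  have sb: "\<bar>s k\<bar> \<le> snorm ?l * snorm u" for k
  proof -
    have "\<bar>s k\<bar> \<le> cmod (fform ?k (ltrans G (z [^] k) ?l) u)" unfolding s_def by (rule abs_Re_le_cmod)
    also have "\<dots> \<le> snorm (ltrans G (z [^] k) ?l) * snorm u"
      unfolding snorm_def by (rule P.fform_CS[OF fsupp_ltrans_closed[OF zk l] u])
    finally show ?thesis unfolding snorm_ltrans[OF zk l] .
  qed
  have "real n * ((snorm u)\<^sup>2 / 2) \<le> s n - s 0" for n
  proof (induction n)
    case (Suc n)
    have "real (Suc n) * ((snorm u)\<^sup>2 / 2) = real n * ((snorm u)\<^sup>2 / 2) + (snorm u)\<^sup>2 / 2" by (simp add: algebra_simps)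
    then show ?case using Suc step[of n] by linarith
  qed simp
  then have bound: "real n * ((snorm u)\<^sup>2 / 2) \<le> 2 * (snorm ?l * snorm u)" for n
    using sb[of n] sb[of 0] order_trans[of "real n * ((snorm u)\<^sup>2 / 2)" "s n - s 0"] by fastforce
  have "(snorm u)\<^sup>2 \<le> 0"
  proof (rule ccontr)
    assume "\<not> ?thesis"
    then have "0 < (snorm u)\<^sup>2 / 2" by simp
    then obtain n where "2 * (snorm ?l * snorm u) < real n * ((snorm u)\<^sup>2 / 2)" using ex_less_of_nat_mult by blast
    then show False using bound[of n] by simp
  qed
  then have N0: "snorm u = 0" by simp
  have "cmod (fform ?k u [(1, inv y)]) \<le> 0"
    using P.fform_CS[OF u l] N0 by (simp add: snorm_def)
  moreover have "inv (inv y) \<otimes> (z \<otimes> inv y) = cj y z" using y z by (simp add: m_assoc)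
  ultimately show ?thesis using y st by (simp add: u_def fform_def fscale_def ltrans_def state_def)
qed

end

end

context urep
begin

text \<open>In finite dimension the operators of \<open>D\<close> are combinations of those of a
  finite \<open>E \<subseteq> D\<close>. By faithfulness an element centralising \<open>E\<close>
  centralises \<open>D\<close>, and the members of \<open>E\<close> have finitely many
  conjugates.\<close>

lemma centralizer_finite_index:
  assumes f: "faithful_irreducible_unitary_rep G H \<rho>" and fd: fin_dim
    and D: "D \<subseteq> carrier G" "\<And>d. d \<in> D \<Longrightarrow> finite (conj_class G d)"
  shows "finite ((\<lambda>x. G.centralizer_of D #>\<^bsub>G\<^esub> x) ` carrier G)"
proof -
  obtain A where A: "finite A" "A \<subseteq> carrier H" "span A = carrier H" using fd unfolding fin_dim_def by blast
  obtain E where E: "finite E" "E \<subseteq> D"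
    "\<forall>d\<in>D. \<exists>c. \<forall>p\<in>A \<times> A. ip H (\<rho> d (fst p)) (snd p) = (\<Sum>e\<in>E. c e * ip H (\<rho> e (fst p)) (snd p))"
    using finite_spanning_family[of "A \<times> A" D "\<lambda>d p. ip H (\<rho> d (fst p)) (snd p)"] A(1) by auto
  have Dc: "d \<in> D \<Longrightarrow> d \<in> carrier G" for d using D(1) by blast
  have Ec: "e \<in> E \<Longrightarrow> e \<in> carrier G" for e using E(2) Dc by blast
  have cent: "G.cj x d = d" if x: "x \<in> carrier G" and xe: "\<And>e. e \<in> E \<Longrightarrow> G.cj x e = e" and d: "d \<in> D" for x d
  proof -
    obtain c where c: "\<And>a b. a \<in> A \<Longrightarrow> b \<in> A \<Longrightarrow> ip H (\<rho> d a) b = (\<Sum>e\<in>E. c e * ip H (\<rho> e a) b)"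
      using E(3) d by fastforce
    have 1: "ip H (\<rho> d u) b = (\<Sum>e\<in>E. c e * ip H (\<rho> e u) b)" if b: "b \<in> A" and u: "u \<in> carrier H" for u b
    proof -
      have bc: "b \<in> carrier H" using b A(2) by blast
      have "subspace class_ring {u \<in> carrier H. ip H (\<rho> d u) b = (\<Sum>e\<in>E. c e * ip H (\<rho> e u) b)} H"
        using bc Dc[OF d] Ec
        by (intro hsubspaceI)
          (auto simp: act_zero act_add act_smult ip_simps sum.distrib sum_distrib_left algebra_simps cong: sum.cong)
      moreover have "A \<subseteq> {u \<in> carrier H. ip H (\<rho> d u) b = (\<Sum>e\<in>E. c e * ip H (\<rho> e u) b)}"
        using c b A(2) by blast
      ultimately show ?thesis using span_least u A(3) by blast
    qed
    have 2: "ip H (\<rho> d u) w = (\<Sum>e\<in>E. c e * ip H (\<rho> e u) w)" if w: "w \<in> carrier H" and u: "u \<in> carrier H" for u w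
    proof -
      have "subspace class_ring {w \<in> carrier H. ip H (\<rho> d u) w = (\<Sum>e\<in>E. c e * ip H (\<rho> e u) w)} H"
        using u Dc[OF d] Ec
        by (intro hsubspaceI)
          (auto simp: ip_simps sum.distrib sum_distrib_left algebra_simps cong: sum.cong)
      moreover have "A \<subseteq> {w \<in> carrier H. ip H (\<rho> d u) w = (\<Sum>e\<in>E. c e * ip H (\<rho> e u) w)}"
        using 1 u A(2) by blast
      ultimately show ?thesis using span_least w A(3) by blast
    qed
    have cjip: "ip H (\<rho> (G.cj x e) u) w = ip H (\<rho> e (\<rho> (ginv x) u)) (\<rho> (ginv x) w)"
      if "e \<in> carrier G" "u \<in> carrier H" "w \<in> carrier H" for e u w
      using that x by (simp add: act_mult act_adjoint)
    have "\<rho> (G.cj x d) u = \<rho> d u" if u: "u \<in> carrier H" for u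
    proof (rule ip_ext)
      show "\<rho> (G.cj x d) u \<in> carrier H" "\<rho> d u \<in> carrier H" using x Dc[OF d] u by auto
      fix w assume w: "w \<in> carrier H"
      have "ip H (\<rho> (G.cj x d) u) w = (\<Sum>e\<in>E. c e * ip H (\<rho> e (\<rho> (ginv x) u)) (\<rho> (ginv x) w))"
        unfolding cjip[OF Dc[OF d] u w] using 2 x u w by simp
      also have "\<dots> = (\<Sum>e\<in>E. c e * ip H (\<rho> e u) w)"
      proof (rule sum.cong[OF refl])
        fix e assume e: "e \<in> E"
        show "c e * ip H (\<rho> e (\<rho> (ginv x) u)) (\<rho> (ginv x) w) = c e * ip H (\<rho> e u) w"
          using cjip[OF Ec[OF e] u w] xe[OF e] by simp
      qed
      finally show "ip H (\<rho> (G.cj x d) u) w = ip H (\<rho> d u) w" using 2 u w by simp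
    qed
    then have "\<rho> (ginv d \<cdot> G.cj x d) u = u" if "u \<in> carrier H" for u
      using that x Dc[OF d] act_mult[of "ginv d" "G.cj x d" u] act_inv(1)[of d u] by simp
    then have "ginv d \<cdot> G.cj x d = \<one>\<^bsub>G\<^esub>"
      using faithful_moves[OF f, of "ginv d \<cdot> G.cj x d"] x Dc[OF d] by auto
    then show ?thesis using G.eq_if_inv_mult_one x Dc[OF d] by simp
  qed
  \<comment> \<open>The inverse occurs because elements in the same right coset of the centraliser
    have the same conjugates \<open>cj (ginv x) e\<close>.\<close>
  have fin: "finite ((\<lambda>x. \<lambda>e\<in>E. G.cj (ginv x) e) ` carrier G)"
  proof (rule finite_subset)
    show "(\<lambda>x. \<lambda>e\<in>E. G.cj (ginv x) e) ` carrier G \<subseteq> (\<Pi>\<^sub>E e\<in>E. conj_class G e)"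
    proof clarsimp
      fix x e assume "x \<in> carrier G" "e \<in> E"
      then show "ginv x \<cdot> e \<cdot> x \<in> conj_class G e"
        unfolding conj_class_def by (intro image_eqI[of _ _ "ginv x"]) auto
    qed
    show "finite (\<Pi>\<^sub>E e\<in>E. conj_class G e)" using E(1,2) D(2) by (intro finite_PiE) auto
  qed
  show ?thesis
  proof (rule finite_image_factor[OF fin])
    fix x y assume xy: "x \<in> carrier G" "y \<in> carrier G"
      and eq: "(\<lambda>e\<in>E. G.cj (ginv x) e) = (\<lambda>e\<in>E. G.cj (ginv y) e)"
    have "G.cj (x \<cdot> ginv y) e = e" if e: "e \<in> E" for e
    proof -
      have "G.cj (x \<cdot> ginv y) e = G.cj x (G.cj (ginv y) e)"
        using xy Ec[OF e] by (intro G.cj_comp[symmetric]) auto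
      also have "G.cj (ginv y) e = G.cj (ginv x) e" using fun_cong[OF eq, of e] e by simp
      also have "G.cj x (G.cj (ginv x) e) = e" using xy Ec[OF e] by (simp add: G.m_assoc)
      finally show ?thesis .
    qed
    then have "x \<cdot> ginv y \<in> G.centralizer_of D"
      using cent[of "x \<cdot> ginv y"] xy by (simp add: G.centralizer_of_def)
    then show "G.centralizer_of D #>\<^bsub>G\<^esub> x = G.centralizer_of D #>\<^bsub>G\<^esub> y"
      using G.coset_eq_iff[OF G.centralizer_subgroup[OF D(1)] xy] by simp
  qed
qed

end

lemma fform_const: "fform (\<lambda>x y. 1) l m = sum_list (map fst l) * cnj (sum_list (map fst m))"
proof (induction l)
  case (Cons p l)
  have "fform (\<lambda>x y. 1) [p] m = fst p * cnj (sum_list (map fst m))"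
    by (induction m) (auto simp: fform_def case_prod_unfold algebra_simps)
  then show ?case using Cons by (simp add: fform_Cons_left[of _ p l] algebra_simps)
qed simp

lemma sum_list_fst_fscale: "sum_list (map fst (fscale c l)) = c * sum_list (map fst l)"
  by (induction l) (auto simp: fscale_def algebra_simps)

lemma bounded_family_pigeonhole:
  fixes f :: "'x \<Rightarrow> 'p \<Rightarrow> complex"
  assumes X: "infinite X" and P: "finite P" and b: "\<And>x p. x \<in> X \<Longrightarrow> p \<in> P \<Longrightarrow> cmod (f x p) \<le> 1" and e: "e > 0"
  shows "\<exists>x\<in>X. \<exists>y\<in>X. x \<noteq> y \<and> (\<forall>p\<in>P. cmod (f x p - f y p) \<le> e)"
proof -
  \<comment> \<open>A grid of mesh at most \<open>e / 2\<close>, so that real and imaginary parts in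
    the same cell each differ by at most \<open>e / 2\<close>.\<close>
  define n where "n = \<lceil>2 / e\<rceil>"
  have n: "2 / e \<le> real_of_int n" "0 < real_of_int n"
    unfolding n_def using e by (auto intro: less_le_trans[of 0 "2/e"])
  define F where "F x = (\<lambda>p\<in>P. (\<lfloor>n * Re (f x p)\<rfloor>, \<lfloor>n * Im (f x p)\<rfloor>))" for x
  have fl: "\<lfloor>real_of_int n * t\<rfloor> \<in> {-n..n}" if "\<bar>t\<bar> \<le> 1" for t :: real
  proof -
    have "\<bar>real_of_int n * t\<bar> \<le> real_of_int n" using that n(2) by (simp add: abs_mult mult_left_le)
    then show ?thesis by (auto simp: le_floor_iff floor_le_iff)
  qed
  have "F ` X \<subseteq> (\<Pi>\<^sub>E p\<in>P. {-n..n} \<times> {-n..n})"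
  proof
    fix h assume "h \<in> F ` X"
    then obtain x where x: "x \<in> X" "h = F x" by blast
    have "\<bar>Re (f x p)\<bar> \<le> 1" "\<bar>Im (f x p)\<bar> \<le> 1" if "p \<in> P" for p
      using b[OF x(1) that] abs_Re_le_cmod[of "f x p"] abs_Im_le_cmod[of "f x p"] by auto
    then show "h \<in> (\<Pi>\<^sub>E p\<in>P. {-n..n} \<times> {-n..n})" unfolding x(2) F_def using fl by auto
  qed
  moreover have "finite (\<Pi>\<^sub>E p\<in>P. {-n..n} \<times> {-n..n})" using P by (intro finite_PiE) auto
  ultimately have "finite (F ` X)" using finite_subset by blast
  then have "\<not> inj_on F X" using X finite_imageD by blast
  then obtain x y where xy: "x \<in> X" "y \<in> X" "x \<noteq> y" "F x = F y" unfolding inj_on_def by blast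
  have close: "\<bar>s - t\<bar> \<le> e / 2" if "\<lfloor>real_of_int n * s\<rfloor> = \<lfloor>real_of_int n * t\<rfloor>" for s t :: real
  proof -
    have "\<bar>real_of_int n * s - real_of_int n * t\<bar> \<le> 1" using that by linarith
    then have "real_of_int n * \<bar>s - t\<bar> \<le> 1" using n(2) by (simp add: abs_mult flip: right_diff_distrib)
    then have "2 / e * \<bar>s - t\<bar> \<le> 1" using mult_right_mono[OF n(1), of "\<bar>s - t\<bar>"] by simp
    then show ?thesis using e by (simp add: field_simps)
  qed
  have "cmod (f x p - f y p) \<le> e" if p: "p \<in> P" for p
  proof -
    have "\<bar>Re (f x p) - Re (f y p)\<bar> \<le> e / 2" "\<bar>Im (f x p) - Im (f y p)\<bar> \<le> e / 2"
      using fun_cong[OF xy(4), of p] p close[of "Re (f x p)" "Re (f y p)"] close[of "Im (f x p)" "Im (f y p)"]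
      by (simp_all add: F_def)
    then show ?thesis using cmod_le[of "f x p - f y p"] by simp
  qed
  then show ?thesis using xy by blast
qed

context group
begin

text \<open>After squaring, both sides are linear in \<open>\<psi>\<close>; in this form the
  condition passes to pointwise limits and to convex combinations.\<close>

lemma near_one_iff:
  assumes "state G \<psi>" "0 \<le> e"
  shows "near_one \<psi> e g \<longleftrightarrow> (\<forall>l. fsupp l \<subseteq> carrier G \<longrightarrow>
    Re (gform G \<psi> (fdiff (ltrans G g l) l) (fdiff (ltrans G g l) l)) \<le> e\<^sup>2 * Re (gform G \<psi> l l))"
proof -
  have "sqrt a \<le> e * sqrt b \<longleftrightarrow> a \<le> e\<^sup>2 * b" for a b
  proof -
    have "e * sqrt b = sqrt (e\<^sup>2 * b)" using assms(2) by (simp add: real_sqrt_mult)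
    then show ?thesis by simp
  qed
  then show ?thesis unfolding near_one_def[OF assms(1)] snorm_def[OF assms(1)] fnorm_def by simp
qed

text \<open>Elements of \<open>n\<close> distinct cosets are orthonormal for \<open>\<phi>\<close>,
  so their sum has squared norm at most \<open>c * n\<close> for \<open>\<psi>\<close>. Its inner
  product with the unit vector of the identity has real part at least \<open>n / 2\<close>, so
  Cauchy-Schwarz gives \<open>n \<le> 4 * c\<close>.\<close>

lemma dominated_spread:
  assumes D: "D \<lhd> G" and st: "state G \<psi>" and \<phi>: "\<phi> \<one> = 1" "\<And>g. g \<notin> D \<Longrightarrow> \<phi> g = 0"
    and dom: "\<And>l. fsupp l \<subseteq> carrier G \<Longrightarrow> Re (gform G \<psi> l l) \<le> c * Re (gform G \<phi> l l)"
    and X: "X \<subseteq> carrier G" "\<And>x. x \<in> X \<Longrightarrow> 1/2 \<le> Re (\<psi> x)"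
  shows "finite ((\<lambda>x. D #> x) ` X)"
proof (rule ccontr)
  interpret P: pd_kernel "carrier G" "\<lambda>x y. \<psi> (inv y \<otimes> x)"
    using st by (simp add: state_def posdef_def)
  assume "infinite ((\<lambda>x. D #> x) ` X)"
  define n where "n = nat \<lceil>4 * \<bar>c\<bar>\<rceil> + 1"
  have n: "0 < real n" "4 * c < real n" unfolding n_def by linarith+
  obtain T where T: "T \<subseteq> (\<lambda>x. D #> x) ` X" "finite T" "card T = n"
    using infinite_arbitrarily_large \<open>infinite ((\<lambda>x. D #> x) ` X)\<close> by blast
  obtain Y where Y: "Y \<subseteq> X" "inj_on (\<lambda>x. D #> x) Y" "T = (\<lambda>x. D #> x) ` Y"
    using T(1) unfolding subset_image_inj by blast
  have Yn: "finite Y" "card Y = n" using T Y(2,3) finite_imageD[of _ Y] card_image[OF Y(2)] by auto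
  have Yc: "y \<in> Y \<Longrightarrow> y \<in> carrier G" for y using Y(1) X(1) by blast
  obtain ys where ys: "set ys = Y" "distinct ys" using finite_distinct_list[OF Yn(1)] by blast
  define l where "l = map (\<lambda>y. (1 :: complex, y)) ys"
  have l: "fsupp l \<subseteq> carrier G" using ys Yc by (auto simp: l_def fsupp_def)
  have "gform G \<phi> l l = (\<Sum>x\<in>Y. \<Sum>y\<in>Y. \<phi> (inv y \<otimes> x))"
    unfolding l_def fform_unit_list[OF ys(2)] ys(1) ..
  also have "\<dots> = (\<Sum>x\<in>Y. \<Sum>y\<in>Y. if x = y then 1 else 0)"
  proof (intro sum.cong refl)
    fix x y assume xy: "x \<in> Y" "y \<in> Y"
    show "\<phi> (inv y \<otimes> x) = (if x = y then 1 else 0)"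
    proof (cases "x = y")
      case False
      then have "D #> x \<noteq> D #> y" using inj_onD[OF Y(2) _ xy] by blast
      then show ?thesis using normal_coset_eq_iff[OF D Yc[OF xy(1)] Yc[OF xy(2)]] \<phi>(2) False by simp
    qed (use \<phi>(1) Yc xy in simp)
  qed
  also have "\<dots> = of_nat n" using Yn by simp
  finally have \<phi>l: "gform G \<phi> l l = of_nat n" .
  have "fform (\<lambda>x y. \<psi> (inv y \<otimes> x)) l [(1, \<one>)] = (\<Sum>y\<in>Y. \<psi> y)"
  proof -
    have "fform (\<lambda>x y. \<psi> (inv y \<otimes> x)) l [(1, \<one>)] = (\<Sum>y\<in>Y. \<psi> (inv \<one> \<otimes> y))"
      using ys by (simp add: l_def fform_def o_def sum_list_distinct_conv_sum_set)
    also have "\<dots> = (\<Sum>y\<in>Y. \<psi> y)" using Yc by (intro sum.cong) auto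
    finally show ?thesis .
  qed
  moreover have "real n * (1/2) \<le> (\<Sum>y\<in>Y. Re (\<psi> y))"
    using sum_mono[of Y "\<lambda>_. 1/2" "\<lambda>y. Re (\<psi> y)"] X(2) Y(1) Yn by auto
  ultimately have "real n / 2 \<le> Re (fform (\<lambda>x y. \<psi> (inv y \<otimes> x)) l [(1, \<one>)])" by simp
  also have "\<dots> \<le> fnorm (\<lambda>x y. \<psi> (inv y \<otimes> x)) l * fnorm (\<lambda>x y. \<psi> (inv y \<otimes> x)) [(1, \<one>)]"
    using P.fform_CS[OF l, of "[(1, \<one>)]"] complex_Re_le_cmod order_trans by fastforce
  also have "fnorm (\<lambda>x y. \<psi> (inv y \<otimes> x)) [(1, \<one>)] = 1" using st by (simp add: fnorm_def fform_def state_def)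
  finally have "(real n / 2)\<^sup>2 \<le> (fnorm (\<lambda>x y. \<psi> (inv y \<otimes> x)) l)\<^sup>2" by (intro power_mono) auto
  also have "\<dots> \<le> c * real n" using P.fnorm_sq[OF l] dom[OF l] \<phi>l by simp
  finally show False using n by (simp add: power2_eq_square)
qed

text \<open>Some \<open>x\<close> centralising \<open>fc_center\<close> has a nontrivial commutator
  \<open>z\<close> with \<open>g\<close> inside \<open>fc_center\<close>, as otherwise
  \<open>g\<close> would have only finitely many conjugates. Since \<open>x\<close> centralises
  \<open>z\<close>, the powers of \<open>z\<close> are the commutators of powers of \<open>x\<close>
  with \<open>g\<close>, hence products of two elements within 1/8 of the identity, and
  \<open>near_powers_trivial\<close> applies.\<close>

lemma near_one_commutator:
  assumes st: "state G \<psi>" and g: "g \<in> carrier G" "g \<notin> fc_center" "near_one \<psi> (1/8) g"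
    and C: "finite ((\<lambda>x. centralizer_of fc_center #> x) ` carrier G)"
    and cj: "finite ((\<lambda>x. fc_center #> x) ` conj_class G g)"
  shows "\<exists>z\<in>fc_center. z \<noteq> \<one> \<and> (\<forall>y\<in>carrier G. \<psi> (cj y z) = 1)"
proof -
  let ?D = fc_center and ?C = "centralizer_of fc_center"
  note d = normalD[OF fc_center_normal]
  have Cs: "subgroup ?C G" by (rule centralizer_subgroup[OF d(2)])
  have "\<exists>x\<in>?C. cj x g \<otimes> inv g \<in> ?D \<and> cj x g \<noteq> g"
  proof (rule ccontr)
    assume no: "\<not> ?thesis"
    \<comment> \<open>If \<open>x\<close> and \<open>y\<close> agree in both cosets, then
      \<open>w = x \<otimes> inv y\<close> centralises \<open>fc_center\<close> and has its
      commutator with \<open>g\<close> in \<open>fc_center\<close>. By \<open>no\<close> that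
      commutator is trivial, so the two conjugates of \<open>g\<close> coincide.\<close>
    have "finite ((\<lambda>x. cj (inv x) g) ` carrier G)"
    proof (rule finite_image_factor[where F = "\<lambda>x. (?C #> x, ?D #> cj (inv x) g)"])
      have "(\<lambda>x. (?C #> x, ?D #> cj (inv x) g)) ` carrier G
          \<subseteq> (\<lambda>x. ?C #> x) ` carrier G \<times> (\<lambda>x. ?D #> x) ` conj_class G g"
      proof (rule image_subsetI)
        fix x assume x: "x \<in> carrier G"
        then have "cj (inv x) g \<in> conj_class G g"
          unfolding conj_class_def by (intro image_eqI[of _ _ "inv x"]) auto
        then show "(?C #> x, ?D #> cj (inv x) g) \<in> (\<lambda>x. ?C #> x) ` carrier G \<times> (\<lambda>x. ?D #> x) ` conj_class G g"
          using x by blast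
      qed
      then show "finite ((\<lambda>x. (?C #> x, ?D #> cj (inv x) g)) ` carrier G)"
        using finite_cartesian_product[OF C cj] finite_subset by blast
    next
      fix x y assume xy: "x \<in> carrier G" "y \<in> carrier G"
        and eq: "(?C #> x, ?D #> cj (inv x) g) = (?C #> y, ?D #> cj (inv y) g)"
      define w where "w = x \<otimes> inv y"
      have wC: "w \<in> ?C" using eq coset_eq_iff[OF Cs xy] by (simp add: w_def)
      have wc: "w \<in> carrier G" using xy by (simp add: w_def)
      have "cj (inv x) g \<otimes> inv (cj (inv y) g) \<in> ?D"
        using eq coset_eq_iff[OF d(1), of "cj (inv x) g" "cj (inv y) g"] xy g(1) by simp
      then have "inv (cj x (cj (inv x) g \<otimes> inv (cj (inv y) g))) \<in> ?D" using d(5,6) xy by blast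
      moreover have "inv (cj x (cj (inv x) g \<otimes> inv (cj (inv y) g))) = cj w g \<otimes> inv g"
        using xy g(1) by (simp add: w_def inv_mult_group m_assoc)
      ultimately have "cj w g = g" using no wC by auto
      then have "cj (inv x) g = cj (inv x) (cj w g)" by simp
      also have "\<dots> = cj (inv y) g" using xy g(1) by (simp add: w_def inv_mult_group m_assoc)
      finally show "cj (inv x) g = cj (inv y) g" .
    qed
    moreover have "conj_class G g \<subseteq> (\<lambda>x. cj (inv x) g) ` carrier G"
    proof
      fix a assume "a \<in> conj_class G g"
      then obtain x where x: "x \<in> carrier G" "a = cj x g" by (auto simp: conj_class_def)
      then show "a \<in> (\<lambda>x. cj (inv x) g) ` carrier G" by (intro image_eqI[of _ _ "inv x"]) auto
    qed
    ultimately show False using g(1,2) finite_subset by (auto simp: fc_center_def)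
  qed
  then obtain x where x: "x \<in> ?C" "cj x g \<otimes> inv g \<in> ?D" "cj x g \<noteq> g" by blast
  have xc: "x \<in> carrier G" using x(1) by (simp add: centralizer_of_def)
  define z where "z = cj x g \<otimes> inv g"
  have zD: "z \<in> ?D" and zc: "z \<in> carrier G" using x(2) d(2) by (auto simp: z_def)
  have z1: "z \<noteq> \<one>" using x(3) eq_if_mult_inv_one[of "cj x g" g] xc g(1) by (auto simp: z_def)
  have zg: "z \<otimes> g = cj x g" using xc g(1) by (simp add: z_def m_assoc)
  have pow: "z [^] k = cj (x [^] k) g \<otimes> inv g" for k :: nat
  proof (induction k)
    case (Suc k)
    have pC: "x [^] k \<in> ?C" by (induction k) (use subgroup.one_closed[OF Cs] subgroup.m_closed[OF Cs _ x(1)] in auto)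
    then have pz: "cj (x [^] k) z = z" using zD by (auto simp: centralizer_of_def)
    have pc: "x [^] k \<in> carrier G" using xc by simp
    have "cj (x [^] Suc k) g = cj (x [^] k) (z \<otimes> g)" unfolding zg using cj_comp[OF pc xc g(1)] by simp
    also have "\<dots> = z \<otimes> cj (x [^] k) g" unfolding cj_mult[OF pc zc g(1)] pz ..
    finally have "cj (x [^] Suc k) g \<otimes> inv g = z \<otimes> z [^] k" unfolding Suc using pc zc g(1) by (simp add: m_assoc)
    then show ?case using nat_pow_Suc2[OF zc, of k] by simp
  qed (use g(1) in simp)
  have "near_one \<psi> (1/4) (z [^] k)" for k :: nat
  proof -
    have pc: "x [^] k \<in> carrier G" using xc by simp
    have "near_one \<psi> (1/8 + 1/8) (cj (x [^] k) g \<otimes> inv g)"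
      using near_mult[OF st _ near_conj[OF st g(1,3) pc] _ near_inv[OF st g(1,3)]] pc g(1) by simp
    then show ?thesis unfolding pow by simp
  qed
  then have "\<psi> (cj y z) = 1" if "y \<in> carrier G" for y by (rule near_powers_trivial[OF st zc _ that])
  then show ?thesis using zD z1 by blast
qed

end

context urep
begin

lemma orbit_vec_simps:
  assumes v: "v \<in> carrier H" and l: "fsupp l \<subseteq> carrier G" "fsupp m \<subseteq> carrier G"
  shows "orbit_vec v (l @ m) = orbit_vec v l \<oplus> orbit_vec v m"
    "orbit_vec v (fscale c l) = c \<odot> orbit_vec v l"
    "g \<in> carrier G \<Longrightarrow> orbit_vec v (ltrans G g l) = \<rho> g (orbit_vec v l)"
proof -
  show "orbit_vec v (l @ m) = orbit_vec v l \<oplus> orbit_vec v m"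
    unfolding orbit_vec_def map_append by (rule lvec_append[OF orbit_supp[OF v l(1)] orbit_supp[OF v l(2)]])
  have "map (\<lambda>(a, x). (a, \<rho> x v)) (fscale c l) = fscale c (map (\<lambda>(a, x). (a, \<rho> x v)) l)"
    by (simp add: fscale_def case_prod_unfold)
  then show "orbit_vec v (fscale c l) = c \<odot> orbit_vec v l"
    unfolding orbit_vec_def using lvec_fscale[OF orbit_supp[OF v l(1)]] by simp
  show "orbit_vec v (ltrans G g l) = \<rho> g (orbit_vec v l)" if g: "g \<in> carrier G"
    using l(1)
  proof (induction l)
    case Nil
    then show ?case using g by (simp add: orbit_vec_def ltrans_def act_zero)
  next
    case (Cons p l)
    obtain a x where p: "p = (a, x)" by (cases p)
    have c: "x \<in> carrier G" "orbit_vec v l \<in> carrier H" using Cons.prems orbit_vec_closed[OF v] p by auto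
    have "orbit_vec v (ltrans G g (p # l)) = a \<odot> \<rho> (g \<cdot> x) v \<oplus> orbit_vec v (ltrans G g l)"
      by (simp add: p orbit_vec_def ltrans_def)
    also have "\<dots> = \<rho> g (a \<odot> \<rho> x v \<oplus> orbit_vec v l)"
      using Cons c g v by (simp add: act_mult act_add act_smult)
    also have "a \<odot> \<rho> x v \<oplus> orbit_vec v l = orbit_vec v (p # l)" by (simp add: p orbit_vec_def)
    finally show ?case .
  qed
qed

text \<open>The element of minimal norm in the closed affine hull of the \<open>M\<close>-orbit of \<open>v\<close> is fixed by
  \<open>M\<close>, hence 0.\<close>

lemma dominated_not_constant:
  assumes M: "subgroup M G" "fixed M = {\<zero>}" and v: "v \<in> carrier H"
    and \<psi>: "\<And>m. m \<in> M \<Longrightarrow> \<psi> m = 1"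
    and dom: "\<And>l. fsupp l \<subseteq> M \<Longrightarrow> Re (gform G \<psi> l l) \<le> c * (nrm (orbit_vec v l))\<^sup>2"
  shows False
proof -
  have Ms: "M \<subseteq> carrier G" by (rule subgroup.subset[OF M(1)])
  define S where "S = {orbit_vec v l |l. fsupp l \<subseteq> M \<and> sum_list (map fst l) = 1}"
  have Sc: "S \<subseteq> carrier H" using orbit_vec_closed[OF v] Ms by (auto simp: S_def)
  have mid: "(1/2) \<odot> (x \<oplus> y) \<in> S" if "x \<in> S" "y \<in> S" for x y
  proof -
    obtain l m where l: "fsupp l \<subseteq> M" "sum_list (map fst l) = 1" "x = orbit_vec v l"
      and m: "fsupp m \<subseteq> M" "sum_list (map fst m) = 1" "y = orbit_vec v m" using \<open>x \<in> S\<close> \<open>y \<in> S\<close> by (auto simp: S_def)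
    have s: "fsupp l \<subseteq> carrier G" "fsupp m \<subseteq> carrier G" "fsupp (l @ m) \<subseteq> carrier G" using l m Ms by auto
    have "(1/2) \<odot> (x \<oplus> y) = orbit_vec v (fscale (1/2) (l @ m))"
      unfolding l(3) m(3) using orbit_vec_simps(1)[OF v s(1,2)] orbit_vec_simps(2)[OF v s(3,3)] by simp
    moreover have "sum_list (map fst (fscale (1/2) (l @ m))) = 1"
      unfolding sum_list_fst_fscale using l m by simp
    moreover have "fsupp (fscale (1/2) (l @ m)) \<subseteq> M" using l m by simp
    ultimately show ?thesis unfolding S_def by blast
  qed
  have tr: "\<rho> k x \<in> S" if "x \<in> S" "k \<in> M" for x k
  proof -
    obtain l where l: "fsupp l \<subseteq> M" "sum_list (map fst l) = 1" "x = orbit_vec v l" using \<open>x \<in> S\<close> by (auto simp: S_def)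
    have s: "fsupp l \<subseteq> carrier G" using l Ms by auto
    have "\<rho> k x = orbit_vec v (ltrans G k l)" using orbit_vec_simps(3)[OF v s s] l(3) that Ms by auto
    moreover have "fsupp (ltrans G k l) \<subseteq> M"
      unfolding G.fsupp_ltrans using l(1) subgroup.m_closed[OF M(1)] that(2) by blast
    moreover have "sum_list (map fst (ltrans G k l)) = 1"
      using l(2) by (simp add: ltrans_def o_def case_prod_unfold)
    ultimately show ?thesis unfolding S_def by blast
  qed
  have "orbit_vec v [(1, \<one>\<^bsub>G\<^esub>)] \<in> S" using subgroup.one_closed[OF M(1)] by (auto simp: S_def intro!: exI[of _ "[(1, \<one>\<^bsub>G\<^esub>)]"])
  then have "S \<noteq> {}" by blast
  then obtain s w where s: "\<And>n. s n \<in> S" "hconv s w" and w: "\<And>x. x \<in> S \<Longrightarrow> nrm w \<le> nrm x"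
    using minimizing_sequence[OF Sc _ mid] by metis
  have wc: "w \<in> carrier H" using hconv_closed[OF s(2)] by blast
  have "\<rho> k w = w" if k: "k \<in> M" for k
  proof -
    have kc: "k \<in> carrier G" using k Ms by blast
    have pc: "\<rho> k w \<in> carrier H" using kc wc by simp
    have "hconv (\<lambda>n. (1/2) \<odot> (s n \<oplus> \<rho> k (s n))) ((1/2) \<odot> (w \<oplus> \<rho> k w))"
      by (intro hconv_smult hconv_add s(2) act_hconv kc)
    then have "nrm w \<le> nrm ((1/2) \<odot> (w \<oplus> \<rho> k w))"
    proof (rule LIMSEQ_le_const[OF hconv_nrm])
      have "nrm w \<le> nrm ((1/2) \<odot> (s n \<oplus> \<rho> k (s n)))" for n by (intro w mid tr s(1) k)
      then show "\<exists>N. \<forall>n\<ge>N. nrm w \<le> nrm ((1/2) \<odot> (s n \<oplus> \<rho> k (s n)))" by blast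
    qed
    \<comment> \<open>The midpoint of \<open>w\<close> and \<open>\<rho> k w\<close> is no shorter
      than \<open>w\<close>, although both have the same norm; the parallelogram law then forces
      them to be equal.\<close>
    then have "2 * nrm w \<le> nrm (w \<oplus> \<rho> k w)" using wc pc by (simp add: nrm_smult norm_divide)
    then have "(2 * nrm w)\<^sup>2 \<le> (nrm (w \<oplus> \<rho> k w))\<^sup>2" using nrm_nonneg[OF wc] by (intro power_mono) auto
    moreover have "(nrm (w \<oplus> \<rho> k w))\<^sup>2 + (nrm (w \<ominus> \<rho> k w))\<^sup>2 = (2 * nrm w)\<^sup>2"
      using parallelogram[OF wc pc] act_nrm[OF kc wc] by (simp add: power_mult_distrib)
    ultimately have "(nrm (w \<ominus> \<rho> k w))\<^sup>2 \<le> 0" by linarith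
    then have "nrm (w \<ominus> \<rho> k w) = 0" by simp
    then have "w \<ominus> \<rho> k w = \<zero>" using ip_norm_eq_0 wc pc by simp
    then show ?thesis using diff_eq_0[OF wc pc] by simp
  qed
  then have "w = \<zero>" using M(2) wc by (auto simp: fixed_def)
  then have "(\<lambda>n. nrm (s n)) \<longlonglongrightarrow> 0" using hconv_nrm[OF s(2)] nrm_zero by simp
  then have "(\<lambda>n. c * (nrm (s n))\<^sup>2) \<longlonglongrightarrow> c * 0\<^sup>2" by (intro tendsto_intros)
  \<comment> \<open>As \<open>\<psi>\<close> is 1 on \<open>M\<close>, its form on a combination
    supported in \<open>M\<close> is the squared modulus of the coefficient sum, here 1. So the
    norms of the \<open>s n\<close> cannot tend to 0.\<close>
  moreover have "1 \<le> c * (nrm (s n))\<^sup>2" for n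
  proof -
    obtain l where l: "fsupp l \<subseteq> M" "sum_list (map fst l) = 1" "s n = orbit_vec v l" using s(1)[of n] by (auto simp: S_def)
    have "gform G \<psi> l l = fform (\<lambda>x y. 1) l l"
      by (rule fform_cong)
        (use l(1) \<psi> subgroup.m_closed[OF M(1)] subgroup.m_inv_closed[OF M(1)] in \<open>auto simp: subset_iff\<close>)
    also have "\<dots> = 1" unfolding fform_const l(2) by simp
    finally show ?thesis using dom[OF l(1)] l(3) by simp
  qed
  then have "1 \<le> c * 0\<^sup>2" by (intro LIMSEQ_le_const[OF calculation]) auto
  then show False by simp
qed

text \<open>Among infinitely many coset representatives two nearly agree in all of their finitely
  many matrix coefficients, hence in operator norm; \<open>ginv y \<cdot> x\<close> is then close to
  the identity and lies outside \<open>D\<close>.\<close>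

lemma fin_dim_almost_fixed:
  assumes fd: fin_dim and D: "D \<lhd> G" "infinite ((\<lambda>x. D #>\<^bsub>G\<^esub> x) ` carrier G)"
  shows "\<exists>g\<in>carrier G. g \<notin> D \<and> (\<forall>w\<in>carrier H. nrm (\<rho> g w \<ominus> w) \<le> 1/8 * nrm w)"
proof -
  obtain A where A: "finite A" "A \<subseteq> carrier H" "span A = carrier H" using fd unfolding fin_dim_def by blast
  obtain B where "parseval_set (carrier H) B" using parseval[OF A(1,2)] unfolding A(3) by blast
  note B = parseval_setD[OF this]
  have Bc: "b \<in> B \<Longrightarrow> b \<in> carrier H" for b using B(2) by blast
  obtain X where X: "X \<subseteq> carrier G" "inj_on (\<lambda>x. D #>\<^bsub>G\<^esub> x) X" "(\<lambda>x. D #>\<^bsub>G\<^esub> x) ` carrier G = (\<lambda>x. D #>\<^bsub>G\<^esub> x) ` X"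
    using subset_image_inj[of "(\<lambda>x. D #>\<^bsub>G\<^esub> x) ` carrier G" "\<lambda>x. D #>\<^bsub>G\<^esub> x" "carrier G"] by auto
  have Xinf: "infinite X" using D(2) X(3) by auto
  \<comment> \<open>Small enough for the errors over all pairs of basis vectors to add up to at most
    1/8.\<close>
  define e :: real where "e = 1 / (8 * (real (card (B \<times> B)) + 1))"
  have e: "e > 0" by (simp add: e_def add_nonneg_pos)
  have "\<exists>x\<in>X. \<exists>y\<in>X. x \<noteq> y \<and> (\<forall>p\<in>B \<times> B. cmod (ip H (\<rho> x (fst p)) (snd p) - ip H (\<rho> y (fst p)) (snd p)) \<le> e)"
  proof (rule bounded_family_pigeonhole[OF Xinf _ _ e])
    fix x p assume "x \<in> X" "p \<in> B \<times> B"
    then have "x \<in> carrier G" "fst p \<in> B" "snd p \<in> B" using X(1) by auto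
    then show "cmod (ip H (\<rho> x (fst p)) (snd p)) \<le> 1"
      using ip_Cauchy_Schwarz[of "\<rho> x (fst p)" "snd p"] B(3) Bc by (simp add: act_nrm)
  qed (use B(1) in simp)
  then obtain x y where xy: "x \<in> X" "y \<in> X" "x \<noteq> y"
    and cl: "\<And>b b'. b \<in> B \<Longrightarrow> b' \<in> B \<Longrightarrow> cmod (ip H (\<rho> x b) b' - ip H (\<rho> y b) b') \<le> e" by fastforce
  have xyc: "x \<in> carrier G" "y \<in> carrier G" using xy X(1) by auto
  have near: "nrm (\<rho> x w \<ominus> \<rho> y w) \<le> 1/8 * nrm w" if w: "w \<in> carrier H" for w
  proof -
    define z where "z = \<rho> x w \<ominus> \<rho> y w"
    have zc: "z \<in> carrier H" using w xyc by (simp add: z_def)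
    have ex: "ip H (\<rho> g w) z = (\<Sum>b\<in>B. \<Sum>b'\<in>B. ip H w b * ip H (\<rho> g b) b' * ip H b' z)" if g: "g \<in> carrier G" for g
    proof -
      have "ip H (\<rho> g w) z = (\<Sum>b\<in>B. ip H w b * ip H b (\<rho> (ginv g) z))"
        using B(4)[OF w, of "\<rho> (ginv g) z"] g w zc by (simp add: act_adjoint)
      also have "\<dots> = (\<Sum>b\<in>B. ip H w b * (\<Sum>b'\<in>B. ip H (\<rho> g b) b' * ip H b' z))"
      proof (rule sum.cong[OF refl])
        fix b assume b: "b \<in> B"
        have "ip H b (\<rho> (ginv g) z) = ip H (\<rho> g b) z" using act_adjoint[OF g Bc[OF b] zc] by simp
        also have "\<dots> = (\<Sum>b'\<in>B. ip H (\<rho> g b) b' * ip H b' z)" by (rule B(4)[OF act_closed[OF g Bc[OF b]] zc])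
        finally show "ip H w b * ip H b (\<rho> (ginv g) z) = ip H w b * (\<Sum>b'\<in>B. ip H (\<rho> g b) b' * ip H b' z)"
          by simp
      qed
      finally show ?thesis by (simp add: sum_distrib_left mult.assoc)
    qed
    have "of_real ((nrm z)\<^sup>2) = ip H (\<rho> x w) z - ip H (\<rho> y w) z"
      unfolding ip_self[OF zc, symmetric] using w xyc zc by (simp add: z_def ip_diff_left)
    also have "\<dots> = (\<Sum>b\<in>B. \<Sum>b'\<in>B. ip H w b * (ip H (\<rho> x b) b' - ip H (\<rho> y b) b') * ip H b' z)"
      unfolding ex[OF xyc(1)] ex[OF xyc(2)] by (simp add: sum_subtractf algebra_simps)
    finally have eq: "of_real ((nrm z)\<^sup>2) = (\<Sum>b\<in>B. \<Sum>b'\<in>B. ip H w b * (ip H (\<rho> x b) b' - ip H (\<rho> y b) b') * ip H b' z)" .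
    have "(nrm z)\<^sup>2 = cmod (of_real ((nrm z)\<^sup>2))" by (simp add: norm_power)
    also have "\<dots> \<le> (\<Sum>b\<in>B. \<Sum>b'\<in>B. nrm w * e * nrm z)"
      unfolding eq
    proof (intro sum_norm_le)
      fix b b' assume b: "b \<in> B" "b' \<in> B"
      have "cmod (ip H w b) \<le> nrm w" "cmod (ip H b' z) \<le> nrm z"
        using ip_Cauchy_Schwarz[OF w Bc[OF b(1)]] ip_Cauchy_Schwarz[OF Bc[OF b(2)] zc] B(3) b by auto
      then show "cmod (ip H w b * (ip H (\<rho> x b) b' - ip H (\<rho> y b) b') * ip H b' z) \<le> nrm w * e * nrm z"
        unfolding norm_mult using cl[OF b] e nrm_nonneg[OF w] by (intro mult_mono) auto
    qed
    also have "\<dots> = (real (card (B \<times> B)) * e) * nrm w * nrm z" by (simp add: card_cartesian_product)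
    also have "\<dots> \<le> 1/8 * nrm w * nrm z"
    proof -
      have "real (card (B \<times> B)) * e \<le> 1/8" by (simp add: e_def divide_simps)
      then show ?thesis using nrm_nonneg[OF w] nrm_nonneg[OF zc] by (intro mult_right_mono) auto
    qed
    finally have "nrm z * nrm z \<le> 1/8 * nrm w * nrm z" by (simp add: power2_eq_square)
    then have "nrm z \<le> 1/8 * nrm w"
      using nrm_nonneg[OF w] nrm_nonneg[OF zc] by (cases "nrm z = 0") (auto simp: mult_le_cancel_right)
    then show ?thesis by (simp add: z_def)
  qed
  let ?g = "ginv y \<cdot> x"
  have "D #>\<^bsub>G\<^esub> x \<noteq> D #>\<^bsub>G\<^esub> y" using inj_onD[OF X(2) _ xy(1,2)] xy(3) by blast
  then have "?g \<notin> D" using G.normal_coset_eq_iff[OF D(1) xyc] by simp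
  moreover have "nrm (\<rho> ?g w \<ominus> w) \<le> 1/8 * nrm w" if w: "w \<in> carrier H" for w
  proof -
    have "\<rho> ?g w \<ominus> w = \<rho> (ginv y) (\<rho> x w \<ominus> \<rho> y w)"
      using w xyc by (simp add: act_mult act_diff act_inv)
    then show ?thesis using near[OF w] w xyc by (simp add: act_nrm)
  qed
  ultimately show ?thesis using xyc by blast
qed

end

context group
begin

text \<open>Irreducible representations whose vector state avoids these conditions are faithful and, when
  \<open>fc_center\<close> has infinite index, infinite dimensional.\<close>

definition degenerate :: "('a \<Rightarrow> complex) \<Rightarrow> 'a \<Rightarrow> bool" where
  "degenerate \<psi> g \<longleftrightarrow> g \<noteq> \<one> \<and>
     (if g \<in> fc_center then \<forall>y\<in>carrier G. \<psi> (cj y g) = 1 else near_one \<psi> (1/8) g)"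

lemma degenerate_limit:
  assumes g: "g \<in> carrier G" and st: "\<And>i::nat. state G (\<phi> i) \<and> degenerate (\<phi> i) g" "state G \<psi>"
    and lim: "\<And>x. x \<in> carrier G \<Longrightarrow> (\<lambda>i. \<phi> i x) \<longlonglongrightarrow> \<psi> x"
  shows "degenerate \<psi> g"
proof -
  have "\<psi> (cj y g) = 1" if "g \<in> fc_center" "y \<in> carrier G" for y
  proof (rule LIMSEQ_unique)
    show "(\<lambda>i. \<phi> i (cj y g)) \<longlonglongrightarrow> \<psi> (cj y g)" using lim g that by simp
    have "\<phi> i (cj y g) = 1" for i using st(1)[of i] that by (simp add: degenerate_def)
    then show "(\<lambda>i. \<phi> i (cj y g)) \<longlonglongrightarrow> 1" by simp
  qed
  moreover have "near_one \<psi> (1/8) g" if n: "g \<notin> fc_center"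
  proof (subst near_one_iff[OF st(2)], simp, intro allI impI)
    fix l assume l: "fsupp l \<subseteq> carrier G"
    let ?d = "fdiff (ltrans G g l) l"
    have d: "fsupp ?d \<subseteq> carrier G" using fsupp_ltrans_closed[OF g l] l by simp
    have le: "Re (gform G (\<phi> i) ?d ?d) \<le> (1/8)\<^sup>2 * Re (gform G (\<phi> i) l l)" for i
      using near_one_iff[of "\<phi> i" "1/8" g] st(1)[of i] n l by (simp add: degenerate_def)
    have lim': "(\<lambda>i. gform G (\<phi> i) m m) \<longlonglongrightarrow> gform G \<psi> m m" if "fsupp m \<subseteq> carrier G" for m
      by (rule tendsto_fform) (use that in \<open>auto intro!: lim\<close>)
    show "Re (gform G \<psi> ?d ?d) \<le> (1/8)\<^sup>2 * Re (gform G \<psi> l l)"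
      by (rule LIMSEQ_le[OF tendsto_Re[OF lim'[OF d]] tendsto_mult_left[OF tendsto_Re[OF lim'[OF l]]]])
        (use le in blast)
  qed
  moreover have "g \<noteq> \<one>" using st(1)[of 0] by (simp add: degenerate_def)
  ultimately show ?thesis by (simp add: degenerate_def)
qed

lemma gform_convex:
  "gform G (\<lambda>x. of_real (1 - t) * \<phi> x + of_real t * \<psi> x) l m
    = of_real (1 - t) * gform G \<phi> l m + of_real t * gform G \<psi> l m"
  by (simp only: fform_kernel_add fform_kernel_mult)

lemma degenerate_convex:
  assumes st: "state G \<phi>" "state G \<psi>" and dg: "degenerate \<phi> g" "degenerate \<psi> g" and t: "0 \<le> t" "t \<le> 1"
  shows "degenerate (\<lambda>x. of_real (1 - t) * \<phi> x + of_real t * \<psi> x) g"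
proof -
  let ?\<chi> = "\<lambda>x. of_real (1 - t) * \<phi> x + of_real t * \<psi> x"
  have "near_one ?\<chi> (1/8) g" if n: "g \<notin> fc_center"
  proof (subst near_one_iff[OF state_convex[OF st t]], simp, intro allI impI)
    fix l assume l: "fsupp l \<subseteq> carrier G"
    let ?d = "fdiff (ltrans G g l) l"
    have "Re (gform G \<phi> ?d ?d) \<le> (1/8)\<^sup>2 * Re (gform G \<phi> l l)" "Re (gform G \<psi> ?d ?d) \<le> (1/8)\<^sup>2 * Re (gform G \<psi> l l)"
      using near_one_iff[OF st(1), of "1/8" g] near_one_iff[OF st(2), of "1/8" g] dg n l
      by (simp_all add: degenerate_def)
    then have "(1 - t) * Re (gform G \<phi> ?d ?d) + t * Re (gform G \<psi> ?d ?d)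
        \<le> (1 - t) * ((1/8)\<^sup>2 * Re (gform G \<phi> l l)) + t * ((1/8)\<^sup>2 * Re (gform G \<psi> l l))"
      using t by (intro add_mono mult_left_mono) auto
    moreover have Re: "Re (gform G ?\<chi> m m) = (1 - t) * Re (gform G \<phi> m m) + t * Re (gform G \<psi> m m)" for m
      unfolding gform_convex by simp
    ultimately show "Re (gform G ?\<chi> ?d ?d) \<le> (1/8)\<^sup>2 * Re (gform G ?\<chi> l l)"
      unfolding Re by (simp add: algebra_simps)
  qed
  then show ?thesis using dg by (auto simp: degenerate_def)
qed

end

context urep
begin

lemma near_one_coefficient:
  assumes st: "state G \<psi>" and \<xi>: "\<xi> \<in> carrier H" "\<And>g. g \<in> carrier G \<Longrightarrow> ip H (\<rho> g \<xi>) \<xi> = \<psi> g"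
    and g: "g \<in> carrier G" and near: "\<And>w. w \<in> carrier H \<Longrightarrow> nrm (\<rho> g w \<ominus> w) \<le> 1/8 * nrm w"
  shows "G.near_one \<psi> (1/8) g"
proof -
  have gf: "Re (gform G \<psi> l l) = (nrm (orbit_vec \<xi> l))\<^sup>2" if l: "fsupp l \<subseteq> carrier G" for l
  proof -
    have "gform G \<psi> l l = gform G (\<lambda>g. ip H (\<rho> g \<xi>) \<xi>) l l"
      by (rule fform_cong) (use l \<xi>(2) in \<open>auto simp: subset_iff\<close>)
    then show ?thesis using gform_orbit_vec[OF \<xi>(1) l l] nrm_sq[OF orbit_vec_closed[OF \<xi>(1) l]] by simp
  qed
  show ?thesis
  proof (subst G.near_one_iff[OF st], simp, intro allI impI)
    fix l assume l: "fsupp l \<subseteq> carrier G"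
    let ?d = "fdiff (ltrans G g l) l" and ?w = "orbit_vec \<xi> l"
    have w: "?w \<in> carrier H" by (rule orbit_vec_closed[OF \<xi>(1) l])
    have t: "fsupp (ltrans G g l) \<subseteq> carrier G" "fsupp (fscale (- 1) l) \<subseteq> carrier G" "fsupp ?d \<subseteq> carrier G"
      using G.fsupp_ltrans_closed[OF g l] l by auto
    have "orbit_vec \<xi> ?d = \<rho> g ?w \<oplus> (- 1) \<odot> ?w"
      using orbit_vec_simps(1)[OF \<xi>(1) t(1,2)] orbit_vec_simps(2,3)[OF \<xi>(1) l l] g by simp
    also have "\<dots> = \<rho> g ?w \<ominus> ?w" using w g by (intro ip_ext) (auto simp: ip_simps)
    finally have "(nrm (orbit_vec \<xi> ?d))\<^sup>2 \<le> (1/8 * nrm ?w)\<^sup>2"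
      using near[OF w] nrm_nonneg[of "\<rho> g ?w \<ominus> ?w"] w g by (simp only:) (intro power_mono, auto)
    then show "Re (gform G \<psi> ?d ?d) \<le> (1/8)\<^sup>2 * Re (gform G \<psi> l l)"
      unfolding gf[OF l] gf[OF t(3)] by (simp only: power_mult_distrib)
  qed
qed

text \<open>Restricting a vector state of a faithful representation to \<open>fc_center\<close> gives a state that has
  no degenerate state as a convex summand.\<close>

lemma dominated_not_degenerate:
  assumes f: "faithful_irreducible_unitary_rep G H \<rho>" and fd: fin_dim
    and v: "v \<in> carrier H" "nrm v = 1" and st: "state G \<psi>" and g: "g \<in> carrier G"
    and dom: "\<And>l. fsupp l \<subseteq> carrier G \<Longrightarrow> Re (gform G \<psi> l l)
        \<le> c * Re (gform G (\<lambda>g. if g \<in> G.fc_center then ip H (\<rho> g v) v else 0) l l)"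
  shows "\<not> G.degenerate \<psi> g"
proof
  let ?D = "G.fc_center"
  let ?\<phi> = "\<lambda>g. if g \<in> ?D then ip H (\<rho> g v) v else 0"
  note D = G.fc_center_normal
  note d = G.normalD[OF D]
  have key: False if z: "z \<in> ?D" "z \<noteq> \<one>\<^bsub>G\<^esub>" "\<And>y. y \<in> carrier G \<Longrightarrow> \<psi> (G.cj y z) = 1" for z
  proof -
    \<comment> \<open>On this normal subgroup \<open>\<psi>\<close> is identically 1, and it
      contains \<open>z\<close>. By faithfulness it has no nonzero fixed vectors in
      \<open>H\<close>, so the domination contradicts \<open>dominated_not_constant\<close>.\<close>
    let ?M = "?D \<inter> {m \<in> carrier G. \<forall>x\<in>carrier G. \<psi> (G.cj x m) = 1}"
    have M: "?M \<lhd> G" by (rule G.normal_Int[OF D G.state_kernel_normal[OF st]])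
    have "z \<in> ?M" using z d(2) by auto
    then have "fixed ?M = {\<zero>}" using faithful_fixed_trivial[OF f M] z(2) by blast
    then show False
    proof (rule dominated_not_constant[OF G.normalD(1)[OF M] _ v(1)])
      show "\<psi> m = 1" if m: "m \<in> ?M" for m
      proof -
        have mc: "m \<in> carrier G" and "\<forall>x\<in>carrier G. \<psi> (G.cj x m) = 1" using m by auto
        then have "\<psi> (G.cj \<one>\<^bsub>G\<^esub> m) = 1" using G.one_closed by blast
        then show ?thesis using mc by simp
      qed
      fix l assume l: "fsupp l \<subseteq> ?M"
      then have lc: "fsupp l \<subseteq> carrier G" by auto
      have "gform G ?\<phi> l l = gform G (\<lambda>g. ip H (\<rho> g v) v) l l"
      proof (rule fform_cong)
        fix x y assume "x \<in> fsupp l" "y \<in> fsupp l"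
        then have "x \<in> ?D" "y \<in> ?D" using l by auto
        then have "ginv y \<cdot> x \<in> ?D" by (intro d(4,5))
        then show "?\<phi> (ginv y \<cdot> x) = ip H (\<rho> (ginv y \<cdot> x) v) v" by simp
      qed
      also have "\<dots> = ip H (orbit_vec v l) (orbit_vec v l)" by (rule gform_orbit_vec[OF v(1) lc lc])
      finally show "Re (gform G \<psi> l l) \<le> c * (nrm (orbit_vec v l))\<^sup>2"
        using dom[OF lc] nrm_sq[OF orbit_vec_closed[OF v(1) lc]] by simp
    qed
  qed
  assume dg: "G.degenerate \<psi> g"
  show False
  proof (cases "g \<in> ?D")
    case True
    then show False using key[of g] dg by (auto simp: G.degenerate_def)
  next
    case False
    then have near: "G.near_one \<psi> (1/8) g" using dg by (simp add: G.degenerate_def)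
    have "finite ((\<lambda>x. ?D #>\<^bsub>G\<^esub> x) ` conj_class G g)"
    proof (rule G.dominated_spread[OF D st _ _ dom])
      show "?\<phi> \<one>\<^bsub>G\<^esub> = 1" using d(3) v by (simp add: act_one ip_self)
      show "?\<phi> g = 0" if "g \<notin> ?D" for g using that by simp
      show "conj_class G g \<subseteq> carrier G" using g by (auto simp: conj_class_def)
      fix x assume "x \<in> conj_class G g"
      then obtain y where y: "y \<in> carrier G" "x = G.cj y g" by (auto simp: conj_class_def)
      have "1 - (1/8)\<^sup>2 / 2 \<le> Re (\<psi> (G.cj (ginv (ginv y)) g))"
        by (rule G.near_single[OF st g near]) (use y in simp)
      then show "1/2 \<le> Re (\<psi> x)" using y by (simp add: power2_eq_square)
    qed
    moreover have "finite ((\<lambda>x. G.centralizer_of ?D #>\<^bsub>G\<^esub> x) ` carrier G)"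
      by (rule centralizer_finite_index[OF f fd d(2)]) (simp add: G.fc_center_def)
    ultimately obtain z where "z \<in> ?D" "z \<noteq> \<one>\<^bsub>G\<^esub>" "\<forall>y\<in>carrier G. \<psi> (G.cj y z) = 1"
      using G.near_one_commutator[OF st g False near] by blast
    then show False using key by blast
  qed
qed

text \<open>Partitioning the kernel of the vector state by the cosets of \<open>D\<close> leaves
  exactly the kernel of its extension by 0.\<close>

lemma restricted_state:
  assumes D: "D \<lhd> G" and v: "v \<in> carrier H" "nrm v = 1"
  shows "state G (\<lambda>g. if g \<in> D then ip H (\<rho> g v) v else 0)"
proof -
  have "pd_kernel (carrier G) (\<lambda>x y. ip H (\<rho> (ginv y \<cdot> x) v) v)"
    using G.posdef_coefficient[OF urep_axioms v(1)] by (simp add: posdef_def)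
  then have "pd_kernel (carrier G)
      (\<lambda>x y. if D #>\<^bsub>G\<^esub> x = D #>\<^bsub>G\<^esub> y then ip H (\<rho> (ginv y \<cdot> x) v) v else 0)"
    by (rule pd_kernel_partition)
  then have "posdef G (\<lambda>g. if g \<in> D then ip H (\<rho> g v) v else 0)"
    unfolding posdef_def by (rule pd_kernel_cong) (simp add: G.normal_coset_eq_iff[OF D])
  then show ?thesis using G.normalD(3)[OF D] v by (simp add: state_def act_one ip_self)
qed

end

text \<open>An element acting trivially in the new representation would satisfy both clauses of
  \<open>degenerate\<close>, and an almost fixed element outside \<open>fc_center\<close> would
  satisfy the second one. The given finite dimensional \<open>H\<close> supplies the starting state
  and also, through \<open>centralizer_finite_index\<close>, the infinite index of
  \<open>fc_center\<close>.\<close>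

theorem infinite_dimensional_faithful_irrep:
  fixes G :: "('a, 'b) monoid_scheme" (structure) and H :: "('l, 'x) inner_product_struct_scheme"
  assumes G: "group G" "countable (carrier G)" and R: "(UNIV :: real set) \<lesssim> (UNIV :: 'h set)"
    and nva: "\<not> virtually_abelian G"
    and rep: "faithful_irreducible_unitary_rep G H \<rho>" and fd: "finite_dimensional H"
  shows "\<exists>(K :: 'h inner_product_struct) \<sigma>. faithful_irreducible_unitary_rep G K \<sigma> \<and> \<not> finite_dimensional K"
proof -
  interpret group G by (rule G)
  have irr: "irreducible_unitary_rep G H \<rho>" using rep by (simp add: faithful_irreducible_unitary_rep_def)
  interpret U: urep G H \<rho>
    by (rule urepI[OF G(1)]) (use irr in \<open>simp add: irreducible_unitary_rep_def\<close>)
  note d = normalD[OF fc_center_normal]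
  obtain v where v: "v \<in> carrier H" "ip_norm H v = 1"
    using U.unit_vector irr by (auto simp: irreducible_unitary_rep_def)
  define \<phi>0 where "\<phi>0 g = (if g \<in> fc_center then ip H (\<rho> g v) v else 0)" for g
  have st0: "state G \<phi>0" unfolding \<phi>0_def by (rule U.restricted_state[OF fc_center_normal v])
  have "\<exists>\<phi>. extreme_state G \<phi> \<and> (\<forall>g\<in>carrier G. \<not> degenerate \<phi> g)"
  proof (rule extreme_state_avoiding[OF G G(2) _ st0])
    show "carrier G \<noteq> {}" using one_closed by blast
  next
    fix g t \<phi> \<psi> assume g: "g \<in> carrier G" and t: "0 < t" "t \<le> (1 :: real)" and st: "state G \<phi>" "state G \<psi>"
      and dg: "degenerate \<psi> g"
      and eq: "\<And>x. x \<in> carrier G \<Longrightarrow> \<phi>0 x = of_real (1 - t) * \<phi> x + of_real t * \<psi> x"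
    \<comment> \<open>The other summand of \<open>\<phi>0\<close> contributes a nonnegative form, so
      \<open>\<psi>\<close> is dominated by \<open>1/t\<close> times \<open>\<phi>0\<close>.\<close>
    have "Re (gform G \<psi> l l) \<le> 1/t * Re (gform G \<phi>0 l l)" if l: "fsupp l \<subseteq> carrier G" for l
    proof -
      have "gform G \<phi>0 l l = gform G (\<lambda>x. of_real (1 - t) * \<phi> x + of_real t * \<psi> x) l l"
        by (rule fform_cong) (use l eq in \<open>auto simp: subset_iff\<close>)
      then have "Re (gform G \<phi>0 l l) = (1 - t) * Re (gform G \<phi> l l) + t * Re (gform G \<psi> l l)"
        unfolding gform_convex by simp
      moreover have "0 \<le> (1 - t) * Re (gform G \<phi> l l)"
        using posdef_gform(2)[OF _ l] st(1) t by (simp add: state_def)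
      ultimately show ?thesis using t by (simp add: field_simps)
    qed
    then show False
      using U.dominated_not_degenerate[OF rep fd v st(2) g, of "1/t"] dg unfolding \<phi>0_def[abs_def] by blast
  next
    fix g \<phi> \<psi> assume "g \<in> carrier G" "\<And>i::nat. state G (\<phi> i) \<and> degenerate (\<phi> i) g" "state G \<psi>"
      "\<And>x. x \<in> carrier G \<Longrightarrow> (\<lambda>i. \<phi> i x) \<longlonglongrightarrow> \<psi> x"
    then show "degenerate \<psi> g" by (rule degenerate_limit)
  qed (rule degenerate_convex)
  then obtain \<phi> where ex: "extreme_state G \<phi>" and nd: "\<And>g. g \<in> carrier G \<Longrightarrow> \<not> degenerate \<phi> g" by blast
  have st: "state G \<phi>" using ex by (simp add: extreme_state_def)
  obtain K :: "'h inner_product_struct" and \<sigma> \<xi> where K: "irreducible_unitary_rep G K \<sigma>" "\<xi> \<in> carrier K"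
      "\<And>g. g \<in> carrier G \<Longrightarrow> ip K (\<sigma> g \<xi>) \<xi> = \<phi> g"
    using extreme_state_representation[OF G R ex] by blast
  interpret K: urep G K \<sigma>
    by (rule urepI[OF G(1)]) (use K(1) in \<open>simp add: irreducible_unitary_rep_def\<close>)
  have "faithful_irreducible_unitary_rep G K \<sigma>"
  proof (rule K.faithfulI[OF K(1)], rule ccontr)
    fix g assume g: "g \<in> carrier G" "g \<noteq> \<one>" and "\<not> (\<exists>w\<in>carrier K. \<sigma> g w \<noteq> w)"
    then have triv: "\<sigma> g w = w" if "w \<in> carrier K" for w using that by blast
    have "\<phi> (cj y g) = 1" if y: "y \<in> carrier G" for y
    proof -
      have "\<phi> (cj y g) = ip K (\<sigma> y (\<sigma> g (\<sigma> (inv y) \<xi>))) \<xi>"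
        using K(2) K(3)[of "cj y g"] g y by (simp add: K.act_mult)
      also have "\<dots> = ip K \<xi> \<xi>" using triv K(2) y K.act_inv(2)[OF y K(2)] by simp
      also have "\<dots> = 1" using K(3)[OF one_closed] K.act_one[OF K(2)] st by (simp add: state_def)
      finally show ?thesis .
    qed
    moreover have "near_one \<phi> (1/8) g"
    proof (rule K.near_one_coefficient[OF st K(2,3) g(1)])
      fix w assume w: "w \<in> carrier K"
      have "w \<ominus>\<^bsub>K\<^esub> w = \<zero>\<^bsub>K\<^esub>" using K.diff_eq_0[OF w w] by simp
      then show "ip_norm K (\<sigma> g w \<ominus>\<^bsub>K\<^esub> w) \<le> 1/8 * ip_norm K w"
        using triv[OF w] K.nrm_nonneg[OF w] K.nrm_zero by simp
    qed
    ultimately show False using nd[OF g(1)] g(2) by (auto simp: degenerate_def split: if_splits)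
  qed
  moreover have "\<not> finite_dimensional K"
  proof
    assume "finite_dimensional K"
    moreover have "infinite ((\<lambda>x. fc_center #> x) ` carrier G)"
      by (rule infinite_fc_center_cosets[OF nva], rule U.centralizer_finite_index[OF rep fd d(2)])
        (simp add: fc_center_def)
    ultimately obtain g where g: "g \<in> carrier G" "g \<notin> fc_center"
        "\<And>w. w \<in> carrier K \<Longrightarrow> ip_norm K (\<sigma> g w \<ominus>\<^bsub>K\<^esub> w) \<le> 1/8 * ip_norm K w"
      using K.fin_dim_almost_fixed[OF _ fc_center_normal] by blast
    have "near_one \<phi> (1/8) g" by (rule K.near_one_coefficient[OF st K(2,3) g(1,3)])
    then show False using nd[OF g(1)] g(2) d(3) by (auto simp: degenerate_def)
  qed
  ultimately show ?thesis by blast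
qed

section \<open>The two equivalences\<close>

theorem theorem4:
  fixes G :: "('a, 'm) monoid_scheme"
    and I :: "'i set" and A :: "'i \<Rightarrow> 'a set"
  assumes "group G" and "countable (carrier G)"
    and "\<forall>i\<in>I. A i \<in> abelian_finite_feet G"
    and "internal_direct_sum G I A (MA G)"
    and "internal_direct_sum G (I <+> nonabelian_finite_feet G) (case_sum A (\<lambda>H. H)) (MS G)"
    and "(UNIV :: real set) \<lesssim> (UNIV :: 'h set)"
  shows
    "((\<exists>(H :: 'h inner_product_struct) \<rho>.
          faithful_irreducible_unitary_rep G H \<rho> \<and> \<not> finite_dimensional H)
        \<longleftrightarrow> irreducibly_represented TYPE('h) G I A \<and> \<not> virtually_abelian G)
     \<and>
     ((\<exists>(H :: 'h inner_product_struct) \<rho>. faithful_irreducible_unitary_rep G H \<rho>) \<and>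
      (\<forall>(H :: 'h inner_product_struct) \<rho>.
          faithful_irreducible_unitary_rep G H \<rho> \<longrightarrow> finite_dimensional H)
        \<longleftrightarrow> irreducibly_represented TYPE('h) G I A \<and> virtually_abelian G)"
proof -
  note G = assms(1,2)
  \<comment> \<open>The conjunction \<open>irreducibly_represented\<close> contains (P1), so it is
    equivalent to (P1) once (P1) is seen to imply the other four properties; what remains concerns
    dimensions.\<close>
  have irrep: "irreducibly_represented TYPE('h) G I A \<longleftrightarrow>
      (\<exists>(H :: 'h inner_product_struct) \<rho>. faithful_irreducible_unitary_rep G H \<rho>)"
  proof
    assume "\<exists>(H :: 'h inner_product_struct) \<rho>. faithful_irreducible_unitary_rep G H \<rho>"
    then obtain H :: "'h inner_product_struct" and \<rho> where rep: "faithful_irreducible_unitary_rep G H \<rho>" by blast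
    have P2: "MA_has_conj_faithful_character G"
      by (rule MA_has_conj_faithful_characterI[OF G assms(3,4) rep])
    have P4: "abelian_sums_conj_generated G I A"
      by (rule group.abelian_sums_conj_generatedI[OF assms(1,3,4) P2])
    have P5: "mixed_sums_conj_generated G I A"
      by (rule group.mixed_sums_conj_generatedI[OF assms(1,3,5) P4])
    show "irreducibly_represented TYPE('h) G I A"
      unfolding irreducibly_represented_def has_faithful_irrep_def
      using rep P2 P4 P5 MS_has_conj_faithful_irrepI[OF G assms(6) rep] by blast
  qed (auto simp: irreducibly_represented_def has_faithful_irrep_def)
  have va: "finite_dimensional H"
    if "virtually_abelian G" "faithful_irreducible_unitary_rep G H \<rho>" for H :: "'h inner_product_struct" and \<rho>
  proof -
    have irr: "irreducible_unitary_rep G H \<rho>" using that(2) by (simp add: faithful_irreducible_unitary_rep_def)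
    then have "unitary_rep G H \<rho>" by (simp add: irreducible_unitary_rep_def)
    then have "urep G H \<rho>" by (rule urepI[OF assms(1)])
    then show ?thesis by (rule urep.virtually_abelian_fin_dim[OF _ irr that(1)])
  qed
  have nva: "\<exists>(H :: 'h inner_product_struct) \<rho>. faithful_irreducible_unitary_rep G H \<rho> \<and> \<not> finite_dimensional H"
    if "\<not> virtually_abelian G" "\<exists>(H :: 'h inner_product_struct) \<rho>. faithful_irreducible_unitary_rep G H \<rho>"
    using infinite_dimensional_faithful_irrep[OF G assms(6)] that by blast
  show ?thesis unfolding irrep using va nva by blast
qed

end
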